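(* Let $N\ge 2$, $n\ge 0$, $0<s<1$, and let $u_0\in L^1(\mathbb{R}^N)$ with $u_0\ge 0$. For $\varepsilon>0$ let $u_\varepsilon$ be the approximate solution with initial datum $u_0+\varepsilon$ (defined in the context). Then the limit solution $\bar u=\lim_{\varepsilon\to 0}u_\varepsilon$ vanishes identically for all $x\in\mathbb{R}^N$, $t>0$, i.e. $\lim_{\varepsilon\to0}u_\varepsilon(x,t)=0$. Moreover, if $u_0$ is bounded, the convergence is uniform in $\mathbb{R}^N\times(\tau,\infty)$ for every $\tau>0$; for general $u_0\in L^1(\mathbb{R}^N)$, $u_0\ge0$, for every ball $B\subset\mathbb{R}^N$ and every $\tau>0$ one has $u_\varepsilon(\cdot,t)\to 0$ in $L^1(B)$ as $\varepsilon\searrow0$, uniformly in $t\ge\tau$.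
   Context: For $0<s<1$, the fractional Laplacian is $(-\Delta)^s v(x)=c(N,s)\,\mathrm{p.v.}\int_{\mathbb{R}^N}\frac{v(x)-v(y)}{|x-y|^{N+2s}}\,dy$ with $c(N,s)>0$. The nonlinearity is $\phi(u)=-u^{-n}$ if $n>0$ and $\phi(u)=\log u$ if $n=0$ (defined for $u>0$). For $\varepsilon>0$ put $\phi_\varepsilon(v)=\phi(v+\varepsilon)-\phi(\varepsilon)$ for $v\ge0$, and let $v_\varepsilon$ be the (unique, nonnegative) weak solution of $\partial_t v+(-\Delta)^s\phi_\varepsilon(v)=0$ in $\mathbb{R}^N\times(0,\infty)$, $v(\cdot,0)=u_0$, meaning $v\in C^0([0,\infty);L^1(\mathbb{R}^N))$, $\phi_\varepsilon(v)\in L^2_{loc}(0,\infty;\dot H^s(\mathbb{R}^N))$, $v(0)=u_0$ a.e., and $\int_0^\infty\!\int_{\mathbb{R}^N} v\,\partial_t\zeta\,dx\,dt-\int_0^\infty\!\int_{\mathbb{R}^N}(-\Delta)^{s/2}\phi_\varepsilon(v)\,(-\Delta)^{s/2}\zeta\,dx\,dt=0$ for all $\zeta\in C_c^\infty(\mathbb{R}^N\times(0,\infty))$. The approximate solution is $u_\varepsilon=v_\varepsilon+\varepsilon$; it solves $\partial_t u+(-\Delta)^s\phi(u)=0$ with $u(\cdot,0)=u_0+\varepsilon$, satisfies $u_\varepsilon\ge\varepsilon$, and $u_\varepsilon$ is nondecreasing in $\varepsilon$, so the monotone limit $\bar u=\lim_{\varepsilon\to0}u_\varepsilon$ (the limit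 solution) exists. *)

theory Defs
  imports "HOL-Analysis.Analysis"
begin

definition phi :: "real \<Rightarrow> real \<Rightarrow> real" where
  "phi n u = (if n > 0 then - (u powr (- n)) else ln u)"

definition phi_eps :: "real \<Rightarrow> real \<Rightarrow> real \<Rightarrow> real" where
  "phi_eps n \<epsilon> v = phi n (v + \<epsilon>) - phi n \<epsilon>"

text \<open>c(N,s) = 4^s Gamma(N/2+s) / (pi^(N/2) |Gamma(-s)|) = s 4^s Gamma(N/2+s) / (pi^(N/2) Gamma(1-s)),
  the constant for which (-Delta)^s has Fourier symbol |xi|^(2s).\<close>
definition frac_const :: "nat \<Rightarrow> real \<Rightarrow> real" where
  "frac_const N s = s * 4 powr s * Gamma (real N / 2 + s) / (pi powr (real N / 2) * Gamma (1 - s))"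

text \<open>For f in the homogeneous space H^s and g smooth with compact support,
  integral of (-Delta)^(s/2) f * (-Delta)^(s/2) g equals
  c(N,s)/2 times the Gagliardo double integral below.\<close>
definition frac_pairing :: "real \<Rightarrow> (real^'d \<Rightarrow> real) \<Rightarrow> (real^'d \<Rightarrow> real) \<Rightarrow> real" where
  "frac_pairing s f g = frac_const CARD('d) s / 2 *
     (\<integral>x. (\<integral>y. (f x - f y) * (g x - g y) / (norm (x - y) powr (real CARD('d) + 2 * s)) \<partial>lebesgue) \<partial>lebesgue)"

definition gagliardo_sq :: "real \<Rightarrow> (real^'d \<Rightarrow> real) \<Rightarrow> ennreal" where
  "gagliardo_sq s f =
     (\<integral>\<^sup>+x. (\<integral>\<^sup>+y. ennreal ((f x - f y)^2 / (norm (x - y) powr (real CARD('d) + 2 * s))) \<partial>lebesgue) \<partial>lebesgue)"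

fun iter_dir :: "'a::real_normed_vector list \<Rightarrow> ('a \<Rightarrow> real) \<Rightarrow> ('a \<Rightarrow> real)" where
  "iter_dir [] f = f"
| "iter_dir (v # vs) f = (\<lambda>x. frechet_derivative (iter_dir vs f) (at x) v)"

definition smooth_fn :: "('a::real_normed_vector \<Rightarrow> real) \<Rightarrow> bool" where
  "smooth_fn f \<longleftrightarrow> (\<forall>vs x. iter_dir vs f differentiable (at x))"

definition test_fn :: "(real \<times> (real^'d) \<Rightarrow> real) \<Rightarrow> bool" where
  "test_fn \<zeta> \<longleftrightarrow> smooth_fn \<zeta> \<and> compact (closure {p. \<zeta> p \<noteq> 0})
      \<and> closure {p. \<zeta> p \<noteq> 0} \<subseteq> {0<..} \<times> UNIV"

definition time_deriv :: "(real \<times> (real^'d) \<Rightarrow> real) \<Rightarrow> real \<Rightarrow> real^'d \<Rightarrow> real" where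
  "time_deriv \<zeta> t x = frechet_derivative \<zeta> (at (t, x)) (1, 0)"

text \<open>v t x stands for v(x,t). Weak (nonnegative) solution of
  d_t v + (-Delta)^s phi_eps(v) = 0, v(0) = u0.\<close>
definition weak_sol_eps ::
  "real \<Rightarrow> real \<Rightarrow> real \<Rightarrow> (real^'d \<Rightarrow> real) \<Rightarrow> (real \<Rightarrow> real^'d \<Rightarrow> real) \<Rightarrow> bool" where
  "weak_sol_eps s n \<epsilon> u0 v \<longleftrightarrow>
     \<comment> \<open>v in C^0([0,infinity); L^1(R^N))\<close>
     (\<forall>t\<ge>0. integrable lebesgue (v t)) \<and>
     (\<forall>t\<ge>0. ((\<lambda>\<tau>. \<integral>x. \<bar>v \<tau> x - v t x\<bar> \<partial>lebesgue) \<longlongrightarrow> 0) (at t within {0..})) \<and>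
     \<comment> \<open>nonnegativity\<close>
     (\<forall>t\<ge>0. AE x in lebesgue. 0 \<le> v t x) \<and>
     \<comment> \<open>initial datum\<close>
     (AE x in lebesgue. v 0 x = u0 x) \<and>
     \<comment> \<open>phi_eps(v) in L^2_loc(0,infinity; homogeneous H^s)\<close>
     (\<forall>a b. 0 < a \<longrightarrow> a < b \<longrightarrow>
        (\<integral>\<^sup>+t\<in>{a..b}. gagliardo_sq s (\<lambda>x. phi_eps n \<epsilon> (v t x)) \<partial>lborel) < \<infinity>) \<and>
     \<comment> \<open>weak formulation\<close>
     (\<forall>\<zeta>::real \<times> (real^'d) \<Rightarrow> real. test_fn \<zeta> \<longrightarrow>
        (\<integral>t\<in>{0<..}. (\<integral>x. v t x * time_deriv \<zeta> t x \<partial>lebesgue) \<partial>lborel)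
        - (\<integral>t\<in>{0<..}. frac_pairing s (\<lambda>x. phi_eps n \<epsilon> (v t x)) (\<lambda>x. \<zeta> (t, x)) \<partial>lborel) = 0)"

end

theory Submission
  imports Defs
begin

text \<open>Write \<open>w = v\<^sub>\<epsilon>\<close> and \<open>F = \<phi>\<^sub>\<epsilon>\<close>, so that \<open>F 0 = 0\<close>, \<open>F\<close> is increasing and Lipschitz on \<open>[0,\<infinity>)\<close>, and \<open>F K \<rightarrow> \<infinity>\<close>
  as \<open>\<epsilon> \<rightarrow> 0\<close> for every fixed \<open>K > 0\<close>. Testing the equation with nondecreasing functions of \<open>F w\<close> (after
  averaging in time, using convexity of the primitive) shows that the excess mass \<open>\<integral>(w - k)\<^sub>+\<close> decreases in
  time and that its decrease controls the Gagliardo energy of truncations of \<open>F w\<close>. A weak-type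
  fractional Sobolev inequality bounds that energy below by a multiple of
  \<open>(F l - F k)\<^sup>2 |{w > l}|\<^bsup>1 - 2s/N\<^esup>\<close>. Since \<open>F K\<close> blows up, \<open>{w(t) > K}\<close> must have small measure at some time
  before \<open>\<tau>\<close>, and because large values carry little mass (uniformly in \<open>\<epsilon>\<close>, as \<open>u\<^sub>0\<close> is integrable), the
  excess mass over any level vanishes from time \<open>\<tau>\<close> on. This gives convergence in \<open>L\<^sup>1\<close> of balls; for
  bounded data a De Giorgi iteration, started from small excess mass, makes it uniform. Doubling the time variable
  yields \<open>L\<^sup>1\<close> comparison, hence monotonicity of \<open>v\<^sub>\<epsilon> + \<epsilon>\<close> in \<open>\<epsilon>\<close>, and convergence in measure
  improves to convergence almost everywhere.\<close>

section \<open>Gagliardo forms\<close>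

text \<open>Hence test functions frozen at one time, backward differences, and inequalities that
  survive the limit. What empties the limit is a mismatch of scaling. Dissipation is quadratic in
  the increment \<open>F l - F k\<close>, the entropy paying for it only linear, and the excess mass
  over level \<open>k\<close> is bounded by the mass of u0. For k = 0 and l = K the increment tends
  to infinity while all other constants are independent of \<epsilon>, so {w > K} cannot stay large.
  Between positive levels the increments are merely bounded below; that cannot start a De Giorgi
  iteration but is enough to run one whose starting value is already small. The Lipschitz constant
  of \<open>F\<close> does blow up and is used only for fixed \<epsilon>. The energy estimate links
  two distinct levels, so each use raises the level; this is why bounds appear with doubled levels.
  The exponent 1 - 2s/N is positive because 2s < N.\<close>

definition gker :: "real \<Rightarrow> 'a::euclidean_space \<times> 'a \<Rightarrow> real" where
  "gker s z = 1 / norm (fst z - snd z) powr (real DIM('a) + 2 * s)"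

text \<open>With the singular kernel absorbed into the measure, the Gagliardo energy is the square
  of a plain L^2 norm of \<open>dif f\<close>, so general L^2 arguments apply. On the diagonal
  \<open>0 powr _ = 0\<close> and division by zero give the kernel the value 0; the density is
  real-valued, which makes the measure sigma-finite.\<close>

definition gm :: "real \<Rightarrow> ('a::euclidean_space \<times> 'a) measure" where
  "gm s = density (lborel \<Otimes>\<^sub>M lborel) (\<lambda>z. ennreal (gker s z))"

definition dif :: "('a \<Rightarrow> real) \<Rightarrow> 'a \<times> 'a \<Rightarrow> real" where
  "dif f z = f (fst z) - f (snd z)"

definition gag :: "real \<Rightarrow> ('a::euclidean_space \<Rightarrow> real) \<Rightarrow> ennreal" where
  "gag s f = (\<integral>\<^sup>+z. ennreal ((dif f z)\<^sup>2) \<partial>gm s)"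

definition gform :: "real \<Rightarrow> ('a::euclidean_space \<Rightarrow> real) \<Rightarrow> ('a \<Rightarrow> real) \<Rightarrow> real" where
  "gform s f g = (\<integral>z. dif f z * dif g z \<partial>gm s)"

text \<open>Lebesgue measure on \<open>{a..b}\<close>, kept on the whole Borel algebra: the
  underlying space does not vary with the end points, so measurability of integrands is settled
  once. For b < a it is the zero measure.\<close>

definition tm :: "real \<Rightarrow> real \<Rightarrow> real measure" where
  "tm a b = density lborel (\<lambda>t. ennreal (indicator {a..b} t))"

lemma gker_nonneg [simp]: "0 \<le> gker s z"
  by (simp add: gker_def)

lemma gker_measurable [measurable]: "gker s \<in> borel_measurable (borel \<Otimes>\<^sub>M borel)"
  unfolding gker_def by measurable

lemma sets_gm [measurable_cong, simp]: "sets (gm s) = sets (borel \<Otimes>\<^sub>M borel)"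
  unfolding gm_def by (simp cong: sets_pair_measure_cong)

lemma space_gm [simp]: "space (gm s) = UNIV"
  unfolding gm_def by (simp add: space_pair_measure)

lemma sets_tm [measurable_cong, simp]: "sets (tm a b) = sets borel"
  unfolding tm_def by simp

lemma space_tm [simp]: "space (tm a b) = UNIV"
  unfolding tm_def by simp

lemma sigma_finite_gm: "sigma_finite_measure (gm s)"
  unfolding gm_def
  by (subst sigma_finite_measure.sigma_finite_iff_density_finite)
     (auto intro!: sigma_finite_pair_measure lborel.sigma_finite_measure_axioms)

lemma sigma_finite_tm: "sigma_finite_measure (tm a b)"
  unfolding tm_def
  by (subst sigma_finite_measure.sigma_finite_iff_density_finite)
     (auto intro!: lborel.sigma_finite_measure_axioms)

lemma pair_tm_gm: "pair_sigma_finite (tm a b) (gm s)"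
  by (intro pair_sigma_finite.intro sigma_finite_gm sigma_finite_tm)

lemma nn_integral_tm:
  assumes [measurable]: "f \<in> borel_measurable borel"
  shows "(\<integral>\<^sup>+t. f t \<partial>tm a b) = (\<integral>\<^sup>+t. f t * indicator {a..b} t \<partial>lborel)"
  unfolding tm_def by (subst nn_integral_density) (auto simp: mult.commute ennreal_indicator)

lemma integral_tm:
  fixes f :: "real \<Rightarrow> real"
  assumes [measurable]: "f \<in> borel_measurable borel"
  shows "(\<integral>t. f t \<partial>tm a b) = (\<integral>t. indicator {a..b} t * f t \<partial>lborel)"
  unfolding tm_def by (subst integral_density) auto

lemma integrable_tm:
  fixes f :: "real \<Rightarrow> real"
  assumes [measurable]: "f \<in> borel_measurable borel"
  shows "integrable (tm a b) f \<longleftrightarrow> integrable lborel (\<lambda>t. indicator {a..b} t * f t)"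
  unfolding tm_def by (subst integrable_density) auto

lemma AE_tm_iff: "(AE t in tm a b. P t) \<longleftrightarrow> (AE t in lborel. t \<in> {a..b} \<longrightarrow> P t)"
  unfolding tm_def by (subst AE_density) (auto simp: indicator_def)

lemma emeasure_tm [simp]: "a \<le> b \<Longrightarrow> emeasure (tm a b) UNIV = ennreal (b - a)"
  unfolding tm_def by (subst emeasure_density) (auto simp: ennreal_indicator)

lemma finite_tm: "finite_measure (tm a b)"
proof (cases "a \<le> b")
  case True then show ?thesis by (intro finite_measureI) auto
next
  case False
  then have "emeasure (tm a b) UNIV = 0"
    unfolding tm_def by (subst emeasure_density) (auto simp: ennreal_indicator)
  then show ?thesis by (intro finite_measureI) auto
qed

lemma dif_measurable [measurable]:
  assumes [measurable]: "f \<in> borel_measurable borel"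
  shows "dif f \<in> borel_measurable (borel \<Otimes>\<^sub>M borel)"
  unfolding dif_def by measurable

lemma gag_measurable [measurable]:
  fixes f :: "'t \<Rightarrow> 'a::euclidean_space \<Rightarrow> real"
  assumes [measurable]: "case_prod f \<in> borel_measurable (M \<Otimes>\<^sub>M borel)"
  shows "(\<lambda>t. gag s (f t)) \<in> borel_measurable M"
proof -
  interpret sigma_finite_measure "gm s :: ('a\<times>'a) measure" by (rule sigma_finite_gm)
  show ?thesis unfolding gag_def dif_def by measurable
qed

lemma gform_measurable [measurable]:
  fixes f g :: "'t \<Rightarrow> 'a::euclidean_space \<Rightarrow> real"
  assumes [measurable]: "case_prod f \<in> borel_measurable (M \<Otimes>\<^sub>M borel)"
    "case_prod g \<in> borel_measurable (M \<Otimes>\<^sub>M borel)"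
  shows "(\<lambda>t. gform s (f t) (g t)) \<in> borel_measurable M"
proof -
  interpret sigma_finite_measure "gm s :: ('a\<times>'a) measure" by (rule sigma_finite_gm)
  show ?thesis unfolding gform_def dif_def by measurable
qed

lemma square_integrable:
  fixes f :: "'a \<Rightarrow> real"
  assumes "f \<in> borel_measurable M" "(\<integral>\<^sup>+z. ennreal ((f z)\<^sup>2) \<partial>M) < \<infinity>"
  shows "integrable M (\<lambda>z. (f z)\<^sup>2)"
  using assms by (auto simp: integrable_iff_bounded)

lemma abs_mult_le_squares: "\<bar>x * y\<bar> \<le> x\<^sup>2 + (y::real)\<^sup>2"
proof -
  have "2 * (\<bar>x\<bar> * \<bar>y\<bar>) \<le> x\<^sup>2 + y\<^sup>2"
    using sum_squares_bound[of "\<bar>x\<bar>" "\<bar>y\<bar>"] by simp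
  moreover have "0 \<le> x\<^sup>2" "0 \<le> y\<^sup>2" by auto
  ultimately show ?thesis unfolding abs_mult by linarith
qed

lemma integrable_mult_squares:
  fixes f g :: "'a \<Rightarrow> real"
  assumes [measurable]: "f \<in> borel_measurable M" "g \<in> borel_measurable M"
    and "(\<integral>\<^sup>+z. ennreal ((f z)\<^sup>2) \<partial>M) < \<infinity>" "(\<integral>\<^sup>+z. ennreal ((g z)\<^sup>2) \<partial>M) < \<infinity>"
  shows "integrable M (\<lambda>z. f z * g z)"
proof (rule Bochner_Integration.integrable_bound)
  show "integrable M (\<lambda>z. (f z)\<^sup>2 + (g z)\<^sup>2)"
    using assms by (intro Bochner_Integration.integrable_add square_integrable)
qed (auto simp: abs_mult_le_squares intro!: AE_I2)

lemma gform_integrable: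
  assumes [measurable]: "f \<in> borel_measurable borel" "g \<in> borel_measurable borel"
    and "gag s f < \<infinity>" "gag s g < \<infinity>"
  shows "integrable (gm s) (\<lambda>z. dif f z * dif g z)"
  using assms(3,4) unfolding gag_def by (intro integrable_mult_squares) auto

text \<open>The extra function \<open>h\<close> allows \<open>g\<close> to depend on the point as
  well as on the value of \<open>f\<close>; differences \<open>f - h\<close> are the special case
  \<open>L = 1\<close>. The factor 2 is
  \<open>(a + b)\<^sup>2 \<le> 2 * (a\<^sup>2 + b\<^sup>2)\<close>.\<close>

lemma gag_bound2:
  assumes [measurable]: "f \<in> borel_measurable borel" "h \<in> borel_measurable borel"
    and L: "L \<ge> 0" "\<And>x y. \<bar>g x - g y\<bar> \<le> L * (\<bar>f x - f y\<bar> + \<bar>h x - h y\<bar>)"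
  shows "gag s g \<le> ennreal (2 * L\<^sup>2) * (gag s f + gag s h)"
proof -
  have *: "(g x - g y)\<^sup>2 \<le> 2 * L\<^sup>2 * ((f x - f y)\<^sup>2 + (h x - h y)\<^sup>2)" for x y
  proof -
    have "(g x - g y)\<^sup>2 \<le> (L * (\<bar>f x - f y\<bar> + \<bar>h x - h y\<bar>))\<^sup>2"
      using L(2)[of x y] L(1) by (subst abs_le_square_iff[symmetric]) auto
    also have "\<dots> = L\<^sup>2 * (\<bar>f x - f y\<bar> + \<bar>h x - h y\<bar>)\<^sup>2" by (simp add: power_mult_distrib)
    also have "\<dots> \<le> L\<^sup>2 * (2 * ((f x - f y)\<^sup>2 + (h x - h y)\<^sup>2))"
      using sum_squares_bound[of "\<bar>f x - f y\<bar>" "\<bar>h x - h y\<bar>"] by (intro mult_left_mono) (simp_all add: power2_sum)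
    finally show ?thesis by (simp add: algebra_simps)
  qed
  have "gag s g \<le> (\<integral>\<^sup>+z. ennreal (2 * L\<^sup>2) * (ennreal ((dif f z)\<^sup>2) + ennreal ((dif h z)\<^sup>2)) \<partial>gm s)"
    unfolding gag_def using *
    by (intro nn_integral_mono) (auto simp: dif_def simp flip: ennreal_plus ennreal_mult intro!: ennreal_leI)
  also have "\<dots> = ennreal (2 * L\<^sup>2) * (gag s f + gag s h)"
    unfolding gag_def by (simp add: nn_integral_cmult nn_integral_add)
  finally show ?thesis .
qed

section \<open>Energies over time intervals and weak continuity of the form\<close>

lemma tm_gag_prod:
  fixes f :: "real \<Rightarrow> 'a::euclidean_space \<Rightarrow> real"
  assumes [measurable]: "case_prod f \<in> borel_measurable (borel \<Otimes>\<^sub>M borel)"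
  shows "(\<integral>\<^sup>+p. ennreal ((dif (f (fst p)) (snd p))\<^sup>2) \<partial>(tm a b \<Otimes>\<^sub>M gm s)) = (\<integral>\<^sup>+t. gag s (f t) \<partial>tm a b)"
proof -
  interpret sigma_finite_measure "gm s :: ('a\<times>'a) measure" by (rule sigma_finite_gm)
  show ?thesis unfolding gag_def
    by (subst nn_integral_fst[symmetric]) (simp_all add: dif_def)
qed

lemma tm_gform_prod:
  fixes f g :: "real \<Rightarrow> 'a::euclidean_space \<Rightarrow> real"
  assumes [measurable]: "case_prod f \<in> borel_measurable (borel \<Otimes>\<^sub>M borel)"
    "case_prod g \<in> borel_measurable (borel \<Otimes>\<^sub>M borel)"
    and "(\<integral>\<^sup>+t. gag s (f t) \<partial>tm a b) < \<infinity>" "(\<integral>\<^sup>+t. gag s (g t) \<partial>tm a b) < \<infinity>"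
  shows "integrable (tm a b \<Otimes>\<^sub>M gm s) (\<lambda>p. dif (f (fst p)) (snd p) * dif (g (fst p)) (snd p))" (is ?A)
    "integrable (tm a b) (\<lambda>t. gform s (f t) (g t))" (is ?B)
    "(\<integral>t. gform s (f t) (g t) \<partial>tm a b)
      = (\<integral>p. dif (f (fst p)) (snd p) * dif (g (fst p)) (snd p) \<partial>(tm a b \<Otimes>\<^sub>M gm s))" (is ?C)
proof -
  interpret pair_sigma_finite "tm a b" "gm s :: ('a\<times>'a) measure" by (rule pair_tm_gm)
  show A: ?A
    using assms(3,4) unfolding tm_gag_prod[OF assms(1), symmetric] tm_gag_prod[OF assms(2), symmetric]
    by (intro integrable_mult_squares) (simp_all add: dif_def)
  show ?B using integrable_fst'[OF A] by (simp add: gform_def)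
  show ?C using integral_fst'[OF A] by (simp add: gform_def)
qed

lemma ennreal_abs_integral_le:
  fixes f :: "'a \<Rightarrow> real"
  shows "ennreal \<bar>integral\<^sup>L M f\<bar> \<le> (\<integral>\<^sup>+z. ennreal \<bar>f z\<bar> \<partial>M)"
proof (cases "integrable M f")
  case True then show ?thesis using integral_norm_bound_ennreal[of M f] by simp
next
  case False then show ?thesis by (simp add: not_integrable_integral_eq)
qed

text \<open>A family bounded in L^2 that tends to 0 in L^1 on each set of an exhaustion tends weakly
  to 0 in L^2. \<open>\<Psi>\<close> is replaced by a bounded truncation living on one
  \<open>S m\<close>; Young's inequality with a small weight absorbs the L^2 error.\<close>

lemma tendsto_integral_mult_weak:
  fixes \<Phi> :: "'w \<Rightarrow> 'z \<Rightarrow> real"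
  assumes [measurable]: "\<And>w. \<Phi> w \<in> borel_measurable M" "\<Psi> \<in> borel_measurable M" "\<And>m. S m \<in> sets M"
    and C: "\<forall>\<^sub>F w in F. (\<integral>\<^sup>+z. ennreal ((\<Phi> w z)\<^sup>2) \<partial>M) \<le> ennreal C"
    and \<Psi>: "(\<integral>\<^sup>+z. ennreal ((\<Psi> z)\<^sup>2) \<partial>M) < \<infinity>"
    and S: "AE z in M. \<forall>\<^sub>F m in sequentially. z \<in> S (m::nat)"
    and lim: "\<And>m. ((\<lambda>w. \<integral>\<^sup>+z. ennreal (indicator (S m) z * \<bar>\<Phi> w z\<bar>) \<partial>M) \<longlongrightarrow> 0) F"
  shows "((\<lambda>w. \<integral>z. \<Phi> w z * \<Psi> z \<partial>M) \<longlongrightarrow> 0) F"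
proof (rule tendstoI)
  fix e :: real assume "e > 0"
  \<comment> \<open>The maximum with 1 keeps the divisor in \<open>\<eta>\<close> positive;
    \<open>\<eta>\<close> is such that the bounded L^2 part costs a quarter of
    \<open>e\<close>.\<close>
  define C' where "C' = max C 1"
  define \<eta> where "\<eta> = e / (4 * C')"
  have \<eta>: "\<eta> > 0" and "C' > 0" using \<open>e > 0\<close> by (auto simp: \<eta>_def C'_def)
  have \<eta>C: "\<eta> * C' = e / 4" using \<open>C' > 0\<close> by (simp add: \<eta>_def)
  define cut where "cut m z = (if z \<in> S m \<and> \<bar>\<Psi> z\<bar> \<le> real m then \<Psi> z else 0)" for m z
  have [measurable]: "cut m \<in> borel_measurable M" for m unfolding cut_def by measurable
  have "(\<lambda>m. \<integral>\<^sup>+z. ennreal ((\<Psi> z - cut m z)\<^sup>2) \<partial>M) \<longlonglongrightarrow> (\<integral>\<^sup>+z. 0 \<partial>M)"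
  proof (rule nn_integral_dominated_convergence)
    show "AE z in M. (\<lambda>m. ennreal ((\<Psi> z - cut m z)\<^sup>2)) \<longlonglongrightarrow> 0"
      using S
    proof eventually_elim
      case (elim z)
      have "\<forall>\<^sub>F m in sequentially. \<bar>\<Psi> z\<bar> \<le> real m"
        using eventually_ge_at_top[of "nat \<lceil>\<bar>\<Psi> z\<bar>\<rceil>"] by eventually_elim linarith
      with elim have "\<forall>\<^sub>F m in sequentially. ennreal ((\<Psi> z - cut m z)\<^sup>2) = 0"
        by eventually_elim (simp add: cut_def)
      then show ?case by (rule tendsto_eventually)
    qed
    show "(\<integral>\<^sup>+z. ennreal ((\<Psi> z)\<^sup>2) \<partial>M) < \<infinity>" by fact
    show "AE z in M. ennreal ((\<Psi> z - cut m z)\<^sup>2) \<le> ennreal ((\<Psi> z)\<^sup>2)" for m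
      by (auto simp: cut_def intro!: AE_I2)
  qed auto
  then have "\<forall>\<^sub>F m in sequentially. (\<integral>\<^sup>+z. ennreal ((\<Psi> z - cut m z)\<^sup>2) \<partial>M) < ennreal (\<eta> * e)"
    using \<eta> \<open>e > 0\<close> by (intro order_tendstoD) (auto simp: ennreal_less_zero_iff)
  \<comment> \<open>From here on \<open>m\<close> is fixed, before \<open>w\<close> varies: the
    truncation error is below \<open>\<eta> * e\<close>, which the weight
    \<open>1 / (4 * \<eta>)\<close> turns into a quarter of \<open>e\<close>.\<close>
  then obtain m where m: "(\<integral>\<^sup>+z. ennreal ((\<Psi> z - cut m z)\<^sup>2) \<partial>M) < ennreal (\<eta> * e)"
    using eventually_happens'[OF sequentially_bot] by blast
  have "\<forall>\<^sub>F w in F. (\<integral>\<^sup>+z. ennreal (indicator (S m) z * \<bar>\<Phi> w z\<bar>) \<partial>M) < ennreal (e / (4 * (real m + 1)))"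
    using \<open>e > 0\<close> by (intro order_tendstoD[OF lim]) (auto simp: ennreal_less_zero_iff)
  with C show "\<forall>\<^sub>F w in F. dist (\<integral>z. \<Phi> w z * \<Psi> z \<partial>M) 0 < e"
  proof eventually_elim
    case (elim w)
    have pw: "\<bar>\<Phi> w z * \<Psi> z\<bar> \<le> \<eta> * (\<Phi> w z)\<^sup>2 + 1 / (4*\<eta>) * (\<Psi> z - cut m z)\<^sup>2
        + real m * (indicator (S m) z * \<bar>\<Phi> w z\<bar>)" for z
    proof -
      have young: "\<bar>x * y\<bar> \<le> \<eta> * x\<^sup>2 + 1 / (4*\<eta>) * y\<^sup>2" for x y :: real
      proof -
        have "0 \<le> (2 * \<eta> * \<bar>x\<bar> - \<bar>y\<bar>)\<^sup>2" by simp
        then have "4 * \<eta> * \<bar>x * y\<bar> \<le> 4 * \<eta> * (\<eta> * x\<^sup>2 + 1 / (4*\<eta>) * y\<^sup>2)"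
          using \<eta> by (simp add: power2_diff abs_mult distrib_left power_mult_distrib) (simp add: power2_eq_square mult_ac)
        then show ?thesis using \<eta> by (simp add: mult_le_cancel_left)
      qed
      have "\<bar>\<Phi> w z * \<Psi> z\<bar> \<le> \<bar>\<Phi> w z * (\<Psi> z - cut m z)\<bar> + \<bar>\<Phi> w z\<bar> * \<bar>cut m z\<bar>"
        using abs_triangle_ineq[of "\<Phi> w z * (\<Psi> z - cut m z)" "\<Phi> w z * cut m z"]
        by (simp add: abs_mult[symmetric] algebra_simps)
      moreover have "\<bar>\<Phi> w z\<bar> * \<bar>cut m z\<bar> \<le> real m * (indicator (S m) z * \<bar>\<Phi> w z\<bar>)"
        by (auto simp: cut_def indicator_def mult.commute intro!: mult_right_mono)
      ultimately show ?thesis using young[of "\<Phi> w z" "\<Psi> z - cut m z"] by linarith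
    qed
    have "ennreal \<bar>\<integral>z. \<Phi> w z * \<Psi> z \<partial>M\<bar> \<le> (\<integral>\<^sup>+z. ennreal \<bar>\<Phi> w z * \<Psi> z\<bar> \<partial>M)"
      by (rule ennreal_abs_integral_le)
    also have "\<dots> \<le> (\<integral>\<^sup>+z. ennreal \<eta> * ennreal ((\<Phi> w z)\<^sup>2) + ennreal (1 / (4*\<eta>)) * ennreal ((\<Psi> z - cut m z)\<^sup>2)
        + ennreal (real m) * ennreal (indicator (S m) z * \<bar>\<Phi> w z\<bar>) \<partial>M)"
      using \<eta> pw by (intro nn_integral_mono) (simp flip: ennreal_mult ennreal_plus)
    also have "\<dots> = ennreal \<eta> * (\<integral>\<^sup>+z. ennreal ((\<Phi> w z)\<^sup>2) \<partial>M)
        + ennreal (1 / (4*\<eta>)) * (\<integral>\<^sup>+z. ennreal ((\<Psi> z - cut m z)\<^sup>2) \<partial>M)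
        + ennreal (real m) * (\<integral>\<^sup>+z. ennreal (indicator (S m) z * \<bar>\<Phi> w z\<bar>) \<partial>M)"
      by (simp add: nn_integral_add nn_integral_cmult)
    also have "\<dots> \<le> ennreal \<eta> * ennreal C' + ennreal (1 / (4*\<eta>)) * ennreal (\<eta> * e)
        + ennreal (real m) * ennreal (e / (4 * (real m + 1)))"
      using elim m by (intro add_mono mult_left_mono) (auto simp: C'_def intro: order_trans[OF elim(1)])
    also have "\<dots> = ennreal (\<eta> * C' + 1 / (4*\<eta>) * (\<eta> * e) + real m * (e / (4 * (real m + 1))))"
      using \<eta> \<open>e > 0\<close> \<open>C' > 0\<close> by (simp flip: ennreal_mult ennreal_plus)
    also have "\<dots> < ennreal e"
    proof (rule ennreal_lessI[OF \<open>e > 0\<close>])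
      have "1 / (4*\<eta>) * (\<eta> * e) = e / 4" using \<eta> by simp
      moreover have "real m * (e / (4 * (real m + 1))) \<le> e / 4"
        using \<open>e > 0\<close> by (simp add: field_simps)
      ultimately show "\<eta> * C' + 1 / (4*\<eta>) * (\<eta> * e) + real m * (e / (4 * (real m + 1))) < e"
        using \<eta>C \<open>e > 0\<close> by linarith
    qed
    finally show ?case by (simp add: ennreal_less_iff)
  qed
qed

text \<open>Bounded pairs at distance at least 1/m. There the kernel is at most m^(N+2s), so an
  L^1-small function has a \<open>dif\<close> that is L^1-small with respect to \<open>gm\<close>;
  the sets increase to the complement of the diagonal.\<close>

definition gcut :: "nat \<Rightarrow> ('a::real_normed_vector \<times> 'a) set" where
  "gcut m = {z. norm (fst z) \<le> real m \<and> norm (snd z) \<le> real m \<and> 1 \<le> real m * norm (fst z - snd z)}"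

lemma gcut_measurable [measurable]: "(gcut m :: ('a::euclidean_space \<times> 'a) set) \<in> sets (borel \<Otimes>\<^sub>M borel)"
  unfolding gcut_def borel_prod
  by (intro borel_closed closed_Collect_conj closed_Collect_le continuous_intros)

lemma nn_integral_gcut_le:
  fixes h :: "'a::euclidean_space \<Rightarrow> real"
  assumes s: "s > 0" and [measurable]: "h \<in> borel_measurable borel"
  shows "(\<integral>\<^sup>+z. ennreal (indicator (gcut m) z * \<bar>dif h z\<bar>) \<partial>gm s)
      \<le> ennreal (2 * real m powr (real DIM('a) + 2 * s)) * emeasure lborel (cball 0 (real m) :: 'a set) * (\<integral>\<^sup>+x. ennreal \<bar>h x\<bar> \<partial>lborel)"
proof -
    define K where "K = real m powr (real DIM('a) + 2 * s)"
    let ?B = "cball 0 (real m) :: 'a set"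
    have K: "K \<ge> 0" by (simp add: K_def)
    have [measurable]: "?B \<in> sets borel" by simp
    have kb: "gker s z \<le> K" if "z \<in> gcut m" for z :: "'a \<times> 'a"
    proof -
      have z: "1 \<le> real m * norm (fst z - snd z)" using that by (auto simp: gcut_def)
      then have n: "norm (fst z - snd z) > 0" by (cases "norm (fst z - snd z) = 0") auto
      have "1 \<le> (real m * norm (fst z - snd z)) powr (real DIM('a) + 2 * s)"
        using z s by (intro ge_one_powr_ge_zero) auto
      also have "\<dots> = K * norm (fst z - snd z) powr (real DIM('a) + 2 * s)"
        by (simp add: K_def powr_mult)
      finally show ?thesis using n by (simp add: gker_def field_simps)
    qed
    have "(\<integral>\<^sup>+z. ennreal (indicator (gcut m) z * \<bar>dif h z\<bar>) \<partial>gm s) = (\<integral>\<^sup>+z. ennreal (gker s z) * ennreal (indicator (gcut m) z * \<bar>dif h z\<bar>) \<partial>(lborel \<Otimes>\<^sub>M lborel))"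
      unfolding gm_def by (subst nn_integral_density) auto
    also have "\<dots> \<le> (\<integral>\<^sup>+z. ennreal K * (ennreal \<bar>h (fst z)\<bar> * indicator ?B (snd z) + ennreal \<bar>h (snd z)\<bar> * indicator ?B (fst z)) \<partial>(lborel \<Otimes>\<^sub>M lborel))"
    proof (intro nn_integral_mono)
      fix z :: "'a\<times>'a"
      show "ennreal (gker s z) * ennreal (indicator (gcut m) z * \<bar>dif h z\<bar>) \<le>
        ennreal K * (ennreal \<bar>h (fst z)\<bar> * indicator ?B (snd z) + ennreal \<bar>h (snd z)\<bar> * indicator ?B (fst z))"
      proof (cases "z \<in> gcut m")
        case True
        then have "fst z \<in> ?B" "snd z \<in> ?B" by (auto simp: gcut_def)
        then show ?thesis using True kb[OF True] K
          by (auto simp: dif_def simp flip: ennreal_plus ennreal_mult intro!: ennreal_leI mult_mono)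
      qed auto
    qed
    also have "\<dots> = ennreal K * ((\<integral>\<^sup>+z. ennreal \<bar>h (fst z)\<bar> * indicator ?B (snd z) \<partial>(lborel \<Otimes>\<^sub>M lborel)) +
        (\<integral>\<^sup>+z. ennreal \<bar>h (snd z)\<bar> * indicator ?B (fst z) \<partial>(lborel \<Otimes>\<^sub>M lborel)))"
      by (simp add: nn_integral_cmult nn_integral_add)
    also have "(\<integral>\<^sup>+z. ennreal \<bar>h (fst z)\<bar> * indicator ?B (snd z) \<partial>(lborel \<Otimes>\<^sub>M lborel)) = (\<integral>\<^sup>+x. ennreal \<bar>h x\<bar> \<partial>lborel) * emeasure lborel ?B"
      by (subst lborel.nn_integral_fst[symmetric]) (simp_all add: nn_integral_cmult nn_integral_multc)
    also have "(\<integral>\<^sup>+z. ennreal \<bar>h (snd z)\<bar> * indicator ?B (fst z) \<partial>(lborel \<Otimes>\<^sub>M lborel)) = (\<integral>\<^sup>+x. ennreal \<bar>h x\<bar> \<partial>lborel) * emeasure lborel ?B"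
      by (subst lborel.nn_integral_fst[symmetric]) (simp_all add: nn_integral_cmult nn_integral_multc)
    finally show ?thesis using K by (simp add: K_def ennreal_mult mult_ac mult_2 flip: mult_2)
qed

text \<open>Bounded energies together with L^1 convergence in space and time suffice to pass to the
  limit in the form against a fixed function of finite energy. It is applied both to translations in
  space and to shifts in time.\<close>

lemma tendsto_gform_weak:
  fixes g :: "'w \<Rightarrow> real \<Rightarrow> 'a::euclidean_space \<Rightarrow> real"
  assumes s: "s > 0"
    and [measurable]: "\<And>w. case_prod (g w) \<in> borel_measurable (borel \<Otimes>\<^sub>M borel)"
      "case_prod f \<in> borel_measurable (borel \<Otimes>\<^sub>M borel)"
    and C: "\<forall>\<^sub>F w in F. (\<integral>\<^sup>+t. gag s (g w t) \<partial>tm a b) \<le> ennreal C"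
    and f: "(\<integral>\<^sup>+t. gag s (f t) \<partial>tm a b) < \<infinity>"
    and lim: "((\<lambda>w. \<integral>\<^sup>+t. \<integral>\<^sup>+x. ennreal \<bar>g w t x\<bar> \<partial>lborel \<partial>tm a b) \<longlongrightarrow> 0) F"
  shows "((\<lambda>w. \<integral>t. gform s (g w t) (f t) \<partial>tm a b) \<longlongrightarrow> 0) F"
proof -
  interpret P: pair_sigma_finite "tm a b" "gm s :: ('a\<times>'a) measure" by (rule pair_tm_gm)
  define S where "S m = {p :: real \<times> ('a\<times>'a). snd p \<in> gcut m}" for m :: nat
  have [measurable]: "S m \<in> sets (tm a b \<Otimes>\<^sub>M gm s)" for m
  proof -
    have "S m = {p \<in> space (tm a b \<Otimes>\<^sub>M gm s). snd p \<in> gcut m}" by (auto simp: S_def space_pair_measure)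
    also have "\<dots> \<in> sets (tm a b \<Otimes>\<^sub>M gm s)" by measurable
    finally show ?thesis .
  qed
  \<comment> \<open>Points with positive kernel lie off the diagonal, so each of the three
    conditions in \<open>gcut\<close> holds for all large \<open>m\<close>.\<close>
  have gmS: "AE z in (gm s :: ('a\<times>'a) measure). \<forall>\<^sub>F m in sequentially. z \<in> gcut m"
    unfolding gm_def
  proof (subst AE_density)
    show "AE z in (lborel \<Otimes>\<^sub>M lborel :: ('a\<times>'a) measure). 0 < ennreal (gker s z) \<longrightarrow> (\<forall>\<^sub>F m in sequentially. z \<in> gcut m)"
    proof (rule AE_I2, rule impI)
      fix z :: "'a \<times> 'a" assume "0 < ennreal (gker s z)"
      then have ne: "norm (fst z - snd z) > 0"
        by (auto simp: gker_def ennreal_less_zero_iff split: if_splits)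
      show "\<forall>\<^sub>F m in sequentially. z \<in> gcut m"
        using eventually_ge_at_top[of "nat \<lceil>norm (fst z)\<rceil>"] eventually_ge_at_top[of "nat \<lceil>norm (snd z)\<rceil>"]
          eventually_ge_at_top[of "nat \<lceil>1 / norm (fst z - snd z)\<rceil>"]
      proof eventually_elim
        case (elim m)
        then have "1 / norm (fst z - snd z) \<le> real m" by linarith
        then have "1 \<le> real m * norm (fst z - snd z)" using ne by (simp add: field_simps)
        moreover have "norm (fst z) \<le> real m" "norm (snd z) \<le> real m" using elim by linarith+
        ultimately show ?case unfolding gcut_def by simp
      qed
    qed
  qed simp
  have "AE p in tm a b \<Otimes>\<^sub>M gm s. \<forall>\<^sub>F m in sequentially. p \<in> S m"
  proof (rule P.AE_pair_measure)
    show "{p \<in> space (tm a b \<Otimes>\<^sub>M gm s). \<forall>\<^sub>F m in sequentially. p \<in> S m} \<in> sets (tm a b \<Otimes>\<^sub>M gm s)"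
      unfolding eventually_sequentially by measurable
    show "AE t in tm a b. AE z in gm s. \<forall>\<^sub>F m in sequentially. (t, z) \<in> S m"
      using gmS by (simp add: S_def)
  qed
  have "((\<lambda>w. \<integral>p. dif (g w (fst p)) (snd p) * dif (f (fst p)) (snd p) \<partial>(tm a b \<Otimes>\<^sub>M gm s)) \<longlongrightarrow> 0) F"
  proof (rule tendsto_integral_mult_weak[where S = S and C = C])
    show "\<forall>\<^sub>F w in F. (\<integral>\<^sup>+p. ennreal ((dif (g w (fst p)) (snd p))\<^sup>2) \<partial>(tm a b \<Otimes>\<^sub>M gm s)) \<le> ennreal C"
      using C by (simp add: tm_gag_prod)
    show "(\<integral>\<^sup>+p. ennreal ((dif (f (fst p)) (snd p))\<^sup>2) \<partial>(tm a b \<Otimes>\<^sub>M gm s)) < \<infinity>"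
      using f by (simp add: tm_gag_prod)
    show "AE p in tm a b \<Otimes>\<^sub>M gm s. \<forall>\<^sub>F m in sequentially. p \<in> S m" by fact
    fix m
    show "S m \<in> sets (tm a b \<Otimes>\<^sub>M gm s)" by measurable
    let ?c = "ennreal (2 * real m powr (real DIM('a) + 2 * s)) * emeasure lborel (cball 0 (real m) :: 'a set)"
    have c: "?c < top"
      using emeasure_lborel_cball_finite[of "0::'a" "real m"] by (auto simp: ennreal_mult_less_top)
    show "((\<lambda>w. \<integral>\<^sup>+ p. ennreal (indicator (S m) p * \<bar>dif (g w (fst p)) (snd p)\<bar>) \<partial>(tm a b \<Otimes>\<^sub>M gm s)) \<longlongrightarrow> 0) F"
    proof (rule tendsto_sandwich[OF _ _ tendsto_const])
      show "\<forall>\<^sub>F w in F. (\<integral>\<^sup>+ p. ennreal (indicator (S m) p * \<bar>dif (g w (fst p)) (snd p)\<bar>) \<partial>(tm a b \<Otimes>\<^sub>M gm s))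
         \<le> ?c * (\<integral>\<^sup>+t. \<integral>\<^sup>+x. ennreal \<bar>g w t x\<bar> \<partial>lborel \<partial>tm a b)"
      proof (rule always_eventually, rule allI)
        fix w
        have "(\<integral>\<^sup>+ p. ennreal (indicator (S m) p * \<bar>dif (g w (fst p)) (snd p)\<bar>) \<partial>(tm a b \<Otimes>\<^sub>M gm s))
          = (\<integral>\<^sup>+t. \<integral>\<^sup>+z. ennreal (indicator (gcut m) z * \<bar>dif (g w t) z\<bar>) \<partial>gm s \<partial>tm a b)"
          by (subst P.M2.nn_integral_fst[symmetric]) (simp_all add: dif_def S_def indicator_def)
        also have "\<dots> \<le> (\<integral>\<^sup>+t. ?c * (\<integral>\<^sup>+x. ennreal \<bar>g w t x\<bar> \<partial>lborel) \<partial>tm a b)"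
          by (intro nn_integral_mono nn_integral_gcut_le s) measurable
        also have "\<dots> = ?c * (\<integral>\<^sup>+t. \<integral>\<^sup>+x. ennreal \<bar>g w t x\<bar> \<partial>lborel \<partial>tm a b)"
          by (subst nn_integral_cmult) auto
        finally show "(\<integral>\<^sup>+ p. ennreal (indicator (S m) p * \<bar>dif (g w (fst p)) (snd p)\<bar>) \<partial>(tm a b \<Otimes>\<^sub>M gm s))
         \<le> ?c * (\<integral>\<^sup>+t. \<integral>\<^sup>+x. ennreal \<bar>g w t x\<bar> \<partial>lborel \<partial>tm a b)" .
      qed
      show "((\<lambda>w. ?c * (\<integral>\<^sup>+t. \<integral>\<^sup>+x. ennreal \<bar>g w t x\<bar> \<partial>lborel \<partial>tm a b)) \<longlongrightarrow> 0) F"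
        using ennreal_tendsto_cmult[OF c lim] by simp
    qed simp
  qed (simp_all add: dif_def)
  moreover have "\<forall>\<^sub>F w in F. (\<integral>p. dif (g w (fst p)) (snd p) * dif (f (fst p)) (snd p) \<partial>(tm a b \<Otimes>\<^sub>M gm s))
      = (\<integral>t. gform s (g w t) (f t) \<partial>tm a b)"
    using C by eventually_elim (intro tm_gform_prod(3)[symmetric], use f in \<open>auto intro: le_less_trans\<close>)
  ultimately show ?thesis by (rule Lim_transform_eventually)
qed

section \<open>Translations and the kernel\<close>

lemma nn_integral_lborel_translate:
  fixes c :: "'a::euclidean_space"
  assumes [measurable]: "f \<in> borel_measurable borel"
  shows "(\<integral>\<^sup>+x. f (c + x) \<partial>lborel) = (\<integral>\<^sup>+x. f x \<partial>lborel)"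
  by (subst (2) lborel_distr_plus[of c, symmetric]) (simp add: nn_integral_distr)

lemma lborel_integral_translate:
  fixes c :: "'a::euclidean_space" and f :: "'a \<Rightarrow> real"
  assumes [measurable]: "f \<in> borel_measurable borel"
  shows "(\<integral>x. f (c + x) \<partial>lborel) = (\<integral>x. f x \<partial>lborel)"
  by (subst (2) lborel_distr_plus[of c, symmetric]) (simp add: integral_distr)

lemma lborel_integrable_translate:
  fixes c :: "'a::euclidean_space" and f :: "'a \<Rightarrow> real"
  assumes "integrable lborel f"
  shows "integrable lborel (\<lambda>x. f (c + x))"
proof -
  have [measurable]: "f \<in> borel_measurable borel" using assms by auto
  have "integrable (distr lborel borel ((+) c)) f" using assms by (simp add: lborel_distr_plus)
  then show ?thesis by (simp add: integrable_distr_eq)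
qed

lemma lborel_distr_neg: "distr lborel borel uminus = (lborel :: 'a::euclidean_space measure)"
  by (subst lborel_affine[of "-1" 0]) (auto simp: density_1)

lemma lborel_integral_neg:
  fixes f :: "'a::euclidean_space \<Rightarrow> real"
  assumes [measurable]: "f \<in> borel_measurable borel"
  shows "(\<integral>x. f (- x) \<partial>lborel) = (\<integral>x. f x \<partial>lborel)"
  by (subst (2) lborel_distr_neg[symmetric]) (simp add: integral_distr)

lemma gag_translate:
  fixes f :: "'a::euclidean_space \<Rightarrow> real"
  assumes [measurable]: "f \<in> borel_measurable borel"
  shows "gag s (\<lambda>x. f (c + x)) = gag s f"
proof -
  have "(\<integral>\<^sup>+y. ennreal (gker s (x, y)) * ennreal ((f (c + x) - f (c + y))\<^sup>2) \<partial>lborel)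
     = (\<integral>\<^sup>+y. ennreal (gker s (c + x, y)) * ennreal ((f (c + x) - f y)\<^sup>2) \<partial>lborel)" for x
    by (subst nn_integral_lborel_translate[of "\<lambda>y. ennreal (gker s (c + x, y)) * ennreal ((f (c + x) - f y)\<^sup>2)" c, symmetric])
       (simp_all add: gker_def)
  moreover have "(\<integral>\<^sup>+x. \<integral>\<^sup>+y. ennreal (gker s (c + x, y)) * ennreal ((f (c + x) - f y)\<^sup>2) \<partial>lborel \<partial>lborel)
     = (\<integral>\<^sup>+x. \<integral>\<^sup>+y. ennreal (gker s (x, y)) * ennreal ((f x - f y)\<^sup>2) \<partial>lborel \<partial>lborel)"
    by (rule nn_integral_lborel_translate) measurable
  moreover have "gag s h = (\<integral>\<^sup>+x. \<integral>\<^sup>+y. ennreal (gker s (x, y)) * ennreal ((h x - h y)\<^sup>2) \<partial>lborel \<partial>lborel)"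
    if [measurable]: "h \<in> borel_measurable borel" for h :: "'a \<Rightarrow> real"
    unfolding gag_def gm_def
    by (subst nn_integral_density) (simp_all add: lborel.nn_integral_fst[symmetric] dif_def)
  ultimately show ?thesis by simp
qed

text \<open>The one-sided difference \<open>?g\<close> converges everywhere, because a point of an
  open set stays inside under small translations. This is enough: translation preserves the measure
  of \<open>U\<close>, so the positive and negative parts of the difference have equal integrals,
  and the absolute value integrates to twice \<open>?g\<close>.\<close>

lemma tendsto_translate_indicator_open:
  fixes U :: "'a::euclidean_space set"
  assumes U: "open U" "emeasure lborel U < \<infinity>" and w: "w \<longlonglongrightarrow> 0"
  shows "(\<lambda>k. \<integral>\<^sup>+x. ennreal \<bar>indicator U (w k + x) - indicator U x\<bar> \<partial>lborel) \<longlonglongrightarrow> 0"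
proof -
  have [measurable]: "U \<in> sets borel" using U by auto
  let ?g = "\<lambda>k x. max 0 (indicator U x - indicator U (w k + x)) :: real"
  have i1: "integrable lborel (indicator U :: 'a \<Rightarrow> real)"
    using U by (intro integrable_real_indicator) auto
  have i2: "integrable lborel (\<lambda>x. indicator U (w k + x) :: real)" for k
    by (rule lborel_integrable_translate[OF i1])
  have i3: "integrable lborel (?g k)" for k
    by (intro Bochner_Integration.integrable_bound[OF i1]) (auto simp: indicator_def)
  have "(\<lambda>k. \<integral>x. ?g k x \<partial>lborel) \<longlonglongrightarrow> (\<integral>x. 0 \<partial>(lborel :: 'a measure))"
  proof (rule integral_dominated_convergence[where w = "indicator U"])
    show "AE x in lborel. (\<lambda>k. ?g k x) \<longlonglongrightarrow> 0"
    proof (rule AE_I2)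
      fix x :: 'a
      show "(\<lambda>k. ?g k x) \<longlonglongrightarrow> 0"
      proof (cases "x \<in> U")
        case True
        have "(\<lambda>k. w k + x) \<longlonglongrightarrow> 0 + x" using w by (intro tendsto_intros)
        then have "\<forall>\<^sub>F k in sequentially. w k + x \<in> U"
          using True U by (simp add: topological_tendstoD)
        then have "\<forall>\<^sub>F k in sequentially. ?g k x = 0" by eventually_elim (simp add: True)
        then show ?thesis by (rule tendsto_eventually)
      next
        case False
        then have "?g k x = 0" for k by (auto simp: indicator_def)
        then show ?thesis by simp
      qed
    qed
  qed (auto simp: i1 indicator_def)
  then have lim: "(\<lambda>k. 2 * (\<integral>x. ?g k x \<partial>lborel)) \<longlonglongrightarrow> 0"
    by (auto intro: tendsto_mult_right_zero)
  have "(\<integral>\<^sup>+x. ennreal \<bar>indicator U (w k + x) - indicator U x\<bar> \<partial>lborel) = ennreal (2 * (\<integral>x. ?g k x \<partial>lborel))" for k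
  proof -
    have eq: "\<bar>indicator U (w k + x) - indicator U x\<bar> = 2 * ?g k x + (indicator U (w k + x) - indicator U x :: real)" for x
      by (auto simp: indicator_def)
    have "(\<integral>x. (indicator U (w k + x) - indicator U x :: real) \<partial>lborel) = 0"
      using i1 i2 by (simp add: lborel_integral_translate)
    then have "(\<integral>x. \<bar>indicator U (w k + x) - indicator U x\<bar> \<partial>lborel) = 2 * (\<integral>x. ?g k x \<partial>lborel)"
      unfolding eq using i1 i2 i3 by (subst Bochner_Integration.integral_add) auto
    then show ?thesis
      by (subst nn_integral_eq_integral) (auto intro!: i1 i2 Bochner_Integration.integrable_abs Bochner_Integration.integrable_diff)
  qed
  then show ?thesis using tendsto_ennrealI[OF lim] by simp
qed

lemma tendsto_translate_L1:
  fixes f :: "'a::euclidean_space \<Rightarrow> real"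
  assumes f: "integrable lborel f" and w: "w \<longlonglongrightarrow> 0"
  shows "(\<lambda>k. \<integral>\<^sup>+x. ennreal \<bar>f (w k + x) - f x\<bar> \<partial>lborel) \<longlonglongrightarrow> 0"
  using f
proof (induction f)
  case (base A c)
  have [measurable]: "A \<in> sets borel" using base by simp
  show ?case
  proof (rule tendsto_zero_ennreal)
    fix r :: real assume "r > 0"
    \<comment> \<open>Three errors of size \<open>e\<close> have to fit: the translation of the open
      set, and the excess \<open>U - A\<close> at the translated and at the original point. The
      divisor |c| + 1 also covers c = 0.\<close>
    define e where "e = r / (\<bar>c\<bar> + 1) / 3"
    have e: "e > 0" "\<bar>c\<bar> * (e + 2 * e) < r"
    proof -
      have "3 * e = r / (\<bar>c\<bar> + 1)" unfolding e_def by (subst times_divide_eq_right, subst nonzero_mult_div_cancel_left) simp_all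
      then have "\<bar>c\<bar> * (e + 2 * e) = r * (\<bar>c\<bar> / (\<bar>c\<bar> + 1))" by (simp add: mult.commute)
      also have "\<dots> < r * 1" using \<open>r > 0\<close> by (intro mult_strict_left_mono) auto
      finally show "\<bar>c\<bar> * (e + 2 * e) < r" by simp
    qed (use \<open>r > 0\<close> in \<open>simp add: e_def\<close>)
    obtain U where U: "open U" "A \<subseteq> U" "emeasure lborel (U - A) < ennreal e"
      using outer_regular_lborel[of A e] e base(1) by (auto simp: ennreal_less_zero_iff)
    have [measurable]: "U \<in> sets borel" using U by auto
    have "emeasure lborel U = emeasure lborel A + emeasure lborel (U - A)"
      using U by (subst plus_emeasure) (auto intro!: arg_cong[where f = "emeasure lborel"])
    also have "\<dots> < \<infinity>" using base U(3) by (auto simp: less_top[symmetric])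
    finally have "(\<lambda>k. \<integral>\<^sup>+x. ennreal \<bar>indicator U (w k + x) - indicator U x\<bar> \<partial>lborel) \<longlonglongrightarrow> 0"
      by (intro tendsto_translate_indicator_open U w)
    then have "\<forall>\<^sub>F k in sequentially. (\<integral>\<^sup>+x. ennreal \<bar>indicator U (w k + x) - indicator U x\<bar> \<partial>lborel) < ennreal e"
      using e by (intro order_tendstoD) (auto simp: ennreal_less_zero_iff)
    then show "\<forall>\<^sub>F k in sequentially. (\<integral>\<^sup>+x. ennreal \<bar>indicator A (w k + x) *\<^sub>R c - indicator A x *\<^sub>R c\<bar> \<partial>lborel) < ennreal r"
    proof eventually_elim
      case (elim k)
      have "(\<integral>\<^sup>+x. ennreal \<bar>indicator A (w k + x) *\<^sub>R c - indicator A x *\<^sub>R c\<bar> \<partial>lborel)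
        \<le> (\<integral>\<^sup>+x. ennreal \<bar>c\<bar> * (ennreal \<bar>indicator U (w k + x) - indicator U x\<bar>
             + (indicator (U - A) (w k + x) + indicator (U - A) x)) \<partial>lborel)"
      proof (intro nn_integral_mono)
        fix x :: 'a
        have "\<bar>indicator A (w k + x) *\<^sub>R c - indicator A x *\<^sub>R c\<bar> \<le> \<bar>c\<bar> * (\<bar>indicator U (w k + x) - indicator U x\<bar>
             + (indicator (U - A) (w k + x) + indicator (U - A) x))"
          using U(2) by (auto simp: indicator_def)
        then have "ennreal \<bar>indicator A (w k + x) *\<^sub>R c - indicator A x *\<^sub>R c\<bar> \<le> ennreal (\<bar>c\<bar> * (\<bar>indicator U (w k + x) - indicator U x\<bar>
             + (indicator (U - A) (w k + x) + indicator (U - A) x)))" by (rule ennreal_leI)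
        also have "\<dots> = ennreal \<bar>c\<bar> * (ennreal \<bar>indicator U (w k + x) - indicator U x\<bar>
             + (indicator (U - A) (w k + x) + indicator (U - A) x))"
          by (simp add: ennreal_mult ennreal_plus ennreal_indicator)
        finally show "ennreal \<bar>indicator A (w k + x) *\<^sub>R c - indicator A x *\<^sub>R c\<bar> \<le> ennreal \<bar>c\<bar> * (ennreal \<bar>indicator U (w k + x) - indicator U x\<bar>
             + (indicator (U - A) (w k + x) + indicator (U - A) x))" .
      qed
      also have "\<dots> = ennreal \<bar>c\<bar> * ((\<integral>\<^sup>+x. ennreal \<bar>indicator U (w k + x) - indicator U x\<bar> \<partial>lborel)
          + ((\<integral>\<^sup>+x. indicator (U - A) (w k + x) \<partial>lborel) + emeasure lborel (U - A)))"
        by (simp add: nn_integral_cmult nn_integral_add)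
      also have "(\<integral>\<^sup>+x. indicator (U - A) (w k + x) \<partial>lborel) = emeasure lborel (U - A)"
        by (subst nn_integral_lborel_translate) auto
      also have "ennreal \<bar>c\<bar> * ((\<integral>\<^sup>+x. ennreal \<bar>indicator U (w k + x) - indicator U x\<bar> \<partial>lborel)
          + (emeasure lborel (U - A) + emeasure lborel (U - A))) \<le> ennreal \<bar>c\<bar> * (ennreal e + (ennreal e + ennreal e))"
        using elim U(3) by (intro mult_left_mono add_mono) auto
      also have "\<dots> = ennreal (\<bar>c\<bar> * (e + 2 * e))"
      proof -
        have "ennreal e + (ennreal e + ennreal e) = ennreal (e + (e + e))" using e by (simp flip: ennreal_plus)
        then show ?thesis using e by (simp add: ennreal_mult'[symmetric] del: ennreal_plus)
      qed
      also have "\<dots> < ennreal r" using e \<open>r > 0\<close> by (intro ennreal_lessI) auto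
      finally show ?case .
    qed
  qed
next
  case (add f g)
  have [measurable]: "f \<in> borel_measurable borel" "g \<in> borel_measurable borel" using add by auto
  show ?case
  proof (rule tendsto_sandwich[OF _ _ tendsto_const])
    show "(\<lambda>k. (\<integral>\<^sup>+x. ennreal \<bar>f (w k + x) - f x\<bar> \<partial>lborel) + (\<integral>\<^sup>+x. ennreal \<bar>g (w k + x) - g x\<bar> \<partial>lborel)) \<longlonglongrightarrow> 0"
      using tendsto_add[OF add(3,4)] by simp
    show "\<forall>\<^sub>F k in sequentially. (\<integral>\<^sup>+x. ennreal \<bar>f (w k + x) + g (w k + x) - (f x + g x)\<bar> \<partial>lborel)
       \<le> (\<integral>\<^sup>+x. ennreal \<bar>f (w k + x) - f x\<bar> \<partial>lborel) + (\<integral>\<^sup>+x. ennreal \<bar>g (w k + x) - g x\<bar> \<partial>lborel)"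
      by (subst nn_integral_add[symmetric])
         (auto simp flip: ennreal_plus intro!: always_eventually nn_integral_mono ennreal_leI)
  qed simp
next
  case (lim f s)
  have [measurable]: "f \<in> borel_measurable borel" "s i \<in> borel_measurable borel" for i using lim(1,4) by auto
  have "(\<lambda>i. \<integral>\<^sup>+x. ennreal \<bar>s i x - f x\<bar> \<partial>lborel) \<longlonglongrightarrow> (\<integral>\<^sup>+x. 0 \<partial>(lborel :: 'a measure))"
  proof (rule nn_integral_dominated_convergence[where w = "\<lambda>x. ennreal (3 * \<bar>f x\<bar>)"])
    show "AE x in lborel. (\<lambda>i. ennreal \<bar>s i x - f x\<bar>) \<longlonglongrightarrow> 0"
    proof (rule AE_I2)
      fix x :: 'a
      have "(\<lambda>i. \<bar>s i x - f x\<bar>) \<longlonglongrightarrow> 0" using lim(2)[of x] by (intro tendsto_rabs_zero LIM_zero) auto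
      then show "(\<lambda>i. ennreal \<bar>s i x - f x\<bar>) \<longlonglongrightarrow> 0" by (simp add: ennreal_tendsto_0_iff)
    qed
    show "AE x in lborel. ennreal \<bar>s j x - f x\<bar> \<le> ennreal (3 * \<bar>f x\<bar>)" for j
      using lim(3)[of _ j] by (intro AE_I2 ennreal_leI) (smt (verit) real_norm_def space_lborel UNIV_I)
    have "integrable lborel (\<lambda>x. 3 * \<bar>f x\<bar>)" using lim(4) by auto
    then show "(\<integral>\<^sup>+x. ennreal (3 * \<bar>f x\<bar>) \<partial>lborel) < \<infinity>"
      by (simp add: nn_integral_eq_integral)
  qed auto
  then have l0: "(\<lambda>i. \<integral>\<^sup>+x. ennreal \<bar>s i x - f x\<bar> \<partial>lborel) \<longlonglongrightarrow> 0" by simp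
  show ?case
  proof (rule tendsto_zero_ennreal)
    fix r :: real assume "r > 0"
    have "\<forall>\<^sub>F i in sequentially. (\<integral>\<^sup>+x. ennreal \<bar>s i x - f x\<bar> \<partial>lborel) < ennreal (r/3)"
      using \<open>r > 0\<close> by (intro order_tendstoD[OF l0]) (auto simp: ennreal_less_zero_iff)
    then obtain i where i: "(\<integral>\<^sup>+x. ennreal \<bar>s i x - f x\<bar> \<partial>lborel) < ennreal (r/3)"
      using eventually_happens'[OF sequentially_bot] by blast
    have "\<forall>\<^sub>F k in sequentially. (\<integral>\<^sup>+x. ennreal \<bar>s i (w k + x) - s i x\<bar> \<partial>lborel) < ennreal (r/3)"
      using \<open>r > 0\<close> by (intro order_tendstoD[OF lim(5)]) (auto simp: ennreal_less_zero_iff)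
    then show "\<forall>\<^sub>F k in sequentially. (\<integral>\<^sup>+x. ennreal \<bar>f (w k + x) - f x\<bar> \<partial>lborel) < ennreal r"
    proof eventually_elim
      case (elim k)
      have "(\<integral>\<^sup>+x. ennreal \<bar>f (w k + x) - f x\<bar> \<partial>lborel) \<le> (\<integral>\<^sup>+x. ennreal \<bar>s i (w k + x) - s i x\<bar> +
          (ennreal \<bar>s i (w k + x) - f (w k + x)\<bar> + ennreal \<bar>s i x - f x\<bar>) \<partial>lborel)"
        by (intro nn_integral_mono) (auto simp flip: ennreal_plus intro!: ennreal_leI)
      also have "\<dots> = (\<integral>\<^sup>+x. ennreal \<bar>s i (w k + x) - s i x\<bar> \<partial>lborel)
         + ((\<integral>\<^sup>+x. ennreal \<bar>s i (w k + x) - f (w k + x)\<bar> \<partial>lborel) + (\<integral>\<^sup>+x. ennreal \<bar>s i x - f x\<bar> \<partial>lborel))"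
        by (simp add: nn_integral_add)
      also have "(\<integral>\<^sup>+x. ennreal \<bar>s i (w k + x) - f (w k + x)\<bar> \<partial>lborel) = (\<integral>\<^sup>+x. ennreal \<bar>s i x - f x\<bar> \<partial>lborel)"
        by (rule nn_integral_lborel_translate[of "\<lambda>x. ennreal \<bar>s i x - f x\<bar>"]) measurable
      also have "(\<integral>\<^sup>+x. ennreal \<bar>s i (w k + x) - s i x\<bar> \<partial>lborel)
         + ((\<integral>\<^sup>+x. ennreal \<bar>s i x - f x\<bar> \<partial>lborel) + (\<integral>\<^sup>+x. ennreal \<bar>s i x - f x\<bar> \<partial>lborel)) < ennreal (r/3) + (ennreal (r/3) + ennreal (r/3))"
        using elim i by (intro add_strict_mono)
      also have "\<dots> = ennreal r" using \<open>r > 0\<close> by (simp flip: ennreal_plus)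
      finally show ?case .
    qed
  qed
qed

section \<open>Integrability of the truncated kernel and finite energy of Lipschitz
  functions\<close>

lemma emeasure_lborel_ball:
  fixes c :: "'a::euclidean_space"
  assumes "r \<ge> 0"
  shows "emeasure lborel (ball c r) = ennreal (unit_ball_vol (real DIM('a)) * r ^ DIM('a))"
    "emeasure lborel (cball c r) = ennreal (unit_ball_vol (real DIM('a)) * r ^ DIM('a))"
  using emeasure_ball[OF assms, of c] emeasure_cball[OF assms, of c] by auto

lemma geometric_powr_summable:
  assumes "c > 0"
  shows "summable (\<lambda>k::nat. (2::real) powr (- c * real k))"
proof -
  have "(2::real) powr (- c * real k) = (2 powr (-c)) ^ k" for k :: nat
    by (simp add: powr_powr powr_realpow[symmetric])
  moreover have "norm ((2::real) powr (-c)) < 1" using assms by (simp add: powr_less_one)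
  ultimately show ?thesis by (simp add: summable_geometric)
qed

lemma dyadic_shell:
  fixes x :: real
  assumes "0 < x" "x \<le> 1"
  obtains k :: nat where "2 powr (- real k - 1) < x" "x \<le> 2 powr (- real k)"
proof
  define y where "y = - log 2 x"
  have y: "y \<ge> 0" and x: "x = 2 powr (- y)" using assms by (auto simp: y_def)
  have "real (nat \<lfloor>y\<rfloor>) \<le> y" "y < real (nat \<lfloor>y\<rfloor>) + 1" using y by linarith+
  then have "- real (nat \<lfloor>y\<rfloor>) - 1 < - y" "- y \<le> - real (nat \<lfloor>y\<rfloor>)" by linarith+
  then show "2 powr (- real (nat \<lfloor>y\<rfloor>) - 1) < x" "x \<le> 2 powr (- real (nat \<lfloor>y\<rfloor>))"
    unfolding x by (intro powr_less_mono powr_mono; simp)+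
qed

text \<open>Dyadic shells: at radius about 2^-k the numerator gains 2^(-2k), leaving the summable
  factor 2^(-(2-2s)k) after multiplication by the volume; at radius about 2^k the factor is
  2^(-2sk). The two ends use s < 1 and s > 0 respectively.\<close>

lemma nn_integral_min_gker_finite:
  assumes s: "0 < s" "s < 1"
  shows "(\<integral>\<^sup>+z. ennreal (min (norm z ^ 2) 1 / norm z powr (real DIM('a) + 2 * s)) \<partial>(lborel :: 'a::euclidean_space measure)) < \<infinity>"
proof -
  let ?d = "real DIM('a)"
  define V where "V = unit_ball_vol ?d"
  have V: "V \<ge> 0" by (simp add: V_def)
  \<comment> \<open>\<open>a k\<close> bounds the integrand on the shell
    \<open>2 powr (- k - 1) < norm z \<le> 2 powr (- k)\<close>, and \<open>b k\<close> on the shell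
    \<open>2 powr k \<le> norm z \<le> 2 powr (k + 1)\<close>; the balls \<open>A k\<close> and
    \<open>B k\<close> are crude covers of these shells.\<close>
  define a where "a k = 2 powr (?d + 2*(s::real)) * 2 powr ((?d + 2 * s - 2) * real k)" for k :: nat
  define b where "b k = 2 powr (- (?d + 2 * s) * real k)" for k :: nat
  define A where "A k = (cball 0 (2 powr (- real k)) :: 'a set)" for k :: nat
  define B where "B k = (cball 0 (2 powr (real k + 1)) :: 'a set)" for k :: nat
  have [measurable]: "A k \<in> sets borel" "B k \<in> sets borel" for k by (auto simp: A_def B_def)
  let ?f = "\<lambda>z::'a. ennreal (min (norm z ^ 2) 1 / norm z powr (?d + 2 * s))"
  have le: "?f z \<le> (\<Sum>k. ennreal (a k) * indicator (A k) z + ennreal (b k) * indicator (B k) z)" (is "_ \<le> (\<Sum>k. ?t k z)") for z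
  proof (cases "z = 0")
    case False
    then have n: "norm z > 0" by simp
    have "\<exists>k. ?f z \<le> ?t k z"
    proof (cases "norm z \<le> 1")
      case True
      obtain k where k: "2 powr (- real k - 1) < norm z" "norm z \<le> 2 powr (- real k)"
        using dyadic_shell[OF n True] .
      have m: "min (norm z ^ 2) 1 \<le> (2 powr (- real k))^2" using k(2) by (intro min.coboundedI1 power_mono) simp_all
      have p: "(2 powr (- real k - 1)) powr (?d + 2 * s) \<le> norm z powr (?d + 2 * s)"
        using k(1) s by (intro powr_mono2) simp_all
      have "min (norm z ^ 2) 1 / norm z powr (?d + 2 * s) \<le> (2 powr (- real k))^2 / (2 powr (- real k - 1)) powr (?d + 2 * s)"
        by (intro frac_le m p) simp_all
      also have "\<dots> = 2 powr (- real k * 2 - (- real k - 1) * (?d + 2 * s))"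
        unfolding powr_powr powr_diff[of 2 "- real k * 2"] by (simp add: powr_power mult.commute)
      also have "\<dots> = 2 powr ((?d + 2 * s) + (?d + 2 * s - 2) * real k)" by (simp add: algebra_simps)
      also have "\<dots> = a k" by (simp only: a_def powr_add)
      finally have "?f z \<le> ennreal (a k)" by (rule ennreal_leI)
      also have "\<dots> = ennreal (a k) * indicator (A k) z" using k by (simp add: A_def)
      also have "\<dots> \<le> ?t k z" by simp
      finally have "?f z \<le> ?t k z" .
      then show ?thesis by blast
    next
      case False
      then have "0 < 1 / norm z" "1 / norm z \<le> 1" using n by (simp_all add: divide_le_eq)
      then obtain k where k: "2 powr (- real k - 1) < 1 / norm z" "1 / norm z \<le> 2 powr (- real k)"
        using dyadic_shell by blast
      have k1: "2 powr (real k) \<le> norm z" using k(2) n by (simp add: powr_minus field_simps)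
      have k2: "norm z \<le> 2 powr (real k + 1)" using k(1) n by (simp add: powr_minus powr_diff powr_add field_simps)
      have "min (norm z ^ 2) 1 / norm z powr (?d + 2 * s) \<le> 1 / (2 powr real k) powr (?d + 2 * s)"
        using k1 s n by (intro frac_le powr_mono2) simp_all
      also have "\<dots> = b k" by (simp add: b_def powr_powr powr_minus_divide[symmetric] algebra_simps)
      finally have "?f z \<le> ennreal (b k)" by (rule ennreal_leI)
      also have "\<dots> = ennreal (b k) * indicator (B k) z" using k2 by (simp add: B_def)
      also have "\<dots> \<le> ?t k z" by simp
      finally have "?f z \<le> ?t k z" .
      then show ?thesis by blast
    qed
    then obtain k where "?f z \<le> ?t k z" ..
    also have "\<dots> = (\<Sum>j\<in>{k}. ?t j z)" by simp
    also have "\<dots> \<le> (\<Sum>j. ?t j z)" by (intro sum_le_suminf) auto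
    finally show ?thesis .
  qed simp
  have "(\<integral>\<^sup>+z. ?f z \<partial>lborel) \<le> (\<integral>\<^sup>+z. (\<Sum>k. ?t k z) \<partial>lborel)"
    by (intro nn_integral_mono le)
  also have "\<dots> = (\<Sum>k. ennreal (a k) * emeasure lborel (A k) + ennreal (b k) * emeasure lborel (B k))"
    by (subst nn_integral_suminf) (auto simp: nn_integral_add nn_integral_cmult)
  also have "\<dots> = (\<Sum>k. ennreal (V * 2 powr (?d + 2 * s) * 2 powr (- (2 - 2 * s) * real k) + V * 2 powr ?d * 2 powr (- (2 * s) * real k)))"
  proof (intro suminf_cong)
    fix k
    have "a k * (V * (2 powr (- real k)) ^ DIM('a)) = V * 2 powr (?d + 2 * s) * 2 powr (- (2 - 2 * s) * real k)"
    proof -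
      have "a k * (2 powr (- real k)) ^ DIM('a) = 2 powr (?d + 2 * s + (?d + 2 * s - 2) * real k + - real k * ?d)"
        by (simp only: a_def powr_add) (simp add: powr_power mult.commute)
      also have "\<dots> = 2 powr (?d + 2 * s + - (2 - 2 * s) * real k)" by (simp add: algebra_simps)
      finally show ?thesis by (simp only: powr_add) (simp add: mult_ac)
    qed
    moreover have "b k * (V * (2 powr (real k + 1)) ^ DIM('a)) = V * 2 powr ?d * 2 powr (- (2 * s) * real k)"
    proof -
      have "b k * (2 powr (real k + 1)) ^ DIM('a) = 2 powr (- (?d + 2 * s) * real k + (real k + 1) * ?d)"
        by (simp only: b_def powr_add[of 2 "- (?d + 2 * s) * real k"]) (simp add: powr_power mult.commute)
      also have "\<dots> = 2 powr (?d + - (2 * s) * real k)" by (simp add: algebra_simps)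
      finally show ?thesis by (simp only: powr_add) (simp add: mult_ac)
    qed
    moreover have "ennreal (a k) * emeasure lborel (A k) = ennreal (a k * (V * (2 powr (- real k)) ^ DIM('a)))"
      by (simp add: A_def emeasure_lborel_ball a_def V_def ennreal_mult)
    moreover have "ennreal (b k) * emeasure lborel (B k) = ennreal (b k * (V * (2 powr (real k + 1)) ^ DIM('a)))"
      by (simp add: B_def emeasure_lborel_ball b_def V_def ennreal_mult)
    ultimately show "ennreal (a k) * emeasure lborel (A k) + ennreal (b k) * emeasure lborel (B k) =
       ennreal (V * 2 powr (?d + 2 * s) * 2 powr (- (2 - 2 * s) * real k) + V * 2 powr ?d * 2 powr (- (2 * s) * real k))"
      using V by (simp only: ennreal_plus mult_nonneg_nonneg powr_ge_zero)
  qed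
  also have "\<dots> < \<infinity>"
    using V s geometric_powr_summable[of "2 - 2 * s"] geometric_powr_summable[of "2 * s"]
    by (subst suminf_ennreal_eq[OF _ summable_sums])
      (auto intro!: summable_add summable_mult)
  finally show ?thesis .
qed

text \<open>The squared difference is at most a multiple of the minimum of the squared distance and
  1 (Lipschitz bound near, sup bound far), and it vanishes unless one of the two points lies in the
  ball. Integrating out the other point gives the constant \<open>I\<close>.\<close>

lemma gag_lipschitz_finite:
  fixes f :: "'a::euclidean_space \<Rightarrow> real"
  assumes s: "0 < s" "s < 1" and [measurable]: "f \<in> borel_measurable borel"
    and L: "\<And>x y. \<bar>f x - f y\<bar> \<le> L * norm (x - y)" and K: "\<And>x. \<bar>f x\<bar> \<le> K"
    and R: "\<And>x. x \<notin> cball c R \<Longrightarrow> f x = 0"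
  shows "gag s f < \<infinity>"
proof -
  let ?d = "real DIM('a)"
  let ?B = "cball c R"
  let ?m = "\<lambda>z::'a. ennreal (min (norm z ^ 2) 1 / norm z powr (?d + 2 * s))"
  define I where "I = (\<integral>\<^sup>+z. ?m z \<partial>lborel)"
  have I: "I < \<infinity>" unfolding I_def by (rule nn_integral_min_gker_finite[OF s])
  define D where "D = max (L\<^sup>2) (4 * K\<^sup>2)"
  have D: "D \<ge> 0" by (simp add: D_def le_max_iff_disj)
  have [measurable]: "?B \<in> sets borel" by simp
  have pw: "(f x - f y)\<^sup>2 \<le> D * min (norm (x - y) ^ 2) 1 * (indicator ?B x + indicator ?B y)" for x y
  proof (cases "x \<in> ?B \<or> y \<in> ?B")
    case True
    have "(f x - f y)\<^sup>2 \<le> (L * norm (x - y))\<^sup>2"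
      using L[of x y] by (subst abs_le_square_iff[symmetric]) auto
    also have "\<dots> \<le> D * norm (x - y)^2" by (simp add: power_mult_distrib D_def mult_right_mono)
    finally have 1: "(f x - f y)\<^sup>2 \<le> D * norm (x - y)^2" .
    have "(f x - f y)\<^sup>2 \<le> (2 * K)\<^sup>2"
      using K[of x] K[of y] by (subst abs_le_square_iff[symmetric]) auto
    also have "\<dots> \<le> D" by (simp add: D_def)
    finally have 2: "(f x - f y)\<^sup>2 \<le> D" .
    have "(f x - f y)\<^sup>2 \<le> D * min (norm (x - y) ^ 2) 1" using 1 2 by (simp add: min_def)
    also have "\<dots> \<le> D * min (norm (x - y) ^ 2) 1 * (indicator ?B x + indicator ?B y)"
    proof -
      have "0 \<le> D * min (norm (x - y) ^ 2) 1" using D by simp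
      moreover have "(1::real) \<le> indicator ?B x + indicator ?B y" using True by (auto simp: indicator_def)
      ultimately show ?thesis using mult_left_mono by fastforce
    qed
    finally show ?thesis .
  next
    case False
    then show ?thesis using R by auto
  qed
  have "gag s f = (\<integral>\<^sup>+z. ennreal (gker s z) * ennreal ((dif f z)\<^sup>2) \<partial>(lborel \<Otimes>\<^sub>M lborel))"
    unfolding gag_def gm_def by (subst nn_integral_density) auto
  also have "\<dots> \<le> (\<integral>\<^sup>+z. ennreal D * (?m (fst z - snd z) * indicator ?B (fst z) + ?m (fst z - snd z) * indicator ?B (snd z)) \<partial>(lborel \<Otimes>\<^sub>M lborel))"
  proof (intro nn_integral_mono)
    fix z :: "'a \<times> 'a"
    have "gker s z * (dif f z)\<^sup>2 \<le> gker s z * (D * min (norm (fst z - snd z) ^ 2) 1 * (indicator ?B (fst z) + indicator ?B (snd z)))"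
      unfolding dif_def using pw by (intro mult_left_mono) auto
    also have "\<dots> = D * (min (norm (fst z - snd z) ^ 2) 1 / norm (fst z - snd z) powr (?d + 2 * s) * indicator ?B (fst z)
         + min (norm (fst z - snd z) ^ 2) 1 / norm (fst z - snd z) powr (?d + 2 * s) * indicator ?B (snd z))"
      by (simp add: gker_def algebra_simps add_divide_distrib)
    finally have *: "gker s z * (dif f z)\<^sup>2 \<le> D * (min (norm (fst z - snd z) ^ 2) 1 / norm (fst z - snd z) powr (?d + 2 * s) * indicator ?B (fst z)
         + min (norm (fst z - snd z) ^ 2) 1 / norm (fst z - snd z) powr (?d + 2 * s) * indicator ?B (snd z))" .
    have **: "ennreal D * (ennreal m * indicator ?B (fst z) + ennreal m * indicator ?B (snd z)) = ennreal (D * (m * indicator ?B (fst z) + m * indicator ?B (snd z)))"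
      if "m \<ge> 0" for m
      using that D by (simp add: ennreal_mult ennreal_plus ennreal_indicator)
    show "ennreal (gker s z) * ennreal ((dif f z)\<^sup>2) \<le> ennreal D * (?m (fst z - snd z) * indicator ?B (fst z) + ?m (fst z - snd z) * indicator ?B (snd z))"
      by (subst **, simp, subst ennreal_mult[symmetric], simp, simp, rule ennreal_leI, rule *)
  qed
  also have "\<dots> = ennreal D * ((\<integral>\<^sup>+z. ?m (fst z - snd z) * indicator ?B (fst z) \<partial>(lborel \<Otimes>\<^sub>M lborel))
      + (\<integral>\<^sup>+z. ?m (fst z - snd z) * indicator ?B (snd z) \<partial>(lborel \<Otimes>\<^sub>M lborel)))"
    by (simp add: nn_integral_cmult nn_integral_add)
  also have "(\<integral>\<^sup>+z. ?m (fst z - snd z) * indicator ?B (fst z) \<partial>(lborel \<Otimes>\<^sub>M lborel))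
     = (\<integral>\<^sup>+x. indicator ?B x * (\<integral>\<^sup>+y. ?m (x - y) \<partial>lborel) \<partial>lborel)"
    by (subst lborel.nn_integral_fst[symmetric]) (simp_all add: nn_integral_multc nn_integral_cmult mult.commute)
  also have "(\<integral>\<^sup>+z. ?m (fst z - snd z) * indicator ?B (snd z) \<partial>(lborel \<Otimes>\<^sub>M lborel))
     = (\<integral>\<^sup>+y. indicator ?B y * (\<integral>\<^sup>+x. ?m (x - y) \<partial>lborel) \<partial>lborel)"
    by (subst lborel_pair.nn_integral_snd[symmetric]) (simp_all add: nn_integral_multc nn_integral_cmult mult.commute case_prod_unfold)
  also have "ennreal D * ((\<integral>\<^sup>+x. indicator ?B x * (\<integral>\<^sup>+y. ?m (x - y) \<partial>lborel) \<partial>lborel) + (\<integral>\<^sup>+y. indicator ?B y * (\<integral>\<^sup>+x. ?m (x - y) \<partial>lborel) \<partial>lborel))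
      = ennreal D * ((\<integral>\<^sup>+x. indicator ?B x * I \<partial>lborel) + (\<integral>\<^sup>+y. indicator ?B y * I \<partial>lborel))"
  proof -
    have "(\<integral>\<^sup>+x. ?m (x - y) \<partial>lborel) = I" for y
      using nn_integral_lborel_translate[of ?m "-y"] by (simp add: I_def)
    then have "(\<integral>\<^sup>+y. indicator ?B y * (\<integral>\<^sup>+x. ?m (x - y) \<partial>lborel) \<partial>lborel) = (\<integral>\<^sup>+y. indicator ?B y * I \<partial>lborel)"
      by (intro nn_integral_cong) simp
    moreover
    have "(\<integral>\<^sup>+y. ?m (x - y) \<partial>lborel) = I" for x
      using nn_integral_lborel_translate[of ?m "-x"] by (simp add: I_def norm_minus_commute)
    then have "(\<integral>\<^sup>+x. indicator ?B x * (\<integral>\<^sup>+y. ?m (x - y) \<partial>lborel) \<partial>lborel) = (\<integral>\<^sup>+y. indicator ?B y * I \<partial>lborel)"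
      by (intro nn_integral_cong) simp
    ultimately show ?thesis by simp
  qed
  also have "\<dots> < \<infinity>"
    using I emeasure_lborel_cball_finite[of c R] by (auto simp: nn_integral_multc ennreal_mult_less_top)
  finally show ?thesis .
qed

section \<open>Weak-type fractional Sobolev inequality\<close>

text \<open>\<open>measure\<close> returns 0 on sets of infinite measure; for \<open>l > 0\<close>
  and nonnegative integrable \<open>g\<close> this is ruled out by Markov's inequality in
  \<open>superlevel_finite\<close>.\<close>

definition superlevel :: "('a::euclidean_space \<Rightarrow> real) \<Rightarrow> real \<Rightarrow> real" where
  "superlevel g l = measure lborel {x. l < g x}"

lemma superlevel_nonneg [simp]: "0 \<le> superlevel g l"
  by (simp add: superlevel_def)

lemma superlevel_finite:
  fixes g :: "'a::euclidean_space \<Rightarrow> real"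
  assumes g: "integrable lborel g" "l > 0" and nn: "\<And>x. g x \<ge> 0"
  shows "emeasure lborel {x. l < g x} = ennreal (superlevel g l)"
    "l * superlevel g l \<le> (\<integral>x. g x \<partial>lborel)"
proof -
  have [measurable]: "g \<in> borel_measurable borel" using g by auto
  have "ennreal l * emeasure lborel {x. l < g x} = (\<integral>\<^sup>+x. ennreal l * indicator {x. l < g x} x \<partial>lborel)"
    by (subst nn_integral_cmult_indicator) auto
  also have "\<dots> \<le> (\<integral>\<^sup>+x. ennreal (g x) \<partial>lborel)"
    using g by (intro nn_integral_mono) (auto simp: indicator_def intro!: ennreal_leI)
  also have "\<dots> = ennreal (\<integral>x. g x \<partial>lborel)"
    using g nn by (intro nn_integral_eq_integral) auto
  finally have *: "ennreal l * emeasure lborel {x. l < g x} \<le> ennreal (\<integral>x. g x \<partial>lborel)" .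
  then have "emeasure lborel {x. l < g x} \<noteq> \<infinity>"
    using \<open>l > 0\<close> by (auto simp: ennreal_mult_eq_top_iff ennreal_top_mult ennreal_mult_top top_unique)
  then show e: "emeasure lborel {x. l < g x} = ennreal (superlevel g l)"
    unfolding superlevel_def by (intro emeasure_eq_ennreal_measure) auto
  have "0 \<le> (\<integral>x. g x \<partial>lborel)" using nn by simp
  then show "l * superlevel g l \<le> (\<integral>x. g x \<partial>lborel)"
    using * \<open>l > 0\<close> unfolding e by (simp add: ennreal_mult[symmetric] ennreal_le_iff)
qed

text \<open>Let b be the measure of {g > l}. A ball of volume 2b around a point with
  \<open>g > 2 * l\<close> has a part of volume at least b outside {g > l}; on that part the
  difference exceeds \<open>l\<close> and the kernel is at least its value at the radius.
  Integrating over {g > 2l} gives the bound; the powers come from expressing the radius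
  \<open>R\<close> through b.\<close>

lemma gag_ge_levels:
  fixes g :: "'a::euclidean_space \<Rightarrow> real"
  assumes s: "s > 0" and g: "integrable lborel g" and nn: "\<And>x. g x \<ge> 0" and l: "l > 0"
    and m: "superlevel g l > 0"
  shows "ennreal ((2 / unit_ball_vol (real DIM('a))) powr (- (real DIM('a) + 2 * s) / real DIM('a))
     * l\<^sup>2 * superlevel g (2 * l) * superlevel g l powr (- 2 * s / real DIM('a))) \<le> gag s g"
proof -
  let ?d = "real DIM('a)"
  have d: "?d > 0" by simp
  have [measurable]: "g \<in> borel_measurable borel" using g by auto
  define V where "V = unit_ball_vol ?d"
  have V: "V > 0" by (simp add: V_def)
  define b where "b = superlevel g l"
  define a where "a = superlevel g (2 * l)"
  have b: "b > 0" and a: "a \<ge> 0" using m by (auto simp: b_def a_def)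
  define A B where "A = {x. 2 * l < g x}" and "B = {x. l < g x}"
  have [measurable]: "A \<in> sets borel" "B \<in> sets borel" unfolding A_def B_def by measurable
  have eB: "emeasure lborel B = ennreal b" and eA: "emeasure lborel A = ennreal a"
    using superlevel_finite(1)[OF g l nn] superlevel_finite(1)[OF g _ nn, of "2 * l"] l
    by (simp_all add: A_def B_def a_def b_def)
  define R where "R = (2 * b / V) powr (1 / ?d)"
  have R: "R > 0" using b V by (simp add: R_def)
  have "R ^ DIM('a) = 2 * b / V" using b V by (simp add: R_def powr_power)
  then have VR: "V * R ^ DIM('a) = 2 * b" using V by simp
  have ball: "ennreal b \<le> emeasure lborel (ball x R - B)" for x
  proof -
    have "ennreal (2 * b) = emeasure lborel (ball x R)" using R VR by (simp add: emeasure_lborel_ball V_def)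
    also have "\<dots> \<le> emeasure lborel ((ball x R - B) \<union> B)" by (intro emeasure_mono) auto
    also have "\<dots> \<le> emeasure lborel (ball x R - B) + ennreal b"
      unfolding eB[symmetric] by (intro emeasure_subadditive) auto
    finally have "ennreal b + ennreal b \<le> ennreal b + emeasure lborel (ball x R - B)"
      using b by (simp add: add.commute flip: ennreal_plus)
    then show ?thesis by (simp only: ennreal_add_left_cancel_le) simp
  qed
  let ?c = "R powr (- (?d + 2 * s)) * l\<^sup>2"
  have "ennreal (?c * b * a) = (\<integral>\<^sup>+x. ennreal (?c * b) * indicator A x \<partial>lborel)"
    using a b by (simp add: nn_integral_cmult_indicator eA ennreal_mult)
  also have "\<dots> \<le> (\<integral>\<^sup>+x. indicator A x * (\<integral>\<^sup>+y. ennreal ?c * indicator (ball x R - B) y \<partial>lborel) \<partial>lborel)"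
  proof (intro nn_integral_mono)
    fix x
    have "ennreal (?c * b) \<le> ennreal ?c * emeasure lborel (ball x R - B)"
      using ball[of x] b by (simp add: ennreal_mult mult_left_mono)
    also have "\<dots> = (\<integral>\<^sup>+y. ennreal ?c * indicator (ball x R - B) y \<partial>lborel)"
      by (subst nn_integral_cmult_indicator) auto
    finally show "ennreal (?c * b) * indicator A x \<le> indicator A x * (\<integral>\<^sup>+y. ennreal ?c * indicator (ball x R - B) y \<partial>lborel)"
      by (auto simp: indicator_def)
  qed
  also have "\<dots> \<le> (\<integral>\<^sup>+x. \<integral>\<^sup>+y. ennreal (gker s (x, y)) * ennreal ((dif g (x, y))\<^sup>2) \<partial>lborel \<partial>lborel)"
  proof (intro nn_integral_mono)
    fix x
    show "indicator A x * (\<integral>\<^sup>+y. ennreal ?c * indicator (ball x R - B) y \<partial>lborel)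
      \<le> (\<integral>\<^sup>+y. ennreal (gker s (x, y)) * ennreal ((dif g (x, y))\<^sup>2) \<partial>lborel)"
    proof (cases "x \<in> A")
      case True
      have "(\<integral>\<^sup>+y. ennreal ?c * indicator (ball x R - B) y \<partial>lborel)
        \<le> (\<integral>\<^sup>+y. ennreal (gker s (x, y)) * ennreal ((dif g (x, y))\<^sup>2) \<partial>lborel)"
      proof (intro nn_integral_mono)
        fix y
        show "ennreal ?c * indicator (ball x R - B) y \<le> ennreal (gker s (x, y)) * ennreal ((dif g (x, y))\<^sup>2)"
        proof (cases "y \<in> ball x R - B")
          case y: True
          then have gy: "g y \<le> l" and gx: "2 * l < g x" and n: "norm (x - y) < R"
            using True by (auto simp: A_def B_def dist_norm)
          then have ne: "norm (x - y) > 0" using l by (cases "x = y") auto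
          have "R powr (- (?d + 2 * s)) \<le> norm (x - y) powr (- (?d + 2 * s))"
            using ne n s by (intro powr_mono2') auto
          then have 1: "R powr (- (?d + 2 * s)) \<le> gker s (x, y)"
            by (simp add: gker_def powr_minus_divide del: minus_add_distrib)
          have 2: "l\<^sup>2 \<le> (dif g (x, y))\<^sup>2" using gx gy l by (auto simp: dif_def intro!: power_mono)
          have "?c \<le> gker s (x, y) * (dif g (x, y))\<^sup>2" by (intro mult_mono 1 2) auto
          then show ?thesis using y by (simp add: ennreal_leI flip: ennreal_mult)
        qed auto
      qed
      then show ?thesis using True by simp
    qed auto
  qed
  also have "\<dots> = gag s g"
    unfolding gag_def gm_def
    by (subst nn_integral_density) (simp_all add: lborel.nn_integral_fst[symmetric] dif_def)
  also have "?c * b * a = (2 / V) powr (- (?d + 2 * s) / ?d) * l\<^sup>2 * a * b powr (- 2 * s / ?d)"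
  proof -
    have "R powr (- (?d + 2 * s)) = ((2 / V) * b) powr (- (?d + 2 * s) / ?d)"
      by (simp add: R_def powr_powr)
    also have "\<dots> = (2 / V) powr (- (?d + 2 * s) / ?d) * b powr (- (?d + 2 * s) / ?d)"
      by (rule powr_mult)
    finally have "R powr (- (?d + 2 * s)) * b = (2 / V) powr (- (?d + 2 * s) / ?d) * (b powr (- (?d + 2 * s) / ?d) * b powr 1)"
      using b by simp
    also have "b powr (- (?d + 2 * s) / ?d) * b powr 1 = b powr (- 2 * s / ?d)"
      unfolding powr_add[symmetric] by (rule arg_cong[where f = "\<lambda>e. b powr e"]) (use d in \<open>simp add: field_simps\<close>)
    finally show ?thesis by (simp add: mult_ac)
  qed
  finally show ?thesis by (simp add: V_def a_def b_def)
qed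

text \<open>The supremum \<open>S\<close> of the left-hand sides is finite, and at a level that almost
  attains it the bound of \<open>gag_ge_levels\<close> is a multiple of \<open>S\<close>.\<close>

lemma weak_sobolev:
  assumes s: "0 < s" and d: "real DIM('a::euclidean_space) > 2 * s"
  obtains c where "c > 0"
    "\<And>(g :: 'a \<Rightarrow> real) l K. integrable lborel g \<Longrightarrow> (\<And>x. 0 \<le> g x) \<Longrightarrow> (\<And>x. g x \<le> K) \<Longrightarrow> gag s g < \<infinity> \<Longrightarrow> l > 0 \<Longrightarrow>
       c * (l\<^sup>2 * superlevel g l powr (1 - 2 * s / real DIM('a))) \<le> enn2real (gag s g)"
proof -
  let ?d = "real DIM('a)"
  define \<theta> where "\<theta> = 1 - 2 * s / ?d"
  have d0: "?d > 0" by simp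
  have \<theta>: "0 < \<theta>" "\<theta> < 1" using d d0 s by (auto simp: \<theta>_def field_simps)
  define c0 where "c0 = (2 / unit_ball_vol ?d) powr (- (?d + 2 * s) / ?d)"
  have c0: "c0 > 0"
  proof -
    have "unit_ball_vol ?d > 0" by simp
    then have "2 / unit_ball_vol ?d > 0" by (rule divide_pos_pos[rotated]) simp
    then show ?thesis unfolding c0_def by (metis powr_gt_zero less_irrefl)
  qed
  \<comment> \<open>At a level 2\<mu> where \<open>q\<close> exceeds S/2, the measure
    \<open>a\<close> of the superlevel set satisfies a^\<theta> > S/(8\<mu>^2); the 1/8, raised to
    the power 1/\<theta>, is the loss.\<close>
  define c where "c = c0 * (1 / 8) powr (1 / \<theta>)"
  have c: "c > 0" using c0 by (simp add: c_def)
  show ?thesis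
  proof (rule that[OF c])
    fix g :: "'a \<Rightarrow> real" and l K
    assume g: "integrable lborel g" and nn: "\<And>x. 0 \<le> g x" and K: "\<And>x. g x \<le> K"
      and fin: "gag s g < \<infinity>" and l: "l > (0::real)"
    define I where "I = (\<integral>x. g x \<partial>lborel)"
    have I: "I \<ge> 0" using nn by (simp add: I_def)
    define q where "q l = l\<^sup>2 * superlevel g l powr \<theta>" for l
    \<comment> \<open>Boundedness of \<open>g\<close> makes the supremum finite: above
      \<open>K\<close> the superlevel sets are empty, and below it Markov's inequality leaves the
      factor l^(2-\<theta>).\<close>
    have qb: "q l \<le> K powr (2 - \<theta>) * I powr \<theta>" if "l > 0" for l
    proof (cases "l < K")
      case True
      have "superlevel g l \<le> I / l" using superlevel_finite(2)[OF g that nn] that by (simp add: I_def field_simps)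
      then have "superlevel g l powr \<theta> \<le> (I / l) powr \<theta>" using \<theta> by (intro powr_mono2) auto
      then have "q l \<le> l\<^sup>2 * (I / l) powr \<theta>" unfolding q_def by (intro mult_left_mono) auto
      also have "\<dots> = (l powr 2 * l powr (- \<theta>)) * I powr \<theta>"
        using that I by (simp add: powr_divide powr_minus_divide)
      also have "\<dots> = l powr (2 - \<theta>) * I powr \<theta>" by (simp flip: powr_add)
      also have "\<dots> \<le> K powr (2 - \<theta>) * I powr \<theta>"
        using that True \<theta> by (intro mult_right_mono powr_mono2) auto
      finally show ?thesis .
    next
      case False
      then have "{x. l < g x} = {}" using K by (auto simp: not_less intro: order_trans)
      then show ?thesis using \<theta> by (simp add: q_def superlevel_def)
    qed
    define S where "S = (SUP l\<in>{0<..}. q l)"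
    have bdd: "bdd_above (q ` {0<..})" using qb by (auto intro!: bdd_aboveI2)
    have qS: "q l \<le> S" if "l > 0" for l unfolding S_def using that by (intro cSUP_upper bdd) auto
    have "c * S \<le> enn2real (gag s g)"
    proof (cases "S > 0")
      case True
      then have "S / 2 < S" by simp
      then obtain l' where l': "l' > 0" "S / 2 < q l'" unfolding S_def using bdd by (subst (asm) less_cSUP_iff) auto
      define \<mu> where "\<mu> = l' / 2"
      have \<mu>: "\<mu> > 0" "l' = 2 * \<mu>" using l' by (auto simp: \<mu>_def)
      define a where "a = superlevel g (2 * \<mu>)"
      define b where "b = superlevel g \<mu>"
      have qa: "S / (8 * \<mu>\<^sup>2) \<le> a powr \<theta>" using l' \<mu> by (simp add: q_def a_def field_simps)
      \<comment> \<open>The supremum is used from above at \<open>\<mu>\<close> and almost attained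
        at \<open>2 * \<mu>\<close>. An upper bound on \<open>b\<close> is what helps, since
        \<open>b\<close> enters \<open>gag_ge_levels\<close> with the negative exponent \<theta> -
        1.\<close>
      have qb': "b powr \<theta> \<le> S / \<mu>\<^sup>2" using qS[of \<mu>] \<mu> by (simp add: q_def b_def field_simps)
      have a0: "a \<ge> 0" by (simp add: a_def)
      have apos: "a > 0"
      proof -
        have "0 < S / (8 * \<mu>\<^sup>2)" using True \<mu> by simp
        then have "a powr \<theta> > 0" using qa by linarith
        then show ?thesis using a0 by (cases "a = 0") auto
      qed
      have "ennreal a \<le> ennreal b"
        unfolding a_def b_def using \<mu> superlevel_finite(1)[OF g _ nn, of \<mu>] superlevel_finite(1)[OF g _ nn, of "2 * \<mu>"]
      proof -
        have [measurable]: "g \<in> borel_measurable borel" using g by auto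
        have "emeasure lborel {x. 2 * \<mu> < g x} \<le> emeasure lborel {x. \<mu> < g x}"
          using \<mu> by (intro emeasure_mono) auto
        then show "ennreal (superlevel g (2 * \<mu>)) \<le> ennreal (superlevel g \<mu>)"
          using \<mu> superlevel_finite(1)[OF g _ nn, of \<mu>] superlevel_finite(1)[OF g _ nn, of "2 * \<mu>"] by simp
      qed
      then have bpos: "b > 0" using apos by (simp add: b_def)
      have "ennreal (c0 * \<mu>\<^sup>2 * a * b powr (\<theta> - 1)) \<le> gag s g"
        using gag_ge_levels[OF s g nn \<mu>(1)] bpos by (simp add: c0_def a_def b_def \<theta>_def)
      then have main: "c0 * \<mu>\<^sup>2 * a * b powr (\<theta> - 1) \<le> enn2real (gag s g)"
        using fin a0 c0 by (metis enn2real_ennreal enn2real_mono infinity_ennreal_def less_eq_real_def mult_nonneg_nonneg powr_ge_zero zero_le_power2)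
      have A: "(S / (8 * \<mu>\<^sup>2)) powr (1 / \<theta>) \<le> a"
      proof -
        have "(S / (8 * \<mu>\<^sup>2)) powr (1 / \<theta>) \<le> (a powr \<theta>) powr (1 / \<theta>)"
          using qa True \<theta> by (intro powr_mono2) auto
        then show ?thesis using \<theta> apos by (simp add: powr_powr)
      qed
      have B: "(S / \<mu>\<^sup>2) powr ((\<theta> - 1) / \<theta>) \<le> b powr (\<theta> - 1)"
      proof -
        have "(S / \<mu>\<^sup>2) powr ((\<theta> - 1) / \<theta>) \<le> (b powr \<theta>) powr ((\<theta> - 1) / \<theta>)"
          using qb' \<theta> bpos by (intro powr_mono2') (auto simp: field_simps)
        then show ?thesis using \<theta> bpos by (simp add: powr_powr)
      qed
      have "c * S = c0 * \<mu>\<^sup>2 * (((1 / 8) powr (1 / \<theta>) * (S / \<mu>\<^sup>2) powr (1 / \<theta>)) * (S / \<mu>\<^sup>2) powr ((\<theta> - 1) / \<theta>))"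
      proof -
        have "(S / \<mu>\<^sup>2) powr (1 / \<theta>) * (S / \<mu>\<^sup>2) powr ((\<theta> - 1) / \<theta>) = (S / \<mu>\<^sup>2) powr 1"
          unfolding powr_add[symmetric] using \<theta> by (simp add: field_simps)
        also have "\<dots> = S / \<mu>\<^sup>2" using True by simp
        finally show ?thesis using \<mu> by (simp add: c_def mult.assoc)
      qed
      also have "(1 / 8) powr (1 / \<theta>) * (S / \<mu>\<^sup>2) powr (1 / \<theta>) = (S / (8 * \<mu>\<^sup>2)) powr (1 / \<theta>)"
        using True by (simp flip: powr_mult)
      also have "c0 * \<mu>\<^sup>2 * ((S / (8 * \<mu>\<^sup>2)) powr (1 / \<theta>) * (S / \<mu>\<^sup>2) powr ((\<theta> - 1) / \<theta>)) \<le> c0 * \<mu>\<^sup>2 * (a * b powr (\<theta> - 1))"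
        using c0 a0 by (intro mult_left_mono mult_mono A B) auto
      also have "\<dots> \<le> enn2real (gag s g)" using main by (simp add: mult.assoc)
      finally show ?thesis .
    next
      case False
      then have "c * S \<le> 0" using c by (simp add: mult_le_0_iff)
      then show ?thesis using enn2real_nonneg order_trans by blast
    qed
    moreover have "c * q l \<le> c * S" using qS[OF l] c by simp
    ultimately show "c * (l\<^sup>2 * superlevel g l powr (1 - 2 * s / ?d)) \<le> enn2real (gag s g)"
      by (simp add: q_def \<theta>_def)
  qed
qed

section \<open>Smooth test functions\<close>

text \<open>The flat functions r^(-k) exp(-1/r). The whole family in \<open>k\<close> is carried
  along because it is closed under differentiation up to linear combinations, see
  \<open>expdec_DERIV\<close>.\<close>

definition expdec :: "nat \<Rightarrow> real \<Rightarrow> real" where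
  "expdec k r = (if r > 0 then (1 / r) ^ k * exp (- (1 / r)) else 0)"

lemma tendsto_expdec_0: "(expdec k \<longlongrightarrow> 0) (at 0)"
proof -
  have "((\<lambda>y::real. y ^ k / exp y) \<longlongrightarrow> 0) at_top" by (rule tendsto_power_div_exp_0)
  then have "((\<lambda>r. (inverse r) ^ k / exp (inverse r)) \<longlongrightarrow> 0) (at_right (0::real))"
    by (rule filterlim_compose[OF _ filterlim_inverse_at_top_right])
  moreover have "\<forall>\<^sub>F r in at_right (0::real). (inverse r) ^ k / exp (inverse r) = expdec k r"
    using eventually_at_right_less[of "0::real"]
    by eventually_elim (simp add: expdec_def exp_minus divide_inverse)
  ultimately have r: "(expdec k \<longlongrightarrow> 0) (at_right 0)" by (rule Lim_transform_eventually)
  have "\<forall>\<^sub>F r in at_left (0::real). 0 = expdec k r"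
    by (auto simp: eventually_at_filter expdec_def)
  then have "(expdec k \<longlongrightarrow> 0) (at_left 0)" by (rule Lim_transform_eventually[OF tendsto_const])
  with r show ?thesis by (simp add: filterlim_at_split)
qed

text \<open>At 0 the difference quotient of \<open>expdec k\<close> is
  \<open>expdec (Suc k)\<close>, which tends to 0; for positive \<open>r\<close> it is the product
  rule.\<close>

lemma expdec_DERIV: "(expdec k has_real_derivative (expdec (k + 2) r - real k * expdec (k + 1) r)) (at r)"
proof (cases r "0::real" rule: linorder_cases)
  case less
  have "((\<lambda>_. 0) has_real_derivative 0) (at r)" by simp
  then have "(expdec k has_real_derivative 0) (at r)"
    by (rule has_field_derivative_transform_within_open[of _ _ _ "{..<0}"]) (use less in \<open>auto simp: expdec_def\<close>)
  then show ?thesis using less by (simp add: expdec_def)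
next
  case equal
  have "((\<lambda>h. expdec k h / h) \<longlongrightarrow> 0) (at 0)"
  proof (rule Lim_transform_eventually[OF tendsto_expdec_0[of "Suc k"]])
    show "\<forall>\<^sub>F x in at 0. expdec (Suc k) x = expdec k x / x"
      by (auto simp: expdec_def intro!: always_eventually)
  qed
  then show ?thesis unfolding equal by (simp add: DERIV_def expdec_def)
next
  case greater
  have "((\<lambda>r. (1 / r) ^ k * exp (- (1 / r))) has_real_derivative
     (real k * (1 / r) ^ (k - 1) * (- 1 / r\<^sup>2)) * exp (- (1 / r)) + (1 / r) ^ k * (exp (- (1 / r)) * (1 / r\<^sup>2))) (at r)"
    using greater by (auto intro!: derivative_eq_intros simp: power2_eq_square)
  moreover have "(real k * (1 / r) ^ (k - 1) * (- 1 / r\<^sup>2)) * exp (- (1 / r)) + (1 / r) ^ k * (exp (- (1 / r)) * (1 / r\<^sup>2))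
     = expdec (k + 2) r - real k * expdec (k + 1) r"
    using greater by (cases k) (auto simp: expdec_def power2_eq_square algebra_simps add_divide_distrib)
  ultimately have "((\<lambda>r. (1 / r) ^ k * exp (- (1 / r))) has_real_derivative (expdec (k + 2) r - real k * expdec (k + 1) r)) (at r)"
    by simp
  then show ?thesis
    by (rule has_field_derivative_transform_within_open[of _ _ _ "{0<..}"]) (use greater in \<open>auto simp: expdec_def\<close>)
qed

text \<open>A class containing the required test functions and closed under directional derivatives.
  Membership yields \<open>smooth_fn\<close> by induction on the list of directions, without
  computing any higher derivative.\<close>

inductive_set smooth_alg :: "('a::real_normed_vector \<Rightarrow> real) set" where
  const: "(\<lambda>_. c) \<in> smooth_alg"
| lin: "bounded_linear f \<Longrightarrow> f \<in> smooth_alg"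
| add: "f \<in> smooth_alg \<Longrightarrow> g \<in> smooth_alg \<Longrightarrow> (\<lambda>x. f x + g x) \<in> smooth_alg"
| mult: "f \<in> smooth_alg \<Longrightarrow> g \<in> smooth_alg \<Longrightarrow> (\<lambda>x. f x * g x) \<in> smooth_alg"
| expdec: "f \<in> smooth_alg \<Longrightarrow> (\<lambda>x. expdec k (f x)) \<in> smooth_alg"
| inv: "f \<in> smooth_alg \<Longrightarrow> (\<And>x. f x \<noteq> 0) \<Longrightarrow> (\<lambda>x. inverse (f x)) \<in> smooth_alg"

lemma smooth_alg_diff:
  assumes "f \<in> smooth_alg" "g \<in> smooth_alg" shows "(\<lambda>x. f x - g x) \<in> smooth_alg"
  using smooth_alg.add[OF assms(1) smooth_alg.mult[OF smooth_alg.const[of "-1"] assms(2)]] by simp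

lemma smooth_alg_sum:
  assumes "finite I" "\<And>i. i \<in> I \<Longrightarrow> f i \<in> smooth_alg" shows "(\<lambda>x. \<Sum>i\<in>I. f i x) \<in> smooth_alg"
  using assms by (induction I rule: finite_induct) (auto intro: smooth_alg.const smooth_alg.add)

lemma smooth_alg_derivative:
  assumes "f \<in> smooth_alg"
  shows "\<exists>f'. (\<forall>x. (f has_derivative f' x) (at x)) \<and> (\<forall>v. (\<lambda>x. f' x v) \<in> smooth_alg)"
  using assms
proof induction
  case (const c)
  show ?case by (intro exI[of _ "\<lambda>_ _. 0"]) (auto intro: smooth_alg.const)
next
  case (lin f)
  then show ?case
    by (intro exI[of _ "\<lambda>_. f"]) (auto intro: smooth_alg.const bounded_linear_imp_has_derivative)
next
  case (add f g)
  then obtain f' g' where "\<forall>x. (f has_derivative f' x) (at x)" "\<forall>v. (\<lambda>x. f' x v) \<in> smooth_alg"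
    "\<forall>x. (g has_derivative g' x) (at x)" "\<forall>v. (\<lambda>x. g' x v) \<in> smooth_alg" by blast
  then show ?case
    by (intro exI[of _ "\<lambda>x v. f' x v + g' x v"]) (auto intro!: smooth_alg.add has_derivative_add)
next
  case (mult f g)
  then obtain f' g' where "\<forall>x. (f has_derivative f' x) (at x)" "\<forall>v. (\<lambda>x. f' x v) \<in> smooth_alg"
    "\<forall>x. (g has_derivative g' x) (at x)" "\<forall>v. (\<lambda>x. g' x v) \<in> smooth_alg" by blast
  then show ?case using mult
    by (intro exI[of _ "\<lambda>x v. f x * g' x v + f' x v * g x"]) (auto intro!: smooth_alg.add smooth_alg.mult has_derivative_mult)
next
  case (expdec f k)
  then obtain f' where f': "\<forall>x. (f has_derivative f' x) (at x)" "\<forall>v. (\<lambda>x. f' x v) \<in> smooth_alg" by blast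
  have "((\<lambda>x. expdec k (f x)) has_derivative (\<lambda>v. f' x v * (expdec (k + 2) (f x) - real k * expdec (k + 1) (f x)))) (at x)" for x
    using DERIV_compose_FDERIV[OF expdec_DERIV] f' by blast
  moreover have "(\<lambda>x. f' x v * (expdec (k + 2) (f x) - real k * expdec (k + 1) (f x))) \<in> smooth_alg" for v
    using f' expdec by (intro smooth_alg.mult smooth_alg_diff smooth_alg.expdec smooth_alg.const) auto
  ultimately show ?case
    by (intro exI[of _ "\<lambda>x v. f' x v * (expdec (k + 2) (f x) - real k * expdec (k + 1) (f x))"]) blast
next
  case (inv f)
  then obtain f' where f': "\<forall>x. (f has_derivative f' x) (at x)" "\<forall>v. (\<lambda>x. f' x v) \<in> smooth_alg" by blast
  have "((\<lambda>x. inverse (f x)) has_derivative (\<lambda>v. f' x v * (- 1 * (inverse (f x) * inverse (f x))))) (at x)" for x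
  proof -
    have "DERIV inverse (f x) :> - 1 * (inverse (f x) * inverse (f x))"
      using DERIV_inverse[of "f x"] inv(2) by (simp add: power2_eq_square)
    then show ?thesis using DERIV_compose_FDERIV f' by blast
  qed
  moreover have "(\<lambda>x. f' x v * (- 1 * (inverse (f x) * inverse (f x)))) \<in> smooth_alg" for v
    using f' inv by (intro smooth_alg.mult smooth_alg.inv smooth_alg.const) auto
  ultimately show ?case by (intro exI[of _ "\<lambda>x v. f' x v * (- 1 * (inverse (f x) * inverse (f x)))"]) blast
qed

lemma smooth_alg_imp_smooth_fn:
  assumes "f \<in> smooth_alg" shows "smooth_fn f"
proof -
  have *: "iter_dir vs f \<in> smooth_alg" for vs
  proof (induction vs)
    case (Cons v vs)
    then obtain f' where f': "\<And>x. (iter_dir vs f has_derivative f' x) (at x)" "(\<lambda>x. f' x v) \<in> smooth_alg"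
      using smooth_alg_derivative by blast
    have "iter_dir (v # vs) f = (\<lambda>x. f' x v)"
      using frechet_derivative_at[OF f'(1)] by simp
    then show ?case using f'(2) by simp
  qed (use assms in simp)
  show ?thesis unfolding smooth_fn_def differentiable_def
    using smooth_alg_derivative[OF *] by blast
qed

lemma smooth_alg_continuous: "f \<in> smooth_alg \<Longrightarrow> continuous_on S f"
  by (meson smooth_alg_derivative has_derivative_at_withinI has_derivative_continuous_on)

text \<open>The standard smooth transition from 0 on r \<le> 0 to 1 on r \<ge> 1; the denominator is
  positive because r or 1 - r is.\<close>

definition sstep :: "real \<Rightarrow> real" where
  "sstep r = expdec 0 r * inverse (expdec 0 r + expdec 0 (1 - r))"

lemma expdec_nonneg [simp]: "0 \<le> expdec k r"
  by (simp add: expdec_def)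

lemma expdec_sum_pos: "0 < expdec 0 r + expdec 0 (1 - r)"
  by (auto simp: expdec_def intro: add_pos_pos)

lemma sstep_smooth: "f \<in> smooth_alg \<Longrightarrow> (\<lambda>x. sstep (f x)) \<in> smooth_alg"
  unfolding sstep_def
  by (intro smooth_alg.mult smooth_alg.inv smooth_alg.add smooth_alg.expdec smooth_alg_diff smooth_alg.const)
     (auto simp: expdec_sum_pos[THEN less_imp_neq, symmetric])

lemma sstep_bounds: "0 \<le> sstep r" "sstep r \<le> 1" "r \<le> 0 \<Longrightarrow> sstep r = 0" "r \<ge> 1 \<Longrightarrow> sstep r = 1"
proof -
  show "0 \<le> sstep r" using expdec_sum_pos[of r] by (simp add: sstep_def)
  show "sstep r \<le> 1" using expdec_sum_pos[of r] by (simp add: sstep_def divide_inverse[symmetric] divide_le_eq)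
  show "r \<le> 0 \<Longrightarrow> sstep r = 0" by (simp add: sstep_def expdec_def)
  show "r \<ge> 1 \<Longrightarrow> sstep r = 1" by (simp add: sstep_def expdec_def)
qed

definition sstep' :: "real \<Rightarrow> real" where "sstep' = deriv sstep"

lemma sstep_DERIV: "(sstep has_real_derivative sstep' r) (at r)"
  and sstep'_continuous: "continuous_on UNIV sstep'"
proof -
  have "(\<lambda>x. sstep (x::real)) \<in> smooth_alg" by (intro sstep_smooth smooth_alg.lin bounded_linear_ident)
  then obtain f' where f': "\<And>x. (sstep has_derivative f' x) (at x)" "(\<lambda>x. f' x 1) \<in> smooth_alg"
    using smooth_alg_derivative by blast
  have *: "(sstep has_real_derivative f' x 1) (at x)" for x
  proof -
    have "f' x = (*) (f' x 1)"
    proof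
      fix v
      have "linear (f' x)" using has_derivative_bounded_linear[OF f'(1)[of x]] by (rule bounded_linear.linear)
      then have "f' x (v *\<^sub>R 1) = v *\<^sub>R f' x 1" by (rule linear_cmul)
      then show "f' x v = f' x 1 * v" by (simp add: mult.commute)
    qed
    then show ?thesis using f'(1)[of x] by (simp add: has_field_derivative_def)
  qed
  then have eq: "sstep' = (\<lambda>x. f' x 1)" unfolding sstep'_def by (intro ext DERIV_imp_deriv)
  then show "(sstep has_real_derivative sstep' r) (at r)" "continuous_on UNIV sstep'"
    using * smooth_alg_continuous[OF f'(2), of UNIV] by (simp_all only: eq)
qed

lemma sstep'_zero:
  assumes "r < 0 \<or> r > 1" shows "sstep' r = 0"
proof -
  have "((\<lambda>_. sstep r) has_real_derivative 0) (at r)" by simp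
  then have "(sstep has_real_derivative 0) (at r)"
  proof (rule has_field_derivative_transform_within_open[of _ _ _ "if r < 0 then {..<0} else {1<..}"])
    show "\<And>x. x \<in> (if r < 0 then {..<0} else {1<..}) \<Longrightarrow> sstep r = sstep x"
      using assms by (auto simp: sstep_bounds split: if_splits)
  qed (use assms in auto)
  then show ?thesis using sstep_DERIV DERIV_unique by blast
qed

text \<open>The usual mollifier profile on the ball of radius \<open>h\<close>, left unnormalised:
  the later arguments rely on its integral being positive, not on the value.\<close>

definition bump :: "real \<Rightarrow> 'a::euclidean_space \<Rightarrow> real" where
  "bump h x = expdec 0 (1 - (norm x / h)\<^sup>2)"

lemma bump_nonneg [simp]: "0 \<le> bump h x"
  by (simp add: bump_def)

lemma bump_le_1: "bump h x \<le> 1"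
  by (simp add: bump_def expdec_def)

lemma bump_pos: "h > 0 \<Longrightarrow> norm x < h \<Longrightarrow> 0 < bump h x"
  by (auto simp: bump_def expdec_def power_less_one_iff abs_square_less_1)

lemma bump_zero: "h > 0 \<Longrightarrow> h \<le> norm x \<Longrightarrow> bump h x = 0"
  by (auto simp: bump_def expdec_def not_less)

lemma bump_smooth:
  fixes z :: "'b::euclidean_space"
  assumes "bounded_linear l"
  shows "(\<lambda>p. bump h (l p - z)) \<in> smooth_alg"
proof -
  have "(norm (l p - z) / h)\<^sup>2 = (\<Sum>i\<in>Basis. (l p \<bullet> i - z \<bullet> i) * (l p \<bullet> i - z \<bullet> i)) * (1 / h\<^sup>2)" for p
  proof -
    have "(norm (l p - z))\<^sup>2 = (l p - z) \<bullet> (l p - z)" by (simp add: power2_norm_eq_inner)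
    also have "\<dots> = (\<Sum>i\<in>Basis. (l p \<bullet> i - z \<bullet> i) * (l p \<bullet> i - z \<bullet> i))"
      by (subst euclidean_inner) (simp add: inner_diff_left)
    finally show ?thesis by (simp add: power_divide)
  qed
  then show ?thesis unfolding bump_def using assms
    by (simp only:) (intro smooth_alg.expdec smooth_alg_diff smooth_alg.const smooth_alg.mult smooth_alg_sum finite_Basis smooth_alg.lin bounded_linear_inner_left_comp)
qed

text \<open>With y = 1/r the derivative is y^2 exp(-y), which is at most 2 by the quadratic Taylor
  bound for exp.\<close>

lemma expdec0_lipschitz: "\<bar>expdec 0 a - expdec 0 b\<bar> \<le> 2 * \<bar>a - b\<bar>"
proof -
  have d: "(expdec 0 has_real_derivative expdec 2 r) (at r)" for r using expdec_DERIV[of 0 r] by (simp add: numeral_2_eq_2)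
  have b: "norm (expdec 2 r) \<le> 2" for r
  proof (cases "r > 0")
    case True
    define y where "y = 1 / r"
    have y: "y > 0" using True by (simp add: y_def)
    have "1 + y + y\<^sup>2 / 2 \<le> exp y" using y by (intro exp_lower_Taylor_quadratic) auto
    then have "y\<^sup>2 \<le> 2 * exp y" using y by simp
    then show ?thesis using True by (simp add: expdec_def y_def[symmetric] exp_minus field_simps)
  qed (simp add: expdec_def)
  have "norm (expdec 0 a - expdec 0 b) \<le> 2 * norm (a - b)"
    by (rule field_differentiable_bound[of UNIV]) (use d b in auto)
  then show ?thesis by simp
qed

lemma bump_lipschitz:
  fixes x y :: "'a::euclidean_space"
  assumes h: "h > 0"
  shows "\<bar>bump h x - bump h y\<bar> \<le> 4 / h * norm (x - y)"
proof -
  \<comment> \<open>Clamping the scaled radius at 1 does not change the bump, as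
    \<open>expdec 0\<close> vanishes for nonpositive arguments, and it makes the square Lipschitz
    with constant 2.\<close>
  define m where "m x = min (norm x / h) 1" for x :: 'a
  have m: "0 \<le> m x" "m x \<le> 1" for x using h by (auto simp: m_def)
  have bm: "bump h x = expdec 0 (1 - (m x)\<^sup>2)" for x
  proof (cases "norm x \<le> h")
    case True
    then have "m x = norm x / h" using h by (simp add: m_def min_def)
    then show ?thesis by (simp add: bump_def)
  next
    case False
    then have "m x = 1" using h by (simp add: m_def min_def)
    then show ?thesis using False h bump_zero[of h x] by (simp add: expdec_def)
  qed
  have "\<bar>m x - m y\<bar> \<le> \<bar>norm x / h - norm y / h\<bar>" unfolding m_def by linarith
  also have "\<dots> = \<bar>norm x - norm y\<bar> / h" using h by (simp add: diff_divide_distrib[symmetric])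
  also have "\<dots> \<le> norm (x - y) / h" using h by (intro divide_right_mono norm_triangle_ineq3) auto
  finally have 1: "\<bar>m x - m y\<bar> \<le> norm (x - y) / h" .
  have "\<bar>(1 - (m x)\<^sup>2) - (1 - (m y)\<^sup>2)\<bar> = \<bar>m x - m y\<bar> * (m x + m y)"
    using m[of x] m[of y] by (simp add: power2_eq_square square_diff_square_factored abs_mult abs_minus_commute mult.commute)
  also have "\<dots> \<le> norm (x - y) / h * 2" using 1 m[of x] m[of y] h by (intro mult_mono) auto
  finally have "\<bar>(1 - (m x)\<^sup>2) - (1 - (m y)\<^sup>2)\<bar> \<le> 2 * norm (x - y) / h" by (simp add: mult.commute)
  then have "2 * \<bar>(1 - (m x)\<^sup>2) - (1 - (m y)\<^sup>2)\<bar> \<le> 4 / h * norm (x - y)" by simp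
  with expdec0_lipschitz[of "1 - (m x)\<^sup>2" "1 - (m y)\<^sup>2"] show ?thesis unfolding bm by linarith
qed

lemma bump_measurable [measurable]: "bump h \<in> borel_measurable borel"
  unfolding bump_def expdec_def by measurable

text \<open>A smooth substitute for the indicator of the time interval from \<open>a\<close> to
  \<open>b\<close>: it rises on \<open>{a..a + \<eta>}\<close> and falls on
  \<open>{b..b + \<eta>}\<close>. Rising only after \<open>a\<close> keeps the support inside the
  positive times.\<close>

definition ramp :: "real \<Rightarrow> real \<Rightarrow> real \<Rightarrow> real \<Rightarrow> real" where
  "ramp a b \<eta> t = sstep ((t - a) / \<eta>) - sstep ((t - b) / \<eta>)"

lemma test_fn_ramp_bump:
  fixes z :: "real^'d"
  assumes "0 < a" "a < b" "\<eta> > 0" "h > 0"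
  shows "test_fn (\<lambda>p. ramp a b \<eta> (fst p) * bump h (snd p - z))"
    and "time_deriv (\<lambda>p. ramp a b \<eta> (fst p) * bump h (snd p - z)) t x
       = (sstep' ((t - a) / \<eta>) - sstep' ((t - b) / \<eta>)) / \<eta> * bump h (x - z)"
proof -
  let ?f = "\<lambda>p :: real \<times> (real^'d). ramp a b \<eta> (fst p) * bump h (snd p - z)"
  have aff: "(\<lambda>p :: real \<times> (real^'d). (fst p - c) / \<eta>) \<in> smooth_alg" for c
    unfolding divide_inverse
    by (intro smooth_alg.mult smooth_alg_diff smooth_alg.const smooth_alg.lin bounded_linear_fst)
  have sm: "?f \<in> smooth_alg"
    unfolding ramp_def
    by (intro smooth_alg.mult smooth_alg_diff sstep_smooth aff bump_smooth bounded_linear_snd)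
  have supp: "{p. ?f p \<noteq> 0} \<subseteq> {a..b + \<eta>} \<times> cball z h"
  proof
    fix p assume "p \<in> {p. ?f p \<noteq> 0}"
    then have 1: "ramp a b \<eta> (fst p) \<noteq> 0" and 2: "bump h (snd p - z) \<noteq> 0" by auto
    have "a \<le> fst p"
    proof (rule ccontr)
      assume "\<not> a \<le> fst p"
      then have "(fst p - a) / \<eta> \<le> 0" "(fst p - b) / \<eta> \<le> 0" using assms by (auto simp: divide_le_0_iff)
      then show False using 1 by (simp add: ramp_def sstep_bounds)
    qed
    moreover have "fst p \<le> b + \<eta>"
    proof (rule ccontr)
      assume "\<not> fst p \<le> b + \<eta>"
      then have "(fst p - a) / \<eta> \<ge> 1" "(fst p - b) / \<eta> \<ge> 1" using assms by (auto simp: le_divide_eq)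
      then show False using 1 by (simp add: ramp_def sstep_bounds)
    qed
    moreover have "norm (snd p - z) \<le> h" using 2 bump_zero[OF \<open>h > 0\<close>, of "snd p - z"] by linarith
    ultimately show "p \<in> {a..b + \<eta>} \<times> cball z h"
      by (cases p) (auto simp: dist_norm norm_minus_commute)
  qed
  have cl: "closure {p. ?f p \<noteq> 0} \<subseteq> {a..b + \<eta>} \<times> cball z h"
    by (intro closure_minimal supp closed_Times) auto
  have cpt: "compact ({a..b + \<eta>} \<times> cball z h)" by (intro compact_Times) auto
  have "compact (closure {p. ?f p \<noteq> 0})"
    using closed_Int_compact[OF closed_closure[of "{p. ?f p \<noteq> 0}"] cpt] unfolding Int_absorb2[OF cl] .
  moreover have "closure {p. ?f p \<noteq> 0} \<subseteq> {0<..} \<times> UNIV" using cl assms by fastforce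
  ultimately show "test_fn ?f" unfolding test_fn_def using smooth_alg_imp_smooth_fn[OF sm] by blast
  obtain f' where f': "\<And>p. (?f has_derivative f' p) (at p)" using smooth_alg_derivative[OF sm] by blast
  have "((\<lambda>r. ?f (r, x)) has_derivative (\<lambda>r. f' (t, x) (r, 0))) (at t)"
  proof -
    have "((\<lambda>r::real. (r, x)) has_derivative (\<lambda>r. (r, 0))) (at t)" by (auto intro!: derivative_eq_intros)
    from has_derivative_compose[OF this f'] show ?thesis by simp
  qed
  moreover have "((\<lambda>r. ?f (r, x)) has_derivative (\<lambda>r. ((sstep' ((t - a) / \<eta>) - sstep' ((t - b) / \<eta>)) / \<eta> * bump h (x - z)) * r)) (at t)"
  proof -
    have "((\<lambda>r. sstep ((r - c) / \<eta>)) has_real_derivative sstep' ((t - c) / \<eta>) * (1 / \<eta>)) (at t)" for c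
      by (rule DERIV_chain2[OF sstep_DERIV]) (use assms in \<open>auto intro!: derivative_eq_intros\<close>)
    then have "((\<lambda>r. ramp a b \<eta> r * bump h (x - z)) has_real_derivative
       (sstep' ((t - a) / \<eta>) * (1 / \<eta>) - sstep' ((t - b) / \<eta>) * (1 / \<eta>)) * bump h (x - z)) (at t)"
      unfolding ramp_def by (intro DERIV_cmult_right DERIV_diff)
    then show ?thesis by (simp add: has_field_derivative_def diff_divide_distrib)
  qed
  ultimately have "(\<lambda>r. f' (t, x) (r, 0)) = (\<lambda>r. ((sstep' ((t - a) / \<eta>) - sstep' ((t - b) / \<eta>)) / \<eta> * bump h (x - z)) * r)"
    by (rule has_derivative_unique)
  then have "f' (t, x) (1, 0) = (sstep' ((t - a) / \<eta>) - sstep' ((t - b) / \<eta>)) / \<eta> * bump h (x - z)"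
    by (metis mult.right_neutral)
  then show "time_deriv ?f t x = (sstep' ((t - a) / \<eta>) - sstep' ((t - b) / \<eta>)) / \<eta> * bump h (x - z)"
    unfolding time_deriv_def using frechet_derivative_at[OF f'] by simp
qed

lemma integrable_bump:
  assumes "h > 0"
  shows "integrable lborel (bump h :: 'a::euclidean_space \<Rightarrow> real)"
proof (rule Bochner_Integration.integrable_bound)
  show "integrable lborel (indicator (cball 0 h) :: 'a \<Rightarrow> real)"
    using emeasure_lborel_cball_finite[of 0 h] by (intro integrable_real_indicator) auto
  show "AE x::'a in lborel. norm (bump h x) \<le> norm (indicator (cball 0 h) x :: real)"
  proof (rule AE_I2)
    fix x :: 'a
    show "norm (bump h x) \<le> norm (indicator (cball 0 h) x :: real)"
      using bump_zero[OF assms, of x] bump_le_1[of h x] by (auto simp: indicator_def)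
  qed
  show "bump h \<in> borel_measurable (lborel :: 'a measure)" by simp
qed

lemma integral_bump_pos:
  assumes "h > 0"
  shows "0 < (\<integral>x. bump h (x :: 'a::euclidean_space) \<partial>lborel)"
proof -
  have "(\<integral>x. bump h (x :: 'a) \<partial>lborel) \<noteq> 0"
  proof
    assume "(\<integral>x. bump h (x :: 'a) \<partial>lborel) = 0"
    then have "AE x in lborel. bump h (x::'a) = 0"
      by (subst (asm) integral_nonneg_eq_0_iff_AE) (auto simp: integrable_bump assms)
    then have "AE x in lborel. x \<notin> ball (0::'a) h"
      by eventually_elim (use bump_pos[OF assms] in force)
    then have "emeasure lborel (ball (0::'a) h) = 0"
      by (intro AE_iff_measurable[THEN iffD1, of _ lborel "\<lambda>x. x \<notin> ball 0 h"]) auto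
    moreover have "0 < unit_ball_vol (real DIM('a)) * h ^ DIM('a)" using assms by (intro mult_pos_pos) auto
    ultimately show False using assms by (simp add: emeasure_lborel_ball ennreal_eq_0_iff)
  qed
  moreover have "0 \<le> (\<integral>x. bump h (x :: 'a) \<partial>lborel)" by simp
  ultimately show ?thesis by linarith
qed

lemma gag_bump_finite:
  assumes "0 < s" "s < 1" "h > 0"
  shows "gag s (\<lambda>x. bump h (x - z :: 'a::euclidean_space)) < \<infinity>"
proof (rule gag_lipschitz_finite[OF assms(1,2)])
  show "\<bar>bump h (x - z) - bump h (y - z)\<bar> \<le> 4 / h * norm (x - y)" for x y
    using bump_lipschitz[OF assms(3), of "x - z" "y - z"] by simp
  show "\<bar>bump h (x - z)\<bar> \<le> 1" for x using bump_le_1[of h "x - z"] by simp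
  show "x \<notin> cball z h \<Longrightarrow> bump h (x - z) = 0" for x
    using bump_zero[OF assms(3), of "x - z"] by (simp add: dist_norm norm_minus_commute)
qed simp

text \<open>A bound on the inner absolute integral that is uniform in \<open>w\<close>, times an
  integrable weight, gives the absolute integrability behind Fubini. The exchange serves to move an
  average over translations from the bump to the test function.\<close>

lemma Fubini_weight:
  fixes G :: "'a::euclidean_space \<Rightarrow> 'p \<Rightarrow> real"
  assumes M: "sigma_finite_measure M" and \<alpha>: "integrable lborel \<alpha>"
    and [measurable]: "case_prod G \<in> borel_measurable (lborel \<Otimes>\<^sub>M M)"
    and K: "\<And>w. (\<integral>\<^sup>+p. ennreal \<bar>G w p\<bar> \<partial>M) \<le> ennreal K"
  shows "(\<integral>w. \<alpha> w * (\<integral>p. G w p \<partial>M) \<partial>lborel) = (\<integral>p. (\<integral>w. \<alpha> w * G w p \<partial>lborel) \<partial>M)"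
    and "integrable lborel (\<lambda>w. \<alpha> w * (\<integral>p. G w p \<partial>M))"
proof -
  interpret M: sigma_finite_measure M by fact
  interpret P: pair_sigma_finite lborel M by unfold_locales
  have [measurable]: "\<alpha> \<in> borel_measurable borel" using \<alpha> by auto
  have "(\<integral>\<^sup>+z. ennreal \<bar>\<alpha> (fst z) * G (fst z) (snd z)\<bar> \<partial>(lborel \<Otimes>\<^sub>M M))
      = (\<integral>\<^sup>+w. ennreal \<bar>\<alpha> w\<bar> * (\<integral>\<^sup>+p. ennreal \<bar>G w p\<bar> \<partial>M) \<partial>lborel)"
    by (subst M.nn_integral_fst[symmetric]) (auto simp: abs_mult ennreal_mult nn_integral_cmult)
  also have "\<dots> \<le> (\<integral>\<^sup>+w. ennreal \<bar>\<alpha> w\<bar> * ennreal K \<partial>lborel)"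
    by (intro nn_integral_mono mult_left_mono K) auto
  also have "\<dots> < \<infinity>" using \<alpha> by (auto simp: nn_integral_multc integrable_iff_bounded ennreal_mult_less_top)
  finally have I: "integrable (lborel \<Otimes>\<^sub>M M) (\<lambda>(w, p). \<alpha> w * G w p)"
    by (intro integrableI_bounded) (auto simp: case_prod_unfold)
  show "(\<integral>w. \<alpha> w * (\<integral>p. G w p \<partial>M) \<partial>lborel) = (\<integral>p. (\<integral>w. \<alpha> w * G w p \<partial>lborel) \<partial>M)"
    using P.Fubini_integral[OF I] by simp
  show "integrable lborel (\<lambda>w. \<alpha> w * (\<integral>p. G w p \<partial>M))"
    using P.integrable_fst[OF I] by simp
qed

lemma integral_convolution_commute:
  fixes \<psi> \<rho> :: "'a::euclidean_space \<Rightarrow> real"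
  assumes [measurable]: "\<psi> \<in> borel_measurable borel" "\<rho> \<in> borel_measurable borel"
  shows "(\<integral>z. \<psi> z * \<rho> (x - z) \<partial>lborel) = (\<integral>w. \<rho> w * \<psi> (x - w) \<partial>lborel)"
proof -
  have "(\<integral>z. \<psi> z * \<rho> (x - z) \<partial>lborel) = (\<integral>z. \<psi> (x + z) * \<rho> (x - (x + z)) \<partial>lborel)"
    by (rule lborel_integral_translate[symmetric]) measurable
  also have "\<dots> = (\<integral>z. \<psi> (x + - z) * \<rho> (x - (x + - z)) \<partial>lborel)"
    by (rule lborel_integral_neg[symmetric]) measurable
  finally show ?thesis by (simp add: mult.commute)
qed

lemma gform_commute: "gform s f g = gform s g f"
  by (simp add: gform_def mult.commute)

lemma tm_gform_diff:
  fixes f g1 g2 :: "real \<Rightarrow> 'a::euclidean_space \<Rightarrow> real"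
  assumes [measurable]: "case_prod f \<in> borel_measurable (borel \<Otimes>\<^sub>M borel)"
    "case_prod g1 \<in> borel_measurable (borel \<Otimes>\<^sub>M borel)" "case_prod g2 \<in> borel_measurable (borel \<Otimes>\<^sub>M borel)"
    and fin: "(\<integral>\<^sup>+t. gag s (f t) \<partial>tm a b) < \<infinity>" "(\<integral>\<^sup>+t. gag s (g1 t) \<partial>tm a b) < \<infinity>" "(\<integral>\<^sup>+t. gag s (g2 t) \<partial>tm a b) < \<infinity>"
  shows "(\<integral>t. gform s (\<lambda>x. g1 t x - g2 t x) (f t) \<partial>tm a b)
     = (\<integral>t. gform s (g1 t) (f t) \<partial>tm a b) - (\<integral>t. gform s (g2 t) (f t) \<partial>tm a b)"
proof -
  have "(\<integral>\<^sup>+t. gag s (\<lambda>x. g1 t x - g2 t x) \<partial>tm a b) \<le> (\<integral>\<^sup>+t. ennreal (2 * 1\<^sup>2) * (gag s (g1 t) + gag s (g2 t)) \<partial>tm a b)"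
    by (intro nn_integral_mono gag_bound2) (auto simp: abs_if)
  also have "\<dots> < \<infinity>"
    using fin by (subst nn_integral_cmult) (auto simp: nn_integral_add ennreal_mult_less_top)
  finally have fin': "(\<integral>\<^sup>+t. gag s (\<lambda>x. g1 t x - g2 t x) \<partial>tm a b) < \<infinity>" .
  have 1: "dif (\<lambda>x. g1 t x - g2 t x) z * dif (f t) z = dif (g1 t) z * dif (f t) z - dif (g2 t) z * dif (f t) z" for t z
    by (simp add: dif_def algebra_simps)
  show ?thesis
    using fin fin' by (simp add: tm_gform_prod(3) 1 Bochner_Integration.integral_diff tm_gform_prod(1))
qed

section \<open>Weak solutions tested with functions of finite energy\<close>

text \<open>The data of v_\<epsilon> on which the estimates rest: \<open>F\<close> stands for
  \<phi>_\<epsilon>, and \<open>v\<close> for a jointly Borel, everywhere nonnegative representative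
  defined for all real times, so that continuity in time is two-sided. The equation is assumed in
  integrated form and against translated bumps; in the application \<open>C\<close> is c(N,s)/2, the
  factor in front of the double integral in \<open>frac_pairing\<close>.\<close>

locale frac_flow =
  fixes s C LF :: real and F :: "real \<Rightarrow> real" and v :: "real \<Rightarrow> 'a::euclidean_space \<Rightarrow> real"
  assumes s: "0 < s" "s < 1" and C: "C > 0"
    and F_strict: "\<And>x y. 0 \<le> x \<Longrightarrow> x < y \<Longrightarrow> F x < F y" and F_0: "F 0 = 0"
    and F_lip: "\<And>x y. 0 \<le> x \<Longrightarrow> 0 \<le> y \<Longrightarrow> \<bar>F x - F y\<bar> \<le> LF * \<bar>x - y\<bar>"
    and F_meas [measurable]: "F \<in> borel_measurable borel"
    and v_meas [measurable]: "case_prod v \<in> borel_measurable (borel \<Otimes>\<^sub>M borel)"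
    and v_nonneg [simp]: "\<And>t x. 0 \<le> v t x"
    and v_int: "\<And>t. integrable lborel (v t)"
    and v_cont: "\<And>t. ((\<lambda>r. \<integral>x. \<bar>v r x - v t x\<bar> \<partial>lborel) \<longlongrightarrow> 0) (at t)"
    and gag_fin: "\<And>a b. 0 < a \<Longrightarrow> (\<integral>\<^sup>+t. gag s (\<lambda>x. F (v t x)) \<partial>tm a b) < \<infinity>"
    and weak_bump: "\<And>a b h z. 0 < a \<Longrightarrow> a < b \<Longrightarrow> h > 0 \<Longrightarrow>
       (\<integral>x. (v b x - v a x) * bump h (x - z) \<partial>lborel)
         = - C * (\<integral>t. gform s (\<lambda>x. F (v t x)) (\<lambda>x. bump h (x - z)) \<partial>tm a b)"
begin

lemma v_meas1 [measurable]: "v t \<in> borel_measurable borel"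
  using v_int[of t] by auto

text \<open>\<open>Z w\<close> is the defect of the identity for the test function translated by
  \<open>w\<close>. For every radius its average against the bump vanishes, because by Fubini it
  equals the average against \<open>\<psi>\<close> of the identities for bumps. As \<open>Z\<close>
  is continuous at 0, a bump of small radius would detect \<open>Z 0 \<noteq> 0\<close>.\<close>

lemma weak:
  assumes ab: "0 < a" "a < b" and [measurable]: "\<psi> \<in> borel_measurable borel"
    and K: "\<And>x. \<bar>\<psi> x\<bar> \<le> K" and \<psi>: "integrable lborel \<psi>" and gag\<psi>: "gag s \<psi> < \<infinity>"
  shows "(\<integral>x. (v b x - v a x) * \<psi> x \<partial>lborel) = - C * (\<integral>t. gform s (\<lambda>x. F (v t x)) \<psi> \<partial>tm a b)"
proof -
  define f where "f t x = F (v t x)" for t x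
  have [measurable]: "case_prod f \<in> borel_measurable (borel \<Otimes>\<^sub>M borel)" unfolding f_def by measurable
  have ffin: "(\<integral>\<^sup>+t. gag s (f t) \<partial>tm a b) < \<infinity>" using gag_fin[OF ab(1)] unfolding f_def .
  define D where "D x = v b x - v a x" for x
  have [measurable]: "D \<in> borel_measurable borel" unfolding D_def by measurable
  have D: "integrable lborel D" unfolding D_def by (intro Bochner_Integration.integrable_diff v_int)
  have K0: "K \<ge> 0" using K[of 0] by linarith
  let ?M = "tm a b \<Otimes>\<^sub>M (gm s :: ('a \<times> 'a) measure)"
  define \<Phi> where "\<Phi> p = dif (f (fst p)) (snd p)" for p
  have [measurable]: "\<Phi> \<in> borel_measurable (borel \<Otimes>\<^sub>M (borel \<Otimes>\<^sub>M borel))" unfolding \<Phi>_def dif_def by measurable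
  have \<Phi>: "(\<integral>\<^sup>+p. ennreal ((\<Phi> p)\<^sup>2) \<partial>?M) < \<infinity>"
    using ffin by (simp add: \<Phi>_def tm_gag_prod)
  have M: "sigma_finite_measure ?M"
    by (intro sigma_finite_pair_measure sigma_finite_gm sigma_finite_tm)
  have form: "(\<integral>t. gform s (f t) g \<partial>tm a b) = (\<integral>p. \<Phi> p * dif g (snd p) \<partial>?M)"
    if [measurable]: "g \<in> borel_measurable borel" and "gag s g < \<infinity>" for g
    using that ffin ab tm_gform_prod(3)[of f "\<lambda>_. g" a b s]
    by (simp add: \<Phi>_def ennreal_mult_less_top)
  \<comment> \<open>All translates of a function have the same energy \<open>G\<close>; the
    resulting bound, uniform in \<open>w\<close>, is the hypothesis of
    \<open>Fubini_weight\<close>.\<close>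
  have bound: "\<exists>K. \<forall>w. (\<integral>\<^sup>+p. ennreal \<bar>\<Phi> p * dif (g w) (snd p)\<bar> \<partial>?M) \<le> ennreal K"
    if [measurable]: "\<And>w. g w \<in> borel_measurable borel" and gg: "\<And>w. gag s (g w) = G" "G < \<infinity>" for g :: "'a \<Rightarrow> 'a \<Rightarrow> real" and G
  proof -
    obtain G' where G': "G = ennreal G'" "G' \<ge> 0" using gg(2) by (cases G) auto
    obtain P where P: "(\<integral>\<^sup>+p. ennreal ((\<Phi> p)\<^sup>2) \<partial>?M) = ennreal P" "P \<ge> 0"
      using \<Phi> by (cases "(\<integral>\<^sup>+p. ennreal ((\<Phi> p)\<^sup>2) \<partial>?M)") auto
    have "(\<integral>\<^sup>+p. ennreal \<bar>\<Phi> p * dif (g w) (snd p)\<bar> \<partial>?M) \<le> ennreal (P + G' * (b - a))" for w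
    proof -
      have "(\<integral>\<^sup>+p. ennreal \<bar>\<Phi> p * dif (g w) (snd p)\<bar> \<partial>?M)
        \<le> (\<integral>\<^sup>+p. ennreal ((\<Phi> p)\<^sup>2) + ennreal ((dif (g w) (snd p))\<^sup>2) \<partial>?M)"
        by (intro nn_integral_mono) (simp add: abs_mult_le_squares ennreal_leI flip: ennreal_plus)
      also have "\<dots> = ennreal P + (\<integral>\<^sup>+p. ennreal ((dif (g w) (snd p))\<^sup>2) \<partial>?M)"
        by (subst nn_integral_add) (simp_all add: P)
      also have "(\<integral>\<^sup>+p. ennreal ((dif (g w) (snd p))\<^sup>2) \<partial>?M) = G * ennreal (b - a)"
        using tm_gag_prod[of "\<lambda>_. g w" a b s] ab by (simp add: gg(1))
      finally show ?thesis using G' P ab by (simp add: ennreal_mult)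
    qed
    then show ?thesis by blast
  qed
  define Z where "Z w = (\<integral>x. D x * \<psi> (x - w) \<partial>lborel) + C * (\<integral>p. \<Phi> p * dif (\<lambda>x. \<psi> (x - w)) (snd p) \<partial>?M)" for w
  have gag_sh: "gag s (\<lambda>x. \<psi> (x - w)) = gag s \<psi>" for w
    using gag_translate[of \<psi> s "- w"] by simp
  have Z0: "(\<integral>w. bump h w * Z w \<partial>lborel) = 0" and Zint: "integrable lborel (\<lambda>w. bump h w * Z w)" if h: "h > 0" for h
  proof -
    have gagb: "gag s (\<lambda>x. bump h (x - z :: 'a)) = gag s (bump h :: 'a \<Rightarrow> real)" for z
      using gag_translate[of "bump h" s "- z"] by simp
    have gagb': "gag s (bump h :: 'a \<Rightarrow> real) < \<infinity>" using gag_bump_finite[OF s h, of 0] by simp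
    obtain K1 where K1: "\<And>z. (\<integral>\<^sup>+p. ennreal \<bar>\<Phi> p * dif (\<lambda>x. bump h (x - z)) (snd p)\<bar> \<partial>?M) \<le> ennreal K1"
      using bound[of "\<lambda>z x. bump h (x - z)"] gagb gagb' by auto
    obtain K2 where K2: "\<And>w. (\<integral>\<^sup>+p. ennreal \<bar>\<Phi> p * dif (\<lambda>x. \<psi> (x - w)) (snd p)\<bar> \<partial>?M) \<le> ennreal K2"
      using bound[of "\<lambda>w x. \<psi> (x - w)"] gag_sh gag\<psi> by auto
    have K3: "(\<integral>\<^sup>+x. ennreal \<bar>D x * bump h (x - z)\<bar> \<partial>lborel) \<le> ennreal (\<integral>x. \<bar>D x\<bar> \<partial>lborel)" for z
      using D bump_le_1[of h] by (subst nn_integral_eq_integral[symmetric])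
        (auto intro!: nn_integral_mono ennreal_leI mult_left_le simp: abs_mult)
    have K4: "(\<integral>\<^sup>+x. ennreal \<bar>D x * \<psi> (x - w)\<bar> \<partial>lborel) \<le> ennreal (\<integral>x. \<bar>D x\<bar> * K \<partial>lborel)" for w
      using D K K0 by (subst nn_integral_eq_integral[symmetric])
        (auto intro!: nn_integral_mono ennreal_leI mult_left_mono simp: abs_mult)
    have ib: "integrable lborel (bump h :: 'a \<Rightarrow> real)" by (rule integrable_bump[OF h])
    have A1: "(\<integral>z. \<psi> z * (\<integral>x. D x * bump h (x - z) \<partial>lborel) \<partial>lborel) = (\<integral>w. bump h w * (\<integral>x. D x * \<psi> (x - w) \<partial>lborel) \<partial>lborel)"
    proof -
      have "(\<integral>z. \<psi> z * (\<integral>x. D x * bump h (x - z) \<partial>lborel) \<partial>lborel) = (\<integral>x. (\<integral>z. \<psi> z * (D x * bump h (x - z)) \<partial>lborel) \<partial>lborel)"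
        by (rule Fubini_weight(1)[OF lborel.sigma_finite_measure_axioms \<psi> _ K3]) measurable
      also have "\<dots> = (\<integral>x. (\<integral>w. bump h w * (D x * \<psi> (x - w)) \<partial>lborel) \<partial>lborel)"
      proof (rule Bochner_Integration.integral_cong[OF refl])
        fix x
        have "(\<integral>z. \<psi> z * (D x * bump h (x - z)) \<partial>lborel) = D x * (\<integral>z. \<psi> z * bump h (x - z) \<partial>lborel)"
          by (subst integral_mult_right_zero[symmetric]) (simp add: mult_ac)
        also have "\<dots> = D x * (\<integral>w. bump h w * \<psi> (x - w) \<partial>lborel)" by (subst integral_convolution_commute) simp_all
        also have "\<dots> = (\<integral>w. bump h w * (D x * \<psi> (x - w)) \<partial>lborel)"
          by (subst integral_mult_right_zero[symmetric]) (simp add: mult_ac)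
        finally show "(\<integral>z. \<psi> z * (D x * bump h (x - z)) \<partial>lborel) = (\<integral>w. bump h w * (D x * \<psi> (x - w)) \<partial>lborel)" .
      qed
      also have "\<dots> = (\<integral>w. bump h w * (\<integral>x. D x * \<psi> (x - w) \<partial>lborel) \<partial>lborel)"
        by (rule Fubini_weight(1)[OF lborel.sigma_finite_measure_axioms ib _ K4, symmetric]) measurable
      finally show ?thesis .
    qed
    have A2: "(\<integral>z. \<psi> z * (\<integral>p. \<Phi> p * dif (\<lambda>x. bump h (x - z)) (snd p) \<partial>?M) \<partial>lborel)
      = (\<integral>w. bump h w * (\<integral>p. \<Phi> p * dif (\<lambda>x. \<psi> (x - w)) (snd p) \<partial>?M) \<partial>lborel)"
    proof -
      have "(\<integral>z. \<psi> z * (\<integral>p. \<Phi> p * dif (\<lambda>x. bump h (x - z)) (snd p) \<partial>?M) \<partial>lborel)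
          = (\<integral>p. (\<integral>z. \<psi> z * (\<Phi> p * dif (\<lambda>x. bump h (x - z)) (snd p)) \<partial>lborel) \<partial>?M)"
        by (rule Fubini_weight(1)[OF M \<psi> _ K1]) (unfold dif_def, measurable)
      also have "\<dots> = (\<integral>p. (\<integral>w. bump h w * (\<Phi> p * dif (\<lambda>x. \<psi> (x - w)) (snd p)) \<partial>lborel) \<partial>?M)"
      proof (rule Bochner_Integration.integral_cong[OF refl])
        fix p :: "real \<times> ('a \<times> 'a)"
        obtain t x y where p: "p = (t, x, y)" by (cases p) auto
        have i1: "integrable lborel (\<lambda>z. \<psi> z * bump h (x - z))" for x
          by (intro Bochner_Integration.integrable_bound[OF \<psi>]) (auto intro!: AE_I2 mult_left_le simp: abs_mult bump_le_1)
        have i2: "integrable lborel (\<lambda>w. bump h w * \<psi> (x - w))" for x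
          using K K0 by (intro Bochner_Integration.integrable_bound[OF integrable_mult_left[OF ib, of K]])
            (auto simp: abs_mult intro!: mult_left_mono)
        have "(\<integral>z. \<psi> z * (\<Phi> p * dif (\<lambda>x. bump h (x - z)) (snd p)) \<partial>lborel)
            = (\<integral>z. \<Phi> p * (\<psi> z * bump h (x - z) - \<psi> z * bump h (y - z)) \<partial>lborel)"
          by (simp add: p dif_def algebra_simps)
        also have "\<dots> = \<Phi> p * ((\<integral>z. \<psi> z * bump h (x - z) \<partial>lborel) - (\<integral>z. \<psi> z * bump h (y - z) \<partial>lborel))"
          by (simp add: i1)
        also have "\<dots> = \<Phi> p * ((\<integral>w. bump h w * \<psi> (x - w) \<partial>lborel) - (\<integral>w. bump h w * \<psi> (y - w) \<partial>lborel))"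
          by (simp add: integral_convolution_commute)
        also have "\<dots> = (\<integral>w. \<Phi> p * (bump h w * \<psi> (x - w) - bump h w * \<psi> (y - w)) \<partial>lborel)"
          by (simp add: i2)
        also have "\<dots> = (\<integral>w. bump h w * (\<Phi> p * dif (\<lambda>x. \<psi> (x - w)) (snd p)) \<partial>lborel)"
          by (simp add: p dif_def algebra_simps)
        finally show "(\<integral>z. \<psi> z * (\<Phi> p * dif (\<lambda>x. bump h (x - z)) (snd p)) \<partial>lborel)
          = (\<integral>w. bump h w * (\<Phi> p * dif (\<lambda>x. \<psi> (x - w)) (snd p)) \<partial>lborel)" .
      qed
      also have "\<dots> = (\<integral>w. bump h w * (\<integral>p. \<Phi> p * dif (\<lambda>x. \<psi> (x - w)) (snd p) \<partial>?M) \<partial>lborel)"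
        by (rule Fubini_weight(1)[OF M ib _ K2, symmetric]) (unfold dif_def, measurable)
      finally show ?thesis .
    qed
    have I1: "integrable lborel (\<lambda>w. bump h w * (\<integral>x. D x * \<psi> (x - w) \<partial>lborel))"
      by (rule Fubini_weight(2)[OF lborel.sigma_finite_measure_axioms ib _ K4]) measurable
    have I2: "integrable lborel (\<lambda>w. bump h w * (\<integral>p. \<Phi> p * dif (\<lambda>x. \<psi> (x - w)) (snd p) \<partial>?M))"
      by (rule Fubini_weight(2)[OF M ib _ K2]) (unfold dif_def, measurable)
    have Zeq: "bump h w * Z w = bump h w * (\<integral>x. D x * \<psi> (x - w) \<partial>lborel)
       + C * (bump h w * (\<integral>p. \<Phi> p * dif (\<lambda>x. \<psi> (x - w)) (snd p) \<partial>?M))" for w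
      by (simp add: Z_def algebra_simps)
    show "integrable lborel (\<lambda>w. bump h w * Z w)"
      unfolding Zeq using I1 I2 by auto
    have "(\<integral>w. bump h w * Z w \<partial>lborel) = (\<integral>z. \<psi> z * (\<integral>x. D x * bump h (x - z) \<partial>lborel) \<partial>lborel)
      + C * (\<integral>z. \<psi> z * (\<integral>p. \<Phi> p * dif (\<lambda>x. bump h (x - z)) (snd p) \<partial>?M) \<partial>lborel)"
      unfolding Zeq using I1 I2 by (simp add: A1 A2)
    also have "(\<integral>z. \<psi> z * (\<integral>x. D x * bump h (x - z) \<partial>lborel) \<partial>lborel)
       = (\<integral>z. - C * (\<psi> z * (\<integral>p. \<Phi> p * dif (\<lambda>x. bump h (x - z)) (snd p) \<partial>?M)) \<partial>lborel)"
    proof (rule Bochner_Integration.integral_cong[OF refl])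
      fix z
      have "(\<integral>x. D x * bump h (x - z) \<partial>lborel) = - C * (\<integral>p. \<Phi> p * dif (\<lambda>x. bump h (x - z)) (snd p) \<partial>?M)"
        using weak_bump[OF ab h, of z] form[of "\<lambda>x. bump h (x - z)"] gag_bump_finite[OF s h, of z]
        by (simp add: D_def f_def[symmetric])
      then show "\<psi> z * (\<integral>x. D x * bump h (x - z) \<partial>lborel) = - C * (\<psi> z * (\<integral>p. \<Phi> p * dif (\<lambda>x. bump h (x - z)) (snd p) \<partial>?M))"
        by simp
    qed
    also have "\<dots> = - C * (\<integral>z. \<psi> z * (\<integral>p. \<Phi> p * dif (\<lambda>x. bump h (x - z)) (snd p) \<partial>?M) \<partial>lborel)"
      by (rule integral_mult_right_zero)
    finally show "(\<integral>w. bump h w * Z w \<partial>lborel) = 0" by simp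
  qed
  \<comment> \<open>The two parts of \<open>Z\<close> use continuity of translations in L^1
    differently: in the first the translation is moved onto \<open>D\<close> and
    \<open>\<psi>\<close> is merely bounded; in the second it acts on \<open>\<psi>\<close>, whose
    energy it preserves, and the form converges weakly.\<close>
  have Zcont: "(\<lambda>k. Z (w k)) \<longlonglongrightarrow> Z 0" if w: "w \<longlonglongrightarrow> 0" for w
  proof -
    have w': "(\<lambda>k. - w k) \<longlonglongrightarrow> 0" using tendsto_minus[OF w] by simp
    have "(\<lambda>k. (\<integral>x. D x * \<psi> (x - w k) \<partial>lborel) - (\<integral>x. D x * \<psi> x \<partial>lborel)) \<longlonglongrightarrow> 0"
    proof (rule tendsto_rabs_zero_cancel, rule tendsto_sandwich[OF _ _ tendsto_const])
      have lim: "(\<lambda>k. \<integral>\<^sup>+x. ennreal \<bar>D (w k + x) - D x\<bar> \<partial>lborel) \<longlonglongrightarrow> 0" by (rule tendsto_translate_L1[OF D w])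
      have iD: "integrable lborel (\<lambda>x. \<bar>D (w k + x) - D x\<bar>)" for k
        by (intro Bochner_Integration.integrable_abs Bochner_Integration.integrable_diff lborel_integrable_translate D)
      have "(\<lambda>k. (\<integral>x. \<bar>D (w k + x) - D x\<bar> \<partial>lborel)) \<longlonglongrightarrow> 0"
        using lim by (simp add: nn_integral_eq_integral[OF iD] ennreal_tendsto_0_iff)
      from tendsto_mult_left[OF this, of K] show "(\<lambda>k. K * (\<integral>x. \<bar>D (w k + x) - D x\<bar> \<partial>lborel)) \<longlonglongrightarrow> 0" by simp
      show "\<forall>\<^sub>F k in sequentially. \<bar>(\<integral>x. D x * \<psi> (x - w k) \<partial>lborel) - (\<integral>x. D x * \<psi> x \<partial>lborel)\<bar> \<le> K * (\<integral>x. \<bar>D (w k + x) - D x\<bar> \<partial>lborel)"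
      proof (intro always_eventually allI)
        fix k
        have eq: "(\<integral>x. D x * \<psi> (x - w k) \<partial>lborel) = (\<integral>x. D (w k + x) * \<psi> x \<partial>lborel)"
          using lborel_integral_translate[of "\<lambda>x. D x * \<psi> (x - w k)" "w k"] by simp
        have i1: "integrable lborel (\<lambda>x. D (c + x) * \<psi> x)" for c
        proof (rule Bochner_Integration.integrable_bound)
          show "integrable lborel (\<lambda>x. K * D (c + x))" using lborel_integrable_translate[OF D, of c] by simp
          show "AE x in lborel. norm (D (c + x) * \<psi> x) \<le> norm (K * D (c + x))"
          proof (rule AE_I2)
            fix x
            have "\<bar>D (c + x)\<bar> * \<bar>\<psi> x\<bar> \<le> \<bar>D (c + x)\<bar> * K" by (intro mult_left_mono K) simp
            then show "norm (D (c + x) * \<psi> x) \<le> norm (K * D (c + x))" using K0 by (simp add: abs_mult mult.commute)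
          qed
        qed measurable
        have "(\<integral>x. D x * \<psi> (x - w k) \<partial>lborel) - (\<integral>x. D x * \<psi> x \<partial>lborel) = (\<integral>x. (D (w k + x) - D x) * \<psi> x \<partial>lborel)"
          using i1[of "w k"] i1[of 0] by (simp add: eq left_diff_distrib)
        also have "\<bar>\<dots>\<bar> \<le> (\<integral>x. K * \<bar>D (w k + x) - D x\<bar> \<partial>lborel)"
          using K K0 iD[of k] by (intro order_trans[OF integral_abs_bound integral_mono']) (auto simp: abs_mult mult.commute[of K] intro!: mult_left_mono)
        finally show "\<bar>(\<integral>x. D x * \<psi> (x - w k) \<partial>lborel) - (\<integral>x. D x * \<psi> x \<partial>lborel)\<bar> \<le> K * (\<integral>x. \<bar>D (w k + x) - D x\<bar> \<partial>lborel)"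
          by simp
      qed
    qed simp
    then have L1: "(\<lambda>k. \<integral>x. D x * \<psi> (x - w k) \<partial>lborel) \<longlonglongrightarrow> (\<integral>x. D x * \<psi> x \<partial>lborel)" by (rule Lim_null[THEN iffD2])
    have gs: "gag s (\<lambda>x. \<psi> (x - w k)) < \<infinity>" for k using gag_sh gag\<psi> by simp
    obtain G' where G': "gag s \<psi> = ennreal G'" "G' \<ge> 0" using gag\<psi> by (cases "gag s \<psi>") auto
    have "(\<lambda>k. \<integral>t. gform s (\<lambda>x. \<psi> (x - w k) - \<psi> x) (f t) \<partial>tm a b) \<longlonglongrightarrow> 0"
    proof (rule tendsto_gform_weak[OF s(1) _ _ _ ffin])
      show "\<forall>\<^sub>F k in sequentially. (\<integral>\<^sup>+t. gag s (\<lambda>x. \<psi> (x - w k) - \<psi> x) \<partial>tm a b) \<le> ennreal (2 * (G' + G') * (b - a))"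
      proof (intro always_eventually allI)
        fix k
        have "gag s (\<lambda>x. \<psi> (x - w k) - \<psi> x) \<le> ennreal (2 * 1\<^sup>2) * (gag s (\<lambda>x. \<psi> (x - w k)) + gag s \<psi>)"
          by (intro gag_bound2) (auto simp: abs_if)
        also have "\<dots> = ennreal (2 * (G' + G'))" using G' by (simp add: gag_sh ennreal_mult flip: ennreal_plus)
        finally have g: "gag s (\<lambda>x. \<psi> (x - w k) - \<psi> x) \<le> ennreal (2 * (G' + G'))" .
        then have "gag s (\<lambda>x. \<psi> (x - w k) - \<psi> x) * ennreal (b - a) \<le> ennreal (2 * (G' + G')) * ennreal (b - a)"
          by (intro mult_right_mono) auto
        then show "(\<integral>\<^sup>+t. gag s (\<lambda>x. \<psi> (x - w k) - \<psi> x) \<partial>tm a b) \<le> ennreal (2 * (G' + G') * (b - a))"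
          using ab G' by (simp add: ennreal_mult)
      qed
      have "(\<lambda>k. ennreal (b - a) * (\<integral>\<^sup>+x. ennreal \<bar>\<psi> (- w k + x) - \<psi> x\<bar> \<partial>lborel)) \<longlonglongrightarrow> ennreal (b - a) * 0"
        by (intro ennreal_tendsto_cmult tendsto_translate_L1[OF \<psi> w']) auto
      then show "(\<lambda>k. \<integral>\<^sup>+t. \<integral>\<^sup>+x. ennreal \<bar>\<psi> (x - w k) - \<psi> x\<bar> \<partial>lborel \<partial>tm a b) \<longlonglongrightarrow> 0"
        using ab by (simp add: mult.commute)
    qed measurable
    moreover have "(\<integral>t. gform s (\<lambda>x. \<psi> (x - w k) - \<psi> x) (f t) \<partial>tm a b)
       = (\<integral>p. \<Phi> p * dif (\<lambda>x. \<psi> (x - w k)) (snd p) \<partial>?M) - (\<integral>p. \<Phi> p * dif \<psi> (snd p) \<partial>?M)" for k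
      using tm_gform_diff[of f "\<lambda>_ x. \<psi> (x - w k)" "\<lambda>_. \<psi>" a b s] ffin gs[of k] gag\<psi> ab form[of "\<lambda>x. \<psi> (x - w k)"] form[of \<psi>]
      by (simp add: ennreal_mult_less_top gform_commute[of s _ "f _"])
    ultimately have "(\<lambda>k. \<integral>p. \<Phi> p * dif (\<lambda>x. \<psi> (x - w k)) (snd p) \<partial>?M) \<longlonglongrightarrow> (\<integral>p. \<Phi> p * dif \<psi> (snd p) \<partial>?M)"
      by (simp add: Lim_null[symmetric])
    with L1 show ?thesis unfolding Z_def by (auto intro!: tendsto_intros)
  qed
  have "Z 0 = 0"
  proof (rule ccontr)
    assume nz: "Z 0 \<noteq> 0"
    have "isCont Z 0" unfolding continuous_at_sequentially o_def using Zcont by simp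
    then obtain h where h: "h > 0" "\<And>w. dist w 0 < h \<Longrightarrow> dist (Z w) (Z 0) < \<bar>Z 0\<bar> / 2"
      unfolding continuous_at_eps_delta using nz by (metis half_gt_zero zero_less_abs_iff)
    \<comment> \<open>Inside the ball of radius \<open>h\<close>, \<open>Z\<close> has the sign of
      \<open>Z 0\<close> and at least half its size; outside, the bump vanishes.\<close>
    have le: "bump h w * (\<bar>Z 0\<bar> / 2) \<le> sgn (Z 0) * (bump h w * Z w)" for w
    proof (cases "norm w < h")
      case True
      then have "\<bar>Z w - Z 0\<bar> < \<bar>Z 0\<bar> / 2" using h(2)[of w] by (simp add: dist_real_def)
      then have "\<bar>Z 0\<bar> / 2 \<le> sgn (Z 0) * Z w" using nz by (auto simp: sgn_if abs_if split: if_splits)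
      from mult_left_mono[OF this bump_nonneg[of h w]] show ?thesis by (simp add: mult_ac)
    qed (simp add: bump_zero[OF h(1)])
    have "(\<integral>w. bump h w * (\<bar>Z 0\<bar> / 2) \<partial>(lborel :: 'a measure)) \<le> (\<integral>w. sgn (Z 0) * (bump h w * Z w) \<partial>lborel)"
      using integrable_bump[OF h(1)] Zint[OF h(1)] by (intro integral_mono le) auto
    also have "\<dots> = 0" using Z0[OF h(1)] by simp
    finally show False using integral_bump_pos[OF h(1), where 'a = 'a] nz by (simp add: mult_le_0_iff)
  qed
  then show ?thesis using form[OF _ gag\<psi>] by (simp add: Z_def D_def f_def[symmetric])
qed

end

lemma ennreal_abs_gform_le:
  assumes [measurable]: "f \<in> borel_measurable borel" "g \<in> borel_measurable borel"
  shows "ennreal \<bar>gform s f g\<bar> \<le> gag s f + gag s g"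
proof -
  have "ennreal \<bar>gform s f g\<bar> \<le> (\<integral>\<^sup>+z. ennreal \<bar>dif f z * dif g z\<bar> \<partial>gm s)"
    unfolding gform_def by (rule ennreal_abs_integral_le)
  also have "\<dots> \<le> (\<integral>\<^sup>+z. ennreal ((dif f z)\<^sup>2) + ennreal ((dif g z)\<^sup>2) \<partial>gm s)"
    by (intro nn_integral_mono) (simp add: abs_mult_le_squares ennreal_leI flip: ennreal_plus)
  also have "\<dots> = gag s f + gag s g" unfolding gag_def by (simp add: nn_integral_add)
  finally show ?thesis .
qed

text \<open>Heine-Cantor for a curve seen through the mutual pseudo-distances of its points. It is
  phrased with \<open>d\<close> because the curves in question live in L^1, where functions that
  agree almost everywhere are not identified.\<close>

lemma uniformly_small_pseudo_dist:
  fixes d :: "real \<Rightarrow> real \<Rightarrow> real"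
  assumes tri: "\<And>a b c. d a c \<le> d a b + d b c" and sym: "\<And>a b. d a b = d b a"
    and refl: "\<And>a. d a a = 0" and lim: "\<And>t. ((\<lambda>r. d r t) \<longlongrightarrow> 0) (at t)" and e: "e > 0"
  shows "\<exists>\<kappa>>0. \<forall>r\<in>{a..b}. \<forall>t\<in>{a..b}. \<bar>r - t\<bar> \<le> \<kappa> \<longrightarrow> d r t < e"
proof (rule ccontr)
  assume neg: "\<not> ?thesis"
  have "\<exists>r t. r \<in> {a..b} \<and> t \<in> {a..b} \<and> \<bar>r - t\<bar> \<le> 1 / real (Suc k) \<and> e \<le> d r t" for k
  proof -
    have "(0::real) < 1 / real (Suc k)" by simp
    with neg show ?thesis by (meson not_less)
  qed
  then obtain R T where RT: "\<And>k. R k \<in> {a..b}" "\<And>k. T k \<in> {a..b}" "\<And>k. \<bar>R k - T k\<bar> \<le> 1 / real (Suc k)" "\<And>k. e \<le> d (R k) (T k)"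
    by metis
  obtain l g where lg: "l \<in> {a..b}" "strict_mono g" "(R \<circ> g) \<longlonglongrightarrow> l"
    using RT(1) compact_Icc[of a b] unfolding compact_def by blast
  have "(\<lambda>k. R k - T k) \<longlonglongrightarrow> 0"
  proof (rule tendsto_rabs_zero_cancel, rule tendsto_sandwich[OF _ _ tendsto_const LIMSEQ_inverse_real_of_nat])
    show "\<forall>\<^sub>F n in sequentially. \<bar>R n - T n\<bar> \<le> inverse (real (Suc n))" using RT(3) by (simp add: divide_inverse)
  qed simp
  then have "((\<lambda>k. R k - T k) \<circ> g) \<longlonglongrightarrow> 0" using lg(2) by (rule LIMSEQ_subseq_LIMSEQ)
  then have "(\<lambda>k. (R \<circ> g) k - ((\<lambda>k. R k - T k) \<circ> g) k) \<longlonglongrightarrow> l - 0" using lg(3) by (intro tendsto_diff)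
  then have Tl: "(T \<circ> g) \<longlonglongrightarrow> l" by (simp add: o_def)
  have c: "isCont (\<lambda>r. d r l) l" using lim[of l] by (simp add: isCont_def refl)
  have "(\<lambda>k. d ((R \<circ> g) k) l + d ((T \<circ> g) k) l) \<longlonglongrightarrow> d l l + d l l"
    by (intro tendsto_add isCont_tendsto_compose[OF c] lg Tl)
  then have "\<forall>\<^sub>F k in sequentially. d ((R \<circ> g) k) l + d ((T \<circ> g) k) l < e" using e refl by (intro order_tendstoD) auto
  then obtain k where "d (R (g k)) l + d (T (g k)) l < e" using eventually_happens'[OF sequentially_bot] by fastforce
  then show False using RT(4)[of "g k"] tri[of "R (g k)" "T (g k)" l] sym[of "T (g k)" l] by linarith
qed

context frac_flow begin

definition fl :: "real \<Rightarrow> 'a \<Rightarrow> real" where "fl t x = F (v t x)"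

lemma fl_meas [measurable]: "case_prod fl \<in> borel_measurable (borel \<Otimes>\<^sub>M borel)"
  unfolding fl_def by measurable

lemma LF_nonneg: "0 \<le> LF"
  using F_lip[of 0 1] by simp

lemma F_mono: "0 \<le> x \<Longrightarrow> x \<le> y \<Longrightarrow> F x \<le> F y"
  using F_strict[of x y] by (cases "x = y") auto

lemma F_nonneg: "0 \<le> x \<Longrightarrow> 0 \<le> F x"
  using F_mono[of 0 x] F_0 by simp

lemma fl_nonneg [simp]: "0 \<le> fl t x"
  unfolding fl_def by (rule F_nonneg) simp

lemma fl_le: "fl t x \<le> LF * v t x"
  unfolding fl_def using F_lip[of "v t x" 0] by (simp add: F_0 F_nonneg)

lemma fl_int: "integrable lborel (fl t)"
  by (rule Bochner_Integration.integrable_bound[OF integrable_mult_right[OF v_int, of LF t]])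
     (use fl_le LF_nonneg in \<open>auto intro!: AE_I2\<close>)

lemma fl_gag_fin: "0 < a \<Longrightarrow> (\<integral>\<^sup>+t. gag s (fl t) \<partial>tm a b) < \<infinity>"
  using gag_fin unfolding fl_def .

lemma v_diff_int: "integrable lborel (\<lambda>x. \<bar>v r x - v t x\<bar>)"
  by (intro Bochner_Integration.integrable_abs Bochner_Integration.integrable_diff v_int)

definition vd :: "real \<Rightarrow> real \<Rightarrow> real" where "vd r t = (\<integral>x. \<bar>v r x - v t x\<bar> \<partial>lborel)"

lemma vd_tri: "vd a c \<le> vd a b + vd b c"
proof -
  have "vd a c \<le> (\<integral>x. \<bar>v a x - v b x\<bar> + \<bar>v b x - v c x\<bar> \<partial>lborel)"
    unfolding vd_def by (intro Bochner_Integration.integral_mono v_diff_int Bochner_Integration.integrable_add) auto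
  then show ?thesis unfolding vd_def by (simp add: v_diff_int)
qed

lemma vd_sym: "vd a b = vd b a"
  by (simp add: vd_def abs_minus_commute)

lemma vd_unif: "e > 0 \<Longrightarrow> \<exists>\<kappa>>0. \<forall>r\<in>{a..b}. \<forall>t\<in>{a..b}. \<bar>r - t\<bar> \<le> \<kappa> \<longrightarrow> vd r t < e"
  by (rule uniformly_small_pseudo_dist[OF vd_tri vd_sym]) (use v_cont in \<open>auto simp: vd_def\<close>)

lemma fl_diff_le: "(\<integral>\<^sup>+x. ennreal \<bar>fl r x - fl t x\<bar> \<partial>lborel) \<le> ennreal (LF * vd r t)"
proof -
  have "(\<integral>\<^sup>+x. ennreal \<bar>fl r x - fl t x\<bar> \<partial>lborel) \<le> (\<integral>\<^sup>+x. ennreal (LF * \<bar>v r x - v t x\<bar>) \<partial>lborel)"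
    by (intro nn_integral_mono ennreal_leI) (simp add: fl_def F_lip)
  also have "\<dots> = ennreal (LF * vd r t)"
    using v_diff_int[of r t] LF_nonneg by (subst nn_integral_eq_integral) (auto simp: vd_def)
  finally show ?thesis .
qed

text \<open>\<open>F\<close> is Lipschitz, so the shifted potentials converge in L^1 uniformly over
  the time interval while their energies stay bounded; weak convergence of the form follows.\<close>

lemma gform_shift_tendsto:
  assumes a: "0 < a" and ab: "a < b" and [measurable]: "case_prod \<psi> \<in> borel_measurable (borel \<Otimes>\<^sub>M borel)"
    and fin: "(\<integral>\<^sup>+t. gag s (\<psi> t) \<partial>tm a b) < \<infinity>"
  shows "((\<lambda>r. \<integral>t. gform s (fl (t - r)) (\<psi> t) \<partial>tm a b) \<longlongrightarrow> (\<integral>t. gform s (fl t) (\<psi> t) \<partial>tm a b)) (at_right 0)"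
proof -
  \<comment> \<open>Shifts by at most \<open>a / 2\<close> keep all times inside
    \<open>{a/2..b}\<close>, where the energy is integrable.\<close>
  define P where "P = (\<integral>\<^sup>+t. gag s (fl t) \<partial>tm (a/2) b)"
  have P: "P < \<infinity>" unfolding P_def using a by (intro fl_gag_fin) simp
  then obtain P' where P': "P = ennreal P'" "P' \<ge> 0" by (cases P) auto
  have sh: "(\<integral>\<^sup>+t. gag s (fl (t - r)) \<partial>tm a b) \<le> P" if "0 \<le> r" "r \<le> a / 2" for r
  proof -
    have "(\<integral>\<^sup>+t. gag s (fl (t - r)) \<partial>tm a b) = (\<integral>\<^sup>+t. gag s (fl (t - r)) * indicator {a..b} t \<partial>lborel)"
      by (subst nn_integral_tm) simp_all
    also have "\<dots> \<le> (\<integral>\<^sup>+t. gag s (fl (- r + t)) * indicator {a/2..b} (- r + t) \<partial>lborel)"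
      using that by (intro nn_integral_mono) (auto simp: indicator_def)
    also have "\<dots> = (\<integral>\<^sup>+t. gag s (fl t) * indicator {a/2..b} t \<partial>lborel)"
      by (rule nn_integral_lborel_translate) measurable
    also have "\<dots> = P" unfolding P_def by (subst nn_integral_tm) simp_all
    finally show ?thesis .
  qed
  have ev: "\<forall>\<^sub>F r in at_right (0::real). 0 < r \<and> r < a / 2"
    using a by (auto simp: eventually_at_right_less eventually_conj_iff intro: eventually_at_rightI[of 0 "a/2"])
  have P0: "(\<integral>\<^sup>+t. gag s (fl t) \<partial>tm a b) \<le> P" using sh[of 0] a by simp
  have bd: "(\<integral>\<^sup>+t. gag s (\<lambda>x. fl (t - r) x - fl t x) \<partial>tm a b) \<le> ennreal (2 * (P' + P'))" if "0 \<le> r" "r \<le> a / 2" for r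
  proof -
    have "(\<integral>\<^sup>+t. gag s (\<lambda>x. fl (t - r) x - fl t x) \<partial>tm a b) \<le> (\<integral>\<^sup>+t. ennreal (2 * 1\<^sup>2) * (gag s (fl (t - r)) + gag s (fl t)) \<partial>tm a b)"
      by (intro nn_integral_mono gag_bound2) (auto simp: abs_if)
    also have "\<dots> = ennreal (2 * 1\<^sup>2) * ((\<integral>\<^sup>+t. gag s (fl (t - r)) \<partial>tm a b) + (\<integral>\<^sup>+t. gag s (fl t) \<partial>tm a b))"
      by (subst nn_integral_cmult) (simp_all add: nn_integral_add)
    also have "\<dots> \<le> ennreal (2 * 1\<^sup>2) * (P + P)"
      using sh[OF that] P0 by (intro mult_left_mono add_mono) auto
    finally show ?thesis using P' by (simp add: ennreal_mult flip: ennreal_plus)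
  qed
  have "((\<lambda>r. \<integral>t. gform s (\<lambda>x. fl (t - r) x - fl t x) (\<psi> t) \<partial>tm a b) \<longlongrightarrow> 0) (at_right 0)"
  proof (rule tendsto_gform_weak[OF s(1) _ _ _ fin])
    show "\<forall>\<^sub>F r in at_right 0. (\<integral>\<^sup>+t. gag s (\<lambda>x. fl (t - r) x - fl t x) \<partial>tm a b) \<le> ennreal (2 * (P' + P'))"
      using ev by eventually_elim (rule bd, auto)
    show "((\<lambda>r. \<integral>\<^sup>+t. \<integral>\<^sup>+x. ennreal \<bar>fl (t - r) x - fl t x\<bar> \<partial>lborel \<partial>tm a b) \<longlongrightarrow> 0) (at_right 0)"
    proof (rule tendsto_zero_ennreal)
      fix e :: real assume e: "e > 0"
      define e' where "e' = e / (LF * (b - a) + 1)"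
      have den: "LF * (b - a) + 1 > 0" using LF_nonneg ab by (simp add: add_nonneg_pos)
      have e': "e' > 0" using e den by (simp add: e'_def)
      obtain \<kappa> where \<kappa>: "\<kappa> > 0" "\<And>r t. r \<in> {0..b} \<Longrightarrow> t \<in> {0..b} \<Longrightarrow> \<bar>r - t\<bar> \<le> \<kappa> \<Longrightarrow> vd r t < e'"
        using vd_unif[OF e'] by blast
      have "\<forall>\<^sub>F r in at_right (0::real). r < \<kappa>" using \<kappa>(1) by (auto intro: eventually_at_rightI[of 0 \<kappa>])
      with ev show "\<forall>\<^sub>F r in at_right 0. (\<integral>\<^sup>+t. \<integral>\<^sup>+x. ennreal \<bar>fl (t - r) x - fl t x\<bar> \<partial>lborel \<partial>tm a b) < ennreal e"
      proof eventually_elim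
        case (elim r)
        have "(\<integral>\<^sup>+t. \<integral>\<^sup>+x. ennreal \<bar>fl (t - r) x - fl t x\<bar> \<partial>lborel \<partial>tm a b) \<le> (\<integral>\<^sup>+t. ennreal (LF * e') \<partial>tm a b)"
        proof (intro nn_integral_mono_AE, unfold AE_tm_iff, intro AE_I2 impI)
          fix t assume t: "t \<in> {a..b}"
          have "vd (t - r) t < e'" using elim t a by (intro \<kappa>(2)) auto
          then show "(\<integral>\<^sup>+x. ennreal \<bar>fl (t - r) x - fl t x\<bar> \<partial>lborel) \<le> ennreal (LF * e')"
            using LF_nonneg by (intro order_trans[OF fl_diff_le] ennreal_leI mult_left_mono) auto
        qed
        also have "\<dots> = ennreal (LF * e' * (b - a))" using ab LF_nonneg e' by (simp add: ennreal_mult)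
        also have "\<dots> < ennreal e"
        proof (rule ennreal_lessI[OF e])
          have "e' * (LF * (b - a)) < e' * (LF * (b - a) + 1)" using e' by (intro mult_strict_left_mono) auto
          also have "\<dots> = e" using den by (simp add: e'_def)
          finally show "LF * e' * (b - a) < e" by (simp add: mult_ac)
        qed
        finally show ?case .
      qed
    qed
  qed measurable
  moreover have "\<forall>\<^sub>F r in at_right 0. (\<integral>t. gform s (\<lambda>x. fl (t - r) x - fl t x) (\<psi> t) \<partial>tm a b)
      = (\<integral>t. gform s (fl (t - r)) (\<psi> t) \<partial>tm a b) - (\<integral>t. gform s (fl t) (\<psi> t) \<partial>tm a b)"
    using ev
  proof eventually_elim
    case (elim r)
    have "(\<integral>\<^sup>+t. gag s (fl (t - r)) \<partial>tm a b) < \<infinity>" using sh[of r] elim P by (auto intro: le_less_trans)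
    then show ?case using fin fl_gag_fin[OF a] by (intro tm_gform_diff) auto
  qed
  ultimately have "((\<lambda>r. (\<integral>t. gform s (fl (t - r)) (\<psi> t) \<partial>tm a b) - (\<integral>t. gform s (fl t) (\<psi> t) \<partial>tm a b)) \<longlongrightarrow> 0) (at_right 0)"
    by (rule Lim_transform_eventually)
  then show ?thesis by (rule Lim_null[THEN iffD2])
qed

end

section \<open>Entropy inequality\<close>

text \<open>\<open>q x (F v)\<close> is the nonlinear test function. It may depend on the point,
  since comparing two solutions puts the other one, at a frozen time, inside \<open>q\<close>.
  \<open>h\<close> controls this dependence in the energy, while \<open>g\<close> bounds
  \<open>q x 0\<close> and thereby makes the test function integrable.\<close>

locale flow_entropy = frac_flow s C LF F v
  for s C LF :: real and F :: "real \<Rightarrow> real" and v :: "real \<Rightarrow> 'a::euclidean_space \<Rightarrow> real" +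
  fixes q :: "'a \<Rightarrow> real \<Rightarrow> real" and h g :: "'a \<Rightarrow> real" and K L :: real
  assumes q_meas [measurable]: "case_prod q \<in> borel_measurable (borel \<Otimes>\<^sub>M borel)"
    and h_meas [measurable]: "h \<in> borel_measurable borel"
    and q_mono: "\<And>x r r'. r \<le> r' \<Longrightarrow> q x r \<le> q x r'"
    and q_bd: "\<And>x r. \<bar>q x r\<bar> \<le> K"
    and q_lip: "\<And>x y r r'. \<bar>q x r - q y r'\<bar> \<le> L * (\<bar>r - r'\<bar> + \<bar>h x - h y\<bar>)"
    and q_dom: "\<And>x r. 0 \<le> r \<Longrightarrow> \<bar>q x r\<bar> \<le> L * r + g x"
    and g_int: "integrable lborel g" and h_gag: "gag s h < \<infinity>" and L_nonneg: "0 \<le> L"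
begin

text \<open>The entropy density, a primitive in \<open>r\<close> of the test function; it is convex
  on nonnegative \<open>r\<close> because \<open>q x\<close> and \<open>F\<close> are
  nondecreasing.\<close>

definition Jq :: "'a \<Rightarrow> real \<Rightarrow> real" where
  "Jq x r = (\<integral>\<sigma>. (if 0 \<le> \<sigma> \<and> \<sigma> \<le> r then q x (F \<sigma>) else 0) \<partial>lborel)"

definition Psi :: "real \<Rightarrow> 'a \<Rightarrow> real" where "Psi t x = q x (fl t x)"

definition JJ :: "real \<Rightarrow> real" where "JJ t = (\<integral>x. Jq x (v t x) \<partial>lborel)"

lemma K_nonneg: "0 \<le> K"
  using q_bd[of undefined 0] by linarith

lemma Psi_meas [measurable]: "case_prod Psi \<in> borel_measurable (borel \<Otimes>\<^sub>M borel)"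
  unfolding Psi_def by measurable

lemma Psi_meas1 [measurable]: "Psi t \<in> borel_measurable borel"
  unfolding Psi_def by measurable

lemma Jq_meas [measurable]: "case_prod Jq \<in> borel_measurable (borel \<Otimes>\<^sub>M borel)"
  unfolding Jq_def by measurable

lemma Jq_integrand_integrable:
  "integrable lborel (\<lambda>\<sigma>. if r0 \<le> \<sigma> \<and> \<sigma> \<le> r then q x (F \<sigma>) else 0)"
proof (rule Bochner_Integration.integrable_bound)
  show "integrable lborel (\<lambda>\<sigma>. K * indicator {r0..r} \<sigma>)"
    by (intro integrable_mult_right integrable_real_indicator) (auto simp: emeasure_lborel_Icc_eq)
  show "AE \<sigma> in lborel. norm (if r0 \<le> \<sigma> \<and> \<sigma> \<le> r then q x (F \<sigma>) else 0) \<le> norm (K * indicator {r0..r} \<sigma>)"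
    using q_bd K_nonneg by (intro AE_I2) (auto simp: indicator_def)
qed measurable

lemma Jq_diff:
  assumes "0 \<le> r0" "r0 \<le> r"
  shows "(r - r0) * q x (F r0) \<le> Jq x r - Jq x r0" "Jq x r - Jq x r0 \<le> (r - r0) * q x (F r)"
proof -
  have i: "integrable lborel (\<lambda>\<sigma>. c * indicator {r0..r} \<sigma>)" for c :: real
    by (intro integrable_mult_right integrable_real_indicator) (auto simp: emeasure_lborel_Icc_eq)
  have "Jq x r - Jq x r0 = (\<integral>\<sigma>. (if 0 \<le> \<sigma> \<and> \<sigma> \<le> r then q x (F \<sigma>) else 0) - (if 0 \<le> \<sigma> \<and> \<sigma> \<le> r0 then q x (F \<sigma>) else 0) \<partial>lborel)"
    unfolding Jq_def by (rule Bochner_Integration.integral_diff[symmetric]) (rule Jq_integrand_integrable)+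
  also have "\<dots> = (\<integral>\<sigma>. (if r0 \<le> \<sigma> \<and> \<sigma> \<le> r then q x (F \<sigma>) else 0) \<partial>lborel)"
  proof (rule integral_cong_AE)
    have "AE \<sigma> in lborel. \<sigma> \<noteq> r0" by (rule AE_lborel_singleton)
    then show "AE \<sigma> in lborel. (if 0 \<le> \<sigma> \<and> \<sigma> \<le> r then q x (F \<sigma>) else 0) - (if 0 \<le> \<sigma> \<and> \<sigma> \<le> r0 then q x (F \<sigma>) else 0)
        = (if r0 \<le> \<sigma> \<and> \<sigma> \<le> r then q x (F \<sigma>) else 0)"
      by eventually_elim (use assms in auto)
  qed measurable
  finally have eq: "Jq x r - Jq x r0 = (\<integral>\<sigma>. (if r0 \<le> \<sigma> \<and> \<sigma> \<le> r then q x (F \<sigma>) else 0) \<partial>lborel)" .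
  have c: "(\<integral>\<sigma>. c * indicator {r0..r} \<sigma> \<partial>lborel) = (r - r0) * c" for c :: real
    using assms by simp
  show "(r - r0) * q x (F r0) \<le> Jq x r - Jq x r0"
    unfolding eq c[symmetric] using assms
    by (intro Bochner_Integration.integral_mono i Jq_integrand_integrable) (auto simp: indicator_def intro!: q_mono F_mono)
  show "Jq x r - Jq x r0 \<le> (r - r0) * q x (F r)"
    unfolding eq c[symmetric] using assms
    by (intro Bochner_Integration.integral_mono i Jq_integrand_integrable) (auto simp: indicator_def intro!: q_mono F_mono)
qed

text \<open>This one-sided convexity inequality takes the place of the chain rule in time. The slope
  is taken at \<open>r\<close>, which in \<open>entropy_step\<close> is the value at the later
  time.\<close>

lemma Jq_subgradient:
  assumes "0 \<le> r0" "0 \<le> r"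
  shows "Jq x r - Jq x r0 \<le> q x (F r) * (r - r0)"
  using Jq_diff[of r0 r x] Jq_diff[of r r0 x] assms by (cases "r0 \<le> r") (auto simp: algebra_simps)

lemma Jq_lip:
  assumes "0 \<le> r0" "0 \<le> r"
  shows "\<bar>Jq x r - Jq x r0\<bar> \<le> K * \<bar>r - r0\<bar>"
proof -
  have *: "\<bar>Jq x b - Jq x a\<bar> \<le> K * (b - a)" if "0 \<le> a" "a \<le> b" for a b
  proof -
    have "(b - a) * q x (F b) \<le> (b - a) * K" "(b - a) * (- K) \<le> (b - a) * q x (F a)"
      using q_bd[of x "F b"] q_bd[of x "F a"] that by (intro mult_left_mono; linarith)+
    then show ?thesis using Jq_diff[OF that, of x] by (simp add: abs_le_iff mult.commute)
  qed
  show ?thesis using *[of r0 r] *[of r r0] assms by (cases "r0 \<le> r") (auto simp: abs_minus_commute)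
qed

lemma Jq_0: "Jq x 0 = 0"
proof -
  have "Jq x 0 = (\<integral>\<sigma>. 0 \<partial>(lborel :: real measure))"
    unfolding Jq_def
  proof (rule integral_cong_AE)
    show "AE \<sigma> in lborel. (if 0 \<le> \<sigma> \<and> \<sigma> \<le> 0 then q x (F \<sigma>) else 0) = 0"
      using AE_lborel_singleton[of "0::real"] by eventually_elim auto
  qed measurable
  then show ?thesis by simp
qed

lemma Jq_abs_le: "0 \<le> r \<Longrightarrow> \<bar>Jq x r\<bar> \<le> K * r"
  using Jq_lip[of 0 r x] by (simp add: Jq_0)

lemma Jq_int: "integrable lborel (\<lambda>x. Jq x (v t x))"
  by (rule Bochner_Integration.integrable_bound[OF integrable_mult_right[OF v_int, of K t]])
     (use Jq_abs_le K_nonneg in \<open>auto intro!: AE_I2\<close>)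

lemma JJ_lip: "\<bar>JJ t - JJ r\<bar> \<le> K * vd t r"
proof -
  have "JJ t - JJ r = (\<integral>x. Jq x (v t x) - Jq x (v r x) \<partial>lborel)" unfolding JJ_def using Jq_int by simp
  also have "\<bar>\<dots>\<bar> \<le> (\<integral>x. K * \<bar>v t x - v r x\<bar> \<partial>lborel)"
    using v_diff_int K_nonneg
    by (intro order_trans[OF integral_abs_bound integral_mono']) (auto intro: Jq_lip)
  finally show ?thesis by (simp add: vd_def)
qed

lemma JJ_isCont: "isCont JJ t"
proof -
  have "((\<lambda>r. K * vd r t) \<longlongrightarrow> K * 0) (at t)" unfolding vd_def by (intro tendsto_intros v_cont)
  then have "((\<lambda>r. JJ r - JJ t) \<longlongrightarrow> 0) (at t)"
  proof (intro tendsto_rabs_zero_cancel[where f = "\<lambda>r. JJ r - JJ t"])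
    assume lim: "((\<lambda>r. K * vd r t) \<longlongrightarrow> K * 0) (at t)"
    show "((\<lambda>r. \<bar>JJ r - JJ t\<bar>) \<longlongrightarrow> 0) (at t)"
      by (rule tendsto_sandwich[OF _ _ tendsto_const]) (use lim in \<open>auto simp: JJ_lip\<close>)
  qed
  then show ?thesis unfolding isCont_def by (rule Lim_null[THEN iffD2])
qed

lemma Psi_gag_le: "gag s (Psi t) \<le> ennreal (2 * L\<^sup>2) * (gag s (fl t) + gag s h)"
  by (rule gag_bound2[OF _ _ L_nonneg]) (auto simp: Psi_def q_lip)

lemma Psi_int: "integrable lborel (Psi t)"
proof (rule Bochner_Integration.integrable_bound)
  show "integrable lborel (\<lambda>x. L * fl t x + g x)" using fl_int g_int by auto
  show "AE x in lborel. norm (Psi t x) \<le> norm (L * fl t x + g x)"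
  proof (rule AE_I2)
    fix x
    show "norm (Psi t x) \<le> norm (L * fl t x + g x)"
      using q_dom[OF fl_nonneg, of x t x] by (simp add: Psi_def)
  qed
qed measurable

lemma Psi_gag_fin:
  assumes "0 < a" "a \<le> b" shows "(\<integral>\<^sup>+t. gag s (Psi t) \<partial>tm a b) < \<infinity>"
proof -
  have "(\<integral>\<^sup>+t. gag s (Psi t) \<partial>tm a b) \<le> (\<integral>\<^sup>+t. ennreal (2 * L\<^sup>2) * (gag s (fl t) + gag s h) \<partial>tm a b)"
    by (intro nn_integral_mono Psi_gag_le)
  also have "\<dots> = ennreal (2 * L\<^sup>2) * ((\<integral>\<^sup>+t. gag s (fl t) \<partial>tm a b) + gag s h * ennreal (b - a))"
    using assms by (simp add: nn_integral_cmult nn_integral_add)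
  also have "\<dots> < \<infinity>" using fl_gag_fin[OF assms(1), of b] h_gag by (auto simp: ennreal_mult_less_top)
  finally show ?thesis .
qed

text \<open>The test function is frozen at the final time \<open>t\<close>; it is admissible for the
  equation on \<open>{t - \<delta>..t}\<close> as soon as its energy at that single time is finite.
  The subgradient at the later value makes the inequality point the right way.\<close>

lemma entropy_step:
  assumes gt: "gag s (Psi t) < \<infinity>" and d: "0 < \<delta>" "\<delta> < t"
  shows "JJ t - JJ (t - \<delta>) \<le> - C * (\<integral>r. gform s (fl (t - r)) (Psi t) \<partial>tm 0 \<delta>)"
proof -
  have i: "integrable lborel (\<lambda>x. (v t x - v (t - \<delta>) x) * Psi t x)"
    by (rule Bochner_Integration.integrable_bound[OF integrable_mult_right[OF v_diff_int, of K t "t - \<delta>"]])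
       (use q_bd K_nonneg in \<open>auto intro!: AE_I2 mult_left_mono simp: Psi_def abs_mult mult.commute[of K]\<close>)
  have "JJ t - JJ (t - \<delta>) = (\<integral>x. Jq x (v t x) - Jq x (v (t - \<delta>) x) \<partial>lborel)" unfolding JJ_def using Jq_int by simp
  also have "\<dots> \<le> (\<integral>x. (v t x - v (t - \<delta>) x) * Psi t x \<partial>lborel)"
  proof (intro Bochner_Integration.integral_mono i Bochner_Integration.integrable_diff Jq_int)
    fix x
    show "Jq x (v t x) - Jq x (v (t - \<delta>) x) \<le> (v t x - v (t - \<delta>) x) * Psi t x"
      using Jq_subgradient[of "v (t - \<delta>) x" "v t x" x] by (simp add: Psi_def fl_def mult.commute)
  qed
  also have "\<dots> = - C * (\<integral>r. gform s (fl r) (Psi t) \<partial>tm (t - \<delta>) t)"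
  proof -
    have "fl = (\<lambda>t x. F (v t x))" by (simp add: fl_def fun_eq_iff)
    moreover have "\<bar>Psi t x\<bar> \<le> K" for x by (simp add: Psi_def q_bd)
    ultimately show ?thesis using weak[OF _ _ Psi_meas1 _ Psi_int gt, of "t - \<delta>" t K] d by simp
  qed
  \<comment> \<open>Reflecting time makes the domain independent of \<open>t\<close>, so that the
    integral over \<open>t\<close> can be exchanged with the one over the lag
    \<open>r\<close>.\<close>
  also have "(\<integral>r. gform s (fl r) (Psi t) \<partial>tm (t - \<delta>) t) = (\<integral>r. gform s (fl (t - r)) (Psi t) \<partial>tm 0 \<delta>)"
  proof -
    have "(\<integral>r. gform s (fl r) (Psi t) \<partial>tm (t - \<delta>) t) = (\<integral>r. indicator {t - \<delta>..t} r * gform s (fl r) (Psi t) \<partial>lborel)"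
      by (rule integral_tm) measurable
    also have "\<dots> = (\<integral>r. indicator {t - \<delta>..t} (t + - 1 * r) * gform s (fl (t + -1 * r)) (Psi t) \<partial>lborel)"
      by (subst lborel_integral_real_affine[where c = "-1" and t = t]) auto
    also have "\<dots> = (\<integral>r. indicator {0..\<delta>} r * gform s (fl (t - r)) (Psi t) \<partial>lborel)"
      by (intro Bochner_Integration.integral_cong refl) (auto simp: indicator_def)
    also have "\<dots> = (\<integral>r. gform s (fl (t - r)) (Psi t) \<partial>tm 0 \<delta>)"
      by (rule integral_tm[symmetric]) measurable
    finally show ?thesis .
  qed
  finally show ?thesis .
qed

text \<open>The lag stays below \<open>a / 2\<close>, so all times lie in \<open>{a/2..b}\<close>;
  there the energies of both factors are integrable in time, and their sum dominates the
  form.\<close>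

lemma gform_shift_Fubini:
  assumes a: "0 < a" "a < b" and d: "0 < \<delta>" "\<delta> \<le> a / 2"
  shows "integrable (tm a b) (\<lambda>t. \<integral>r. gform s (fl (t - r)) (Psi t) \<partial>tm 0 \<delta>)"
    "(\<integral>t. (\<integral>r. gform s (fl (t - r)) (Psi t) \<partial>tm 0 \<delta>) \<partial>tm a b) = (\<integral>r. (\<integral>t. gform s (fl (t - r)) (Psi t) \<partial>tm a b) \<partial>tm 0 \<delta>)"
    "integrable (tm 0 \<delta>) (\<lambda>r. \<integral>t. gform s (fl (t - r)) (Psi t) \<partial>tm a b)"
proof -
  interpret T: sigma_finite_measure "tm a b" by (rule sigma_finite_tm)
  interpret R: sigma_finite_measure "tm 0 \<delta>" by (rule sigma_finite_tm)
  interpret P: pair_sigma_finite "tm a b" "tm 0 \<delta>" by unfold_locales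
  have sh: "(\<integral>\<^sup>+t. gag s (fl (t - r)) \<partial>tm a b) \<le> (\<integral>\<^sup>+t. gag s (fl t) \<partial>tm (a/2) b)" if "0 \<le> r" "r \<le> a / 2" for r
  proof -
    have "(\<integral>\<^sup>+t. gag s (fl (t - r)) \<partial>tm a b) = (\<integral>\<^sup>+t. gag s (fl (t - r)) * indicator {a..b} t \<partial>lborel)"
      by (subst nn_integral_tm) simp_all
    also have "\<dots> \<le> (\<integral>\<^sup>+t. gag s (fl (- r + t)) * indicator {a/2..b} (- r + t) \<partial>lborel)"
      using that by (intro nn_integral_mono) (auto simp: indicator_def)
    also have "\<dots> = (\<integral>\<^sup>+t. gag s (fl t) * indicator {a/2..b} t \<partial>lborel)"
      by (rule nn_integral_lborel_translate) measurable
    also have "\<dots> = (\<integral>\<^sup>+t. gag s (fl t) \<partial>tm (a/2) b)" by (subst nn_integral_tm) simp_all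
    finally show ?thesis .
  qed
  have [measurable]: "(\<lambda>p. gform s (fl (fst p - snd p)) (Psi (fst p))) \<in> borel_measurable (borel \<Otimes>\<^sub>M borel)"
    by (rule gform_measurable) measurable
  have [measurable]: "(\<lambda>p. gag s (fl (fst p - snd p))) \<in> borel_measurable (borel \<Otimes>\<^sub>M borel)"
    by (rule gag_measurable) measurable
  have [measurable]: "(\<lambda>t. gag s (Psi t)) \<in> borel_measurable borel"
    by (rule gag_measurable) measurable
  have "(\<integral>\<^sup>+p. ennreal \<bar>gform s (fl (fst p - snd p)) (Psi (fst p))\<bar> \<partial>(tm a b \<Otimes>\<^sub>M tm 0 \<delta>))
     \<le> (\<integral>\<^sup>+p. gag s (fl (fst p - snd p)) + gag s (Psi (fst p)) \<partial>(tm a b \<Otimes>\<^sub>M tm 0 \<delta>))"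
    by (intro nn_integral_mono ennreal_abs_gform_le) measurable
  also have "\<dots> = (\<integral>\<^sup>+p. gag s (fl (fst p - snd p)) \<partial>(tm a b \<Otimes>\<^sub>M tm 0 \<delta>)) + (\<integral>\<^sup>+p. gag s (Psi (fst p)) \<partial>(tm a b \<Otimes>\<^sub>M tm 0 \<delta>))"
    by (rule nn_integral_add) measurable
  also have "(\<integral>\<^sup>+p. gag s (fl (fst p - snd p)) \<partial>(tm a b \<Otimes>\<^sub>M tm 0 \<delta>)) = (\<integral>\<^sup>+r. \<integral>\<^sup>+t. gag s (fl (t - r)) \<partial>tm a b \<partial>tm 0 \<delta>)"
    by (subst P.nn_integral_snd[symmetric]) (simp_all add: case_prod_unfold)
  also have "(\<integral>\<^sup>+p. gag s (Psi (fst p)) \<partial>(tm a b \<Otimes>\<^sub>M tm 0 \<delta>)) = (\<integral>\<^sup>+t. gag s (Psi t) \<partial>tm a b) * ennreal \<delta>"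
    using d by (subst R.nn_integral_fst[symmetric]) (simp_all add: nn_integral_multc)
  also have "(\<integral>\<^sup>+r. \<integral>\<^sup>+t. gag s (fl (t - r)) \<partial>tm a b \<partial>tm 0 \<delta>) \<le> (\<integral>\<^sup>+r. (\<integral>\<^sup>+t. gag s (fl t) \<partial>tm (a/2) b) \<partial>tm 0 \<delta>)"
    by (intro nn_integral_mono_AE, unfold AE_tm_iff, intro AE_I2 impI sh) (use d in auto)
  also have "(\<integral>\<^sup>+r. (\<integral>\<^sup>+t. gag s (fl t) \<partial>tm (a/2) b) \<partial>tm 0 \<delta>) + (\<integral>\<^sup>+t. gag s (Psi t) \<partial>tm a b) * ennreal \<delta> < \<infinity>"
    using d a fl_gag_fin[of "a/2" b] Psi_gag_fin[of a b] by (auto simp: ennreal_mult_less_top)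
  finally have I: "integrable (tm a b \<Otimes>\<^sub>M tm 0 \<delta>) (\<lambda>(t, r). gform s (fl (t - r)) (Psi t))"
    by (intro integrableI_bounded) (auto simp: case_prod_unfold add_right_mono)
  show "integrable (tm a b) (\<lambda>t. \<integral>r. gform s (fl (t - r)) (Psi t) \<partial>tm 0 \<delta>)" using P.integrable_fst[OF I] .
  show "(\<integral>t. (\<integral>r. gform s (fl (t - r)) (Psi t) \<partial>tm 0 \<delta>) \<partial>tm a b) = (\<integral>r. (\<integral>t. gform s (fl (t - r)) (Psi t) \<partial>tm a b) \<partial>tm 0 \<delta>)"
    using P.Fubini_integral[OF I] by simp
  show "integrable (tm 0 \<delta>) (\<lambda>r. \<integral>t. gform s (fl (t - r)) (Psi t) \<partial>tm a b)" using P.integrable_snd[OF I] .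
qed

text \<open>A limit from the right is enough, since the single time 0 is a null set for the
  average.\<close>

lemma tendsto_average:
  fixes e :: "real \<Rightarrow> real"
  assumes lim: "(e \<longlongrightarrow> l) (at_right 0)" and int: "\<forall>\<^sub>F \<delta> in at_right 0. integrable (tm 0 \<delta>) e"
  shows "((\<lambda>\<delta>. (\<integral>r. e r \<partial>tm 0 \<delta>) / \<delta>) \<longlongrightarrow> l) (at_right 0)"
proof (rule tendstoI)
  fix \<eta> :: real assume \<eta>: "\<eta> > 0"
  have "\<forall>\<^sub>F r in at_right 0. dist (e r) l < \<eta> / 2" using lim \<eta> by (intro tendstoD) auto
  then obtain b where b: "b > 0" "\<And>r. 0 < r \<Longrightarrow> r < b \<Longrightarrow> dist (e r) l < \<eta> / 2"
    unfolding eventually_at_right_field by (auto simp: eventually_at_right[of 0 1])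
  have "\<forall>\<^sub>F \<delta> in at_right (0::real). \<delta> \<in> {0<..<b}" using b(1) by (rule eventually_at_right_real)
  with int show "\<forall>\<^sub>F \<delta> in at_right 0. dist ((\<integral>r. e r \<partial>tm 0 \<delta>) / \<delta>) l < \<eta>"
  proof eventually_elim
    case (elim \<delta>)
    interpret finite_measure "tm 0 \<delta>" by (rule finite_tm)
    have d: "\<delta> > 0" "\<delta> < b" using elim by auto
    have m: "measure (tm 0 \<delta>) UNIV = \<delta>" using d by (simp add: measure_def)
    have "\<bar>(\<integral>r. e r \<partial>tm 0 \<delta>) - \<delta> * l\<bar> = \<bar>\<integral>r. e r - l \<partial>tm 0 \<delta>\<bar>"
      using elim m by (simp add: Bochner_Integration.integral_diff)
    also have "\<dots> \<le> (\<integral>r. \<bar>e r - l\<bar> \<partial>tm 0 \<delta>)" by (rule integral_abs_bound)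
    also have "\<dots> \<le> (\<integral>r. \<eta> / 2 \<partial>tm 0 \<delta>)"
    proof (rule integral_mono_AE)
      have "AE r in lborel. r \<noteq> (0::real)" by (rule AE_lborel_singleton)
      then show "AE r in tm 0 \<delta>. \<bar>e r - l\<bar> \<le> \<eta> / 2"
        unfolding AE_tm_iff by eventually_elim (use d b(2) in \<open>auto simp: dist_real_def less_imp_le\<close>)
    qed (use elim in auto)
    also have "\<dots> = \<delta> * (\<eta> / 2)" using m by simp
    finally have "\<bar>(\<integral>r. e r \<partial>tm 0 \<delta>) - \<delta> * l\<bar> \<le> \<delta> * (\<eta> / 2)" .
    then have "\<bar>(\<integral>r. e r \<partial>tm 0 \<delta>) / \<delta> - l\<bar> \<le> \<eta> / 2"
      using d by (simp add: abs_le_iff field_simps)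
    then show ?case using \<eta> by (simp add: dist_real_def)
  qed
qed

lemma JJ_tm_integrable: "integrable (tm a b) JJ" "integrable (tm a b) (\<lambda>t. JJ (t - \<delta>))"
proof -
  have c: "continuous_on UNIV JJ" by (intro continuous_at_imp_continuous_on ballI JJ_isCont)
  then have [measurable]: "JJ \<in> borel_measurable borel" by (rule borel_measurable_continuous_onI)
  have "set_integrable lborel {a..b} JJ"
    by (intro borel_integrable_atLeastAtMost') (rule continuous_on_subset[OF c], simp)
  then show "integrable (tm a b) JJ" by (subst integrable_tm) (auto simp: set_integrable_def)
  have "set_integrable lborel {a..b} (\<lambda>t. JJ (t - \<delta>))"
    by (intro borel_integrable_atLeastAtMost' continuous_on_compose2[OF c] continuous_intros) auto
  then show "integrable (tm a b) (\<lambda>t. JJ (t - \<delta>))" by (subst integrable_tm) (auto simp: set_integrable_def)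
qed

text \<open>The integral telescopes: what survives are the averages over the stretches of length
  \<open>\<delta>\<close> just before \<open>b\<close> and just before \<open>a\<close>.\<close>

lemma JJ_quotient:
  assumes ab: "a < b"
  shows "((\<lambda>\<delta>. (\<integral>t. JJ t - JJ (t - \<delta>) \<partial>tm a b) / \<delta>) \<longlongrightarrow> JJ b - JJ a) (at_right 0)"
proof -
  have c: "continuous_on UNIV JJ" by (intro continuous_at_imp_continuous_on ballI JJ_isCont)
  have [measurable]: "JJ \<in> borel_measurable borel" by (rule borel_measurable_continuous_onI[OF c])
  have i: "integrable (tm x y) JJ" for x y by (rule JJ_tm_integrable)
  have refl': "integrable lborel (\<lambda>t. indicator {x..y} t * JJ t)" for x y using i[of x y] by (simp add: integrable_tm)
  have shift: "(\<integral>t. JJ (t - \<delta>) \<partial>tm x y) = (\<integral>t. JJ t \<partial>tm (x - \<delta>) (y - \<delta>))" for x y \<delta>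
  proof -
    have "(\<integral>t. JJ (t - \<delta>) \<partial>tm x y) = (\<integral>t. indicator {x..y} t * JJ (t - \<delta>) \<partial>lborel)"
      by (rule integral_tm) measurable
    also have "\<dots> = (\<integral>t. indicator {x..y} (\<delta> + 1 * t) * JJ ((\<delta> + 1 * t) - \<delta>) \<partial>lborel)"
      by (subst lborel_integral_real_affine[where c = 1 and t = \<delta>]) auto
    also have "\<dots> = (\<integral>t. indicator {x - \<delta>..y - \<delta>} t * JJ t \<partial>lborel)"
      by (intro Bochner_Integration.integral_cong refl) (auto simp: indicator_def)
    finally show ?thesis by (simp add: integral_tm)
  qed
  have split: "(\<integral>t. JJ t \<partial>tm x z) = (\<integral>t. JJ t \<partial>tm x y) + (\<integral>t. JJ t \<partial>tm y z)" if "x \<le> y" "y \<le> z" for x y z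
  proof -
    have "(\<integral>t. JJ t \<partial>tm x z) = (\<integral>t. indicator {x..y} t * JJ t + indicator {y..z} t * JJ t \<partial>lborel)"
      unfolding integral_tm[OF \<open>JJ \<in> borel_measurable borel\<close>]
    proof (rule integral_cong_AE)
      show "AE t in lborel. indicator {x..z} t * JJ t = indicator {x..y} t * JJ t + indicator {y..z} t * JJ t"
        using AE_lborel_singleton[of y] by eventually_elim (use that in \<open>auto simp: indicator_def\<close>)
    qed measurable
    then show ?thesis using refl' by (simp add: integral_tm)
  qed
  have avg: "((\<lambda>\<delta>. (\<integral>t. JJ t \<partial>tm (y - \<delta>) y) / \<delta>) \<longlongrightarrow> JJ y) (at_right 0)" for y
  proof -
    have eq: "(\<integral>t. JJ t \<partial>tm (y - \<delta>) y) = (\<integral>r. JJ (y - r) \<partial>tm 0 \<delta>)" for \<delta>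
    proof -
      have "(\<integral>t. JJ t \<partial>tm (y - \<delta>) y) = (\<integral>r. indicator {y - \<delta>..y} (y + -1 * r) * JJ (y + -1 * r) \<partial>lborel)"
        by (subst integral_tm, simp, subst lborel_integral_real_affine[where c = "-1" and t = y]) auto
      also have "\<dots> = (\<integral>r. indicator {0..\<delta>} r * JJ (y - r) \<partial>lborel)"
        by (intro Bochner_Integration.integral_cong refl) (auto simp: indicator_def)
      also have "\<dots> = (\<integral>r. JJ (y - r) \<partial>tm 0 \<delta>)" by (rule integral_tm[symmetric]) measurable
      finally show ?thesis .
    qed
    have cy: "continuous_on UNIV (\<lambda>r. JJ (y - r))"
      by (intro continuous_on_compose2[OF c] continuous_intros) auto
    show ?thesis unfolding eq
    proof (rule tendsto_average)
      have "isCont (\<lambda>r. JJ (y - r)) 0" using cy continuous_on_eq_continuous_at[OF open_UNIV] by blast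
      then have "((\<lambda>r. JJ (y - r)) \<longlongrightarrow> JJ y) (at 0)" by (simp add: isCont_def)
      then show "((\<lambda>r. JJ (y - r)) \<longlongrightarrow> JJ y) (at_right 0)" by (rule tendsto_mono[OF at_le, rotated]) auto
      have "set_integrable lborel {0..\<delta>} (\<lambda>r. JJ (y - r))" for \<delta>
        by (intro borel_integrable_atLeastAtMost' continuous_on_subset[OF cy]) auto
      then show "\<forall>\<^sub>F \<delta> in at_right 0. integrable (tm 0 \<delta>) (\<lambda>r. JJ (y - r))"
        by (intro always_eventually allI) (subst integrable_tm, auto simp: set_integrable_def)
    qed
  qed
  have "((\<lambda>\<delta>. (\<integral>t. JJ t \<partial>tm (b - \<delta>) b) / \<delta> - (\<integral>t. JJ t \<partial>tm (a - \<delta>) a) / \<delta>) \<longlongrightarrow> JJ b - JJ a) (at_right 0)"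
    by (intro tendsto_diff avg)
  moreover have "\<forall>\<^sub>F \<delta> in at_right 0. (\<integral>t. JJ t \<partial>tm (b - \<delta>) b) / \<delta> - (\<integral>t. JJ t \<partial>tm (a - \<delta>) a) / \<delta> = (\<integral>t. JJ t - JJ (t - \<delta>) \<partial>tm a b) / \<delta>"
  proof (rule eventually_mono)
    show "\<forall>\<^sub>F \<delta> in at_right 0. \<delta> \<in> {0<..<b - a}" using ab by (intro eventually_at_right_real) simp
    fix \<delta> assume "\<delta> \<in> {0<..<b - a}"
    then have d: "0 < \<delta>" "\<delta> < b - a" by auto
    have "(\<integral>t. JJ t - JJ (t - \<delta>) \<partial>tm a b) = (\<integral>t. JJ t \<partial>tm a b) - (\<integral>t. JJ t \<partial>tm (a - \<delta>) (b - \<delta>))"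
      using JJ_tm_integrable by (simp add: shift)
    moreover have "(\<integral>t. JJ t \<partial>tm a b) = (\<integral>t. JJ t \<partial>tm a (b - \<delta>)) + (\<integral>t. JJ t \<partial>tm (b - \<delta>) b)"
      using d by (intro split) auto
    moreover have "(\<integral>t. JJ t \<partial>tm (a - \<delta>) (b - \<delta>)) = (\<integral>t. JJ t \<partial>tm (a - \<delta>) a) + (\<integral>t. JJ t \<partial>tm a (b - \<delta>))"
      using d by (intro split) auto
    ultimately have "(\<integral>t. JJ t - JJ (t - \<delta>) \<partial>tm a b) = (\<integral>t. JJ t \<partial>tm (b - \<delta>) b) - (\<integral>t. JJ t \<partial>tm (a - \<delta>) a)" by linarith
    then show "(\<integral>t. JJ t \<partial>tm (b - \<delta>) b) / \<delta> - (\<integral>t. JJ t \<partial>tm (a - \<delta>) a) / \<delta> = (\<integral>t. JJ t - JJ (t - \<delta>) \<partial>tm a b) / \<delta>"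
      by (simp add: diff_divide_distrib)
  qed
  ultimately show ?thesis by (rule Lim_transform_eventually)
qed

text \<open>\<open>entropy_step\<close> requires finite energy at \<open>t\<close>, hence is
  available for almost every \<open>t\<close>; it is integrated over \<open>{a..b}\<close> and
  divided by \<open>\<delta>\<close> before \<delta> tends to 0. The left side telescopes, and on
  the right the lag disappears by \<open>gform_shift_tendsto\<close>.\<close>

lemma entropy:
  assumes a: "0 < a" "a < b"
  shows "JJ b - JJ a \<le> - C * (\<integral>t. gform s (fl t) (Psi t) \<partial>tm a b)"
proof (rule tendsto_le[OF _ _ JJ_quotient[OF a(2)]])
  show "((\<lambda>\<delta>. - C * ((\<integral>r. (\<integral>t. gform s (fl (t - r)) (Psi t) \<partial>tm a b) \<partial>tm 0 \<delta>) / \<delta>)) \<longlongrightarrow> - C * (\<integral>t. gform s (fl t) (Psi t) \<partial>tm a b)) (at_right 0)"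
  proof (intro tendsto_mult_left tendsto_average gform_shift_tendsto a Psi_meas Psi_gag_fin less_imp_le)
    have "\<forall>\<^sub>F \<delta> in at_right (0::real). \<delta> \<in> {0<..<a/2}" using a by (intro eventually_at_right_real) simp
    then show "\<forall>\<^sub>F \<delta> in at_right 0. integrable (tm 0 \<delta>) (\<lambda>r. \<integral>t. gform s (fl (t - r)) (Psi t) \<partial>tm a b)"
      by eventually_elim (use a in \<open>intro gform_shift_Fubini(3), auto\<close>)
  qed
  have "\<forall>\<^sub>F \<delta> in at_right (0::real). \<delta> \<in> {0<..<a/2}" using a by (intro eventually_at_right_real) simp
  then show "\<forall>\<^sub>F \<delta> in at_right 0. (\<integral>t. JJ t - JJ (t - \<delta>) \<partial>tm a b) / \<delta> \<le> - C * ((\<integral>r. (\<integral>t. gform s (fl (t - r)) (Psi t) \<partial>tm a b) \<partial>tm 0 \<delta>) / \<delta>)"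
  proof eventually_elim
    case (elim \<delta>)
    then have d: "0 < \<delta>" "\<delta> \<le> a / 2" by auto
    have "AE t in tm a b. gag s (Psi t) \<noteq> \<infinity>"
      using Psi_gag_fin[of a b] a by (intro nn_integral_PInf_AE) auto
    then have ae: "AE t in lborel. t \<in> {a..b} \<longrightarrow> gag s (Psi t) < \<infinity>"
      unfolding AE_tm_iff by eventually_elim (auto simp: less_top)
    have "(\<integral>t. JJ t - JJ (t - \<delta>) \<partial>tm a b) \<le> (\<integral>t. - C * (\<integral>r. gform s (fl (t - r)) (Psi t) \<partial>tm 0 \<delta>) \<partial>tm a b)"
    proof (rule integral_mono_AE)
      show "AE t in tm a b. JJ t - JJ (t - \<delta>) \<le> - C * (\<integral>r. gform s (fl (t - r)) (Psi t) \<partial>tm 0 \<delta>)"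
        unfolding AE_tm_iff using ae by eventually_elim (use d a in \<open>auto intro!: entropy_step[simplified]\<close>)
    qed (use JJ_tm_integrable gform_shift_Fubini(1)[OF a d] in auto)
    also have "\<dots> = - C * (\<integral>r. (\<integral>t. gform s (fl (t - r)) (Psi t) \<partial>tm a b) \<partial>tm 0 \<delta>)"
      using gform_shift_Fubini(2)[OF a d] by simp
    finally show ?case using d by (simp add: field_simps)
  qed
qed simp

end

section \<open>Decay of the excess mass and measure of superlevel sets\<close>

context frac_flow begin

definition pp :: "real \<Rightarrow> real \<Rightarrow> real" where
  "pp k t = (\<integral>x. max 0 (v t x - k) \<partial>lborel)"

lemma pp_int: "0 \<le> k \<Longrightarrow> integrable lborel (\<lambda>x. max 0 (v t x - k))"
  by (rule Bochner_Integration.integrable_bound[OF v_int[of t]]) (auto intro!: AE_I2)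

lemma pp_nonneg [simp]: "0 \<le> pp k t"
  by (simp add: pp_def)

lemma pp_zero_AE:
  assumes "0 \<le> k" "pp k t = 0" shows "AE x in lborel. v t x \<le> k"
proof -
  have "AE x in lborel. max 0 (v t x - k) = 0"
    using assms(2) pp_int[OF assms(1), of t] unfolding pp_def by (subst (asm) integral_nonneg_eq_0_iff_AE) auto
  then show ?thesis by eventually_elim (simp add: max_def split: if_splits)
qed

lemma pp_level_mono: "0 \<le> k \<Longrightarrow> k \<le> l \<Longrightarrow> pp l t \<le> pp k t"
  unfolding pp_def by (intro Bochner_Integration.integral_mono pp_int) auto

text \<open>The test function is the part of the potential between \<open>F k\<close> and
  \<open>F l\<close>. It does not depend on the point and vanishes at \<open>r = 0\<close>, so
  \<open>h\<close> and \<open>g\<close> can be taken to be 0.\<close>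

lemma superlevel_clip:
  assumes "0 \<le> k" "k < l"
  shows "flow_entropy s C LF F v (\<lambda>_ r. max 0 (min (r - F k) (F l - F k))) (\<lambda>_. 0) (\<lambda>_. 0) (F l - F k) 1"
proof (unfold_locales)
  show "\<bar>max 0 (min (r - F k) (F l - F k)) - max 0 (min (r' - F k) (F l - F k))\<bar> \<le> 1 * (\<bar>r - r'\<bar> + \<bar>0 - 0\<bar>)" for r r' :: real
    by (auto simp: max_def min_def abs_if)
  show "\<bar>max 0 (min (r - F k) (F l - F k))\<bar> \<le> 1 * r + 0" if "0 \<le> r" for r
    using F_nonneg[OF assms(1)] that by (auto simp: max_def min_def)
  show "\<bar>max 0 (min (r - F k) (F l - F k))\<bar> \<le> F l - F k" for r
    using F_strict[OF assms] by (auto simp: max_def min_def)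
  show "r \<le> r' \<Longrightarrow> max 0 (min (r - F k) (F l - F k)) \<le> max 0 (min (r' - F k) (F l - F k))" for r r'
    by (auto simp: max_def min_def)
  show "gag s (\<lambda>_::'a. 0) < \<infinity>" by (simp add: gag_def dif_def)
qed auto

text \<open>The entropy density of this truncation lies between \<open>\<Lambda>\<close> times the
  positive part of \<open>r - l\<close> and \<open>\<Lambda>\<close> times that of
  \<open>r - k\<close>, so a nonincreasing entropy bounds the excess over \<open>l\<close> at
  \<open>b\<close> by the excess over \<open>k\<close> at \<open>a\<close>. For
  \<open>level_time\<close>: were {v > l} large throughout \<open>{a'..b}\<close>, the Sobolev
  inequality would make the dissipation exceed the entropy available at \<open>a\<close>. That
  inequality enters as a hypothesis with constant \<open>c\<close> and exponent
  \<open>\<theta>\<close>.\<close>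

lemma level_estimates:
  assumes k: "0 \<le> k" "k < l" and ab: "0 \<le> a" "a < b"
  shows pp_mono: "pp l b \<le> pp k a"
    and level_time: "\<And>c a' \<theta> B. \<lbrakk>c > 0; a \<le> a'; 0 < a'; a' < b;
      \<And>(g :: 'a \<Rightarrow> real) l K. integrable lborel g \<Longrightarrow> (\<And>x. 0 \<le> g x) \<Longrightarrow> (\<And>x. g x \<le> K) \<Longrightarrow> gag s g < \<infinity> \<Longrightarrow> l > 0 \<Longrightarrow>
       c * (l\<^sup>2 * superlevel g l powr \<theta>) \<le> enn2real (gag s g); \<theta> > 0;
      4 * pp k a < C * c * (F l - F k) * (b - a') * B\<rbrakk> \<Longrightarrow> \<exists>\<tau>\<in>{a'..b}. superlevel (v \<tau>) l powr \<theta> < B"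
proof -
  define \<Lambda> where "\<Lambda> = F l - F k"
  have \<Lambda>: "\<Lambda> > 0" using F_strict[OF k] by (simp add: \<Lambda>_def)
  interpret E: flow_entropy s C LF F v "\<lambda>_ r. max 0 (min (r - F k) \<Lambda>)" "\<lambda>_. 0" "\<lambda>_. 0" \<Lambda> 1
    unfolding \<Lambda>_def by (rule superlevel_clip[OF k])
  have l0: "l > 0" using k by linarith
  have qk: "max 0 (min (F r - F k) \<Lambda>) = 0" if "0 \<le> r" "r \<le> k" for r
    using F_mono[OF that] \<Lambda> by simp
  have ql: "max 0 (min (F r - F k) \<Lambda>) = \<Lambda>" if "l \<le> r" for r
    using F_mono[of l r] that l0 \<Lambda> by (simp add: \<Lambda>_def)
  have up: "E.Jq x r \<le> \<Lambda> * max 0 (r - k)" if "0 \<le> r" for x r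
  proof (cases "r \<le> k")
    case True
    have "E.Jq x r \<le> 0" using E.Jq_diff(2)[of 0 r x] qk[OF that True] that by (simp add: E.Jq_0)
    then show ?thesis using True by simp
  next
    case False
    have "E.Jq x k \<le> 0" using E.Jq_diff(2)[of 0 k x] qk[of k] k by (simp add: E.Jq_0)
    moreover have "E.Jq x r - E.Jq x k \<le> \<Lambda> * \<bar>r - k\<bar>" using E.Jq_lip[of k r x] k that by linarith
    ultimately show ?thesis using False by simp
  qed
  have lo0: "0 \<le> E.Jq x r" if "0 \<le> r" for x r
  proof -
    have "(r - 0) * max 0 (min (F 0 - F k) \<Lambda>) \<le> E.Jq x r - E.Jq x 0" by (rule E.Jq_diff(1)) (use that in auto)
    moreover have "0 \<le> (r - 0) * max 0 (min (F 0 - F k) \<Lambda>)" using that by (intro mult_nonneg_nonneg) auto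
    ultimately show ?thesis by (simp add: E.Jq_0)
  qed
  have lo: "\<Lambda> * max 0 (r - l) \<le> E.Jq x r" if "0 \<le> r" for x r
  proof (cases "l \<le> r")
    case True
    have "(r - l) * \<Lambda> \<le> E.Jq x r - E.Jq x l" using E.Jq_diff(1)[of l r x] ql[of l] True l0 by simp
    then show ?thesis using lo0[of l x] l0 True by (simp add: mult.commute)
  qed (use lo0[OF that] in auto)
  have JJup: "E.JJ t \<le> \<Lambda> * pp k t" for t
  proof -
    have "E.JJ t \<le> (\<integral>x. \<Lambda> * max 0 (v t x - k) \<partial>lborel)" unfolding E.JJ_def
      by (intro Bochner_Integration.integral_mono E.Jq_int integrable_mult_right pp_int k up) auto
    then show ?thesis by (simp add: pp_def)
  qed
  have JJlo: "\<Lambda> * pp l t \<le> E.JJ t" for t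
  proof -
    have "(\<integral>x. \<Lambda> * max 0 (v t x - l) \<partial>lborel) \<le> E.JJ t" unfolding E.JJ_def
      using l0 by (intro Bochner_Integration.integral_mono E.Jq_int integrable_mult_right pp_int lo) auto
    then show ?thesis by (simp add: pp_def)
  qed
  have JJ0: "0 \<le> E.JJ t" for t unfolding E.JJ_def by (intro integral_nonneg_AE AE_I2 lo0) simp
  \<comment> \<open>A truncation is nondecreasing and 1-Lipschitz, so its energy is at most its form
    with the potential itself.\<close>
  have pw: "(dif (E.Psi t) z)\<^sup>2 \<le> dif (fl t) z * dif (E.Psi t) z" for t z
  proof -
    let ?q = "\<lambda>r. max 0 (min (r - F k) \<Lambda>)"
    have "(?q r - ?q r') * (?q r - ?q r') \<le> (r - r') * (?q r - ?q r')" for r r'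
    proof (cases "r' \<le> r")
      case True
      then have "0 \<le> ?q r - ?q r'" "?q r - ?q r' \<le> r - r'" by (auto simp: max_def min_def)
      then show ?thesis by (intro mult_right_mono)
    next
      case False
      then have "?q r - ?q r' \<le> 0" "r - r' \<le> ?q r - ?q r'" by (auto simp: max_def min_def)
      then show ?thesis by (intro mult_right_mono_neg)
    qed
    then show ?thesis by (simp add: dif_def E.Psi_def power2_eq_square)
  qed
  have gform_ge: "enn2real (gag s (E.Psi t)) \<le> gform s (fl t) (E.Psi t)" if "gag s (fl t) < \<infinity>" "gag s (E.Psi t) < \<infinity>" for t
  proof -
    have i: "integrable (gm s) (\<lambda>z. (dif (E.Psi t) z)\<^sup>2)"
      using that(2) unfolding gag_def by (intro square_integrable) auto
    have "enn2real (gag s (E.Psi t)) = (\<integral>z. (dif (E.Psi t) z)\<^sup>2 \<partial>gm s)"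
      unfolding gag_def by (rule integral_eq_nn_integral[symmetric]) auto
    also have "\<dots> \<le> gform s (fl t) (E.Psi t)"
      unfolding gform_def using that by (intro Bochner_Integration.integral_mono i gform_integrable pw) auto
    finally show ?thesis .
  qed
  have gae: "AE t in tm x y. gag s (fl t) < \<infinity> \<and> gag s (E.Psi t) < \<infinity>" if "0 < x" for x y
  proof -
    have "AE t in tm x y. gag s (fl t) \<noteq> \<infinity>"
      using fl_gag_fin[OF that, of y] by (intro nn_integral_PInf_AE) auto
    then show ?thesis
    proof eventually_elim
      case (elim t)
      have "gag s (E.Psi t) \<le> ennreal (2 * 1\<^sup>2) * (gag s (fl t) + gag s (\<lambda>_::'a. 0))" by (rule E.Psi_gag_le)
      also have "\<dots> < \<infinity>" using elim E.h_gag by (auto simp: ennreal_mult_less_top less_top)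
      finally show ?case using elim by (auto simp: less_top)
    qed
  qed
  have JJ_mono1: "E.JJ y \<le> E.JJ x" if "0 < x" "x < y" for x y
  proof -
    have "0 \<le> (\<integral>t. gform s (fl t) (E.Psi t) \<partial>tm x y)"
    proof (rule integral_nonneg_AE)
      show "AE t in tm x y. 0 \<le> gform s (fl t) (E.Psi t)"
        using gae[OF that(1)] by eventually_elim (use gform_ge enn2real_nonneg order_trans in blast)
    qed
    then have "- C * (\<integral>t. gform s (fl t) (E.Psi t) \<partial>tm x y) \<le> 0" using C by simp
    then show ?thesis using E.entropy[OF that] by linarith
  qed
  \<comment> \<open>Time 0 is reached by continuity of the entropy, since the energy is controlled
    on positive times only.\<close>
  have JJ_mono: "E.JJ y \<le> E.JJ x" if "0 \<le> x" "x \<le> y" for x y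
  proof (cases "x = y")
    case False
    have "(E.JJ \<longlongrightarrow> E.JJ x) (at_right x)" using E.JJ_isCont[of x] unfolding isCont_def by (rule tendsto_mono[OF at_le, rotated]) auto
    moreover have "\<forall>\<^sub>F r in at_right x. E.JJ y \<le> E.JJ r"
      using eventually_at_right_real[of x y] that False by (auto elim!: eventually_mono intro!: JJ_mono1)
    ultimately show ?thesis by (intro tendsto_lowerbound) auto
  qed simp
  have "\<Lambda> * pp l b \<le> \<Lambda> * pp k a" using JJlo[of b] JJ_mono[of a b] JJup[of a] ab by linarith
  then show "pp l b \<le> pp k a" using \<Lambda> by simp
  show "\<exists>\<tau>\<in>{a'..b}. superlevel (v \<tau>) l powr \<theta> < B"
    if c: "c > 0" and a': "a \<le> a'" "0 < a'" "a' < b"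
    and WS: "\<And>(g :: 'a \<Rightarrow> real) l K. integrable lborel g \<Longrightarrow> (\<And>x. 0 \<le> g x) \<Longrightarrow> (\<And>x. g x \<le> K) \<Longrightarrow> gag s g < \<infinity> \<Longrightarrow> l > 0 \<Longrightarrow>
       c * (l\<^sup>2 * superlevel g l powr \<theta>) \<le> enn2real (gag s g)" and \<theta>: "\<theta> > 0"
    and B: "4 * pp k a < C * c * (F l - F k) * (b - a') * B" for c a' \<theta> B
  proof (rule ccontr)
    assume "\<not> (\<exists>\<tau>\<in>{a'..b}. superlevel (v \<tau>) l powr \<theta> < B)"
    then have ge: "B \<le> superlevel (v t) l powr \<theta>" if "t \<in> {a'..b}" for t using that by (auto simp: not_less)
    have key: "c * ((\<Lambda> / 2)\<^sup>2 * B) \<le> gform s (fl t) (E.Psi t)" if t: "t \<in> {a'..b}" and fin: "gag s (fl t) < \<infinity>" "gag s (E.Psi t) < \<infinity>" for t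
    proof -
      have Pn: "0 \<le> E.Psi t x" "E.Psi t x \<le> \<Lambda>" for x using \<Lambda> by (auto simp: E.Psi_def)
      \<comment> \<open>The truncation equals \<open>\<Lambda>\<close> where v > l; half that level
        is used because superlevel sets are strict. The square of this half is the source of the
        factor 4 in the hypothesis on \<open>B\<close>.\<close>
      have sub: "{x. l < v t x} \<subseteq> {x. \<Lambda> / 2 < E.Psi t x}"
        using ql[OF less_imp_le] \<Lambda> by (auto simp: E.Psi_def fl_def)
      have "emeasure lborel {x. l < v t x} \<le> emeasure lborel {x. \<Lambda> / 2 < E.Psi t x}"
        using sub by (intro emeasure_mono) auto
      then have "superlevel (v t) l \<le> superlevel (E.Psi t) (\<Lambda> / 2)"
        using superlevel_finite(1)[OF v_int l0, of t] superlevel_finite(1)[OF E.Psi_int _ Pn(1), of "\<Lambda> / 2"] \<Lambda> by simp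
      then have "superlevel (v t) l powr \<theta> \<le> superlevel (E.Psi t) (\<Lambda> / 2) powr \<theta>"
        using \<theta> by (intro powr_mono2) auto
      then have "B \<le> superlevel (E.Psi t) (\<Lambda> / 2) powr \<theta>" using ge[OF t] by linarith
      then have "c * ((\<Lambda> / 2)\<^sup>2 * B) \<le> c * ((\<Lambda> / 2)\<^sup>2 * superlevel (E.Psi t) (\<Lambda> / 2) powr \<theta>)"
        using c by (intro mult_left_mono) auto
      also have "\<dots> \<le> enn2real (gag s (E.Psi t))" using \<Lambda> by (intro WS[OF E.Psi_int Pn fin(2)]) auto
      also have "\<dots> \<le> gform s (fl t) (E.Psi t)" by (rule gform_ge[OF fin])
      finally show ?thesis .
    qed
    have m: "measure (tm a' b) UNIV = b - a'" using a' by (simp add: measure_def)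
    interpret FM: finite_measure "tm a' b" by (rule finite_tm)
    have "(b - a') * (c * ((\<Lambda> / 2)\<^sup>2 * B)) = (\<integral>t. c * ((\<Lambda> / 2)\<^sup>2 * B) \<partial>tm a' b)" using m by simp
    also have "\<dots> \<le> (\<integral>t. gform s (fl t) (E.Psi t) \<partial>tm a' b)"
    proof (rule integral_mono_AE)
      show "integrable (tm a' b) (\<lambda>t. gform s (fl t) (E.Psi t))"
        using a' by (intro tm_gform_prod(2) fl_gag_fin E.Psi_gag_fin) auto
      show "AE t in tm a' b. c * ((\<Lambda> / 2)\<^sup>2 * B) \<le> gform s (fl t) (E.Psi t)"
        using gae[OF a'(2), of b] unfolding AE_tm_iff by eventually_elim (use key in auto)
    qed simp
    finally have "C * ((b - a') * (c * ((\<Lambda> / 2)\<^sup>2 * B))) \<le> C * (\<integral>t. gform s (fl t) (E.Psi t) \<partial>tm a' b)"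
      using C by (intro mult_left_mono) auto
    also have "\<dots> \<le> E.JJ a' - E.JJ b" using E.entropy[OF a'(2,3)] by linarith
    also have "\<dots> \<le> \<Lambda> * pp k a" using JJ0[of b] JJ_mono[of a a'] JJup[of a] a' ab by linarith
    \<comment> \<open>The energy is quadratic in \<open>\<Lambda>\<close> and the entropy linear;
      what remains after cancelling still grows with the increment of \<open>F\<close>.\<close>
    finally have "\<Lambda> * (C * c * \<Lambda> * (b - a') * B) \<le> \<Lambda> * (4 * pp k a)"
      by (simp add: power2_eq_square algebra_simps)
    then have "C * c * \<Lambda> * (b - a') * B \<le> 4 * pp k a" using \<Lambda> by simp
    then show False using B by (simp add: \<Lambda>_def)
  qed
qed

lemma pp_decay:
  assumes "0 \<le> k" "k < l" "0 \<le> a" "a \<le> b" shows "pp l b \<le> pp k a"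
  using pp_mono[OF assms(1-3), of b] pp_level_mono[of k l a] assms by (cases "a = b") auto

lemma pp_le_superlevel:
  assumes "0 \<le> l" "0 < l'" "l' \<le> l" "0 \<le> M" and M: "AE x in lborel. v t x \<le> M"
  shows "pp l t \<le> M * superlevel (v t) l'"
proof -
  have fin: "emeasure lborel {x. l' < v t x} < \<infinity>"
    using superlevel_finite(1)[OF v_int assms(2), of t] by simp
  have "pp l t \<le> (\<integral>x. M * indicator {x. l' < v t x} x \<partial>lborel)"
    unfolding pp_def
  proof (rule integral_mono_AE)
    show "AE x in lborel. max 0 (v t x - l) \<le> M * indicator {x. l' < v t x} x"
      using M by eventually_elim (use assms in \<open>auto simp: indicator_def max_def\<close>)
  qed (use assms fin in \<open>auto intro!: pp_int integrable_mult_right integrable_real_indicator\<close>)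
  also have "\<dots> = M * superlevel (v t) l'" by (simp add: superlevel_def)
  finally show ?thesis .
qed

end

section \<open>De Giorgi iteration\<close>

text \<open>Fast geometric convergence: the recursion Y(j+1) \<le> M (D 4^j Y(j))^\<beta> with
  \<beta> > 1 is dominated by a geometric sequence. \<open>\<rho>\<close> is fixed by 4^\<beta>
  \<rho>^(\<beta>-1) = 1, which cancels the growing factor, and \<open>\<eta>\<close> by
  \<eta>^(\<beta>-1) = \<rho>/(M D^\<beta>), which turns the inequality into an equality.\<close>

lemma powr_iteration:
  fixes \<beta> M D :: real
  assumes \<beta>: "\<beta> > 1" and "M > 0" "D > 0"
  obtains \<eta> \<rho> where "0 < \<eta>" "0 < \<rho>" "\<rho> < 1" "\<And>j::nat. M * (D * 4 ^ j * (\<eta> * \<rho> ^ j)) powr \<beta> \<le> \<eta> * \<rho> ^ Suc j"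
proof -
  define \<rho> where "\<rho> = 4 powr (- \<beta> / (\<beta> - 1))"
  define \<eta> where "\<eta> = (\<rho> / (M * D powr \<beta>)) powr (1 / (\<beta> - 1))"
  have \<rho>: "0 < \<rho>" "\<rho> < 1" using \<beta> by (auto simp: \<rho>_def intro!: powr_less_one)
  have \<eta>: "0 < \<eta>" using \<rho> assms by (simp add: \<eta>_def)
  have r: "4 powr \<beta> * \<rho> powr (\<beta> - 1) = 1" using \<beta> by (simp add: \<rho>_def powr_powr powr_add[symmetric])
  have e: "\<eta> powr (\<beta> - 1) = \<rho> / (M * D powr \<beta>)" using \<beta> \<rho> assms by (simp add: \<eta>_def powr_powr)
  have "M * (D * 4 ^ j * (\<eta> * \<rho> ^ j)) powr \<beta> \<le> \<eta> * \<rho> ^ Suc j" for j :: nat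
  proof -
    have "(4 ^ j) powr \<beta> * (\<rho> ^ j) powr \<beta> = \<rho> ^ j"
    proof -
      have "(4 ^ j) powr \<beta> * (\<rho> ^ j) powr \<beta> = (4 powr \<beta>) ^ j * (\<rho> powr \<beta>) ^ j"
        using \<rho> by (simp add: powr_realpow[symmetric] powr_powr mult.commute)
      also have "\<rho> powr \<beta> = \<rho> powr (\<beta> - 1) * \<rho>" using \<rho> powr_add[of \<rho> "\<beta> - 1" 1] by simp
      also have "(4 powr \<beta>) ^ j * (\<rho> powr (\<beta> - 1) * \<rho>) ^ j = ((4 powr \<beta> * \<rho> powr (\<beta> - 1)) * \<rho>) ^ j"
        by (simp add: power_mult_distrib mult_ac)
      finally show ?thesis by (simp add: r)
    qed
    then have "M * (D * 4 ^ j * (\<eta> * \<rho> ^ j)) powr \<beta> = M * D powr \<beta> * \<eta> powr \<beta> * \<rho> ^ j"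
      by (simp add: powr_mult mult_ac)
    also have "\<eta> powr \<beta> = \<eta> powr (\<beta> - 1) * \<eta>" using \<eta> powr_add[of \<eta> "\<beta> - 1" 1] by simp
    also have "M * D powr \<beta> * (\<eta> powr (\<beta> - 1) * \<eta>) * \<rho> ^ j = \<eta> * \<rho> ^ Suc j"
      unfolding e using assms by simp
    finally show ?thesis by simp
  qed
  then show ?thesis using that \<eta> \<rho> by blast
qed

context frac_flow begin

text \<open>Levels rise from \<open>K\<close> towards \<open>2 * K\<close> and times from
  \<open>T\<close> towards \<open>2 * T\<close>, with gaps that halve at each step. The dissipation
  estimate finds a time at which the superlevel set is bounded by the power 1/\<theta> > 1 of the
  previous excess, and the sup bound \<open>M\<close> turns measure back into excess mass. The
  product of a level gap and a time gap produces the factor 4^j.\<close>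

lemma de_giorgi:
  assumes c: "c > 0" and \<theta>: "0 < \<theta>" "\<theta> < 1"
    and WS: "\<And>(g :: 'a \<Rightarrow> real) l K. integrable lborel g \<Longrightarrow> (\<And>x. 0 \<le> g x) \<Longrightarrow> (\<And>x. g x \<le> K) \<Longrightarrow> gag s g < \<infinity> \<Longrightarrow> l > 0 \<Longrightarrow>
       c * (l\<^sup>2 * superlevel g l powr \<theta>) \<le> enn2real (gag s g)"
    and T: "T > 0" and K: "K > 0" and M: "M > 0" "\<And>t. 0 \<le> t \<Longrightarrow> AE x in lborel. v t x \<le> M"
    and c0: "c0 > 0" "\<And>k l. K \<le> k \<Longrightarrow> k < l \<Longrightarrow> l \<le> 2 * K \<Longrightarrow> c0 * (l - k) \<le> F l - F k"
    and \<eta>: "0 < \<eta>" "0 < \<rho>" "\<rho> < 1" "\<And>j::nat. M * ((64 / (C * c * c0 * K * T)) * 4 ^ j * (\<eta> * \<rho> ^ j)) powr (1 / \<theta>) \<le> \<eta> * \<rho> ^ Suc j"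
    and init: "pp K T \<le> \<eta>" and t: "t \<ge> 2 * T"
  shows "AE x in lborel. v t x \<le> 2 * K"
proof -
  define Tj where "Tj j = T * (2 - (1/2) ^ j)" for j :: nat
  define Kj where "Kj j = K * (2 - (1/2) ^ j)" for j :: nat
  have half: "0 < (1/2::real) ^ j" "(1/2::real) ^ j \<le> 1" for j :: nat by (auto simp: power_le_one)
  have Tj: "T \<le> Tj j" "Tj j < 2 * T" and Kj: "K \<le> Kj j" "Kj j < 2 * K" for j
    using half[of j] T K mult_left_mono[of 1 "2 - (1/2::real)^j" T] mult_left_mono[of 1 "2 - (1/2::real)^j" K]
      mult_strict_left_mono[of "2 - (1/2::real)^j" 2 T] mult_strict_left_mono[of "2 - (1/2::real)^j" 2 K]
    by (auto simp: Tj_def Kj_def mult.commute[of 2])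
  have main: "pp (Kj j) (Tj j) \<le> \<eta> * \<rho> ^ j" for j
  proof (induction j)
    case 0
    then show ?case using init by (simp add: Tj_def Kj_def)
  next
    case (Suc j)
    define p where "p = (1/2::real) ^ j"
    have p: "p > 0" by (simp add: p_def)
    \<comment> \<open>Halfway between \<open>Kj j\<close> and \<open>Kj (Suc j)\<close>: the first
      half pays for the energy estimate, the second for the strict increase of level that
      \<open>pp_decay\<close> requires.\<close>
    define l where "l = Kj j + K * p / 4"
    have Kl: "Kj j < l" "l < Kj (Suc j)" "l - Kj j = K * p / 4" "Tj (Suc j) - Tj j = T * p / 2"
      using K p by (auto simp: l_def Kj_def Tj_def p_def algebra_simps)
    define Y where "Y = \<eta> * \<rho> ^ j"
    have Y: "Y > 0" "pp (Kj j) (Tj j) \<le> Y" using \<eta> Suc by (auto simp: Y_def)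
    define D where "D = 64 / (C * c * c0 * K * T)"
    have D: "D > 0" using C c c0 K T by (simp add: D_def)
    define B where "B = D * 4 ^ j * Y"
    have B0: "B > 0" using D Y by (simp add: B_def)
    have "p * p * 4 ^ j = 1" by (simp add: p_def power_mult_distrib[symmetric])
    \<comment> \<open>Doubling the bound gains the strict inequality. The 64 in \<open>D\<close>,
      divided by the 8 coming from the gaps \<open>K * p / 4\<close> and \<open>T * p / 2\<close>,
      gives exactly this \<open>8 * Y\<close>.\<close>
    have "4 * pp (Kj j) (Tj j) < 8 * Y" using Y by linarith
    also have "\<dots> = C * c * (c0 * (K * p / 4)) * (T * p / 2) * B"
    proof -
      have "C * c * (c0 * (K * p / 4)) * (T * p / 2) * B = (C * c * c0 * K * T * D) * (p * p * 4 ^ j) * Y / 8"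
        by (simp add: B_def)
      also have "C * c * c0 * K * T * D = 64" using C c c0 K T by (simp add: D_def)
      finally show ?thesis using \<open>p * p * 4 ^ j = 1\<close> by simp
    qed
    also have "\<dots> \<le> C * c * (F l - F (Kj j)) * (Tj (Suc j) - Tj j) * B"
    proof -
      have "c0 * (K * p / 4) \<le> F l - F (Kj j)"
        using c0(2)[of "Kj j" l] Kl Kj[of j] Kj[of "Suc j"] by simp
      then show ?thesis unfolding Kl(4) using C c T p B0
        by (intro mult_right_mono mult_left_mono) auto
    qed
    finally have lt: "4 * pp (Kj j) (Tj j) < C * c * (F l - F (Kj j)) * (Tj (Suc j) - Tj j) * B" .
    have "0 < T * p / 2" using T p by simp
    then have Tlt: "Tj j < Tj (Suc j)" using Kl(4) by linarith
    have "\<exists>\<tau>\<in>{Tj j..Tj (Suc j)}. superlevel (v \<tau>) l powr \<theta> < B"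
    proof (rule level_time[OF _ Kl(1) _ Tlt c order_refl _ Tlt WS \<theta>(1) lt])
      show "0 \<le> Kj j" "0 \<le> Tj j" "0 < Tj j" using Kj[of j] Tj[of j] K T by linarith+
    qed
    then obtain \<tau> where \<tau>: "Tj j \<le> \<tau>" "\<tau> \<le> Tj (Suc j)" "superlevel (v \<tau>) l powr \<theta> < B" by auto
    have "superlevel (v \<tau>) l = (superlevel (v \<tau>) l powr \<theta>) powr (1 / \<theta>)"
      using \<theta> by (simp add: powr_powr)
    also have "\<dots> \<le> B powr (1 / \<theta>)" using \<tau>(3) \<theta> by (intro powr_mono2) auto
    finally have sl: "superlevel (v \<tau>) l \<le> B powr (1 / \<theta>)" .
    have \<tau>0: "0 \<le> \<tau>" using \<tau> Tj[of j] T by linarith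
    have l0: "0 < l" using Kl Kj[of j] K by linarith
    have "pp (Kj (Suc j)) (Tj (Suc j)) \<le> pp l \<tau>" using Kl \<tau> \<tau>0 l0 by (intro pp_decay) auto
    also have "\<dots> \<le> M * superlevel (v \<tau>) l" using l0 M \<tau>0 by (intro pp_le_superlevel) auto
    also have "\<dots> \<le> M * B powr (1 / \<theta>)" using sl M by (intro mult_left_mono) auto
    also have "\<dots> \<le> \<eta> * \<rho> ^ Suc j" using \<eta>(4)[of j] by (simp add: B_def D_def Y_def)
    finally show ?case .
  qed
  \<comment> \<open>All levels and times of the iteration stay below \<open>2 * K\<close> and
    \<open>2 * T\<close>, so the estimate for every \<open>j\<close> bounds one and the same
    quantity.\<close>
  have "pp (2 * K) t \<le> \<eta> * \<rho> ^ j" for j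
    using main[of j] pp_decay[of "Kj j" "2 * K" "Tj j" t] Kj[of j] Tj[of j] t T K by auto
  moreover have "(\<lambda>j. \<eta> * \<rho> ^ j) \<longlonglongrightarrow> \<eta> * 0" using \<eta> by (intro tendsto_intros) auto
  ultimately have "pp (2 * K) t \<le> 0" by (intro tendsto_lowerbound[of "\<lambda>j. \<eta> * \<rho> ^ j" "\<eta> * 0" sequentially, simplified]) auto
  then have "pp (2 * K) t = 0" using pp_nonneg[of "2 * K" t] by linarith
  then show ?thesis using K by (intro pp_zero_AE) auto
qed

end

section \<open>Doubling the time variable\<close>

text \<open>Both sides are the integral over \<open>{\<eta>..\<eta> + \<kappa>}\<close> minus the
  one over \<open>{0..\<kappa>}\<close>. A window of length \<open>\<eta>\<close> shifted by
  \<open>\<kappa>\<close> is traded for a window of length \<open>\<kappa>\<close> shifted by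
  \<open>\<eta>\<close>, so that small shifts become short integrals.\<close>

lemma integral_shift_diff:
  fixes g :: "real \<Rightarrow> real"
  assumes g: "continuous_on UNIV g" and "0 \<le> \<eta>" "0 \<le> \<kappa>"
  shows "integral {0..\<eta>} (\<lambda>r. g (r + \<kappa>)) - integral {0..\<eta>} g = integral {0..\<kappa>} (\<lambda>r. g (\<eta> + r)) - integral {0..\<kappa>} g"
proof -
  have "continuous_on {0..\<eta> + \<kappa>} g" by (rule continuous_on_subset[OF g]) simp
  then obtain G where G: "\<And>x. x \<in> {0..\<eta> + \<kappa>} \<Longrightarrow> (G has_vector_derivative g x) (at x within {0..\<eta> + \<kappa>})"
    using antiderivative_continuous by blast
  have i: "integral {0..w} (\<lambda>r. g (c + r)) = G (c + w) - G c" if "0 \<le> c" "0 \<le> w" "c + w \<le> \<eta> + \<kappa>" for c w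
  proof (rule integral_unique, rule fundamental_theorem_of_calculus[where f = "\<lambda>r. G (c + r)" and a = 0, simplified])
    show "0 \<le> w" by fact
    fix x assume "0 \<le> x \<and> x \<le> w"
    then have x: "c + x \<in> {0..\<eta> + \<kappa>}" using that by auto
    have "(((+) c) has_vector_derivative 1) (at x within {0..w})"
      by (auto intro!: derivative_eq_intros)
    moreover have "(G has_vector_derivative g (c + x)) (at (c + x) within (+) c ` {0..w})"
      by (rule has_vector_derivative_within_subset[OF G[OF x]]) (use that in auto)
    ultimately have "((G \<circ> (+) c) has_vector_derivative 1 *\<^sub>R g (c + x)) (at x within {0..w})"
      by (rule vector_diff_chain_within)
    then show "((\<lambda>r. G (c + r)) has_vector_derivative g (c + x)) (at x within {0..w})" by (simp add: o_def)
  qed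
  show ?thesis
    using i[of \<kappa> \<eta>] i[of 0 \<eta>] i[of \<eta> \<kappa>] i[of 0 \<kappa>] assms by (simp add: add.commute)
qed

lemma integral_const_le:
  fixes f :: "real \<Rightarrow> real"
  assumes "continuous_on {0..w} f" "0 \<le> w" "\<And>x. x \<in> {0..w} \<Longrightarrow> f x \<le> c"
  shows "integral {0..w} f \<le> w * c"
proof -
  have "integral {0..w} f \<le> integral {0..w} (\<lambda>_. c)"
    using assms by (intro integral_le integrable_continuous_interval) auto
  then show ?thesis using assms by simp
qed

text \<open>For small steps the difference quotients are at most \<open>e\<close>, uniformly in
  \<open>t\<close>; summing over equal steps from \<open>t0\<close> to \<open>t1\<close> leaves an
  increase of at most \<open>(t1 - t0) * e\<close>.\<close>

lemma nonincreasing_by_small_steps: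
  fixes M :: "real \<Rightarrow> real"
  assumes t: "t0 \<le> t1" and step: "\<And>e. e > 0 \<Longrightarrow> \<exists>\<kappa>0>0. \<forall>\<kappa> t. 0 < \<kappa> \<longrightarrow> \<kappa> < \<kappa>0 \<longrightarrow> t0 \<le> t \<longrightarrow> t \<le> t1 \<longrightarrow> M (t + \<kappa>) - M t \<le> \<kappa> * e"
  shows "M t1 \<le> M t0"
proof (rule field_le_epsilon)
  fix e :: real assume e: "e > 0"
  define e' where "e' = e / (t1 - t0 + 1)"
  have e': "e' > 0" "(t1 - t0) * e' \<le> e"
  proof -
    show "e' > 0" using e t by (simp add: e'_def)
    have "(t1 - t0) * e' \<le> (t1 - t0 + 1) * e'" using \<open>e' > 0\<close> by (intro mult_right_mono) auto
    also have "\<dots> = e" using t by (simp add: e'_def)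
    finally show "(t1 - t0) * e' \<le> e" .
  qed
  obtain \<kappa>0 where \<kappa>0: "\<kappa>0 > 0" "\<And>\<kappa> t. 0 < \<kappa> \<Longrightarrow> \<kappa> < \<kappa>0 \<Longrightarrow> t0 \<le> t \<Longrightarrow> t \<le> t1 \<Longrightarrow> M (t + \<kappa>) - M t \<le> \<kappa> * e'"
    using step[OF e'(1)] by blast
  show "M t1 \<le> M t0 + e"
  proof (cases "t0 = t1")
    case True then show ?thesis using e by simp
  next
    case False
    then have lt: "t0 < t1" using t by simp
    obtain N :: nat where N: "real N > (t1 - t0) / \<kappa>0" using reals_Archimedean2 by blast
    then have Npos: "real N > 0" using lt \<kappa>0 by (meson divide_pos_pos diff_gt_0_iff_gt less_trans)
    define \<kappa> where "\<kappa> = (t1 - t0) / real N"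
    have \<kappa>: "0 < \<kappa>" "\<kappa> < \<kappa>0" "real N * \<kappa> = t1 - t0" using N Npos lt \<kappa>0 by (auto simp: \<kappa>_def field_simps)
    have "M (t0 + real k * \<kappa>) \<le> M t0 + real k * (\<kappa> * e')" if "k \<le> N" for k
      using that
    proof (induction k)
      case (Suc k)
      have "real k * \<kappa> \<le> real N * \<kappa>" using Suc(2) \<kappa>(1) by (intro mult_right_mono) auto
      then have "M (t0 + real k * \<kappa> + \<kappa>) - M (t0 + real k * \<kappa>) \<le> \<kappa> * e'"
        using \<kappa> by (intro \<kappa>0(2)) auto
      then show ?case using Suc by (simp add: algebra_simps)
    qed simp
    from this[of N] have "M t1 \<le> M t0 + (t1 - t0) * e'" using \<kappa>(3) by (simp flip: mult.assoc)
    then show ?thesis using e'(2) by linarith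
  qed
qed

text \<open>If \<open>(\<partial>\<^sub>x + \<partial>\<^sub>y) D \<le> 0\<close> in the integrated sense on squares, then the averages of \<open>D\<close> over the
  squares \<open>{t..t + \<eta>} \<times> {t..t + \<eta>}\<close> are nonincreasing in \<open>t\<close>.\<close>

lemma diagonal_nonincreasing:
  fixes D :: "real \<Rightarrow> real \<Rightarrow> real"
  assumes D: "continuous_on UNIV (\<lambda>(x, y). D x y)"
    and sq: "\<And>t \<eta>. 0 < t \<Longrightarrow> 0 < \<eta> \<Longrightarrow>
      integral {0..\<eta>} (\<lambda>r. D (t + \<eta>) (t + r) - D t (t + r)) + integral {0..\<eta>} (\<lambda>r. D (t + r) (t + \<eta>) - D (t + r) t) \<le> 0"
    and t: "0 < t0" "t0 \<le> t1"
  shows "D t1 t1 \<le> D t0 t0"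
proof (rule field_le_epsilon)
  fix e :: real assume e: "e > 0"
  have cD: "continuous_on A (\<lambda>z. D (f z) (g z))" if "continuous_on A f" "continuous_on A g" for A :: "'z::topological_space set" and f g
    using continuous_on_compose2[OF D continuous_on_Pair[OF that]] by auto
  have unif: "\<exists>\<kappa>>0. \<forall>x y x' y'. x \<in> {0..t1 + 2} \<longrightarrow> y \<in> {0..t1 + 2} \<longrightarrow> x' \<in> {0..t1 + 2} \<longrightarrow> y' \<in> {0..t1 + 2} \<longrightarrow> \<bar>x - x'\<bar> < \<kappa> \<longrightarrow> \<bar>y - y'\<bar> < \<kappa> \<longrightarrow> \<bar>D x y - D x' y'\<bar> < e"
    if "e > 0" for e
  proof -
    have "uniformly_continuous_on ({0..t1 + 2} \<times> {0..t1 + 2}) (\<lambda>(x, y). D x y)"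
      by (intro compact_uniformly_continuous continuous_on_subset[OF D] compact_Times) auto
    then obtain d where d: "d > 0" "\<And>p p'. p \<in> {0..t1 + 2} \<times> {0..t1 + 2} \<Longrightarrow> p' \<in> {0..t1 + 2} \<times> {0..t1 + 2} \<Longrightarrow> dist p' p < d \<Longrightarrow> dist (case p' of (x, y) \<Rightarrow> D x y) (case p of (x, y) \<Rightarrow> D x y) < e"
      unfolding uniformly_continuous_on_def using \<open>e > 0\<close> by metis
    show ?thesis
    proof (intro exI[of _ "d / 2"] conjI allI impI)
      fix x y x' y' assume a: "x \<in> {0..t1 + 2}" "y \<in> {0..t1 + 2}" "x' \<in> {0..t1 + 2}" "y' \<in> {0..t1 + 2}" "\<bar>x - x'\<bar> < d / 2" "\<bar>y - y'\<bar> < d / 2"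
      have "dist (x, y) (x', y') \<le> dist x x' + dist y y'"
        by (simp add: dist_Pair_Pair sqrt_sum_squares_le_sum)
      also have "\<dots> < d" using a by (simp add: dist_real_def)
      finally show "\<bar>D x y - D x' y'\<bar> < e" using d(2)[of "(x', y')" "(x, y)"] a by (simp add: dist_real_def)
    qed (use d in simp)
  qed
  obtain \<kappa>1 where \<kappa>1: "\<kappa>1 > 0" "\<And>x y x' y'. x \<in> {0..t1 + 2} \<Longrightarrow> y \<in> {0..t1 + 2} \<Longrightarrow> x' \<in> {0..t1 + 2} \<Longrightarrow> y' \<in> {0..t1 + 2} \<Longrightarrow> \<bar>x - x'\<bar> < \<kappa>1 \<Longrightarrow> \<bar>y - y'\<bar> < \<kappa>1 \<Longrightarrow> \<bar>D x y - D x' y'\<bar> < e / 2"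
    using unif[of "e / 2"] e by auto
  \<comment> \<open>Small enough for the average over the square to lie within \<open>e / 2\<close>
    of the value on the diagonal. The cap 1, together with steps below 1, keeps all arguments in
    \<open>{0..t1 + 2}\<close>.\<close>
  define \<eta> where "\<eta> = min (\<kappa>1 / 2) 1"
  have \<eta>: "0 < \<eta>" "\<eta> < \<kappa>1" "\<eta> \<le> 1" using \<kappa>1(1) by (auto simp: \<eta>_def)
  define M where "M t = integral {0..\<eta>} (\<lambda>r. integral {0..\<eta>} (\<lambda>r'. D (t + r) (t + r')))" for t
  have cI: "continuous_on UNIV (\<lambda>r. integral {0..\<eta>} (\<lambda>r'. D (f r) (g r')))" if "continuous_on UNIV f" "continuous_on UNIV g" for f g :: "real \<Rightarrow> real"
  proof (rule integral_continuous_on_param[where a = 0 and b = \<eta> and U = UNIV and f = "\<lambda>r r'. D (f r) (g r')", unfolded cbox_interval])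
    show "continuous_on (UNIV \<times> {0..\<eta>}) (\<lambda>(r, r'). D (f r) (g r'))"
      unfolding case_prod_unfold
      by (intro cD continuous_on_compose2[OF that(1)] continuous_on_compose2[OF that(2)] continuous_intros) auto
  qed
  have M: "M t1 \<le> M t0"
  proof (rule nonincreasing_by_small_steps[OF t(2)])
    fix e' :: real assume e': "e' > 0"
    \<comment> \<open>Four errors of size \<open>\<eta> * d\<close> arise, two from each coordinate
      direction; together they make \<open>e'\<close>.\<close>
    define d where "d = e' / (4 * \<eta>)"
    have d: "d > 0" "4 * \<eta> * d = e'" using e' \<eta> by (auto simp: d_def)
    obtain \<kappa>2 where \<kappa>2: "\<kappa>2 > 0" "\<And>x y x' y'. x \<in> {0..t1 + 2} \<Longrightarrow> y \<in> {0..t1 + 2} \<Longrightarrow> x' \<in> {0..t1 + 2} \<Longrightarrow> y' \<in> {0..t1 + 2} \<Longrightarrow> \<bar>x - x'\<bar> < \<kappa>2 \<Longrightarrow> \<bar>y - y'\<bar> < \<kappa>2 \<Longrightarrow> \<bar>D x y - D x' y'\<bar> < d"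
      using unif[OF d(1)] by auto
    show "\<exists>\<kappa>0>0. \<forall>\<kappa> t. 0 < \<kappa> \<longrightarrow> \<kappa> < \<kappa>0 \<longrightarrow> t0 \<le> t \<longrightarrow> t \<le> t1 \<longrightarrow> M (t + \<kappa>) - M t \<le> \<kappa> * e'"
    proof (intro exI[of _ "min \<kappa>2 1"] conjI allI impI)
      fix \<kappa> t assume \<kappa>: "0 < \<kappa>" "\<kappa> < min \<kappa>2 1" and tt: "t0 \<le> t" "t \<le> t1"
      have t0: "0 < t" using tt t by linarith
      \<comment> \<open>The diagonal move is split into two axis-parallel ones: in \<open>A\<close>
        the second argument has already moved by \<open>\<kappa>\<close>, in \<open>A'\<close> it
        has not.\<close>
      define A where "A \<rho> = integral {0..\<eta>} (\<lambda>r'. D (t + \<rho>) (t + \<kappa> + r'))" for \<rho>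
      define A' where "A' \<rho> = integral {0..\<eta>} (\<lambda>r'. D (t + \<rho>) (t + r'))" for \<rho>
      have cA: "continuous_on UNIV A" "continuous_on UNIV A'"
        unfolding A_def A'_def by (intro cI continuous_intros)+
      have inr: "continuous_on S (\<lambda>r'. D x (c + r'))" "continuous_on S (\<lambda>r'. D (c + r') x)" for S :: "real set" and x c
        by (intro cD continuous_intros)+
      have "M (t + \<kappa>) - M t = (integral {0..\<eta>} (\<lambda>r. A (r + \<kappa>)) - integral {0..\<eta>} A) + (integral {0..\<eta>} A - integral {0..\<eta>} A')"
      proof -
        have "M t = integral {0..\<eta>} A'" by (simp add: M_def A'_def[abs_def])
        moreover have "M (t + \<kappa>) = integral {0..\<eta>} (\<lambda>r. A (r + \<kappa>))" by (simp add: M_def A_def add_ac)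
        ultimately show ?thesis by simp
      qed
      also have "integral {0..\<eta>} (\<lambda>r. A (r + \<kappa>)) - integral {0..\<eta>} A = integral {0..\<kappa>} (\<lambda>r. A (\<eta> + r) - A r)"
        using integral_shift_diff[OF cA(1), of \<eta> \<kappa>] \<eta> \<kappa>
        by (subst Henstock_Kurzweil_Integration.integral_diff)
           (auto intro!: integrable_continuous_interval continuous_on_compose2[OF cA(1)] continuous_on_subset[OF cA(1)] continuous_intros)
      also have "\<dots> \<le> \<kappa> * ((A' \<eta> - A' 0) + 2 * \<eta> * d)"
      proof (rule integral_const_le)
        show "continuous_on {0..\<kappa>} (\<lambda>r. A (\<eta> + r) - A r)"
          by (auto intro!: continuous_on_compose2[OF cA(1)] continuous_on_subset[OF cA(1)] continuous_intros)
        fix r assume r: "r \<in> {0..\<kappa>}"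
        have "A (\<rho> + r) - A' \<rho> \<le> \<eta> * d" "A' \<rho> - A (\<rho> + r) \<le> \<eta> * d" if "0 \<le> \<rho>" "\<rho> \<le> \<eta>" for \<rho>
        proof -
          have *: "\<bar>D (t + (\<rho> + r)) (t + \<kappa> + r') - D (t + \<rho>) (t + r')\<bar> < d" if "r' \<in> {0..\<eta>}" for r'
            using that r \<kappa> tt t0 \<eta> \<open>0 \<le> \<rho>\<close> \<open>\<rho> \<le> \<eta>\<close> by (intro \<kappa>2(2)) auto
          have eq: "A (\<rho> + r) - A' \<rho> = integral {0..\<eta>} (\<lambda>r'. D (t + (\<rho> + r)) (t + \<kappa> + r') - D (t + \<rho>) (t + r'))"
            unfolding A_def A'_def
            by (rule Henstock_Kurzweil_Integration.integral_diff[symmetric]) (intro integrable_continuous_interval inr)+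
          have eq': "A' \<rho> - A (\<rho> + r) = integral {0..\<eta>} (\<lambda>r'. D (t + \<rho>) (t + r') - D (t + (\<rho> + r)) (t + \<kappa> + r'))"
            unfolding A_def A'_def
            by (rule Henstock_Kurzweil_Integration.integral_diff[symmetric]) (intro integrable_continuous_interval inr)+
          show "A (\<rho> + r) - A' \<rho> \<le> \<eta> * d" unfolding eq
          proof (rule integral_const_le)
            show "continuous_on {0..\<eta>} (\<lambda>r'. D (t + (\<rho> + r)) (t + \<kappa> + r') - D (t + \<rho>) (t + r'))" by (intro continuous_on_diff inr)
            show "0 \<le> \<eta>" using \<eta> by simp
            fix y assume "y \<in> {0..\<eta>}"
            from *[OF this] show "D (t + (\<rho> + r)) (t + \<kappa> + y) - D (t + \<rho>) (t + y) \<le> d" by linarith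
          qed
          show "A' \<rho> - A (\<rho> + r) \<le> \<eta> * d" unfolding eq'
          proof (rule integral_const_le)
            show "continuous_on {0..\<eta>} (\<lambda>r'. D (t + \<rho>) (t + r') - D (t + (\<rho> + r)) (t + \<kappa> + r'))" by (intro continuous_on_diff inr)
            show "0 \<le> \<eta>" using \<eta> by simp
            fix y assume "y \<in> {0..\<eta>}"
            from *[OF this] show "D (t + \<rho>) (t + y) - D (t + (\<rho> + r)) (t + \<kappa> + y) \<le> d" by linarith
          qed
        qed
        from this(1)[of \<eta>] this(2)[of 0] show "A (\<eta> + r) - A r \<le> (A' \<eta> - A' 0) + 2 * \<eta> * d" using \<eta> by simp
      qed (use \<kappa> in simp)
      also have "integral {0..\<eta>} A - integral {0..\<eta>} A' = integral {0..\<eta>} (\<lambda>r. A r - A' r)"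
        by (rule Henstock_Kurzweil_Integration.integral_diff[symmetric])
           (auto intro!: integrable_continuous_interval continuous_on_subset[OF cA(1)] continuous_on_subset[OF cA(2)])
      also have "\<dots> \<le> integral {0..\<eta>} (\<lambda>r. \<kappa> * (D (t + r) (t + \<eta>) - D (t + r) t + 2 * d))"
      proof (rule integral_le)
        show "(\<lambda>r. A r - A' r) integrable_on {0..\<eta>}"
          by (intro integrable_continuous_interval continuous_on_diff continuous_on_subset[OF cA(1)] continuous_on_subset[OF cA(2)]) auto
        show "(\<lambda>r. \<kappa> * (D (t + r) (t + \<eta>) - D (t + r) t + 2 * d)) integrable_on {0..\<eta>}"
          by (intro integrable_continuous_interval continuous_intros cD)
        fix r assume r: "r \<in> {0..\<eta>}"
        have "A r - A' r = integral {0..\<kappa>} (\<lambda>r'. D (t + r) (t + (\<eta> + r'))) - integral {0..\<kappa>} (\<lambda>r'. D (t + r) (t + r'))"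
          using integral_shift_diff[OF inr(1)[of UNIV "t + r" t], of \<eta> \<kappa>] \<eta> \<kappa> by (simp add: A_def A'_def add_ac)
        also have "\<dots> = integral {0..\<kappa>} (\<lambda>r'. D (t + r) (t + (\<eta> + r')) - D (t + r) (t + r'))"
          by (rule Henstock_Kurzweil_Integration.integral_diff[symmetric]) (intro integrable_continuous_interval cD continuous_intros)+
        also have "\<dots> \<le> \<kappa> * (D (t + r) (t + \<eta>) - D (t + r) t + 2 * d)"
        proof (rule integral_const_le)
          show "continuous_on {0..\<kappa>} (\<lambda>r'. D (t + r) (t + (\<eta> + r')) - D (t + r) (t + r'))"
            by (intro cD continuous_intros)
          fix r' assume r': "r' \<in> {0..\<kappa>}"
          have "\<bar>D (t + r) (t + (\<eta> + r')) - D (t + r) (t + \<eta>)\<bar> < d" "\<bar>D (t + r) t - D (t + r) (t + r')\<bar> < d"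
            using r r' \<kappa> tt t0 \<eta> \<kappa>2(1) by (intro \<kappa>2(2); simp)+
          then show "D (t + r) (t + (\<eta> + r')) - D (t + r) (t + r') \<le> D (t + r) (t + \<eta>) - D (t + r) t + 2 * d" by linarith
        qed (use \<kappa> in simp)
        finally show "A r - A' r \<le> \<kappa> * (D (t + r) (t + \<eta>) - D (t + r) t + 2 * d)" .
      qed
      also have "\<dots> = \<kappa> * (integral {0..\<eta>} (\<lambda>r. D (t + r) (t + \<eta>) - D (t + r) t) + 2 * \<eta> * d)"
      proof -
        have "integral {0..\<eta>} (\<lambda>r. D (t + r) (t + \<eta>) - D (t + r) t + 2 * d) = integral {0..\<eta>} (\<lambda>r. D (t + r) (t + \<eta>) - D (t + r) t) + integral {0..\<eta>} (\<lambda>r. 2 * d)"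
          by (rule Henstock_Kurzweil_Integration.integral_add) (intro integrable_continuous_interval cD continuous_intros)+
        then show ?thesis using \<eta> by simp
      qed
      finally have "M (t + \<kappa>) - M t \<le> \<kappa> * ((A' \<eta> - A' 0) + 2 * \<eta> * d) + \<kappa> * (integral {0..\<eta>} (\<lambda>r. D (t + r) (t + \<eta>) - D (t + r) t) + 2 * \<eta> * d)"
        by simp
      also have "\<dots> = \<kappa> * ((A' \<eta> - A' 0) + integral {0..\<eta>} (\<lambda>r. D (t + r) (t + \<eta>) - D (t + r) t)) + \<kappa> * (4 * \<eta> * d)"
        by (simp add: algebra_simps)
      also have "A' \<eta> - A' 0 = integral {0..\<eta>} (\<lambda>r. D (t + \<eta>) (t + r) - D t (t + r))"
        unfolding A'_def by (simp, rule Henstock_Kurzweil_Integration.integral_diff[symmetric]) (intro integrable_continuous_interval inr)+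
      also have "\<kappa> * (integral {0..\<eta>} (\<lambda>r. D (t + \<eta>) (t + r) - D t (t + r)) + integral {0..\<eta>} (\<lambda>r. D (t + r) (t + \<eta>) - D (t + r) t)) \<le> \<kappa> * 0"
        using sq[OF t0 \<eta>(1)] \<kappa> by (intro mult_left_mono) auto
      finally show "M (t + \<kappa>) - M t \<le> \<kappa> * e'" using d by simp
    qed (use \<kappa>2 in simp)
  qed
  have Mb: "\<bar>M t - \<eta> * (\<eta> * D t t)\<bar> \<le> \<eta> * (\<eta> * (e / 2))" if tt: "t0 \<le> t" "t \<le> t1" for t
  proof -
    have t0: "0 < t" using tt t by linarith
    have *: "\<bar>D (t + r) (t + r') - D t t\<bar> < e / 2" if "r \<in> {0..\<eta>}" "r' \<in> {0..\<eta>}" for r r'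
      using that tt t0 \<eta> by (intro \<kappa>1(2)) auto
    have i1: "\<bar>integral {0..\<eta>} (\<lambda>r'. D (t + r) (t + r')) - \<eta> * D t t\<bar> \<le> \<eta> * (e / 2)" if r: "r \<in> {0..\<eta>}" for r
    proof -
      have "integral {0..\<eta>} (\<lambda>r'. D (t + r) (t + r')) \<le> \<eta> * (D t t + e / 2)"
      proof (rule integral_const_le)
        show "continuous_on {0..\<eta>} (\<lambda>r'. D (t + r) (t + r'))" by (intro cD continuous_intros)
        show "0 \<le> \<eta>" using \<eta> by simp
        fix y assume "y \<in> {0..\<eta>}"
        from *[OF r this] show "D (t + r) (t + y) \<le> D t t + e / 2" by linarith
      qed
      moreover have "integral {0..\<eta>} (\<lambda>r'. - D (t + r) (t + r')) \<le> \<eta> * (- D t t + e / 2)"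
      proof (rule integral_const_le)
        show "continuous_on {0..\<eta>} (\<lambda>r'. - D (t + r) (t + r'))" by (intro continuous_on_minus cD continuous_intros)
        show "0 \<le> \<eta>" using \<eta> by simp
        fix y assume "y \<in> {0..\<eta>}"
        from *[OF r this] show "- D (t + r) (t + y) \<le> - D t t + e / 2" by linarith
      qed
      ultimately show ?thesis unfolding abs_le_iff by (simp add: algebra_simps)
    qed
    have ci: "continuous_on {0..\<eta>} (\<lambda>r. integral {0..\<eta>} (\<lambda>r'. D (t + r) (t + r')))"
      by (rule continuous_on_subset[OF cI]) (auto intro!: continuous_intros)
    have "M t \<le> \<eta> * (\<eta> * D t t + \<eta> * (e / 2))" unfolding M_def
    proof (rule integral_const_le[OF ci])
      fix y assume "y \<in> {0..\<eta>}"
      from i1[OF this] show "integral {0..\<eta>} (\<lambda>r'. D (t + y) (t + r')) \<le> \<eta> * D t t + \<eta> * (e / 2)" by linarith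
    qed (use \<eta> in simp)
    moreover have "integral {0..\<eta>} (\<lambda>r. - integral {0..\<eta>} (\<lambda>r'. D (t + r) (t + r'))) \<le> \<eta> * (- (\<eta> * D t t) + \<eta> * (e / 2))"
    proof (rule integral_const_le[OF continuous_on_minus[OF ci]])
      fix y assume "y \<in> {0..\<eta>}"
      from i1[OF this] show "- integral {0..\<eta>} (\<lambda>r'. D (t + y) (t + r')) \<le> - (\<eta> * D t t) + \<eta> * (e / 2)" by linarith
    qed (use \<eta> in simp)
    then have "- M t \<le> \<eta> * (- (\<eta> * D t t) + \<eta> * (e / 2))" by (simp add: M_def)
    ultimately show ?thesis unfolding abs_le_iff by (simp add: algebra_simps)
  qed
  have "\<eta> * (\<eta> * D t1 t1) \<le> M t1 + \<eta> * (\<eta> * (e / 2))" "M t0 \<le> \<eta> * (\<eta> * D t0 t0) + \<eta> * (\<eta> * (e / 2))"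
    using Mb[OF t(2) order_refl] Mb[OF order_refl t(2)] unfolding abs_le_iff by linarith+
  then have "\<eta> * (\<eta> * D t1 t1) \<le> \<eta> * (\<eta> * (D t0 t0 + e))" using M by (simp add: algebra_simps)
  then show "D t1 t1 \<le> D t0 t0 + e" using \<eta> by simp
qed

section \<open>Comparison of two flows in L^1\<close>

definition clip :: "real \<Rightarrow> real \<Rightarrow> real" where "clip \<delta> y = max 0 (min (y / \<delta>) 1)"

lemma clip_bounds [simp]: "0 \<le> clip \<delta> y" "clip \<delta> y \<le> 1"
  by (auto simp: clip_def)

lemma clip_mono: "\<delta> > 0 \<Longrightarrow> y \<le> y' \<Longrightarrow> clip \<delta> y \<le> clip \<delta> y'"
  unfolding clip_def by (intro max.mono min.mono divide_right_mono) auto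

lemma clip_lip: "\<delta> > 0 \<Longrightarrow> \<bar>clip \<delta> y - clip \<delta> y'\<bar> \<le> 1 / \<delta> * \<bar>y - y'\<bar>"
proof -
  assume d: "\<delta> > 0"
  have "\<bar>clip \<delta> y - clip \<delta> y'\<bar> \<le> \<bar>y / \<delta> - y' / \<delta>\<bar>" unfolding clip_def by linarith
  also have "\<dots> = 1 / \<delta> * \<bar>y - y'\<bar>" using d by (simp add: diff_divide_distrib[symmetric])
  finally show ?thesis .
qed

lemma clip_le: "\<delta> > 0 \<Longrightarrow> 0 \<le> r \<Longrightarrow> y \<le> r \<Longrightarrow> clip \<delta> y \<le> 1 / \<delta> * r"
  unfolding clip_def by (simp add: divide_right_mono min.coboundedI1)

lemma clip_measurable [measurable]: "clip \<delta> \<in> borel_measurable borel"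
  unfolding clip_def by measurable

lemma clip_tendsto: "(\<lambda>k. clip (1 / real (Suc k)) y) \<longlonglongrightarrow> (if 0 < y then 1 else 0)"
proof (cases "0 < y")
  case True
  have "\<forall>\<^sub>F k in sequentially. clip (1 / real (Suc k)) y = 1"
    using eventually_ge_at_top[of "nat \<lceil>1 / y\<rceil>"]
  proof eventually_elim
    case (elim k)
    then have "1 / y \<le> real (Suc k)" by linarith
    then have "1 \<le> y * real (Suc k)" using True by (simp add: field_simps)
    then show ?case by (simp add: clip_def)
  qed
  then show ?thesis using True by (simp add: tendsto_eventually)
next
  case False
  then have "clip (1 / real (Suc k)) y = 0" for k
  proof -
    have "y / (1 / real (Suc k)) \<le> 0" using False by (intro divide_nonpos_pos) auto
    then show ?thesis by (simp only: clip_def max_def min_def) auto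
  qed
  then show ?thesis using False by simp
qed

text \<open>In the application \<open>\<kappa> = \<phi> e2 - \<phi> e1\<close>, so that \<open>A.fl t x - \<kappa> - B.fl t' x\<close> is
  \<open>\<phi> (v1 t x + e1) - \<phi> (v2 t' x + e2)\<close>.\<close>

locale two_flows = A: frac_flow s C L1 F1 v1 + B: frac_flow s C L2 F2 v2
  for s C L1 L2 :: real and F1 F2 :: "real \<Rightarrow> real" and v1 v2 :: "real \<Rightarrow> 'a::euclidean_space \<Rightarrow> real" +
  fixes \<kappa> e1 e2 :: real
  assumes \<kappa>: "0 \<le> \<kappa>" and e12: "e1 \<le> e2"
    and order: "\<And>r r'. 0 \<le> r \<Longrightarrow> 0 \<le> r' \<Longrightarrow> 0 < F1 r - \<kappa> - F2 r' \<longleftrightarrow> r' + e2 < r + e1"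
begin

definition psi where "psi \<delta> t t' x = clip \<delta> (A.fl t x - \<kappa> - B.fl t' x)"

text \<open>The entropy densities of the two flows, each with the other solution frozen at its own
  time. For the second flow the test function is \<open>- psi\<close>, because it is the negative of
  \<open>clip\<close> that is nondecreasing in the potential of \<open>v2\<close>.\<close>

definition J1 where "J1 \<delta> t' x r = (\<integral>\<sigma>. (if 0 \<le> \<sigma> \<and> \<sigma> \<le> r then clip \<delta> (F1 \<sigma> - \<kappa> - B.fl t' x) else 0) \<partial>lborel)"
definition J2 where "J2 \<delta> t x r = (\<integral>\<sigma>. (if 0 \<le> \<sigma> \<and> \<sigma> \<le> r then - clip \<delta> (A.fl t x - \<kappa> - F2 \<sigma>) else 0) \<partial>lborel)"
definition JJ1 where "JJ1 \<delta> t' t = (\<integral>x. J1 \<delta> t' x (v1 t x) \<partial>lborel)"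
definition JJ2 where "JJ2 \<delta> t t' = (\<integral>x. J2 \<delta> t x (v2 t' x) \<partial>lborel)"
definition DD where "DD t t' = (\<integral>x. max 0 (v1 t x + e1 - (v2 t' x + e2)) \<partial>lborel)"

lemma flow_entropy_fst:
  assumes d: "\<delta> > 0" and g: "gag s (B.fl t') < \<infinity>"
  shows "flow_entropy s C L1 F1 v1 (\<lambda>x r. clip \<delta> (r - \<kappa> - B.fl t' x)) (B.fl t') (\<lambda>_. 0) 1 (1 / \<delta>)"
proof unfold_locales
  show "\<bar>clip \<delta> (r - \<kappa> - B.fl t' x) - clip \<delta> (r' - \<kappa> - B.fl t' y)\<bar> \<le> 1 / \<delta> * (\<bar>r - r'\<bar> + \<bar>B.fl t' x - B.fl t' y\<bar>)" for x y r r'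
    using d by (intro order_trans[OF clip_lip[OF d]] mult_left_mono) auto
  show "\<bar>clip \<delta> (r - \<kappa> - B.fl t' x)\<bar> \<le> 1 / \<delta> * r + 0" if "0 \<le> r" for x r
    using clip_le[OF d that, of "r - \<kappa> - B.fl t' x"] \<kappa> B.fl_nonneg[of t' x] by simp
  show "\<bar>clip \<delta> (r - \<kappa> - B.fl t' x)\<bar> \<le> 1" for x r by (simp add: abs_of_nonneg)
  show "r \<le> r' \<Longrightarrow> clip \<delta> (r - \<kappa> - B.fl t' x) \<le> clip \<delta> (r' - \<kappa> - B.fl t' x)" for x r r'
    by (intro clip_mono d) simp
  show "gag s (B.fl t') < \<infinity>" by fact
qed (use d in auto)

text \<open>This test function need not vanish where the second solution does; its values are
  dominated there by \<open>A.fl t\<close> divided by \<open>\<delta>\<close>, which supplies the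
  \<open>g\<close> of the locale.\<close>

lemma flow_entropy_snd:
  assumes d: "\<delta> > 0" and g: "gag s (A.fl t) < \<infinity>"
  shows "flow_entropy s C L2 F2 v2 (\<lambda>x r. - clip \<delta> (A.fl t x - \<kappa> - r)) (A.fl t) (\<lambda>x. 1 / \<delta> * A.fl t x) 1 (1 / \<delta>)"
proof unfold_locales
  show "\<bar>- clip \<delta> (A.fl t x - \<kappa> - r) - - clip \<delta> (A.fl t y - \<kappa> - r')\<bar> \<le> 1 / \<delta> * (\<bar>r - r'\<bar> + \<bar>A.fl t x - A.fl t y\<bar>)" for x y r r'
  proof -
    have "\<bar>clip \<delta> (A.fl t x - \<kappa> - r) - clip \<delta> (A.fl t y - \<kappa> - r')\<bar> \<le> 1 / \<delta> * (\<bar>r - r'\<bar> + \<bar>A.fl t x - A.fl t y\<bar>)"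
      using d by (intro order_trans[OF clip_lip[OF d]] mult_left_mono) auto
    then show ?thesis by (simp add: abs_minus_commute)
  qed
  show "\<bar>- clip \<delta> (A.fl t x - \<kappa> - r)\<bar> \<le> 1 / \<delta> * r + 1 / \<delta> * A.fl t x" if "0 \<le> r" for x r
    using clip_le[OF d A.fl_nonneg, of "A.fl t x - \<kappa> - r" t x] \<kappa> that d by (simp add: add_increasing)
  show "\<bar>- clip \<delta> (A.fl t x - \<kappa> - r)\<bar> \<le> 1" for x r by (simp add: abs_of_nonneg)
  show "r \<le> r' \<Longrightarrow> - clip \<delta> (A.fl t x - \<kappa> - r) \<le> - clip \<delta> (A.fl t x - \<kappa> - r')" for x r r'
    using clip_mono[OF d, of "A.fl t x - \<kappa> - r'" "A.fl t x - \<kappa> - r"] by simp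
  show "gag s (A.fl t) < \<infinity>" by fact
  show "integrable lborel (\<lambda>x. 1 / \<delta> * A.fl t x)" using A.fl_int by simp
qed (use d in auto)

lemma psi_meas [measurable]: "(\<lambda>p. psi \<delta> (f p) (g p) (h p)) \<in> borel_measurable M"
  if [measurable]: "f \<in> borel_measurable M" "g \<in> borel_measurable M" "h \<in> M \<rightarrow>\<^sub>M borel"
  unfolding psi_def by measurable

lemma entropy_fst:
  assumes d: "\<delta> > 0" and g: "gag s (B.fl t') < \<infinity>" and ab: "0 < a" "a < b"
  shows "JJ1 \<delta> t' b - JJ1 \<delta> t' a \<le> - C * (\<integral>t. gform s (A.fl t) (psi \<delta> t t') \<partial>tm a b)"
proof -
  note fe = flow_entropy_fst[OF d g]
  have "flow_entropy.JJ F1 v1 (\<lambda>x r. clip \<delta> (r - \<kappa> - B.fl t' x)) t = JJ1 \<delta> t' t" for t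
    by (simp add: flow_entropy.JJ_def[OF fe] flow_entropy.Jq_def[OF fe] JJ1_def J1_def)
  moreover have "flow_entropy.Psi F1 v1 (\<lambda>x r. clip \<delta> (r - \<kappa> - B.fl t' x)) t = psi \<delta> t t'" for t
    by (simp add: flow_entropy.Psi_def[OF fe] psi_def fun_eq_iff)
  ultimately show ?thesis using flow_entropy.entropy[OF fe ab] by simp
qed

lemma entropy_snd:
  assumes d: "\<delta> > 0" and g: "gag s (A.fl t) < \<infinity>" and ab: "0 < a" "a < b"
  shows "JJ2 \<delta> t b - JJ2 \<delta> t a \<le> C * (\<integral>t'. gform s (B.fl t') (psi \<delta> t t') \<partial>tm a b)"
proof -
  note fe = flow_entropy_snd[OF d g]
  have "flow_entropy.JJ F2 v2 (\<lambda>x r. - clip \<delta> (A.fl t x - \<kappa> - r)) t' = JJ2 \<delta> t t'" for t'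
    by (simp add: flow_entropy.JJ_def[OF fe] flow_entropy.Jq_def[OF fe] JJ2_def J2_def)
  moreover have "flow_entropy.Psi F2 v2 (\<lambda>x r. - clip \<delta> (A.fl t x - \<kappa> - r)) t' = (\<lambda>x. - psi \<delta> t t' x)" for t'
    by (simp add: flow_entropy.Psi_def[OF fe] psi_def fun_eq_iff)
  moreover have "gform s f (\<lambda>x. - p x) = - gform s f p" for f p :: "'a \<Rightarrow> real"
    unfolding gform_def dif_def by (subst integral_minus[symmetric]) (simp add: algebra_simps)
  ultimately show ?thesis using flow_entropy.entropy[OF fe ab] by simp
qed

lemma J1_meas [measurable]: "(\<lambda>p. J1 \<delta> (f p) (g p) (h p)) \<in> borel_measurable M"
  if [measurable]: "f \<in> borel_measurable M" "g \<in> M \<rightarrow>\<^sub>M borel" "h \<in> borel_measurable M"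
  unfolding J1_def by measurable

lemma J2_meas [measurable]: "(\<lambda>p. J2 \<delta> (f p) (g p) (h p)) \<in> borel_measurable M"
  if [measurable]: "f \<in> borel_measurable M" "g \<in> M \<rightarrow>\<^sub>M borel" "h \<in> borel_measurable M"
  unfolding J2_def by measurable

lemma JJ_meas [measurable]: "(\<lambda>t'. JJ1 \<delta> t' t) \<in> borel_measurable borel" "(\<lambda>t. JJ2 \<delta> t t') \<in> borel_measurable borel"
  unfolding JJ1_def JJ2_def by measurable

lemma DD_meas [measurable]: "(\<lambda>t'. DD t t') \<in> borel_measurable borel" "(\<lambda>t. DD t t') \<in> borel_measurable borel"
  unfolding DD_def by measurable

lemma abs_integral_unit_le:
  fixes f :: "real \<Rightarrow> real"
  assumes "0 \<le> r" "\<And>\<sigma>. \<bar>f \<sigma>\<bar> \<le> indicator {0..r} \<sigma>" and [measurable]: "f \<in> borel_measurable borel"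
  shows "\<bar>\<integral>\<sigma>. f \<sigma> \<partial>lborel\<bar> \<le> r"
proof -
  have i: "integrable lborel (indicator {0..r} :: real \<Rightarrow> real)" by (intro integrable_real_indicator) (auto simp: emeasure_lborel_Icc_eq)
  have "\<bar>\<integral>\<sigma>. f \<sigma> \<partial>lborel\<bar> \<le> (\<integral>\<sigma>. indicator {0..r} \<sigma> \<partial>lborel)"
    using assms by (intro order_trans[OF integral_abs_bound integral_mono'] i) auto
  then show ?thesis using assms by simp
qed

lemma J_abs_le:
  assumes "0 \<le> r" shows "\<bar>J1 \<delta> t' x r\<bar> \<le> r" "\<bar>J2 \<delta> t x r\<bar> \<le> r"
  unfolding J1_def J2_def using assms by (intro abs_integral_unit_le; auto simp: indicator_def abs_of_nonneg)+

lemma JJ_abs_le: "\<bar>JJ1 \<delta> t' t\<bar> \<le> (\<integral>x. v1 t x \<partial>lborel)" "\<bar>JJ2 \<delta> t t'\<bar> \<le> (\<integral>x. v2 t' x \<partial>lborel)"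
  unfolding JJ1_def JJ2_def
  by (intro order_trans[OF integral_abs_bound integral_mono'] A.v_int B.v_int; auto intro: J_abs_le)+

text \<open>\<open>clip\<close> tends to the indicator of the positive numbers, and
  \<open>order\<close> turns positivity of the potential difference into \<sigma> + e1 > v2 + e2.
  Since e1 \<le> e2 the threshold \<open>?m\<close> is nonnegative, so nothing is cut off at
  0.\<close>

lemma J1_tendsto:
  assumes "0 \<le> r"
  shows "(\<lambda>k. J1 (1 / real (Suc k)) t' x r) \<longlonglongrightarrow> max 0 (r + e1 - (v2 t' x + e2))"
proof -
  let ?m = "v2 t' x + e2 - e1"
  have m: "0 \<le> ?m" using e12 by (simp add: add_increasing)
  have "(\<lambda>k. J1 (1 / real (Suc k)) t' x r) \<longlonglongrightarrow> (\<integral>\<sigma>. indicator {?m<..r} \<sigma> \<partial>lborel)"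
    unfolding J1_def
  proof (rule integral_dominated_convergence[where w = "indicator {0..r}"])
    show "AE \<sigma> in lborel. (\<lambda>k. if 0 \<le> \<sigma> \<and> \<sigma> \<le> r then clip (1 / real (Suc k)) (F1 \<sigma> - \<kappa> - B.fl t' x) else 0) \<longlonglongrightarrow> indicator {?m<..r} \<sigma>"
    proof (rule AE_I2)
      fix \<sigma> :: real
      show "(\<lambda>k. if 0 \<le> \<sigma> \<and> \<sigma> \<le> r then clip (1 / real (Suc k)) (F1 \<sigma> - \<kappa> - B.fl t' x) else 0) \<longlonglongrightarrow> indicator {?m<..r} \<sigma>"
      proof (cases "0 \<le> \<sigma> \<and> \<sigma> \<le> r")
        case True
        have "(0 < F1 \<sigma> - \<kappa> - B.fl t' x) \<longleftrightarrow> ?m < \<sigma>"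
          using order[of \<sigma> "v2 t' x"] True by (auto simp: B.fl_def)
        then have "indicator {?m<..r} \<sigma> = (if 0 < F1 \<sigma> - \<kappa> - B.fl t' x then 1 else 0 :: real)"
          using True by (auto simp: indicator_def)
        then show ?thesis using True clip_tendsto[of "F1 \<sigma> - \<kappa> - B.fl t' x"] by simp
      qed (use m in \<open>auto simp: indicator_def\<close>)
    qed
    show "integrable lborel (indicator {0..r} :: real \<Rightarrow> real)" by (intro integrable_real_indicator) (auto simp: emeasure_lborel_Icc_eq)
    show "AE \<sigma> in lborel. norm (if 0 \<le> \<sigma> \<and> \<sigma> \<le> r then clip (1 / real (Suc k)) (F1 \<sigma> - \<kappa> - B.fl t' x) else 0) \<le> indicator {0..r} \<sigma>" for k
      by (auto simp: indicator_def abs_of_nonneg intro!: AE_I2)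
  qed measurable
  also have "(\<integral>\<sigma>. indicator {?m<..r} \<sigma> \<partial>lborel) = max 0 (r + e1 - (v2 t' x + e2))"
    by (cases "?m \<le> r") (auto simp: max_def)
  finally show ?thesis .
qed

text \<open>Discarding the single value \<sigma> = \<open>?m\<close> turns the strict inequality
  from \<open>order\<close> into a weak one. Here \<open>?m\<close> may be negative, whence the
  outer maximum.\<close>

lemma J2_tendsto:
  assumes "0 \<le> r"
  shows "(\<lambda>k. J2 (1 / real (Suc k)) t x r) \<longlonglongrightarrow> - max 0 (min r (v1 t x + e1 - e2))"
proof -
  let ?m = "v1 t x + e1 - e2"
  have "(\<lambda>k. J2 (1 / real (Suc k)) t x r) \<longlonglongrightarrow> (\<integral>\<sigma>. - indicator {0..min r ?m} \<sigma> \<partial>lborel)"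
    unfolding J2_def
  proof (rule integral_dominated_convergence[where w = "indicator {0..r}"])
    show "AE \<sigma> in lborel. (\<lambda>k. if 0 \<le> \<sigma> \<and> \<sigma> \<le> r then - clip (1 / real (Suc k)) (A.fl t x - \<kappa> - F2 \<sigma>) else 0) \<longlonglongrightarrow> - indicator {0..min r ?m} \<sigma>"
      using AE_lborel_singleton[of ?m]
    proof eventually_elim
      case (elim \<sigma>)
      show "(\<lambda>k. if 0 \<le> \<sigma> \<and> \<sigma> \<le> r then - clip (1 / real (Suc k)) (A.fl t x - \<kappa> - F2 \<sigma>) else 0) \<longlonglongrightarrow> - indicator {0..min r ?m} \<sigma>"
      proof (cases "0 \<le> \<sigma> \<and> \<sigma> \<le> r")
        case True
        have "(0 < A.fl t x - \<kappa> - F2 \<sigma>) \<longleftrightarrow> \<sigma> \<le> ?m"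
          using order[of "v1 t x" \<sigma>] True elim by (auto simp: A.fl_def)
        then have "indicator {0..min r ?m} \<sigma> = (if 0 < A.fl t x - \<kappa> - F2 \<sigma> then 1 else 0 :: real)"
          using True by (auto simp: indicator_def)
        then show ?thesis using True tendsto_minus[OF clip_tendsto[of "A.fl t x - \<kappa> - F2 \<sigma>"]] by simp
      qed (auto simp: indicator_def)
    qed
    show "integrable lborel (indicator {0..r} :: real \<Rightarrow> real)" by (intro integrable_real_indicator) (auto simp: emeasure_lborel_Icc_eq)
    show "AE \<sigma> in lborel. norm (if 0 \<le> \<sigma> \<and> \<sigma> \<le> r then - clip (1 / real (Suc k)) (A.fl t x - \<kappa> - F2 \<sigma>) else 0) \<le> indicator {0..r} \<sigma>" for k
      by (auto simp: indicator_def abs_of_nonneg intro!: AE_I2)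
  qed measurable
  also have "(\<integral>\<sigma>. - indicator {0..min r ?m} \<sigma> \<partial>lborel) = - max 0 (min r ?m)"
    by (cases "0 \<le> min r ?m") (auto simp: max_def)
  finally show ?thesis .
qed

definition excess where "excess t = (\<integral>x. max 0 (v1 t x + e1 - e2) \<partial>lborel)"

lemma DD_int: "integrable lborel (\<lambda>x. max 0 (v1 t x + e1 - (v2 t' x + e2)))"
proof (rule Bochner_Integration.integrable_bound[OF A.v_int[of t]])
  show "AE x in lborel. norm (max 0 (v1 t x + e1 - (v2 t' x + e2))) \<le> norm (v1 t x)"
  proof (rule AE_I2)
    fix x show "norm (max 0 (v1 t x + e1 - (v2 t' x + e2))) \<le> norm (v1 t x)"
      using A.v_nonneg[of t x] B.v_nonneg[of t' x] e12 unfolding real_norm_def max_def abs_if by (smt (verit))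
  qed
qed measurable

lemma JJ1_tendsto: "(\<lambda>k. JJ1 (1 / real (Suc k)) t' t) \<longlonglongrightarrow> DD t t'"
  unfolding JJ1_def DD_def
proof (rule integral_dominated_convergence[where w = "v1 t"])
  show "AE x in lborel. (\<lambda>k. J1 (1 / real (Suc k)) t' x (v1 t x)) \<longlonglongrightarrow> max 0 (v1 t x + e1 - (v2 t' x + e2))"
    by (intro AE_I2 J1_tendsto A.v_nonneg)
  show "AE x in lborel. norm (J1 (1 / real (Suc k)) t' x (v1 t x)) \<le> v1 t x" for k
    unfolding real_norm_def by (intro AE_I2 J_abs_le A.v_nonneg)
  show "(\<lambda>x. J1 (1 / real (Suc k)) t' x (v1 t x)) \<in> borel_measurable lborel" for k
    by (rule J1_meas) auto
  show "(\<lambda>x. max 0 (v1 t x + e1 - (v2 t' x + e2))) \<in> borel_measurable lborel"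
    by simp
  show "integrable lborel (v1 t)" by (rule A.v_int)
qed

lemma JJ2_tendsto: "(\<lambda>k. JJ2 (1 / real (Suc k)) t t') \<longlonglongrightarrow> DD t t' - excess t"
proof -
  have i: "integrable lborel (\<lambda>x. max 0 (v1 t x + e1 - e2))"
    by (rule Bochner_Integration.integrable_bound[OF A.v_int[of t]])
       (use e12 A.v_nonneg in \<open>auto intro!: AE_I2 simp: max_def\<close>)
  have eq: "- max 0 (min (v2 t' x) (v1 t x + e1 - e2)) = max 0 (v1 t x + e1 - (v2 t' x + e2)) - max 0 (v1 t x + e1 - e2)" for x
    using B.v_nonneg[of t' x] unfolding max_def min_def by (smt (verit))
  have "(\<lambda>k. JJ2 (1 / real (Suc k)) t t') \<longlonglongrightarrow> (\<integral>x. - max 0 (min (v2 t' x) (v1 t x + e1 - e2)) \<partial>lborel)"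
    unfolding JJ2_def
  proof (rule integral_dominated_convergence[where w = "v2 t'"])
    show "AE x in lborel. (\<lambda>k. J2 (1 / real (Suc k)) t x (v2 t' x)) \<longlonglongrightarrow> - max 0 (min (v2 t' x) (v1 t x + e1 - e2))"
      by (intro AE_I2 J2_tendsto B.v_nonneg)
    show "AE x in lborel. norm (J2 (1 / real (Suc k)) t x (v2 t' x)) \<le> v2 t' x" for k
      unfolding real_norm_def by (intro AE_I2 J_abs_le B.v_nonneg)
    show "(\<lambda>x. J2 (1 / real (Suc k)) t x (v2 t' x)) \<in> borel_measurable lborel" for k
      by (rule J2_meas) auto
    show "(\<lambda>x. - max 0 (min (v2 t' x) (v1 t x + e1 - e2))) \<in> borel_measurable lborel"
      by simp
    show "integrable lborel (v2 t')" by (rule B.v_int)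
  qed
  moreover have "(\<integral>x. - max 0 (min (v2 t' x) (v1 t x + e1 - e2)) \<partial>lborel) = DD t t' - excess t"
    unfolding eq DD_def excess_def by (rule Bochner_Integration.integral_diff[OF DD_int i])
  ultimately show ?thesis by simp
qed

lemma psi_gag_le: "\<delta> > 0 \<Longrightarrow> gag s (psi \<delta> t t') \<le> ennreal (2 * (1 / \<delta>)\<^sup>2) * (gag s (A.fl t) + gag s (B.fl t'))"
proof (rule gag_bound2)
  assume d: "\<delta> > 0"
  show "\<bar>psi \<delta> t t' x - psi \<delta> t t' y\<bar> \<le> 1 / \<delta> * (\<bar>A.fl t x - A.fl t y\<bar> + \<bar>B.fl t' x - B.fl t' y\<bar>)" for x y
    unfolding psi_def using d by (intro order_trans[OF clip_lip[OF d]] mult_left_mono) auto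
qed auto

text \<open>The right side minus the left is the form of \<open>A.fl t - B.fl t'\<close> with a
  nondecreasing function of itself, the constant \<open>\<kappa>\<close> dropping out of
  differences.\<close>

lemma gform_le_psi:
  assumes d: "\<delta> > 0" and g: "gag s (A.fl t) < \<infinity>" "gag s (B.fl t') < \<infinity>"
  shows "gform s (B.fl t') (psi \<delta> t t') \<le> gform s (A.fl t) (psi \<delta> t t')"
proof -
  have gp: "gag s (psi \<delta> t t') < \<infinity>"
    using g by (intro le_less_trans[OF psi_gag_le[OF d]]) (auto simp: ennreal_mult_less_top)
  show ?thesis unfolding gform_def
  proof (intro Bochner_Integration.integral_mono gform_integrable g gp)
    fix z :: "'a \<times> 'a"
    let ?a = "\<lambda>x. A.fl t x - \<kappa> - B.fl t' x"
    have "0 \<le> (?a (fst z) - ?a (snd z)) * (clip \<delta> (?a (fst z)) - clip \<delta> (?a (snd z)))"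
    proof (cases "?a (snd z) \<le> ?a (fst z)")
      case True then show ?thesis using clip_mono[OF d True] by (intro mult_nonneg_nonneg) auto
    next
      case False then show ?thesis using clip_mono[OF d, of "?a (fst z)" "?a (snd z)"] by (intro mult_nonpos_nonpos) auto
    qed
    then show "dif (B.fl t') z * dif (psi \<delta> t t') z \<le> dif (A.fl t) z * dif (psi \<delta> t t') z"
      by (simp add: dif_def psi_def algebra_simps)
  qed auto
qed

lemma prod_integrable:
  assumes d: "\<delta> > 0" and ab: "0 < a" "a < b" "0 < a'" "a' < b'"
  shows "integrable (tm a b \<Otimes>\<^sub>M tm a' b') (\<lambda>(t, t'). gform s (A.fl t) (psi \<delta> t t'))"
    "integrable (tm a b \<Otimes>\<^sub>M tm a' b') (\<lambda>(t, t'). gform s (B.fl t') (psi \<delta> t t'))"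
proof -
  interpret T: sigma_finite_measure "tm a b" by (rule sigma_finite_tm)
  interpret R: sigma_finite_measure "tm a' b'" by (rule sigma_finite_tm)
  interpret P: pair_sigma_finite "tm a b" "tm a' b'" by unfold_locales
  let ?M = "tm a b \<Otimes>\<^sub>M tm a' b'"
  let ?K = "ennreal (2 * (1 / \<delta>)\<^sup>2)"
  have [measurable]: "(\<lambda>p. gform s (A.fl (fst p)) (psi \<delta> (fst p) (snd p))) \<in> borel_measurable (borel \<Otimes>\<^sub>M borel)"
    "(\<lambda>p. gform s (B.fl (snd p)) (psi \<delta> (fst p) (snd p))) \<in> borel_measurable (borel \<Otimes>\<^sub>M borel)"
    by (rule gform_measurable; measurable)+
  have [measurable]: "(\<lambda>t. gag s (A.fl t)) \<in> borel_measurable borel" "(\<lambda>t. gag s (B.fl t)) \<in> borel_measurable borel"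
    by (rule gag_measurable; measurable)+
  have fin: "(\<integral>\<^sup>+p. (gag s (A.fl (fst p)) + gag s (B.fl (snd p))) + ?K * (gag s (A.fl (fst p)) + gag s (B.fl (snd p))) \<partial>?M) < \<infinity>"
  proof -
    have 1: "(\<integral>\<^sup>+p. gag s (A.fl (fst p)) \<partial>?M) = (\<integral>\<^sup>+t. gag s (A.fl t) \<partial>tm a b) * ennreal (b' - a')"
      using ab by (subst R.nn_integral_fst[symmetric]) (simp_all add: nn_integral_multc)
    have 2: "(\<integral>\<^sup>+p. gag s (B.fl (snd p)) \<partial>?M) = (\<integral>\<^sup>+t. gag s (B.fl t) \<partial>tm a' b') * ennreal (b - a)"
      using ab by (subst R.nn_integral_fst[symmetric]) (simp_all add: nn_integral_multc)
    have "(\<integral>\<^sup>+p. (gag s (A.fl (fst p)) + gag s (B.fl (snd p))) + ?K * (gag s (A.fl (fst p)) + gag s (B.fl (snd p))) \<partial>?M)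
      = ((\<integral>\<^sup>+p. gag s (A.fl (fst p)) \<partial>?M) + (\<integral>\<^sup>+p. gag s (B.fl (snd p)) \<partial>?M)) + ?K * ((\<integral>\<^sup>+p. gag s (A.fl (fst p)) \<partial>?M) + (\<integral>\<^sup>+p. gag s (B.fl (snd p)) \<partial>?M))"
      by (simp add: nn_integral_add nn_integral_cmult)
    also have "\<dots> < \<infinity>" unfolding 1 2 using A.fl_gag_fin[OF ab(1), of b] B.fl_gag_fin[OF ab(3), of b']
      by (auto simp: ennreal_mult_less_top)
    finally show ?thesis .
  qed
  have bA: "ennreal \<bar>gform s (A.fl t) (psi \<delta> t t')\<bar> \<le> (gag s (A.fl t) + gag s (B.fl t')) + ?K * (gag s (A.fl t) + gag s (B.fl t'))" for t t'
  proof (rule order_trans[OF ennreal_abs_gform_le])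
    show "gag s (A.fl t) + gag s (psi \<delta> t t') \<le> (gag s (A.fl t) + gag s (B.fl t')) + ?K * (gag s (A.fl t) + gag s (B.fl t'))"
      by (intro add_mono psi_gag_le[OF d]) simp
  qed measurable
  have bB: "ennreal \<bar>gform s (B.fl t') (psi \<delta> t t')\<bar> \<le> (gag s (A.fl t) + gag s (B.fl t')) + ?K * (gag s (A.fl t) + gag s (B.fl t'))" for t t'
  proof (rule order_trans[OF ennreal_abs_gform_le])
    show "gag s (B.fl t') + gag s (psi \<delta> t t') \<le> (gag s (A.fl t) + gag s (B.fl t')) + ?K * (gag s (A.fl t) + gag s (B.fl t'))"
      by (intro add_mono psi_gag_le[OF d]) simp
  qed measurable
  show "integrable ?M (\<lambda>(t, t'). gform s (A.fl t) (psi \<delta> t t'))"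
    by (rule integrableI_bounded) (auto simp: case_prod_unfold intro!: le_less_trans[OF nn_integral_mono fin[unfolded infinity_ennreal_def]] bA)
  show "integrable ?M (\<lambda>(t, t'). gform s (B.fl t') (psi \<delta> t t'))"
    by (rule integrableI_bounded) (auto simp: case_prod_unfold intro!: le_less_trans[OF nn_integral_mono fin[unfolded infinity_ennreal_def]] bB)
qed

lemma AE_gag_finite:
  assumes "0 < a"
  shows "AE t in tm a b. gag s (A.fl t) < \<infinity>" "AE t in tm a b. gag s (B.fl t) < \<infinity>"
proof -
  have [measurable]: "(\<lambda>t. gag s (A.fl t)) \<in> borel_measurable borel" "(\<lambda>t. gag s (B.fl t)) \<in> borel_measurable borel"
    by (rule gag_measurable; measurable)+
  have "AE t in tm a b. gag s (A.fl t) \<noteq> \<infinity>"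
    using A.fl_gag_fin[OF assms, of b] by (intro nn_integral_PInf_AE) auto
  moreover have "AE t in tm a b. gag s (B.fl t) \<noteq> \<infinity>"
    using B.fl_gag_fin[OF assms, of b] by (intro nn_integral_PInf_AE) auto
  ultimately show "AE t in tm a b. gag s (A.fl t) < \<infinity>" "AE t in tm a b. gag s (B.fl t) < \<infinity>"
    by (auto simp: less_top)
qed

lemma JJ_tm_int: "integrable (tm a b) (\<lambda>t'. JJ1 \<delta> t' t)" "integrable (tm a b) (\<lambda>t. JJ2 \<delta> t t')"
proof -
  interpret finite_measure "tm a b" by (rule finite_tm)
  show "integrable (tm a b) (\<lambda>t'. JJ1 \<delta> t' t)"
    by (rule integrable_const_bound[where B = "\<integral>x. v1 t x \<partial>lborel"]) (auto simp: JJ_abs_le)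
  show "integrable (tm a b) (\<lambda>t. JJ2 \<delta> t t')"
    by (rule integrable_const_bound[where B = "\<integral>x. v2 t' x \<partial>lborel"]) (auto simp: JJ_abs_le)
qed

text \<open>Each entropy inequality is integrated over the time frozen in it, and the two are added.
  The dissipation terms then live on the same rectangle of pairs of times, where
  \<open>gform_le_psi\<close> makes their sum nonpositive. With independent times, each solution is
  a fixed function of the point for the equation of the other.\<close>

lemma rectangle_delta:
  assumes d: "\<delta> > 0" and ab: "0 < a" "a < b" "0 < a'" "a' < b'"
  shows "(\<integral>t'. JJ1 \<delta> t' b - JJ1 \<delta> t' a \<partial>tm a' b') + (\<integral>t. JJ2 \<delta> t b' - JJ2 \<delta> t a' \<partial>tm a b) \<le> 0"
proof -
  interpret T: sigma_finite_measure "tm a b" by (rule sigma_finite_tm)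
  interpret R: sigma_finite_measure "tm a' b'" by (rule sigma_finite_tm)
  interpret P: pair_sigma_finite "tm a b" "tm a' b'" by unfold_locales
  note I = prod_integrable[OF d ab]
  have C: "C > 0" by (rule A.C)
  have "(\<integral>t'. JJ1 \<delta> t' b - JJ1 \<delta> t' a \<partial>tm a' b') \<le> (\<integral>t'. - C * (\<integral>t. gform s (A.fl t) (psi \<delta> t t') \<partial>tm a b) \<partial>tm a' b')"
  proof (rule integral_mono_AE)
    show "AE t' in tm a' b'. JJ1 \<delta> t' b - JJ1 \<delta> t' a \<le> - C * (\<integral>t. gform s (A.fl t) (psi \<delta> t t') \<partial>tm a b)"
      using AE_gag_finite(2)[OF ab(3)] by eventually_elim (rule entropy_fst[OF d _ ab(1,2)])
    show "integrable (tm a' b') (\<lambda>t'. - C * (\<integral>t. gform s (A.fl t) (psi \<delta> t t') \<partial>tm a b))"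
      by (intro integrable_mult_right P.integrable_snd I(1))
  qed (intro Bochner_Integration.integrable_diff JJ_tm_int)
  also have "\<dots> = - C * (\<integral>p. (case p of (t, t') \<Rightarrow> gform s (A.fl t) (psi \<delta> t t')) \<partial>(tm a b \<Otimes>\<^sub>M tm a' b'))"
    by (simp add: P.integral_snd[OF I(1)])
  finally have 1: "(\<integral>t'. JJ1 \<delta> t' b - JJ1 \<delta> t' a \<partial>tm a' b') \<le> - C * (\<integral>p. (case p of (t, t') \<Rightarrow> gform s (A.fl t) (psi \<delta> t t')) \<partial>(tm a b \<Otimes>\<^sub>M tm a' b'))" .
  have "(\<integral>t. JJ2 \<delta> t b' - JJ2 \<delta> t a' \<partial>tm a b) \<le> (\<integral>t. C * (\<integral>t'. gform s (B.fl t') (psi \<delta> t t') \<partial>tm a' b') \<partial>tm a b)"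
  proof (rule integral_mono_AE)
    show "AE t in tm a b. JJ2 \<delta> t b' - JJ2 \<delta> t a' \<le> C * (\<integral>t'. gform s (B.fl t') (psi \<delta> t t') \<partial>tm a' b')"
      using AE_gag_finite(1)[OF ab(1)] by eventually_elim (rule entropy_snd[OF d _ ab(3,4)])
    show "integrable (tm a b) (\<lambda>t. C * (\<integral>t'. gform s (B.fl t') (psi \<delta> t t') \<partial>tm a' b'))"
      by (intro integrable_mult_right P.integrable_fst I(2))
  qed (intro Bochner_Integration.integrable_diff JJ_tm_int)
  also have "\<dots> = C * (\<integral>p. (case p of (t, t') \<Rightarrow> gform s (B.fl t') (psi \<delta> t t')) \<partial>(tm a b \<Otimes>\<^sub>M tm a' b'))"
    by (simp add: P.integral_fst[OF I(2)])
  also have "\<dots> \<le> C * (\<integral>p. (case p of (t, t') \<Rightarrow> gform s (A.fl t) (psi \<delta> t t')) \<partial>(tm a b \<Otimes>\<^sub>M tm a' b'))"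
  proof (intro mult_left_mono integral_mono_AE I)
    have [measurable]: "(\<lambda>t. gag s (A.fl t)) \<in> borel_measurable borel" "(\<lambda>t. gag s (B.fl t)) \<in> borel_measurable borel"
      by (rule gag_measurable; measurable)+
    have "AE p in tm a b \<Otimes>\<^sub>M tm a' b'. gag s (A.fl (fst p)) < \<infinity> \<and> gag s (B.fl (snd p)) < \<infinity>"
    proof (rule P.AE_pair_measure)
      show "{p \<in> space (tm a b \<Otimes>\<^sub>M tm a' b'). gag s (A.fl (fst p)) < \<infinity> \<and> gag s (B.fl (snd p)) < \<infinity>} \<in> sets (tm a b \<Otimes>\<^sub>M tm a' b')"
        by measurable
      show "AE x in tm a b. AE y in tm a' b'. gag s (A.fl (fst (x, y))) < \<infinity> \<and> gag s (B.fl (snd (x, y))) < \<infinity>"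
        using AE_gag_finite(1)[OF ab(1), of b]
      proof eventually_elim
        case (elim x)
        show ?case using AE_gag_finite(2)[OF ab(3), of b'] by eventually_elim (use elim in simp)
      qed
    qed
    then show "AE p in tm a b \<Otimes>\<^sub>M tm a' b'. (case p of (t, t') \<Rightarrow> gform s (B.fl t') (psi \<delta> t t')) \<le> (case p of (t, t') \<Rightarrow> gform s (A.fl t) (psi \<delta> t t'))"
      by eventually_elim (auto simp: case_prod_unfold intro!: gform_le_psi d)
  qed (use C in simp)
  finally show ?thesis using 1 by linarith
qed

text \<open>The bounds on \<open>JJ1\<close> and \<open>JJ2\<close> by the masses do not depend on
  \<open>\<delta>\<close>, so the limit passes under the time integrals; the energies have already
  been eliminated.\<close>

lemma rectangle:
  assumes ab: "0 < a" "a < b" "0 < a'" "a' < b'"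
  shows "(\<integral>t'. DD b t' - DD a t' \<partial>tm a' b') + (\<integral>t. DD t b' - DD t a' \<partial>tm a b) \<le> 0"
proof -
  interpret T: finite_measure "tm a b" by (rule finite_tm)
  interpret R: finite_measure "tm a' b'" by (rule finite_tm)
  let ?\<delta> = "\<lambda>k. 1 / real (Suc k)"
  have 1: "(\<lambda>k. \<integral>t'. JJ1 (?\<delta> k) t' b - JJ1 (?\<delta> k) t' a \<partial>tm a' b') \<longlonglongrightarrow> (\<integral>t'. DD b t' - DD a t' \<partial>tm a' b')"
  proof (rule integral_dominated_convergence[where w = "\<lambda>_. (\<integral>x. v1 b x \<partial>lborel) + (\<integral>x. v1 a x \<partial>lborel)"])
    show "AE t' in tm a' b'. (\<lambda>k. JJ1 (?\<delta> k) t' b - JJ1 (?\<delta> k) t' a) \<longlonglongrightarrow> DD b t' - DD a t'"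
      by (intro AE_I2 tendsto_diff JJ1_tendsto)
    show "AE t' in tm a' b'. norm (JJ1 (?\<delta> k) t' b - JJ1 (?\<delta> k) t' a) \<le> (\<integral>x. v1 b x \<partial>lborel) + (\<integral>x. v1 a x \<partial>lborel)" for k
      using JJ_abs_le(1)[of "?\<delta> k" _ b] JJ_abs_le(1)[of "?\<delta> k" _ a]
      by (intro AE_I2 order_trans[OF norm_triangle_ineq4]) (auto intro!: add_mono)
  qed auto
  have 2: "(\<lambda>k. \<integral>t. JJ2 (?\<delta> k) t b' - JJ2 (?\<delta> k) t a' \<partial>tm a b) \<longlonglongrightarrow> (\<integral>t. DD t b' - DD t a' \<partial>tm a b)"
  proof (rule integral_dominated_convergence[where w = "\<lambda>_. (\<integral>x. v2 b' x \<partial>lborel) + (\<integral>x. v2 a' x \<partial>lborel)"])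
    show "AE t in tm a b. (\<lambda>k. JJ2 (?\<delta> k) t b' - JJ2 (?\<delta> k) t a') \<longlonglongrightarrow> DD t b' - DD t a'"
    proof (rule AE_I2)
      fix t
      show "(\<lambda>k. JJ2 (?\<delta> k) t b' - JJ2 (?\<delta> k) t a') \<longlonglongrightarrow> DD t b' - DD t a'"
        using tendsto_diff[OF JJ2_tendsto[of t b'] JJ2_tendsto[of t a']] by simp
    qed
    show "AE t in tm a b. norm (JJ2 (?\<delta> k) t b' - JJ2 (?\<delta> k) t a') \<le> (\<integral>x. v2 b' x \<partial>lborel) + (\<integral>x. v2 a' x \<partial>lborel)" for k
      using JJ_abs_le(2)[of "?\<delta> k" _ b'] JJ_abs_le(2)[of "?\<delta> k" _ a']
      by (intro AE_I2 order_trans[OF norm_triangle_ineq4]) (auto intro!: add_mono)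
  qed auto
  show ?thesis
    by (rule LIMSEQ_le_const2[OF tendsto_add[OF 1 2]]) (use rectangle_delta[OF _ ab] in auto)
qed

lemma DD_lip: "\<bar>DD t t' - DD r r'\<bar> \<le> A.vd t r + B.vd t' r'"
proof -
  have "DD t t' - DD r r' = (\<integral>x. max 0 (v1 t x + e1 - (v2 t' x + e2)) - max 0 (v1 r x + e1 - (v2 r' x + e2)) \<partial>lborel)"
    unfolding DD_def by (rule Bochner_Integration.integral_diff[OF DD_int[of t t'] DD_int[of r r'], symmetric])
  also have "\<bar>\<dots>\<bar> \<le> (\<integral>x. \<bar>v1 t x - v1 r x\<bar> + \<bar>v2 t' x - v2 r' x\<bar> \<partial>lborel)"
  proof (intro order_trans[OF integral_abs_bound integral_mono'] Bochner_Integration.integrable_add A.v_diff_int B.v_diff_int)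
    have "\<bar>max 0 (p - q) - max 0 (p' - q')\<bar> \<le> \<bar>p - p'\<bar> + \<bar>q - q'\<bar>" for p q p' q' :: real
      by (cases "p \<le> q"; cases "p' \<le> q'") (simp_all add: max_def abs_if)
    from this[of "v1 t x + e1" "v2 t' x + e2" "v1 r x + e1" "v2 r' x + e2" for x]
    show "\<bar>max 0 (v1 t x + e1 - (v2 t' x + e2)) - max 0 (v1 r x + e1 - (v2 r' x + e2))\<bar> \<le> \<bar>v1 t x - v1 r x\<bar> + \<bar>v2 t' x - v2 r' x\<bar>" for x
      by simp
  qed simp
  finally show ?thesis using A.v_diff_int B.v_diff_int by (simp add: A.vd_def B.vd_def)
qed

lemma DD_continuous: "continuous_on UNIV (\<lambda>(x, y). DD x y)"
proof (rule continuous_at_imp_continuous_on, intro ballI)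
  fix p :: "real \<times> real"
  obtain t t' where p: "p = (t, t')" by (cases p)
  have l: "((\<lambda>r. A.vd r t) \<longlongrightarrow> 0) (nhds t)" "((\<lambda>r. B.vd r t') \<longlongrightarrow> 0) (nhds t')"
    using A.v_cont[of t] B.v_cont[of t'] unfolding tendsto_nhds_iff by (auto simp: A.vd_def B.vd_def)
  have "((\<lambda>q. A.vd (fst q) t + B.vd (snd q) t') \<longlongrightarrow> 0 + 0) (at p)"
    by (intro tendsto_add filterlim_compose[OF l(1)] filterlim_compose[OF l(2)])
       (auto simp: p intro!: tendsto_eq_intros)
  then have "((\<lambda>q. DD (fst q) (snd q) - DD t t') \<longlongrightarrow> 0) (at p)"
    by (intro tendsto_rabs_zero_cancel[where f = "\<lambda>q. DD (fst q) (snd q) - DD t t'"])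
       (rule tendsto_sandwich[OF _ _ tendsto_const], auto simp: DD_lip)
  then show "isCont (\<lambda>(x, y). DD x y) p"
    unfolding isCont_def case_prod_unfold p by (simp add: Lim_null[of "\<lambda>q. DD (fst q) (snd q)"])
qed

lemma tm_to_HK:
  fixes f :: "real \<Rightarrow> real"
  assumes f: "continuous_on UNIV f" and "0 < \<eta>"
  shows "(\<integral>r. f r \<partial>tm t (t + \<eta>)) = integral {0..\<eta>} (\<lambda>r. f (t + r))"
proof -
  have [measurable]: "f \<in> borel_measurable borel" by (rule borel_measurable_continuous_onI[OF f])
  have c: "continuous_on UNIV (\<lambda>r. f (t + r))" by (intro continuous_on_compose2[OF f] continuous_intros) auto
  have "(\<integral>r. f r \<partial>tm t (t + \<eta>)) = (\<integral>r. indicator {t..t + \<eta>} (t + 1 * r) * f (t + 1 * r) \<partial>lborel)"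
    by (subst integral_tm, simp, subst lborel_integral_real_affine[where c = 1 and t = t]) auto
  also have "\<dots> = (LINT r:{0..\<eta>}|lborel. f (t + r))"
    unfolding set_lebesgue_integral_def by (intro Bochner_Integration.integral_cong refl) (auto simp: indicator_def)
  also have "\<dots> = integral {0..\<eta>} (\<lambda>r. f (t + r))"
    by (intro set_borel_integral_eq_integral borel_integrable_atLeastAtMost' continuous_on_subset[OF c]) auto
  finally show ?thesis .
qed

text \<open>Rectangles with equal sides and a corner on the diagonal are the squares in the
  hypothesis of \<open>diagonal_nonincreasing\<close>; the initial time is then added by
  continuity.\<close>

lemma DD_diag:
  assumes "0 \<le> t" shows "DD t t \<le> DD 0 0"
proof (cases "t = 0")
  case False
  then have t: "0 < t" using assms by simp
  have cD: "continuous_on A (\<lambda>z. DD (f z) (g z))" if "continuous_on A f" "continuous_on A g" for A :: "real set" and f g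
    using continuous_on_compose2[OF DD_continuous continuous_on_Pair[OF that]] by auto
  have main: "DD t t \<le> DD r r" if "0 < r" "r \<le> t" for r
  proof (rule diagonal_nonincreasing[OF DD_continuous _ that])
    fix x \<eta> :: real assume "0 < x" "0 < \<eta>"
    then show "integral {0..\<eta>} (\<lambda>r. DD (x + \<eta>) (x + r) - DD x (x + r)) + integral {0..\<eta>} (\<lambda>r. DD (x + r) (x + \<eta>) - DD (x + r) x) \<le> 0"
      using rectangle[of x "x + \<eta>" x "x + \<eta>"]
        tm_to_HK[of "\<lambda>t'. DD (x + \<eta>) t' - DD x t'" \<eta> x] tm_to_HK[of "\<lambda>t. DD t (x + \<eta>) - DD t x" \<eta> x]
      by (simp add: cD continuous_intros)
  qed
  have "isCont (\<lambda>r. DD r r) 0"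
    using cD[of UNIV "\<lambda>r. r" "\<lambda>r. r"] continuous_on_eq_continuous_at[OF open_UNIV] by auto
  then have "((\<lambda>r. DD r r) \<longlongrightarrow> DD 0 0) (at_right 0)"
    unfolding isCont_def by (rule tendsto_mono[OF at_le, rotated]) auto
  moreover have "\<forall>\<^sub>F r in at_right 0. DD t t \<le> DD r r"
    using eventually_at_right_real[OF t] by (auto elim!: eventually_mono intro!: main)
  ultimately show ?thesis by (intro tendsto_lowerbound) auto
qed simp

lemma comparison:
  assumes init: "AE x in lborel. v1 0 x + e1 \<le> v2 0 x + e2" and t: "0 \<le> t"
  shows "AE x in lborel. v1 t x + e1 \<le> v2 t x + e2"
proof -
  have "DD 0 0 = (\<integral>x. 0 \<partial>(lborel :: 'a measure))"
    unfolding DD_def by (rule integral_cong_AE) (use init in auto)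
  then have "DD t t \<le> 0" using DD_diag[OF t] by simp
  moreover have "0 \<le> DD t t" unfolding DD_def by simp
  ultimately have "DD t t = 0" by simp
  then have "AE x in lborel. max 0 (v1 t x + e1 - (v2 t x + e2)) = 0"
    unfolding DD_def using DD_int[of t t] by (subst (asm) integral_nonneg_eq_0_iff_AE) auto
  then show ?thesis by eventually_elim (simp add: max_def split: if_splits)
qed

end

section \<open>From the weak formulation to the flow\<close>

lemma borel_measurable_completion_cong_AE:
  fixes f g :: "'a \<Rightarrow> real"
  assumes f: "f \<in> borel_measurable (completion M)" and ae: "AE x in M. f x = g x"
  shows "g \<in> borel_measurable (completion M)"
proof (rule measurableI)
  fix A :: "real set" assume [measurable]: "A \<in> sets borel"
  obtain N where N0: "{x \<in> space M. f x \<noteq> g x} \<subseteq> N" "emeasure M N = 0" "N \<in> sets M" using AE_E[OF ae] by blast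
  then have N: "{x \<in> space M. f x \<noteq> g x} \<subseteq> N" "N \<in> null_sets M" by auto
  have 1: "f -` A \<inter> space (completion M) \<in> sets (completion M)" using f by (rule measurable_sets) simp
  have sub: "g -` A \<inter> space M \<inter> N \<in> null_sets (completion M)"
    using N(2) by (intro null_sets_completion_subset[OF _ null_sets_completionI]) auto
  have "g -` A \<inter> space (completion M) = ((f -` A \<inter> space (completion M)) - N) \<union> (g -` A \<inter> space M \<inter> N)"
    using N(1) by auto
  also have "\<dots> \<in> sets (completion M)" using 1 sub N(2) by (intro sets.Un sets.Diff) auto
  finally show "g -` A \<inter> space (completion M) \<in> sets (completion M)" .
qed simp

text \<open>Measurability of \<open>f\<close> is inherited from \<open>g\<close>, since the Lebesgue
  measure is complete.\<close>

lemma integral_lebesgue_cong_AE: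
  fixes f g :: "'a::euclidean_space \<Rightarrow> real"
  assumes g: "g \<in> borel_measurable borel" and ae: "AE x in lebesgue. f x = g x"
  shows "(\<integral>x. f x \<partial>lebesgue) = (\<integral>x. g x \<partial>lborel)"
proof -
  have ae': "AE x in lborel. g x = f x" using ae by (simp add: AE_completion_iff eq_commute)
  have gl: "g \<in> borel_measurable lebesgue" using g by (intro measurable_completion) simp
  have "(\<integral>x. f x \<partial>lebesgue) = (\<integral>x. g x \<partial>lebesgue)"
    using borel_measurable_completion_cong_AE[OF gl ae'] gl ae by (intro integral_cong_AE) auto
  also have "\<dots> = (\<integral>x. g x \<partial>lborel)" using g by (intro integral_completion) simp
  finally show ?thesis .
qed

lemma integrable_lebesgue_cong_AE:
  fixes f g :: "'a::euclidean_space \<Rightarrow> real"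
  assumes f: "integrable lebesgue f" and g: "g \<in> borel_measurable borel" and ae: "AE x in lebesgue. f x = g x"
  shows "integrable lborel g"
proof -
  have gl: "g \<in> borel_measurable lebesgue" using g by (intro measurable_completion) simp
  have "integrable lebesgue g" using integrable_cong_AE_imp[OF f gl] ae by (simp add: eq_commute)
  then show ?thesis using g by (subst (asm) integrable_completion) auto
qed

text \<open>The hypotheses treat each time separately, so joint measurability has to be created. The
  curve is sampled on time grids fine enough for the L^1 error of the j-th step function to be below
  2^-j; these functions are jointly Borel, and summability of the errors makes them converge almost
  everywhere at each time.\<close>

lemma L1_measurable_version:
  fixes v :: "real \<Rightarrow> 'a::euclidean_space \<Rightarrow> real"
  assumes int: "\<And>t. 0 \<le> t \<Longrightarrow> integrable lebesgue (v t)"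
    and cont: "\<And>t. 0 \<le> t \<Longrightarrow> ((\<lambda>\<tau>. \<integral>x. \<bar>v \<tau> x - v t x\<bar> \<partial>lebesgue) \<longlongrightarrow> 0) (at t within {0..})"
    and nn: "\<And>t. 0 \<le> t \<Longrightarrow> AE x in lebesgue. 0 \<le> v t x"
  obtains w where "case_prod w \<in> borel_measurable (borel \<Otimes>\<^sub>M borel)" "\<And>t x. 0 \<le> w t x"
    "\<And>t. integrable lborel (w t)" "\<And>t. ((\<lambda>r. \<integral>x. \<bar>w r x - w t x\<bar> \<partial>lborel) \<longlongrightarrow> 0) (at t)"
    "\<And>t. 0 \<le> t \<Longrightarrow> AE x in lebesgue. v t x = w t x"
proof -
  have "\<exists>h. h \<in> borel_measurable borel \<and> (AE x in lebesgue. v t x = h x)" if "0 \<le> t" for t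
    using completion_ex_borel_measurable_real[of "v t" lborel] int[OF that] by (auto simp: AE_completion_iff)
  then obtain h where h: "\<And>t. 0 \<le> t \<Longrightarrow> h t \<in> borel_measurable borel" "\<And>t. 0 \<le> t \<Longrightarrow> AE x in lebesgue. v t x = h t x"
    by metis
  \<comment> \<open>Negative times receive the initial value, which makes continuity in time
    two-sided.\<close>
  define g where "g t = h (max 0 t)" for t
  have g_meas [measurable]: "g t \<in> borel_measurable borel" for t unfolding g_def by (rule h) simp
  have g_ae: "AE x in lebesgue. v (max 0 t) x = g t x" for t unfolding g_def by (rule h) simp
  have g_int: "integrable lborel (g t)" for t
    by (rule integrable_lebesgue_cong_AE[OF int g_meas g_ae]) simp
  define d where "d r t = (\<integral>x. \<bar>g r x - g t x\<bar> \<partial>lborel)" for r t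
  have d_eq: "(\<integral>x. \<bar>v (max 0 r) x - v (max 0 t) x\<bar> \<partial>lebesgue) = d r t" for r t
    unfolding d_def
  proof (rule integral_lebesgue_cong_AE)
    show "AE x in lebesgue. \<bar>v (max 0 r) x - v (max 0 t) x\<bar> = \<bar>g r x - g t x\<bar>"
      using g_ae[of r] g_ae[of t] by eventually_elim simp
  qed measurable
  have gdi: "integrable lborel (\<lambda>x. \<bar>g r x - g t x\<bar>)" for r t
    by (intro Bochner_Integration.integrable_abs Bochner_Integration.integrable_diff g_int)
  have d_tri: "d a c \<le> d a b + d b c" for a b c
  proof -
    have "d a c \<le> (\<integral>x. \<bar>g a x - g b x\<bar> + \<bar>g b x - g c x\<bar> \<partial>lborel)"
      unfolding d_def by (intro Bochner_Integration.integral_mono gdi Bochner_Integration.integrable_add) auto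
    then show ?thesis unfolding d_def by (simp add: gdi)
  qed
  have d_sym: "d a b = d b a" for a b by (simp add: d_def abs_minus_commute)
  have d_refl: "d a a = 0" for a by (simp add: d_def)
  have d_lim: "((\<lambda>r. d r t) \<longlongrightarrow> 0) (at t)" for t
  proof (rule tendstoI)
    fix e :: real assume e: "e > 0"
    have "\<forall>\<^sub>F \<tau> in at (max 0 t) within {0..}. dist (\<integral>x. \<bar>v \<tau> x - v (max 0 t) x\<bar> \<partial>lebesgue) 0 < e"
      using cont[of "max 0 t"] e by (intro tendstoD) auto
    then obtain \<kappa> where \<kappa>: "\<kappa> > 0" "\<And>\<tau>. \<tau> \<ge> 0 \<Longrightarrow> \<tau> \<noteq> max 0 t \<Longrightarrow> dist \<tau> (max 0 t) < \<kappa> \<Longrightarrow> \<bar>\<integral>x. \<bar>v \<tau> x - v (max 0 t) x\<bar> \<partial>lebesgue\<bar> < e"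
      unfolding eventually_at by auto
    show "\<forall>\<^sub>F r in at t. dist (d r t) 0 < e"
      unfolding eventually_at
    proof (intro exI[of _ \<kappa>] conjI ballI impI \<kappa>(1))
      fix r assume r: "r \<noteq> t \<and> dist r t < \<kappa>"
      show "dist (d r t) 0 < e"
      proof (cases "max 0 r = max 0 t")
        case True
        then have "d r t = 0" by (simp add: d_def g_def)
        then show ?thesis using e by simp
      next
        case False
        have "dist (max 0 r) (max 0 t) < \<kappa>" using r by (auto simp: dist_real_def)
        then show ?thesis using \<kappa>(2)[of "max 0 r"] False d_eq[of r t] by simp
      qed
    qed
  qed
  \<comment> \<open>The windows grow with \<open>j\<close>, so that every time is eventually
    covered; the extra 1 leaves room for the grid point next to \<open>t\<close>.\<close>
  have "\<exists>\<kappa>>0. \<forall>r\<in>{- (real j + 1)..real j + 1}. \<forall>t\<in>{- (real j + 1)..real j + 1}. \<bar>r - t\<bar> \<le> \<kappa> \<longrightarrow> d r t < (1/2) ^ j" for j :: nat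
    by (rule uniformly_small_pseudo_dist[OF d_tri d_sym d_refl d_lim]) simp
  then obtain \<kappa> where \<kappa>: "\<And>j::nat. \<kappa> j > 0" "\<And>j r t. r \<in> {- (real j + 1)..real j + 1} \<Longrightarrow> t \<in> {- (real j + 1)..real j + 1} \<Longrightarrow> \<bar>r - t\<bar> \<le> \<kappa> j \<Longrightarrow> d r t < (1/2) ^ j"
    by metis
  define m where "m j = nat \<lceil>1 / \<kappa> j\<rceil> + 1" for j
  have m: "real (m j) \<ge> 1" "1 / real (m j) \<le> \<kappa> j" for j
  proof -
    have "1 / \<kappa> j \<le> real (m j)" unfolding m_def using \<kappa>(1)[of j] by linarith
    then have "1 \<le> \<kappa> j * real (m j)" using \<kappa>(1)[of j] by (simp add: pos_divide_le_eq mult.commute)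
    moreover have "real (m j) > 0" by (simp add: m_def)
    ultimately show "1 / real (m j) \<le> \<kappa> j" by (simp add: pos_divide_le_eq)
  qed (simp add: m_def)
  define gr where "gr j t = of_int \<lfloor>real (m j) * t\<rfloor> / real (m j)" for j t
  have gr: "\<bar>gr j t - t\<bar> \<le> 1 / real (m j)" for j t
  proof -
    have "\<bar>of_int \<lfloor>real (m j) * t\<rfloor> - real (m j) * t\<bar> \<le> 1" by linarith
    then have "\<bar>of_int \<lfloor>real (m j) * t\<rfloor> - real (m j) * t\<bar> / real (m j) \<le> 1 / real (m j)" by (intro divide_right_mono) auto
    moreover have "gr j t - t = (of_int \<lfloor>real (m j) * t\<rfloor> - real (m j) * t) / real (m j)"
      using m(1)[of j] by (simp add: gr_def field_simps)
    ultimately show ?thesis by simp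
  qed
  define G where "G j t x = g (gr j t) x" for j t x
  have G_meas [measurable]: "(\<lambda>p. G j (fst p) (snd p)) \<in> borel_measurable (borel \<Otimes>\<^sub>M borel)" for j
  proof -
    have "(\<lambda>p. (\<lambda>(i::int) p. g (of_int i / real (m j)) (snd p)) \<lfloor>real (m j) * fst p\<rfloor> p) \<in> borel_measurable (borel \<Otimes>\<^sub>M (borel :: 'a measure))"
      by (rule measurable_compose_countable) measurable
    then show ?thesis by (simp add: G_def gr_def)
  qed
  have G_close: "d (gr j t) t < (1/2) ^ j" if "\<bar>t\<bar> \<le> real j" for j t
  proof -
    have "1 / real (m j) \<le> 1" using m(1)[of j] by (simp add: divide_le_eq)
    then show ?thesis using gr[of j t] m(2)[of j] that by (intro \<kappa>(2)) auto
  qed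
  \<comment> \<open>Where the sequence diverges, the value of \<open>lim\<close> is unspecified; the
    maximum with 0 secures nonnegativity at every point and changes the limit on a null set
    only.\<close>
  define w where "w t x = max 0 (lim (\<lambda>j. G j t x))" for t x
  have w_meas: "case_prod w \<in> borel_measurable (borel \<Otimes>\<^sub>M borel)"
    unfolding w_def case_prod_unfold by measurable
  have w_ae_g: "AE x in lborel. w t x = g t x" for t
  proof -
    \<comment> \<open>Dropping the first \<open>J\<close> grids puts \<open>t\<close> inside every
      remaining window.\<close>
    define J where "J = nat \<lceil>\<bar>t\<bar>\<rceil>"
    have J: "\<bar>t\<bar> \<le> real (j + J)" for j unfolding J_def by linarith
    have "(\<integral>\<^sup>+x. (\<Sum>j. ennreal \<bar>G (j + J) t x - g t x\<bar>) \<partial>lborel) = (\<Sum>j. \<integral>\<^sup>+x. ennreal \<bar>G (j + J) t x - g t x\<bar> \<partial>lborel)"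
      unfolding G_def by (rule nn_integral_suminf) measurable
    also have "\<dots> = (\<Sum>j. ennreal (d (gr (j + J) t) t))"
      unfolding G_def by (subst nn_integral_eq_integral[OF gdi]) (auto simp: d_def)
    also have "\<dots> \<le> (\<Sum>j. ennreal ((1/2) ^ (j + J)))"
      using G_close[OF J] by (intro suminf_le ennreal_leI less_imp_le) auto
    also have "\<dots> < \<infinity>"
    proof -
      have "summable (\<lambda>j. (1/2::real) ^ (j + J))" by (intro summable_ignore_initial_segment summable_geometric) simp
      then show ?thesis by (subst suminf_ennreal_eq[OF _ summable_sums]) auto
    qed
    finally have "AE x in lborel. (\<Sum>j. ennreal \<bar>G (j + J) t x - g t x\<bar>) \<noteq> \<infinity>"
      unfolding G_def by (intro nn_integral_PInf_AE) auto
    moreover have "AE x in lborel. 0 \<le> g t x"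
    proof -
      have "AE x in lebesgue. 0 \<le> v (max 0 t) x" by (rule nn) simp
      then have "AE x in lebesgue. 0 \<le> g t x" using g_ae[of t] by eventually_elim simp
      then show ?thesis by (simp add: AE_completion_iff)
    qed
    ultimately show ?thesis
    proof eventually_elim
      case (elim x)
      have "summable (\<lambda>j. \<bar>G (j + J) t x - g t x\<bar>)" using elim(1) by (intro summable_suminf_not_top) auto
      then have "(\<lambda>j. \<bar>G (j + J) t x - g t x\<bar>) \<longlonglongrightarrow> 0" by (rule summable_LIMSEQ_zero)
      then have "(\<lambda>j. G (j + J) t x - g t x) \<longlonglongrightarrow> 0" by (rule tendsto_rabs_zero_cancel)
      then have "(\<lambda>j. G (j + J) t x) \<longlonglongrightarrow> g t x" by (rule LIM_zero_cancel)
      then have "(\<lambda>j. G j t x) \<longlonglongrightarrow> g t x" by (rule LIMSEQ_offset)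
      then show ?case using elim(2) by (simp add: w_def limI max_def)
    qed
  qed
  have [measurable]: "w t \<in> borel_measurable borel" for t using w_meas by measurable
  show thesis
  proof (rule that[OF w_meas])
    show "0 \<le> w t x" for t x by (simp add: w_def)
    show "integrable lborel (w t)" for t
      using integrable_cong_AE_imp[OF g_int[of t], of "w t"] w_ae_g[of t] by (simp add: eq_commute)
    have dw: "(\<integral>x. \<bar>w r x - w t x\<bar> \<partial>lborel) = d r t" for r t
      unfolding d_def
    proof (rule integral_cong_AE)
      show "AE x in lborel. \<bar>w r x - w t x\<bar> = \<bar>g r x - g t x\<bar>" using w_ae_g[of r] w_ae_g[of t] by eventually_elim simp
    qed measurable
    show "((\<lambda>r. \<integral>x. \<bar>w r x - w t x\<bar> \<partial>lborel) \<longlongrightarrow> 0) (at t)" for t unfolding dw by (rule d_lim)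
    show "AE x in lebesgue. v t x = w t x" if "0 \<le> t" for t
    proof -
      have "AE x in lebesgue. w t x = g t x" using w_ae_g[of t] by (simp add: AE_completion_iff)
      then show ?thesis using g_ae[of t] by eventually_elim (use that in simp)
    qed
  qed
qed

section \<open>Energies and pairings of Borel representatives\<close>

lemma gagliardo_sq_eq_gag:
  fixes f f' :: "real^'d \<Rightarrow> real"
  assumes [measurable]: "f' \<in> borel_measurable borel" and ae: "AE x in lebesgue. f x = f' x"
  shows "gagliardo_sq s f = gag s f'"
proof -
  let ?k = "\<lambda>f (x::real^'d) y. ennreal ((f x - f y)^2 / (norm (x - y) powr (real CARD('d) + 2 * s)))"
  have "gagliardo_sq s f = (\<integral>\<^sup>+x. (\<integral>\<^sup>+y. ?k f' x y \<partial>lebesgue) \<partial>lebesgue)"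
    unfolding gagliardo_sq_def
  proof (rule nn_integral_cong_AE)
    show "AE x in lebesgue. (\<integral>\<^sup>+y. ?k f x y \<partial>lebesgue) = (\<integral>\<^sup>+y. ?k f' x y \<partial>lebesgue)"
      using ae
    proof eventually_elim
      case (elim x)
      show ?case by (rule nn_integral_cong_AE) (use ae in eventually_elim, use elim in simp)
    qed
  qed
  also have "\<dots> = (\<integral>\<^sup>+x. (\<integral>\<^sup>+y. ?k f' x y \<partial>lborel) \<partial>lborel)" by (simp add: nn_integral_completion)
  also have "\<dots> = (\<integral>\<^sup>+x. (\<integral>\<^sup>+y. ennreal (gker s (x, y)) * ennreal ((dif f' (x, y))\<^sup>2) \<partial>lborel) \<partial>lborel)"
    by (simp add: gker_def dif_def ennreal_mult[symmetric])
  also have "\<dots> = gag s f'"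
    unfolding gag_def gm_def by (subst nn_integral_density) (simp_all add: lborel.nn_integral_fst[symmetric] dif_def)
  finally show ?thesis .
qed

text \<open>The iterated integral as it stands in the weak formulation. It is kept apart from
  \<open>gform\<close> because Fubini identifies the two when both energies are finite, whereas
  scaling of the second argument is valid regardless.\<close>

definition itform :: "real \<Rightarrow> (real^'d \<Rightarrow> real) \<Rightarrow> (real^'d \<Rightarrow> real) \<Rightarrow> real" where
  "itform s f g = (\<integral>x. (\<integral>y. (f x - f y) * (g x - g y) / (norm (x - y) powr (real CARD('d) + 2 * s)) \<partial>lborel) \<partial>lborel)"

lemma frac_pairing_eq_itform:
  fixes f f' g :: "real^'d \<Rightarrow> real"
  assumes [measurable]: "f' \<in> borel_measurable borel" "g \<in> borel_measurable borel" and ae: "AE x in lebesgue. f x = f' x"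
  shows "frac_pairing s f g = frac_const CARD('d) s / 2 * itform s f' g"
proof -
  have "(\<integral>x. (\<integral>y. (f x - f y) * (g x - g y) / (norm (x - y) powr (real CARD('d) + 2 * s)) \<partial>lebesgue) \<partial>lebesgue) = itform s f' g"
    unfolding itform_def
  proof (rule integral_lebesgue_cong_AE)
    show "AE x in lebesgue. (\<integral>y. (f x - f y) * (g x - g y) / (norm (x - y) powr (real CARD('d) + 2 * s)) \<partial>lebesgue)
      = (\<integral>y. (f' x - f' y) * (g x - g y) / (norm (x - y) powr (real CARD('d) + 2 * s)) \<partial>lborel)"
      using ae
    proof eventually_elim
      case (elim x)
      show ?case
        by (rule integral_lebesgue_cong_AE, measurable) (use ae in eventually_elim, use elim in simp)
    qed
  qed measurable
  then show ?thesis by (simp add: frac_pairing_def)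
qed

lemma itform_eq_gform:
  fixes f g :: "real^'d \<Rightarrow> real"
  assumes [measurable]: "f \<in> borel_measurable borel" "g \<in> borel_measurable borel" and fin: "gag s f < \<infinity>" "gag s g < \<infinity>"
  shows "itform s f g = gform s f g"
proof -
  have "integrable (gm s) (\<lambda>z. dif f z * dif g z)" using fin by (intro gform_integrable) auto
  then have i: "integrable (lborel \<Otimes>\<^sub>M lborel) (\<lambda>z. gker s z * (dif f z * dif g z))"
    unfolding gm_def by (subst (asm) integrable_density) auto
  have "gform s f g = (\<integral>z. gker s z * (dif f z * dif g z) \<partial>(lborel \<Otimes>\<^sub>M lborel))"
    unfolding gform_def gm_def by (subst integral_density) auto
  also have "\<dots> = (\<integral>x. (\<integral>y. gker s (x, y) * (dif f (x, y) * dif g (x, y)) \<partial>lborel) \<partial>lborel)"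
    by (rule lborel_pair.integral_fst'[OF i, symmetric])
  finally show ?thesis by (simp add: itform_def gker_def dif_def)
qed

lemma itform_scale: "itform s f (\<lambda>x. c * g x) = c * itform s f g"
proof -
  have eq: "(f x - f y) * (c * g x - c * g y) / k = c * ((f x - f y) * (g x - g y) / k)" for x y k
    by (simp add: algebra_simps diff_divide_distrib add_divide_distrib)
  show ?thesis unfolding itform_def eq by (simp only: integral_mult_right_zero)
qed

lemma frac_const_pos: "0 < s \<Longrightarrow> s < 1 \<Longrightarrow> 0 < frac_const N s"
  unfolding frac_const_def by (intro mult_pos_pos divide_pos_pos) (auto intro!: Gamma_real_pos add_nonneg_pos)

text \<open>\<open>sstep'\<close> has integral 1 and vanishes outside \<open>{0..1}\<close>, so its
  rescalings concentrate at \<open>a\<close> from the right. They are the time derivatives of the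
  edges of \<open>ramp\<close>.\<close>

lemma sstep_mollify:
  fixes g :: "real \<Rightarrow> real"
  assumes g: "continuous_on UNIV g"
  shows "(\<lambda>k. \<integral>t. sstep' ((t - a) / (1 / real (Suc k))) / (1 / real (Suc k)) * g t \<partial>lborel) \<longlonglongrightarrow> g a"
    and "\<And>\<eta>. \<eta> > 0 \<Longrightarrow> integrable lborel (\<lambda>t. sstep' ((t - a) / \<eta>) / \<eta> * g t)"
proof -
  have [measurable]: "g \<in> borel_measurable borel" by (rule borel_measurable_continuous_onI[OF g])
  have [measurable]: "sstep' \<in> borel_measurable borel" by (rule borel_measurable_continuous_onI[OF sstep'_continuous])
  obtain K where K: "\<And>r. r \<in> {0..1} \<Longrightarrow> \<bar>sstep' r\<bar> \<le> K"
    using compact_continuous_image[OF continuous_on_subset[OF sstep'_continuous], of "{0..1}"]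
    by (force dest!: compact_imp_bounded simp: bounded_iff)
  have K0: "0 \<le> K" using K[of 0] by (simp add: order_trans[OF abs_ge_zero])
  obtain G where G: "\<And>t. t \<in> {a..a+1} \<Longrightarrow> \<bar>g t\<bar> \<le> G"
    using compact_continuous_image[OF continuous_on_subset[OF g], of "{a..a+1}"]
    by (force dest!: compact_imp_bounded simp: bounded_iff)
  show "integrable lborel (\<lambda>t. sstep' ((t - a) / \<eta>) / \<eta> * g t)" if \<eta>: "\<eta> > 0" for \<eta>
  proof (rule Bochner_Integration.integrable_bound)
    have "continuous_on {a..a + \<eta>} (\<lambda>t. K / \<eta> * \<bar>g t\<bar>)"
      by (intro continuous_intros continuous_on_subset[OF g]) auto
    from borel_integrable_atLeastAtMost'[OF this]
    show "integrable lborel (\<lambda>t. indicator {a..a + \<eta>} t * (K / \<eta> * \<bar>g t\<bar>))" by (simp add: set_integrable_def)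
    show "AE t in lborel. norm (sstep' ((t - a) / \<eta>) / \<eta> * g t) \<le> norm (indicator {a..a + \<eta>} t * (K / \<eta> * \<bar>g t\<bar>))"
    proof (rule AE_I2)
      fix t
      show "norm (sstep' ((t - a) / \<eta>) / \<eta> * g t) \<le> norm (indicator {a..a + \<eta>} t * (K / \<eta> * \<bar>g t\<bar>))"
      proof (cases "t \<in> {a..a + \<eta>}")
        case True
        then have "(t - a) / \<eta> \<in> {0..1}" using \<eta> by auto
        then have "\<bar>sstep' ((t - a) / \<eta>)\<bar> / \<eta> * \<bar>g t\<bar> \<le> K / \<eta> * \<bar>g t\<bar>"
          using K \<eta> by (intro mult_right_mono divide_right_mono) auto
        then show ?thesis using True \<eta> K0 by (simp add: abs_mult)
      next
        case False
        then have "(t - a) / \<eta> < 0 \<or> (t - a) / \<eta> > 1" using \<eta> by (auto simp: divide_less_0_iff)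
        then show ?thesis by (simp add: sstep'_zero)
      qed
    qed
  qed measurable
  have sub: "(\<integral>t. sstep' ((t - a) / \<eta>) / \<eta> * g t \<partial>lborel) = (\<integral>r. sstep' r * g (a + \<eta> * r) \<partial>lborel)" if "\<eta> > 0" for \<eta>
  proof -
    have "(\<integral>t. sstep' ((t - a) / \<eta>) / \<eta> * g t \<partial>lborel) = \<bar>\<eta>\<bar> *\<^sub>R (\<integral>r. sstep' (((a + \<eta> * r) - a) / \<eta>) / \<eta> * g (a + \<eta> * r) \<partial>lborel)"
      using that by (intro lborel_integral_real_affine) auto
    also have "\<dots> = (\<integral>r. \<eta> * (sstep' (((a + \<eta> * r) - a) / \<eta>) / \<eta> * g (a + \<eta> * r)) \<partial>lborel)" using that by simp
    finally show ?thesis using that by simp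
  qed
  have FTC: "(\<integral>r. sstep' r \<partial>lborel) = 1"
  proof -
    have "(\<integral>r. sstep' r \<partial>lborel) = (\<integral>r. sstep' r * indicator {0..1} r \<partial>lborel)"
    proof (intro Bochner_Integration.integral_cong refl)
      fix r :: real
      show "sstep' r = sstep' r * indicator {0..1} r"
        using sstep'_zero[of r] by (cases "r < 0 \<or> r > 1") auto
    qed
    also have "\<dots> = sstep 1 - sstep 0"
      using sstep'_continuous continuous_on_eq_continuous_at[OF open_UNIV, of sstep'] by (intro integral_FTC_Icc_real sstep_DERIV) auto
    finally show ?thesis by (simp add: sstep_bounds)
  qed
  have "(\<lambda>k. \<integral>r. sstep' r * g (a + (1 / real (Suc k)) * r) \<partial>lborel) \<longlonglongrightarrow> (\<integral>r. sstep' r * g a \<partial>lborel)"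
  proof (rule integral_dominated_convergence[where w = "\<lambda>r. indicator {0..1} r * (K * G)"])
    show "integrable lborel (\<lambda>r. indicator {0..1::real} r * (K * G))"
      by (intro integrable_mult_left integrable_real_indicator) auto
    show "AE r in lborel. (\<lambda>k. sstep' r * g (a + (1 / real (Suc k)) * r)) \<longlonglongrightarrow> sstep' r * g a"
    proof (rule AE_I2)
      fix r :: real
      have "(\<lambda>k. a + inverse (real (Suc k)) * r) \<longlonglongrightarrow> a + 0 * r" by (intro tendsto_intros LIMSEQ_inverse_real_of_nat)
      moreover have "isCont g a" using g continuous_on_eq_continuous_at[OF open_UNIV] by blast
      ultimately have "(\<lambda>k. g (a + inverse (real (Suc k)) * r)) \<longlonglongrightarrow> g a"
        using isCont_tendsto_compose[of a g "\<lambda>k. a + inverse (real (Suc k)) * r" sequentially] by simp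
      then show "(\<lambda>k. sstep' r * g (a + (1 / real (Suc k)) * r)) \<longlonglongrightarrow> sstep' r * g a"
        by (intro tendsto_mult_left) (simp add: divide_inverse)
    qed
    show "AE r in lborel. norm (sstep' r * g (a + (1 / real (Suc k)) * r)) \<le> indicator {0..1} r * (K * G)" for k
    proof (rule AE_I2)
      fix r :: real
      show "norm (sstep' r * g (a + (1 / real (Suc k)) * r)) \<le> indicator {0..1} r * (K * G)"
      proof (cases "r \<in> {0..1}")
        case True
        have "1 / real (Suc k) * r \<le> 1 * 1" using True by (intro mult_mono) auto
        then have "a + 1 / real (Suc k) * r \<in> {a..a+1}" using True by auto
        then have "\<bar>sstep' r\<bar> * \<bar>g (a + 1 / real (Suc k) * r)\<bar> \<le> K * G" using K[OF True] G K0 by (intro mult_mono) auto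
        then show ?thesis using True by (simp add: abs_mult)
      next
        case False
        then have "sstep' r = 0" by (intro sstep'_zero) auto
        then show ?thesis using False by simp
      qed
    qed
  qed measurable
  then show "(\<lambda>k. \<integral>t. sstep' ((t - a) / (1 / real (Suc k))) / (1 / real (Suc k)) * g t \<partial>lborel) \<longlonglongrightarrow> g a"
    using sub[of "1 / real (Suc k)" for k] FTC by simp
qed

text \<open>The derivative of \<open>phi\<close>: for n = 0 the exponent -1 gives that of the
  logarithm, so one power law covers both cases.\<close>

definition phi_rate :: "real \<Rightarrow> real \<Rightarrow> real" where
  "phi_rate n u = (if n > 0 then n else 1) * u powr (- n - 1)"

lemma phi_DERIV: "0 \<le> n \<Longrightarrow> 0 < u \<Longrightarrow> (phi n has_real_derivative phi_rate n u) (at u)"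
proof (cases "n > 0")
  case True
  assume u: "0 < u"
  have "((\<lambda>u. - (u powr (- n))) has_real_derivative - (- n * u powr (- n - 1))) (at u)"
    using u by (intro derivative_eq_intros) auto
  then show ?thesis using True by (simp add: phi_def[abs_def] phi_rate_def)
next
  case False
  assume "0 \<le> n" and u: "0 < u"
  then have "n = 0" using False by simp
  then show ?thesis using u by (auto simp: phi_def[abs_def] phi_rate_def powr_minus divide_inverse intro!: derivative_eq_intros)
qed

lemma phi_MVT:
  assumes n: "0 \<le> n" and ab: "0 < a" "a < b"
  obtains z where "a < z" "z < b" "phi n b - phi n a = (b - a) * phi_rate n z"
proof -
  have "\<exists>z>a. z < b \<and> phi n b - phi n a = (b - a) * phi_rate n z"
    using ab by (intro MVT2 phi_DERIV[OF n]) auto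
  then show thesis using that by blast
qed

lemma phi_rate_antimono: "0 \<le> n \<Longrightarrow> 0 < u \<Longrightarrow> u \<le> w \<Longrightarrow> phi_rate n w \<le> phi_rate n u"
  unfolding phi_rate_def by (intro mult_left_mono powr_mono2') auto

lemma phi_rate_pos: "0 < u \<Longrightarrow> 0 < phi_rate n u"
  by (simp add: phi_rate_def)

lemma phi_strict_mono: "0 \<le> n \<Longrightarrow> 0 < a \<Longrightarrow> a < b \<Longrightarrow> phi n a < phi n b"
proof -
  assume a: "0 \<le> n" "0 < a" "a < b"
  obtain z where z: "a < z" "z < b" "phi n b - phi n a = (b - a) * phi_rate n z" by (rule phi_MVT[OF a])
  have "0 < (b - a) * phi_rate n z" using z a by (intro mult_pos_pos phi_rate_pos) auto
  then show ?thesis using z(3) by linarith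
qed

text \<open>The derivative is nonincreasing, so its value at the upper bound \<open>R\<close>
  controls increments from below. With \<open>R\<close> fixed, the bound is independent of
  \<epsilon>.\<close>

lemma phi_increment_ge:
  assumes "0 \<le> n" "0 < a" "a \<le> b" "b \<le> R" shows "phi_rate n R * (b - a) \<le> phi n b - phi n a"
proof (cases "a = b")
  case False
  then have "a < b" using assms by simp
  then obtain z where z: "a < z" "z < b" "phi n b - phi n a = (b - a) * phi_rate n z"
    by (rule phi_MVT[OF assms(1,2)])
  have "phi_rate n R \<le> phi_rate n z" using z assms by (intro phi_rate_antimono) auto
  then show ?thesis using z assms by (simp add: mult.commute mult_left_mono)
qed simp

text \<open>The constant blows up as \<epsilon> tends to 0. It serves integrability and continuity
  for each fixed \<epsilon> and enters no estimate that has to be uniform.\<close>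

lemma phi_eps_lipschitz:
  assumes n: "0 \<le> n" and \<epsilon>: "0 < \<epsilon>" and "0 \<le> x" "0 \<le> y"
  shows "\<bar>phi_eps n \<epsilon> x - phi_eps n \<epsilon> y\<bar> \<le> phi_rate n \<epsilon> * \<bar>x - y\<bar>"
proof -
  have *: "\<bar>phi n (b + \<epsilon>) - phi n (a + \<epsilon>)\<bar> \<le> phi_rate n \<epsilon> * (b - a)" if ab: "0 \<le> a" "a < b" for a b
  proof -
    obtain z where z: "a + \<epsilon> < z" "z < b + \<epsilon>" "phi n (b + \<epsilon>) - phi n (a + \<epsilon>) = (b + \<epsilon> - (a + \<epsilon>)) * phi_rate n z"
      by (rule phi_MVT[OF n, of "a + \<epsilon>" "b + \<epsilon>"]) (use ab \<epsilon> in auto)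
    have "0 \<le> phi_rate n z" "phi_rate n z \<le> phi_rate n \<epsilon>"
      using z ab \<epsilon> n by (auto intro!: phi_rate_antimono phi_rate_pos[THEN less_imp_le])
    then show ?thesis using z(3) that by (simp add: abs_mult mult.commute mult_right_mono)
  qed
  show ?thesis
    using *[of x y] *[of y x] assms(3,4) by (cases x y rule: linorder_cases) (auto simp: phi_eps_def abs_minus_commute)
qed

lemma phi_measurable [measurable]: "phi n \<in> borel_measurable borel"
  unfolding phi_def by measurable

lemma phi_eps_measurable [measurable]: "phi_eps n \<epsilon> \<in> borel_measurable borel"
  unfolding phi_eps_def by measurable

text \<open>The weak formulation is tested with \<open>ramp\<close> times a bump, and the width of
  the ramp tends to 0. The time derivative then evaluates the continuous function \<open>g\<close>
  at the end points, and the other term becomes the integral of the form over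
  \<open>{a..b}\<close>.\<close>

lemma weak_sol_flow:
  fixes u0 :: "real^'d \<Rightarrow> real"
  assumes s: "0 < s" "s < 1" and n: "0 \<le> n" and \<epsilon>: "0 < \<epsilon>" and sol: "weak_sol_eps s n \<epsilon> u0 v"
  obtains w where "frac_flow s (frac_const CARD('d) s / 2) (phi_rate n \<epsilon>) (phi_eps n \<epsilon>) w"
    "\<And>t. 0 \<le> t \<Longrightarrow> AE x in lebesgue. v t x = w t x"
proof -
  obtain w where w_meas [measurable]: "case_prod w \<in> borel_measurable (borel \<Otimes>\<^sub>M borel)" and w_nn: "\<And>t x. 0 \<le> w t x"
    and w_int: "\<And>t. integrable lborel (w t)" and w_cont: "\<And>t. ((\<lambda>r. \<integral>x. \<bar>w r x - w t x\<bar> \<partial>lborel) \<longlongrightarrow> 0) (at t)"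
    and w_ae: "\<And>t. 0 \<le> t \<Longrightarrow> AE x in lebesgue. v t x = w t x"
    by (rule L1_measurable_version[of v]) (use sol in \<open>auto simp: weak_sol_eps_def\<close>)
  let ?F = "phi_eps n \<epsilon>"
  let ?C = "frac_const CARD('d) s / 2"
  have C: "?C > 0" using frac_const_pos[OF s] by simp
  define f where "f t x = ?F (w t x)" for t x
  have [measurable]: "case_prod f \<in> borel_measurable (borel \<Otimes>\<^sub>M borel)" unfolding f_def by measurable
  have f_ae: "AE x in lebesgue. ?F (v t x) = f t x" if "0 \<le> t" for t
    using w_ae[OF that] by eventually_elim (simp add: f_def)
  have gag_eq: "gagliardo_sq s (\<lambda>x. ?F (v t x)) = gag s (f t)" if "0 \<le> t" for t
    by (rule gagliardo_sq_eq_gag[OF _ f_ae[OF that]]) measurable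
  have gag_fin: "(\<integral>\<^sup>+t. gag s (f t) \<partial>tm a b) < \<infinity>" if a: "0 < a" for a b
  proof -
    have "(\<integral>\<^sup>+t. gag s (f t) \<partial>tm a b) = (\<integral>\<^sup>+t. gag s (f t) * indicator {a..b} t \<partial>lborel)"
      by (rule nn_integral_tm) measurable
    \<comment> \<open>The energy bound in the definition of a solution is stated for nondegenerate
      intervals, hence the enlarged right end.\<close>
    also have "\<dots> \<le> (\<integral>\<^sup>+t\<in>{a..max b (a + 1)}. gagliardo_sq s (\<lambda>x. ?F (v t x)) \<partial>lborel)"
      using a by (intro nn_integral_mono) (auto simp: indicator_def gag_eq)
    also have "\<dots> < \<infinity>" using sol a unfolding weak_sol_eps_def by auto
    finally show ?thesis .
  qed
  have bump: "(\<integral>x. (w b x - w a x) * bump h (x - z) \<partial>lborel)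
      = - ?C * (\<integral>t. gform s (f t) (\<lambda>x. bump h (x - z)) \<partial>tm a b)" if ab: "0 < a" "a < b" and h: "h > 0" for a b h and z :: "real^'d"
  proof -
    define \<rho> where "\<rho> x = bump h (x - z)" for x
    have [measurable]: "\<rho> \<in> borel_measurable borel" unfolding \<rho>_def by measurable
    have \<rho>b: "0 \<le> \<rho> x" "\<rho> x \<le> 1" for x by (auto simp: \<rho>_def bump_le_1)
    have gag\<rho>: "gag s \<rho> < \<infinity>" unfolding \<rho>_def by (rule gag_bump_finite[OF s h])
    define g where "g t = (\<integral>x. w t x * \<rho> x \<partial>lborel)" for t
    have wr: "integrable lborel (\<lambda>x. w t x * \<rho> x)" for t
      by (rule Bochner_Integration.integrable_bound[OF w_int[of t]])
         (use \<rho>b w_nn in \<open>auto intro!: AE_I2 mult_left_le simp: abs_mult\<close>)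
    have g_lip: "\<bar>g r - g t\<bar> \<le> (\<integral>x. \<bar>w r x - w t x\<bar> \<partial>lborel)" for r t
    proof -
      have "g r - g t = (\<integral>x. w r x * \<rho> x - w t x * \<rho> x \<partial>lborel)" unfolding g_def using wr by simp
      also have "\<bar>\<dots>\<bar> \<le> (\<integral>x. \<bar>w r x - w t x\<bar> \<partial>lborel)"
        by (intro order_trans[OF integral_abs_bound integral_mono'] Bochner_Integration.integrable_abs Bochner_Integration.integrable_diff w_int)
           (use \<rho>b in \<open>auto simp: left_diff_distrib[symmetric] abs_mult intro!: mult_left_le\<close>)
      finally show ?thesis .
    qed
    have g_cont: "continuous_on UNIV g"
    proof (intro continuous_at_imp_continuous_on ballI)
      fix t
      have "((\<lambda>r. \<bar>g r - g t\<bar>) \<longlongrightarrow> 0) (at t)"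
        by (rule tendsto_sandwich[OF _ _ tendsto_const w_cont[of t]]) (auto simp: g_lip)
      then have "((\<lambda>r. g r - g t) \<longlongrightarrow> 0) (at t)" by (rule tendsto_rabs_zero_cancel)
      then show "isCont g t" unfolding isCont_def by (rule Lim_null[THEN iffD2])
    qed
    define \<eta> where "\<eta> k = 1 / real (Suc k)" for k
    have \<eta>: "0 < \<eta> k" "\<eta> k \<le> 1" for k by (auto simp: \<eta>_def divide_le_eq)
    define I where "I t = ?C * itform s (f t) \<rho>" for t
    have [measurable]: "I \<in> borel_measurable borel" unfolding I_def itform_def by measurable
    have sst [measurable]: "sstep \<in> borel_measurable borel"
      by (rule borel_measurable_continuous_onI) (meson DERIV_isCont sstep_DERIV continuous_at_imp_continuous_on)
    have [measurable]: "ramp a b (\<eta> k) \<in> borel_measurable borel" for k unfolding ramp_def by measurable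
    have [measurable]: "sstep' \<in> borel_measurable borel" by (rule borel_measurable_continuous_onI[OF sstep'_continuous])
    let ?K = "\<lambda>c k t. sstep' ((t - c) / \<eta> k) / \<eta> k"
    let ?H = "\<lambda>t. ?C * gform s (f t) \<rho>"
    \<comment> \<open>The ramps have width at most 1, so all of them live on
      \<open>{a..b + 1}\<close>, a domain independent of \<open>k\<close>.\<close>
    have key: "(\<integral>t. ?K a k t * g t \<partial>lborel) - (\<integral>t. ?K b k t * g t \<partial>lborel) = (\<integral>t. ramp a b (\<eta> k) t * ?H t \<partial>tm a (b + 1))" for k
    proof -
      let ?\<zeta> = "\<lambda>p :: real \<times> (real^'d). ramp a b (\<eta> k) (fst p) * bump h (snd p - z)"
      note tf = test_fn_ramp_bump[OF ab \<eta>(1)[of k] h, of z]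
      have eq0: "(\<integral>t\<in>{0<..}. (\<integral>x. v t x * time_deriv ?\<zeta> t x \<partial>lebesgue) \<partial>lborel)
        - (\<integral>t\<in>{0<..}. frac_pairing s (\<lambda>x. ?F (v t x)) (\<lambda>x. ?\<zeta> (t, x)) \<partial>lborel) = 0"
        using sol tf(1) unfolding weak_sol_eps_def by blast
      have "(\<integral>x. v t x * time_deriv ?\<zeta> t x \<partial>lebesgue) = ?K a k t * g t - ?K b k t * g t" if "0 < t" for t
      proof -
        have "(\<integral>x. v t x * time_deriv ?\<zeta> t x \<partial>lebesgue) = (\<integral>x. w t x * ((?K a k t - ?K b k t) * \<rho> x) \<partial>lborel)"
          unfolding tf(2) \<rho>_def diff_divide_distrib
          by (rule integral_lebesgue_cong_AE, measurable) (use w_ae[OF less_imp_le[OF that]] in \<open>eventually_elim, simp\<close>)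
        also have "\<dots> = (\<integral>x. (?K a k t - ?K b k t) * (w t x * \<rho> x) \<partial>lborel)" by (simp add: mult_ac)
        also have "\<dots> = (?K a k t - ?K b k t) * g t" unfolding g_def by simp
        finally show ?thesis by (simp add: left_diff_distrib)
      qed
      then have "(\<integral>t\<in>{0<..}. (\<integral>x. v t x * time_deriv ?\<zeta> t x \<partial>lebesgue) \<partial>lborel) = (\<integral>t\<in>{0<..}. ?K a k t * g t - ?K b k t * g t \<partial>lborel)"
        by (intro set_lebesgue_integral_cong) auto
      also have "\<dots> = (\<integral>t. ?K a k t * g t - ?K b k t * g t \<partial>lborel)"
        unfolding set_lebesgue_integral_def
      proof (intro Bochner_Integration.integral_cong refl)
        fix t :: real
        have "sstep' ((t - a) / \<eta> k) = 0" "sstep' ((t - b) / \<eta> k) = 0" if "t \<le> 0"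
          using that ab \<eta>(1)[of k] by (auto intro!: sstep'_zero simp: divide_less_0_iff)
        then show "indicat_real {0<..} t *\<^sub>R (?K a k t * g t - ?K b k t * g t) = ?K a k t * g t - ?K b k t * g t"
          by (auto simp: indicator_def)
      qed
      also have "\<dots> = (\<integral>t. ?K a k t * g t \<partial>lborel) - (\<integral>t. ?K b k t * g t \<partial>lborel)"
        by (intro Bochner_Integration.integral_diff sstep_mollify(2)[OF g_cont] \<eta>)
      finally have L: "(\<integral>t\<in>{0<..}. (\<integral>x. v t x * time_deriv ?\<zeta> t x \<partial>lebesgue) \<partial>lborel) = (\<integral>t. ?K a k t * g t \<partial>lborel) - (\<integral>t. ?K b k t * g t \<partial>lborel)" .
      have "frac_pairing s (\<lambda>x. ?F (v t x)) (\<lambda>x. ?\<zeta> (t, x)) = ramp a b (\<eta> k) t * I t" if "0 < t" for t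
      proof -
        have "frac_pairing s (\<lambda>x. ?F (v t x)) (\<lambda>x. ?\<zeta> (t, x)) = ?C * itform s (f t) (\<lambda>x. ramp a b (\<eta> k) t * \<rho> x)"
          using that unfolding fst_conv snd_conv \<rho>_def[symmetric]
          by (intro frac_pairing_eq_itform f_ae) auto
        then show ?thesis by (simp add: itform_scale I_def)
      qed
      then have "(\<integral>t\<in>{0<..}. frac_pairing s (\<lambda>x. ?F (v t x)) (\<lambda>x. ?\<zeta> (t, x)) \<partial>lborel) = (\<integral>t\<in>{0<..}. ramp a b (\<eta> k) t * I t \<partial>lborel)"
        by (intro set_lebesgue_integral_cong) auto
      also have "\<dots> = (\<integral>t. indicator {a..b + 1} t * (ramp a b (\<eta> k) t * I t) \<partial>lborel)"
        unfolding set_lebesgue_integral_def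
      proof (intro Bochner_Integration.integral_cong refl)
        fix t :: real
        have "ramp a b (\<eta> k) t = 0" if "t \<notin> {a..b + 1}"
        proof (cases "t < a")
          case True
          then have "(t - a) / \<eta> k \<le> 0" "(t - b) / \<eta> k \<le> 0" using ab \<eta>(1)[of k] by (auto simp: divide_le_0_iff)
          then show ?thesis by (simp add: ramp_def sstep_bounds)
        next
          case False
          then have "(t - a) / \<eta> k \<ge> 1" "(t - b) / \<eta> k \<ge> 1" using that ab \<eta>[of k] by (auto simp: le_divide_eq)
          then show ?thesis by (simp add: ramp_def sstep_bounds)
        qed
        then show "indicat_real {0<..} t *\<^sub>R (ramp a b (\<eta> k) t * I t) = indicat_real {a..b + 1} t * (ramp a b (\<eta> k) t * I t)"
          using ab by (auto simp: indicator_def)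
      qed
      also have "\<dots> = (\<integral>t. ramp a b (\<eta> k) t * I t \<partial>tm a (b + 1))"
        by (rule integral_tm[symmetric]) measurable
      \<comment> \<open>At almost every time the energy is finite, and there the iterated integral
        agrees with the form.\<close>
      also have "\<dots> = (\<integral>t. ramp a b (\<eta> k) t * ?H t \<partial>tm a (b + 1))"
      proof (rule integral_cong_AE)
        have "AE t in tm a (b + 1). gag s (f t) \<noteq> \<infinity>"
          using gag_fin[OF ab(1), of "b + 1"] by (intro nn_integral_PInf_AE) auto
        then show "AE t in tm a (b + 1). ramp a b (\<eta> k) t * I t = ramp a b (\<eta> k) t * ?H t"
          by eventually_elim (use gag\<rho> in \<open>simp add: I_def itform_eq_gform less_top\<close>)
      qed measurable
      finally show ?thesis using eq0 L by simp
    qed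
    have Hint: "integrable (tm a (b + 1)) ?H"
      using gag_fin[OF ab(1), of "b + 1"] gag\<rho> ab
      by (intro integrable_mult_right tm_gform_prod(2)) (auto simp: ennreal_mult_less_top)
    have R: "(\<lambda>k. \<integral>t. ramp a b (\<eta> k) t * ?H t \<partial>tm a (b + 1)) \<longlonglongrightarrow> (\<integral>t. indicator {a<..b} t * ?H t \<partial>tm a (b + 1))"
    proof (rule integral_dominated_convergence[where w = "\<lambda>t. \<bar>?H t\<bar>"])
      show "AE t in tm a (b + 1). (\<lambda>k. ramp a b (\<eta> k) t * ?H t) \<longlonglongrightarrow> indicator {a<..b} t * ?H t"
      proof (intro AE_I2 tendsto_mult_right)
        fix t :: real
        have st: "(\<lambda>k. sstep ((t - c) / \<eta> k)) \<longlonglongrightarrow> (if c < t then 1 else 0)" for c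
        proof (cases "c < t")
          case True
          have "\<forall>\<^sub>F k in sequentially. sstep ((t - c) / \<eta> k) = 1"
            using eventually_ge_at_top[of "nat \<lceil>1 / (t - c)\<rceil>"]
          proof eventually_elim
            case (elim k)
            then have "1 / (t - c) \<le> real (Suc k)" by linarith
            then have "1 \<le> (t - c) / \<eta> k" using True by (simp add: \<eta>_def field_simps)
            then show ?case by (rule sstep_bounds)
          qed
          then show ?thesis using True by (simp add: tendsto_eventually)
        next
          case False
          then have "sstep ((t - c) / \<eta> k) = 0" for k
            using \<eta>(1)[of k] by (intro sstep_bounds) (auto simp: divide_le_0_iff)
          then show ?thesis using False by simp
        qed
        have "(\<lambda>k. ramp a b (\<eta> k) t) \<longlonglongrightarrow> (if a < t then 1 else 0) - (if b < t then 1 else 0)"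
          unfolding ramp_def by (intro tendsto_diff st)
        also have "(if a < t then 1 else 0) - (if b < t then 1 else 0) = (indicator {a<..b} t :: real)"
          using ab by (auto simp: indicator_def)
        finally show "(\<lambda>k. ramp a b (\<eta> k) t) \<longlonglongrightarrow> indicator {a<..b} t" .
      qed
      show "AE t in tm a (b + 1). norm (ramp a b (\<eta> k) t * ?H t) \<le> \<bar>?H t\<bar>" for k
      proof (rule AE_I2)
        fix t :: real
        have "\<bar>ramp a b (\<eta> k) t\<bar> \<le> 1"
          using sstep_bounds(1,2)[of "(t - a) / \<eta> k"] sstep_bounds(1,2)[of "(t - b) / \<eta> k"] unfolding ramp_def by linarith
        then have "\<bar>ramp a b (\<eta> k) t\<bar> * \<bar>?H t\<bar> \<le> 1 * \<bar>?H t\<bar>" by (intro mult_right_mono) auto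
        then show "norm (ramp a b (\<eta> k) t * ?H t) \<le> \<bar>?H t\<bar>" by (simp only: real_norm_def abs_mult mult_1)
      qed
      show "integrable (tm a (b + 1)) (\<lambda>t. \<bar>?H t\<bar>)" using Hint by (rule Bochner_Integration.integrable_abs)
    qed measurable
    have "(\<integral>t. indicator {a<..b} t * ?H t \<partial>tm a (b + 1)) = (\<integral>t. indicator {a..b + 1} t * (indicator {a<..b} t * ?H t) \<partial>lborel)"
      by (rule integral_tm) measurable
    also have "\<dots> = (\<integral>t. indicator {a..b} t * ?H t \<partial>lborel)"
    proof (rule integral_cong_AE)
      show "AE t in lborel. indicator {a..b + 1} t * (indicator {a<..b} t * ?H t) = indicator {a..b} t * ?H t"
        using AE_lborel_singleton[of a] by eventually_elim (auto simp: indicator_def)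
    qed measurable
    also have "\<dots> = (\<integral>t. ?H t \<partial>tm a b)" by (rule integral_tm[symmetric]) measurable
    also have "\<dots> = ?C * (\<integral>t. gform s (f t) \<rho> \<partial>tm a b)" by simp
    finally have Rv: "(\<integral>t. indicator {a<..b} t * ?H t \<partial>tm a (b + 1)) = ?C * (\<integral>t. gform s (f t) \<rho> \<partial>tm a b)" .
    have "(\<lambda>k. (\<integral>t. ?K a k t * g t \<partial>lborel) - (\<integral>t. ?K b k t * g t \<partial>lborel)) \<longlonglongrightarrow> g a - g b"
      unfolding \<eta>_def by (intro tendsto_diff sstep_mollify(1)[OF g_cont])
    then have "g a - g b = ?C * (\<integral>t. gform s (f t) \<rho> \<partial>tm a b)"
      unfolding key using R unfolding Rv by (rule LIMSEQ_unique)
    moreover have "(\<integral>x. (w b x - w a x) * \<rho> x \<partial>lborel) = g b - g a"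
      unfolding g_def using wr by (simp add: left_diff_distrib)
    ultimately show ?thesis by (simp add: \<rho>_def[symmetric])
  qed
  have "frac_flow s ?C (phi_rate n \<epsilon>) ?F w"
  proof
    show "?F x < ?F y" if "0 \<le> x" "x < y" for x y
      unfolding phi_eps_def using phi_strict_mono[OF n, of "x + \<epsilon>" "y + \<epsilon>"] that \<epsilon> by simp
    show "?F 0 = 0" by (simp add: phi_eps_def)
    show "\<bar>?F x - ?F y\<bar> \<le> phi_rate n \<epsilon> * \<bar>x - y\<bar>" if "0 \<le> x" "0 \<le> y" for x y
      by (rule phi_eps_lipschitz[OF n \<epsilon> that])
    show "(\<integral>\<^sup>+t. gag s (\<lambda>x. ?F (w t x)) \<partial>tm a b) < \<infinity>" if "0 < a" for a b
      using gag_fin[OF that] by (simp add: f_def[abs_def])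
    show "(\<integral>x. (w b x - w a x) * bump h (x - z) \<partial>lborel) = - ?C * (\<integral>t. gform s (\<lambda>x. ?F (w t x)) (\<lambda>x. bump h (x - z)) \<partial>tm a b)"
      if "0 < a" "a < b" "0 < h" for a b h z
      using bump[OF that] by (simp add: f_def[abs_def])
  qed (use s C w_nn w_int w_cont in auto)
  then show thesis using that w_ae by blast
qed

section \<open>From small superlevel sets to small excess, and back\<close>

context frac_flow begin

text \<open>Where the solution exceeds \<open>K\<close>, its excess is at most \<open>M\<close> plus
  the excess over \<open>M\<close>. A small superlevel set therefore gives small excess once the
  mass at very large values is under control.\<close>

lemma pp_split:
  assumes "0 < K" "0 \<le> M"
  shows "pp K t \<le> pp M t + M * superlevel (v t) K"
proof -
  have fin: "emeasure lborel {x. K < v t x} < \<infinity>"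
    using superlevel_finite(1)[OF v_int assms(1), of t] by simp
  have i: "integrable lborel (\<lambda>x. M * indicator {x. K < v t x} x)"
    using fin by (intro integrable_mult_right integrable_real_indicator) auto
  have "pp K t \<le> (\<integral>x. max 0 (v t x - M) + M * indicator {x. K < v t x} x \<partial>lborel)"
    unfolding pp_def using assms
    by (intro Bochner_Integration.integral_mono pp_int Bochner_Integration.integrable_add i) (auto simp: indicator_def)
  also have "\<dots> = pp M t + M * superlevel (v t) K"
    using assms i by (simp add: pp_int pp_def superlevel_def)
  finally show ?thesis .
qed

lemma pp_Markov:
  assumes [measurable]: "S \<in> sets borel" and K: "0 \<le> K" "0 < c" and S: "\<And>x. x \<in> S \<Longrightarrow> K + c \<le> v t x"
  shows "ennreal c * emeasure lborel S \<le> ennreal (pp K t)"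
proof -
  have "ennreal c * emeasure lborel S = (\<integral>\<^sup>+x. ennreal c * indicator S x \<partial>lborel)"
    by (subst nn_integral_cmult_indicator) auto
  also have "\<dots> \<le> (\<integral>\<^sup>+x. ennreal (max 0 (v t x - K)) \<partial>lborel)"
    using S K by (intro nn_integral_mono) (auto simp: indicator_def intro!: ennreal_leI dest!: S)
  also have "\<dots> = ennreal (pp K t)"
    unfolding pp_def by (rule nn_integral_eq_integral[OF pp_int[OF K(1)]]) auto
  finally show ?thesis .
qed

end

section \<open>Vanishing of the limit\<close>

text \<open>Here the singularity enters: \<open>phi n \<epsilon>\<close> tends to minus infinity,
  while \<open>phi n (K + \<epsilon>)\<close> stays above \<open>phi n K\<close>.\<close>

lemma phi_eps_blowup:
  assumes n: "0 \<le> n" and K: "0 < K"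
  shows "\<exists>\<epsilon>0>0. \<forall>\<epsilon>. 0 < \<epsilon> \<and> \<epsilon> < \<epsilon>0 \<longrightarrow> X < phi_eps n \<epsilon> K"
proof -
  have "\<forall>\<^sub>F \<epsilon> in at_right 0. phi n \<epsilon> < phi n K - X"
  proof (cases "n > 0")
    case True
    define Y where "Y = max 1 (X - phi n K + 1)"
    have Y: "0 < Y" "X - phi n K < Y" by (auto simp: Y_def)
    have "\<forall>\<^sub>F \<epsilon> in at_right (0::real). \<epsilon> \<in> {0<..<Y powr (- 1 / n)}" by (rule eventually_at_right_real) (use Y in simp)
    then show ?thesis
    proof eventually_elim
      case (elim \<epsilon>)
      have "(Y powr (- 1 / n)) powr (- n) < \<epsilon> powr (- n)" using elim True by (intro powr_less_mono2_neg) auto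
      then have "Y < \<epsilon> powr (- n)" using Y True by (simp add: powr_powr)
      then show ?case using Y True by (simp add: phi_def)
    qed
  next
    case False
    have "\<forall>\<^sub>F \<epsilon> in at_right 0. ln \<epsilon> < phi n K - X" using ln_at_0 unfolding filterlim_at_bot_dense by blast
    then show ?thesis using False by (simp add: phi_def)
  qed
  then obtain b where b: "b > 0" "\<And>\<epsilon>. 0 < \<epsilon> \<Longrightarrow> \<epsilon> < b \<Longrightarrow> phi n \<epsilon> < phi n K - X"
    unfolding eventually_at_right_field by blast
  show ?thesis
  proof (intro exI[of _ b] conjI allI impI b(1))
    fix \<epsilon> assume e: "0 < \<epsilon> \<and> \<epsilon> < b"
    have "phi n K < phi n (K + \<epsilon>)" using phi_strict_mono[OF n K] e by simp
    then show "X < phi_eps n \<epsilon> K" using b(2)[of \<epsilon>] e by (simp add: phi_eps_def)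
  qed
qed

text \<open>One flow for each \<epsilon>, with a common constant \<open>C\<close> and a common Borel
  initial datum \<open>U\<close>. Apart from the solution itself, what varies with \<epsilon> is
  \<open>phi_eps\<close> and its Lipschitz constant.\<close>

locale flow_family =
  fixes s n C :: real and W :: "real \<Rightarrow> real \<Rightarrow> 'a::euclidean_space \<Rightarrow> real" and U :: "'a \<Rightarrow> real"
  assumes n: "0 \<le> n" and s: "0 < s" "s < 1" and dim: "2 * s < real DIM('a)"
    and flow: "\<And>\<epsilon>. 0 < \<epsilon> \<Longrightarrow> frac_flow s C (phi_rate n \<epsilon>) (phi_eps n \<epsilon>) (W \<epsilon>)"
    and init: "\<And>\<epsilon>. 0 < \<epsilon> \<Longrightarrow> AE x in lborel. W \<epsilon> 0 x = U x"
    and U_meas [measurable]: "U \<in> borel_measurable borel" and U_nn: "\<And>x. 0 \<le> U x" and U_int: "integrable lborel U"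
begin

abbreviation "mass_above \<epsilon> k t \<equiv> frac_flow.pp (W \<epsilon>) k t"

definition U0 where "U0 k = (\<integral>x. max 0 (U x - k) \<partial>lborel)"

lemma mass_above_0: "0 < \<epsilon> \<Longrightarrow> mass_above \<epsilon> k 0 = U0 k"
proof -
  assume e: "0 < \<epsilon>"
  interpret A: frac_flow s C "phi_rate n \<epsilon>" "phi_eps n \<epsilon>" "W \<epsilon>" by (rule flow[OF e])
  show ?thesis unfolding A.pp_def U0_def by (rule integral_cong_AE) (use init[OF e] in auto)
qed

lemma U0_tendsto: "(\<lambda>j. U0 (real j)) \<longlonglongrightarrow> 0"
proof -
  have "(\<lambda>j. U0 (real j)) \<longlonglongrightarrow> (\<integral>x. 0 \<partial>(lborel :: 'a measure))"
    unfolding U0_def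
  proof (rule integral_dominated_convergence[where w = U])
    show "AE x in lborel. (\<lambda>j. max 0 (U x - real j)) \<longlonglongrightarrow> 0"
    proof (rule AE_I2)
      fix x
      have "\<forall>\<^sub>F j in sequentially. max 0 (U x - real j) = 0"
        using eventually_ge_at_top[of "nat \<lceil>U x\<rceil>"] by eventually_elim linarith
      then show "(\<lambda>j. max 0 (U x - real j)) \<longlonglongrightarrow> 0" by (rule tendsto_eventually)
    qed
  qed (use U_nn U_int in auto)
  then show ?thesis by simp
qed

lemma C_pos: "0 < C"
  using frac_flow.C[OF flow[of 1]] by simp

text \<open>The constants are fixed in the order \<open>L\<close>, \<open>B\<close>,
  \<open>X\<close>, \<open>\<epsilon>0\<close>: a height above which the initial datum has little
  mass, the measure allowed for {w > K}, and the size of \<open>phi_eps n \<epsilon> K\<close> that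
  forces this measure at some time in \<open>{\<tau> / 2..\<tau>}\<close>. The first three do not
  depend on \<epsilon>.\<close>

lemma excess_vanishes:
  assumes \<tau>: "0 < \<tau>" and K: "0 < K" and \<eta>: "0 < \<eta>"
  shows "\<exists>\<epsilon>0>0. \<forall>\<epsilon>. 0 < \<epsilon> \<and> \<epsilon> < \<epsilon>0 \<longrightarrow> (\<forall>t\<ge>\<tau>. mass_above \<epsilon> (2 * K) t \<le> \<eta>)"
proof -
  obtain c where c: "c > 0" and WS: "\<And>(g :: 'a \<Rightarrow> real) l K. integrable lborel g \<Longrightarrow> (\<And>x. 0 \<le> g x) \<Longrightarrow> (\<And>x. g x \<le> K) \<Longrightarrow> gag s g < \<infinity> \<Longrightarrow> l > 0 \<Longrightarrow>
       c * (l\<^sup>2 * superlevel g l powr (1 - 2 * s / real DIM('a))) \<le> enn2real (gag s g)"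
    by (rule weak_sobolev[OF s(1) dim]) blast
  define \<theta> where "\<theta> = 1 - 2 * s / real DIM('a)"
  have \<theta>: "0 < \<theta>" using dim by (simp add: \<theta>_def field_simps)
  have "\<forall>\<^sub>F j in sequentially. U0 (real j) < \<eta> / 2 \<and> 0 < j"
    using \<eta> by (intro eventually_conj order_tendstoD(2)[OF U0_tendsto] eventually_gt_at_top) simp
  then obtain j :: nat where j: "U0 (real j) < \<eta> / 2" "0 < j" using eventually_happens'[OF sequentially_bot] by blast
  define L where "L = real j"
  have L: "0 < L" "U0 L \<le> \<eta> / 2" using j by (auto simp: L_def)
  \<comment> \<open>A set of measure \<eta>/(4L) times the height 2L costs half of
    \<open>\<eta>\<close>; the excess over \<open>2 * L\<close> costs the other half.\<close>
  define B where "B = (\<eta> / (4 * L)) powr \<theta>"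
  have B: "0 < B" using \<eta> L by (simp add: B_def)
  \<comment> \<open>The condition of \<open>level_time\<close> for k = 0, l = K and a time interval
    of length \<tau>/2, solved for the increment of \<open>phi_eps\<close>; \<open>U0 0\<close> is
    the total mass.\<close>
  define X where "X = 4 * U0 0 / (C * c * (\<tau> / 2) * B)"
  obtain \<epsilon>0 where \<epsilon>0: "\<epsilon>0 > 0" "\<And>\<epsilon>. 0 < \<epsilon> \<Longrightarrow> \<epsilon> < \<epsilon>0 \<Longrightarrow> X < phi_eps n \<epsilon> K"
    using phi_eps_blowup[OF n K, of X] by blast
  show ?thesis
  proof (intro exI[of _ \<epsilon>0] conjI allI impI \<epsilon>0(1))
    fix \<epsilon> t assume e: "0 < \<epsilon> \<and> \<epsilon> < \<epsilon>0" and t: "\<tau> \<le> t"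
    interpret A: frac_flow s C "phi_rate n \<epsilon>" "phi_eps n \<epsilon>" "W \<epsilon>" using flow e by blast
    have "4 * mass_above \<epsilon> 0 0 < C * c * (phi_eps n \<epsilon> K - phi_eps n \<epsilon> 0) * (\<tau> - \<tau> / 2) * B"
    proof -
      have "0 < C * c * (\<tau> / 2) * B" using C_pos c \<tau> B by simp
      then have "4 * U0 0 < phi_eps n \<epsilon> K * (C * c * (\<tau> / 2) * B)"
        using \<epsilon>0(2)[of \<epsilon>] e by (simp add: X_def pos_divide_less_eq)
      moreover have "phi_eps n \<epsilon> 0 = 0" by (rule A.F_0)
      ultimately show ?thesis using mass_above_0[of \<epsilon> 0] e by (simp add: mult_ac)
    qed
    then have "\<exists>r\<in>{\<tau> / 2..\<tau>}. superlevel (W \<epsilon> r) K powr \<theta> < B"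
      using c \<tau> K \<theta> by (intro A.level_time[of 0 K 0 \<tau> c "\<tau> / 2" \<theta> B] WS[folded \<theta>_def]) auto
    then obtain r where r: "\<tau> / 2 \<le> r" "r \<le> \<tau>" "superlevel (W \<epsilon> r) K powr \<theta> < B" by auto
    have sl: "superlevel (W \<epsilon> r) K \<le> \<eta> / (4 * L)"
    proof (rule ccontr)
      assume "\<not> ?thesis"
      then have "B \<le> superlevel (W \<epsilon> r) K powr \<theta>" unfolding B_def using \<theta> \<eta> L by (intro powr_mono2) auto
      then show False using r by simp
    qed
    have "mass_above \<epsilon> (2 * K) t \<le> mass_above \<epsilon> K r" using K r \<tau> t by (intro A.pp_decay) auto
    also have "\<dots> \<le> mass_above \<epsilon> (2 * L) r + 2 * L * superlevel (W \<epsilon> r) K" using K L by (intro A.pp_split) auto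
    also have "mass_above \<epsilon> (2 * L) r \<le> mass_above \<epsilon> L 0" using L r \<tau> by (intro A.pp_decay) auto
    also have "mass_above \<epsilon> L 0 \<le> \<eta> / 2" using mass_above_0[of \<epsilon> L] e L by simp
    also have "2 * L * superlevel (W \<epsilon> r) K \<le> 2 * L * (\<eta> / (4 * L))" using sl L by (intro mult_left_mono) auto
    also have "\<eta> / 2 + 2 * L * (\<eta> / (4 * L)) = \<eta>" using L by simp
    finally show "mass_above \<epsilon> (2 * K) t \<le> \<eta>" by simp
  qed
qed

lemma ball_integral_vanishes:
  assumes \<tau>: "0 < \<tau>" and \<delta>: "0 < \<delta>"
  shows "\<exists>\<epsilon>0>0. \<forall>\<epsilon>. 0 < \<epsilon> \<and> \<epsilon> < \<epsilon>0 \<longrightarrow> (\<forall>t\<ge>\<tau>. (\<integral>x. indicator (ball c r) x * (W \<epsilon> t x + \<epsilon>) \<partial>lborel) \<le> \<delta>)"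
proof -
  define V where "V = measure lborel (ball c r)"
  have V: "0 \<le> V" by (simp add: V_def)
  have Bfin: "emeasure lborel (ball c r) < \<infinity>" by (rule emeasure_lborel_ball_finite)
  \<comment> \<open>On the ball the integrand is at most \<open>3 * K\<close> plus the excess over
    \<open>2 * K\<close>, as \<epsilon> < K; the constant part integrates to at most \<delta>/2. The
    summand 1 keeps the divisor positive.\<close>
  define K where "K = \<delta> / (6 * (V + 1))"
  have K: "0 < K" "3 * K * V \<le> \<delta> / 2"
  proof -
    show "0 < K" using \<delta> V by (simp add: K_def)
    have "3 * K * V \<le> 3 * K * (V + 1)" using \<open>0 < K\<close> by simp
    also have "\<dots> = \<delta> / 2" using V by (simp add: K_def field_simps)
    finally show "3 * K * V \<le> \<delta> / 2" .
  qed
  obtain \<epsilon>0 where \<epsilon>0: "\<epsilon>0 > 0" "\<And>\<epsilon> t. 0 < \<epsilon> \<Longrightarrow> \<epsilon> < \<epsilon>0 \<Longrightarrow> \<tau> \<le> t \<Longrightarrow> mass_above \<epsilon> (2 * K) t \<le> \<delta> / 2"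
    using excess_vanishes[OF \<tau> K(1), of "\<delta> / 2"] \<delta> by auto
  show ?thesis
  proof (intro exI[of _ "min \<epsilon>0 K"] conjI allI impI)
    show "0 < min \<epsilon>0 K" using \<epsilon>0 K by simp
    fix \<epsilon> t assume e: "0 < \<epsilon> \<and> \<epsilon> < min \<epsilon>0 K" and t: "\<tau> \<le> t"
    interpret A: frac_flow s C "phi_rate n \<epsilon>" "phi_eps n \<epsilon>" "W \<epsilon>" using flow e by blast
    have ib: "integrable lborel (\<lambda>x. 3 * K * indicator (ball c r) x)"
      using Bfin by (intro integrable_mult_right integrable_real_indicator) auto
    have "(\<integral>x. indicator (ball c r) x * (W \<epsilon> t x + \<epsilon>) \<partial>lborel) \<le> (\<integral>x. 3 * K * indicator (ball c r) x + max 0 (W \<epsilon> t x - 2 * K) \<partial>lborel)"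
      using e K by (intro integral_mono' Bochner_Integration.integrable_add ib A.pp_int) (auto simp: indicator_def)
    also have "\<dots> = 3 * K * V + mass_above \<epsilon> (2 * K) t"
      using ib K by (simp add: A.pp_int A.pp_def V_def)
    also have "\<dots> \<le> \<delta> / 2 + \<delta> / 2" using K \<epsilon>0(2)[of \<epsilon> t] e t by (intro add_mono) auto
    finally show "(\<integral>x. indicator (ball c r) x * (W \<epsilon> t x + \<epsilon>) \<partial>lborel) \<le> \<delta>" by simp
  qed
qed

text \<open>The smallness \<open>\<eta>\<close> demanded by the De Giorgi iteration depends on the
  lower bound \<open>c0\<close> for the slope of \<open>phi_eps\<close>, which is the same for all
  \<epsilon> < 1; so \<open>excess_vanishes\<close> can supply it at time \<open>T\<close>. The sup
  bound on the datum persists as vanishing of the excess over \<open>2 * M0\<close>.\<close>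

lemma uniformly_vanishes:
  assumes M: "AE x in lborel. U x \<le> M" and \<tau>: "0 < \<tau>" and \<delta>: "0 < \<delta>"
  shows "\<exists>\<epsilon>0>0. \<forall>\<epsilon>. 0 < \<epsilon> \<and> \<epsilon> < \<epsilon>0 \<longrightarrow> (\<forall>t\<ge>\<tau>. AE x in lborel. W \<epsilon> t x + \<epsilon> \<le> \<delta>)"
proof -
  obtain c where c: "c > 0" and WS: "\<And>(g :: 'a \<Rightarrow> real) l K. integrable lborel g \<Longrightarrow> (\<And>x. 0 \<le> g x) \<Longrightarrow> (\<And>x. g x \<le> K) \<Longrightarrow> gag s g < \<infinity> \<Longrightarrow> l > 0 \<Longrightarrow>
       c * (l\<^sup>2 * superlevel g l powr (1 - 2 * s / real DIM('a))) \<le> enn2real (gag s g)"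
    by (rule weak_sobolev[OF s(1) dim]) blast
  define \<theta> where "\<theta> = 1 - 2 * s / real DIM('a)"
  have \<theta>: "0 < \<theta>" "\<theta> < 1" using dim s by (auto simp: \<theta>_def field_simps)
  define M0 where "M0 = max M 1"
  have M0: "0 < M0" by (simp add: M0_def)
  have "U0 M0 = (\<integral>x. 0 \<partial>(lborel :: 'a measure))"
    unfolding U0_def by (rule integral_cong_AE) (use M in \<open>auto simp: M0_def\<close>)
  then have U00: "U0 M0 = 0" by simp
  \<comment> \<open>The iteration ends at the level \<open>2 * K\<close>, and \<epsilon> < 2K adds
    at most as much again.\<close>
  define K where "K = \<delta> / 4"
  have K: "0 < K" using \<delta> by (simp add: K_def)
  define T where "T = \<tau> / 2"
  have T: "0 < T" using \<tau> by (simp add: T_def)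
  define c0 where "c0 = phi_rate n (2 * K + 1)"
  have c0: "0 < c0" unfolding c0_def using K by (intro phi_rate_pos) simp
  obtain \<eta> \<rho> where \<eta>: "0 < \<eta>" "0 < \<rho>" "\<rho> < 1" "\<And>j::nat. 2 * M0 * ((64 / (C * c * c0 * K * T)) * 4 ^ j * (\<eta> * \<rho> ^ j)) powr (1 / \<theta>) \<le> \<eta> * \<rho> ^ Suc j"
    by (rule powr_iteration[of "1 / \<theta>" "2 * M0" "64 / (C * c * c0 * K * T)"]) (use \<theta> M0 C_pos c c0 K T in auto)
  obtain \<epsilon>0 where \<epsilon>0: "\<epsilon>0 > 0" "\<And>\<epsilon> t. 0 < \<epsilon> \<Longrightarrow> \<epsilon> < \<epsilon>0 \<Longrightarrow> T \<le> t \<Longrightarrow> mass_above \<epsilon> K t \<le> \<eta>"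
    using excess_vanishes[OF T, of "K / 2" \<eta>] K \<eta> by auto
  show ?thesis
  proof (intro exI[of _ "min \<epsilon>0 (min 1 (2 * K))"] conjI allI impI)
    show "0 < min \<epsilon>0 (min 1 (2 * K))" using \<epsilon>0 K by simp
    fix \<epsilon> t assume e: "0 < \<epsilon> \<and> \<epsilon> < min \<epsilon>0 (min 1 (2 * K))" and t: "\<tau> \<le> t"
    interpret A: frac_flow s C "phi_rate n \<epsilon>" "phi_eps n \<epsilon>" "W \<epsilon>" using flow e by blast
    have bd: "AE x in lborel. W \<epsilon> t x \<le> 2 * M0" if "0 \<le> t" for t
    proof -
      have "mass_above \<epsilon> (2 * M0) t \<le> mass_above \<epsilon> M0 0" using M0 that by (intro A.pp_decay) auto
      then have "mass_above \<epsilon> (2 * M0) t = 0" using mass_above_0[of \<epsilon> M0] U00 e A.pp_nonneg[of "2 * M0" t] by simp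
      then show ?thesis using M0 by (intro A.pp_zero_AE) auto
    qed
    have "AE x in lborel. W \<epsilon> t x \<le> 2 * K"
    proof (rule A.de_giorgi[OF c \<theta> WS[folded \<theta>_def] T K _ bd c0 _ \<eta>])
      show "0 < 2 * M0" using M0 by simp
      show "c0 * (l - k) \<le> phi_eps n \<epsilon> l - phi_eps n \<epsilon> k" if "K \<le> k" "k < l" "l \<le> 2 * K" for k l
        using phi_increment_ge[OF n, of "k + \<epsilon>" "l + \<epsilon>" "2 * K + 1"] that e K by (simp add: phi_eps_def c0_def)
      show "mass_above \<epsilon> K T \<le> \<eta>" using \<epsilon>0(2)[of \<epsilon> T] e by simp
      show "2 * T \<le> t" using t by (simp add: T_def)
    qed
    then show "AE x in lborel. W \<epsilon> t x + \<epsilon> \<le> \<delta>"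
      by eventually_elim (use e in \<open>simp add: K_def\<close>)
  qed
qed

lemma monotone_in_eps:
  assumes e: "0 < \<epsilon>1" "\<epsilon>1 < \<epsilon>2" and t: "0 \<le> t"
  shows "AE x in lborel. W \<epsilon>1 t x + \<epsilon>1 \<le> W \<epsilon>2 t x + \<epsilon>2"
proof -
  have e2: "0 < \<epsilon>2" using e by linarith
  interpret A: frac_flow s C "phi_rate n \<epsilon>1" "phi_eps n \<epsilon>1" "W \<epsilon>1" by (rule flow[OF e(1)])
  interpret B: frac_flow s C "phi_rate n \<epsilon>2" "phi_eps n \<epsilon>2" "W \<epsilon>2" by (rule flow[OF e2])
  interpret cmp: two_flows s C "phi_rate n \<epsilon>1" "phi_rate n \<epsilon>2" "phi_eps n \<epsilon>1" "phi_eps n \<epsilon>2" "W \<epsilon>1" "W \<epsilon>2" "phi n \<epsilon>2 - phi n \<epsilon>1" \<epsilon>1 \<epsilon>2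
  proof
    show "0 \<le> phi n \<epsilon>2 - phi n \<epsilon>1" using phi_strict_mono[OF n e] by simp
    show "\<epsilon>1 \<le> \<epsilon>2" using e by simp
    fix r r' :: real assume r: "0 \<le> r" "0 \<le> r'"
    have "phi n (r' + \<epsilon>2) < phi n (r + \<epsilon>1) \<longleftrightarrow> r' + \<epsilon>2 < r + \<epsilon>1"
      using phi_strict_mono[OF n, of "r' + \<epsilon>2" "r + \<epsilon>1"] phi_strict_mono[OF n, of "r + \<epsilon>1" "r' + \<epsilon>2"] r e
      by (cases "r' + \<epsilon>2" "r + \<epsilon>1" rule: linorder_cases) auto
    then show "0 < phi_eps n \<epsilon>1 r - (phi n \<epsilon>2 - phi n \<epsilon>1) - phi_eps n \<epsilon>2 r' \<longleftrightarrow> r' + \<epsilon>2 < r + \<epsilon>1"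
      by (simp add: phi_eps_def)
  qed
  show ?thesis
  proof (rule cmp.comparison[OF _ t])
    show "AE x in lborel. W \<epsilon>1 0 x + \<epsilon>1 \<le> W \<epsilon>2 0 x + \<epsilon>2"
      using init[OF e(1)] init[OF e2] by eventually_elim (use e in simp)
  qed
qed

text \<open>For almost every point some \<open>d j\<close> already has a small value, because the
  set where all of them stay large is null. Monotonicity in \<epsilon> transfers this to every
  \<open>e k\<close> below \<open>d j\<close>; it is invoked for the countably many pairs (k, j), so
  the exceptional set stays null.\<close>

lemma pointwise_vanishes:
  assumes t: "0 < t" and e: "\<And>k. 0 < e k" and lim: "e \<longlonglongrightarrow> 0"
  shows "AE x in lborel. (\<lambda>k. W (e k) t x + e k) \<longlonglongrightarrow> 0"
proof -
  define d where "d j = 1 / real (Suc j)" for j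
  have d: "0 < d j" for j by (simp add: d_def)
  have W_meas [measurable]: "W \<epsilon> t \<in> borel_measurable borel" if "0 < \<epsilon>" for \<epsilon>
  proof -
    interpret A: frac_flow s C "phi_rate n \<epsilon>" "phi_eps n \<epsilon>" "W \<epsilon>" by (rule flow[OF that])
    show ?thesis by (rule A.v_meas1)
  qed
  have small: "AE x in lborel. \<exists>j. W (d j) t x + d j \<le> 4 * K" if K: "0 < K" for K
  proof -
    \<comment> \<open>On \<open>S\<close>, every \<open>d j\<close> below \<open>K\<close> leaves a
      solution larger than 3K, hence an excess of at least \<open>K\<close> over the level 2K;
      Markov's inequality then bounds the measure of \<open>S\<close> by arbitrarily small
      numbers.\<close>
    define S where "S = {x. \<forall>j. 4 * K < W (d j) t x + d j}"
    have S_meas: "S \<in> sets borel"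
    proof -
      have [measurable]: "W (d j) t \<in> borel_measurable borel" for j by (rule W_meas[OF d])
      show ?thesis unfolding S_def by measurable
    qed
    have le: "ennreal K * emeasure lborel S \<le> 0 + ennreal \<eta>" if \<eta>: "0 < \<eta>" for \<eta>
    proof -
      obtain \<epsilon>0 where \<epsilon>0: "\<epsilon>0 > 0" "\<And>\<epsilon>. 0 < \<epsilon> \<Longrightarrow> \<epsilon> < \<epsilon>0 \<Longrightarrow> mass_above \<epsilon> (2 * K) t \<le> \<eta>"
        using excess_vanishes[OF t K \<eta>] by blast
      obtain j where j: "d j < min \<epsilon>0 K"
        unfolding d_def using reals_Archimedean[of "min \<epsilon>0 K"] \<epsilon>0 K by (auto simp: inverse_eq_divide)
      interpret A: frac_flow s C "phi_rate n (d j)" "phi_eps n (d j)" "W (d j)" by (rule flow[OF d])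
      have "ennreal K * emeasure lborel S \<le> ennreal (mass_above (d j) (2 * K) t)"
      proof (rule A.pp_Markov[OF S_meas])
        fix x assume "x \<in> S"
        then have "4 * K < W (d j) t x + d j" by (auto simp: S_def)
        then show "2 * K + K \<le> W (d j) t x" using j by simp
      qed (use K in auto)
      also have "\<dots> \<le> ennreal \<eta>" using \<epsilon>0(2)[of "d j"] d j by (intro ennreal_leI) auto
      finally show ?thesis by simp
    qed
    have "ennreal K * emeasure lborel S \<le> 0" by (rule ennreal_le_epsilon) (rule le)
    then have "emeasure lborel S = 0" using K by (simp add: ennreal_eq_0_iff)
    then have "AE x in lborel. x \<notin> S" using S_meas by (intro AE_not_in) auto
    then show ?thesis by eventually_elim (auto simp: S_def not_less)
  qed
  have "AE x in lborel. \<forall>i. \<exists>j. W (d j) t x + d j \<le> 4 * d i"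
    unfolding AE_all_countable using small d by blast
  moreover have "AE x in lborel. \<forall>k j. e k < d j \<longrightarrow> W (e k) t x + e k \<le> W (d j) t x + d j"
    unfolding AE_all_countable
  proof (intro allI)
    fix k j
    show "AE x in lborel. e k < d j \<longrightarrow> W (e k) t x + e k \<le> W (d j) t x + d j"
      using monotone_in_eps[OF e, of k "d j" t] t by (cases "e k < d j") auto
  qed
  ultimately show ?thesis
  proof eventually_elim
    case (elim x)
    have nn: "0 \<le> W (e k) t x" for k using frac_flow.v_nonneg[OF flow[OF e]] .
    show "(\<lambda>k. W (e k) t x + e k) \<longlonglongrightarrow> 0"
    proof (rule tendstoI)
      fix r :: real assume r: "0 < r"
      obtain i where i: "d i < r / 4" unfolding d_def using reals_Archimedean[of "r / 4"] r by (auto simp: inverse_eq_divide)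
      obtain j where j: "W (d j) t x + d j \<le> 4 * d i" using elim(1) by blast
      have "\<forall>\<^sub>F k in sequentially. e k < d j" using order_tendstoD(2)[OF lim d] .
      then show "\<forall>\<^sub>F k in sequentially. dist (W (e k) t x + e k) 0 < r"
      proof eventually_elim
        case (elim k)
        then have "W (e k) t x + e k \<le> W (d j) t x + d j" using \<open>\<forall>k j. e k < d j \<longrightarrow> W (e k) t x + e k \<le> W (d j) t x + d j\<close> by blast
        then show ?case using i j nn[of k] e[of k] by simp
      qed
    qed
  qed
qed

end

section \<open>Return from the Borel representatives to the given solutions\<close>

theorem theorem2p1:
  fixes u0 :: "real^'d \<Rightarrow> real"
    and v :: "real \<Rightarrow> real \<Rightarrow> real^'d \<Rightarrow> real"
    and s n :: real
  assumes "CARD('d) \<ge> 2"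
    and "n \<ge> 0" and "0 < s" and "s < 1"
    and "integrable lebesgue u0" and "AE x in lebesgue. u0 x \<ge> 0"
    and "\<forall>\<epsilon>>0. weak_sol_eps s n \<epsilon> u0 (v \<epsilon>)"
  shows "(\<forall>t>0. \<forall>e::nat \<Rightarrow> real. (\<forall>k. e k > 0) \<longrightarrow> e \<longlonglongrightarrow> 0 \<longrightarrow>
           (AE x in lebesgue. (\<lambda>k. v (e k) t x + e k) \<longlonglongrightarrow> 0)) \<and>
         ((\<exists>M. AE x in lebesgue. u0 x \<le> M) \<longrightarrow>
           (\<forall>\<tau>>0. \<forall>\<delta>>0. \<exists>\<epsilon>0>0. \<forall>\<epsilon>. 0 < \<epsilon> \<and> \<epsilon> < \<epsilon>0 \<longrightarrow>
              (\<forall>t>\<tau>. AE x in lebesgue. \<bar>v \<epsilon> t x + \<epsilon>\<bar> \<le> \<delta>))) \<and>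
         (\<forall>c r \<tau>. \<tau> > 0 \<longrightarrow> (\<forall>\<delta>>0. \<exists>\<epsilon>0>0. \<forall>\<epsilon>. 0 < \<epsilon> \<and> \<epsilon> < \<epsilon>0 \<longrightarrow>
              (\<forall>t\<ge>\<tau>. (\<integral>x\<in>ball c r. \<bar>v \<epsilon> t x + \<epsilon>\<bar> \<partial>lebesgue) \<le> \<delta>)))"
proof -
  have "\<exists>w. frac_flow s (frac_const CARD('d) s / 2) (phi_rate n \<epsilon>) (phi_eps n \<epsilon>) w \<and> (\<forall>t\<ge>0. AE x in lebesgue. v \<epsilon> t x = w t x)"
    if "\<epsilon> > 0" for \<epsilon>
    by (rule weak_sol_flow[OF assms(3,4,2) that]) (use assms(7) that in blast)+
  then obtain W where W: "\<And>\<epsilon>. \<epsilon> > 0 \<Longrightarrow> frac_flow s (frac_const CARD('d) s / 2) (phi_rate n \<epsilon>) (phi_eps n \<epsilon>) (W \<epsilon>)"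
    and vW: "\<And>\<epsilon> t. \<epsilon> > 0 \<Longrightarrow> 0 \<le> t \<Longrightarrow> AE x in lebesgue. v \<epsilon> t x = W \<epsilon> t x"
    by metis
  \<comment> \<open>Any \<epsilon> would serve: at time 0 all representatives agree almost
    everywhere with \<open>u0\<close>, and \<open>W 1 0\<close> is Borel, nonnegative and
    integrable.\<close>
  define U where "U = W 1 0"
  have vu: "AE x in lebesgue. v \<epsilon> 0 x = u0 x" if "\<epsilon> > 0" for \<epsilon>
    using assms(7) that unfolding weak_sol_eps_def by blast
  have Wu: "AE x in lebesgue. W \<epsilon> 0 x = u0 x" if "\<epsilon> > 0" for \<epsilon>
    using vu[OF that] vW[OF that order_refl] by eventually_elim simp
  interpret F1: frac_flow s "frac_const CARD('d) s / 2" "phi_rate n 1" "phi_eps n 1" "W 1" by (rule W) simp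
  interpret flow_family s n "frac_const CARD('d) s / 2" W U
  proof (rule flow_family.intro)
    show "0 \<le> n" "0 < s" "s < 1" by fact+
    \<comment> \<open>From s < 1 and a dimension of at least 2; this makes the Sobolev exponent
      positive.\<close>
    show "2 * s < real DIM(real ^ 'd)" using assms(1,4) by simp
    show "frac_flow s (frac_const CARD('d) s / 2) (phi_rate n \<epsilon>) (phi_eps n \<epsilon>) (W \<epsilon>)" if "0 < \<epsilon>" for \<epsilon>
      by (rule W[OF that])
    show "AE x in lborel. W \<epsilon> 0 x = U x" if "0 < \<epsilon>" for \<epsilon>
    proof -
      have "AE x in lebesgue. W \<epsilon> 0 x = U x"
        unfolding U_def using Wu[OF that] Wu[of 1, OF zero_less_one] by eventually_elim simp
      then show ?thesis by (simp add: AE_completion_iff)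
    qed
    show "U \<in> borel_measurable borel" "0 \<le> U x" "integrable lborel U" for x
      unfolding U_def by (rule F1.v_meas1 F1.v_nonneg F1.v_int)+
  qed
  have nn: "0 \<le> W \<epsilon> t x" if "0 < \<epsilon>" for \<epsilon> t x using frac_flow.v_nonneg[OF W[OF that]] .
  show ?thesis
  proof (intro conjI allI impI)
    fix t :: real and e :: "nat \<Rightarrow> real" assume t: "0 < t" and e: "\<forall>k. 0 < e k" and lim: "e \<longlonglongrightarrow> 0"
    have "AE x in lebesgue. \<forall>k. v (e k) t x = W (e k) t x"
      unfolding AE_all_countable using vW e t by (auto intro: less_imp_le)
    moreover have "AE x in lebesgue. (\<lambda>k. W (e k) t x + e k) \<longlonglongrightarrow> 0"
      unfolding AE_completion_iff using pointwise_vanishes[OF t _ lim] e by blast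
    ultimately show "AE x in lebesgue. (\<lambda>k. v (e k) t x + e k) \<longlonglongrightarrow> 0" by eventually_elim simp
  next
    fix \<tau> \<delta> :: real assume M: "\<exists>M. AE x in lebesgue. u0 x \<le> M" and \<tau>: "0 < \<tau>" and \<delta>: "0 < \<delta>"
    from M obtain M where "AE x in lebesgue. u0 x \<le> M" by blast
    then have "AE x in lebesgue. U x \<le> M" using Wu[of 1, OF zero_less_one] unfolding U_def by eventually_elim simp
    then have "AE x in lborel. U x \<le> M" by (simp add: AE_completion_iff)
    from uniformly_vanishes[OF this \<tau> \<delta>] obtain \<epsilon>0 where \<epsilon>0: "\<epsilon>0 > 0"
      "\<And>\<epsilon> t. 0 < \<epsilon> \<Longrightarrow> \<epsilon> < \<epsilon>0 \<Longrightarrow> \<tau> \<le> t \<Longrightarrow> AE x in lborel. W \<epsilon> t x + \<epsilon> \<le> \<delta>" by blast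
    show "\<exists>\<epsilon>0>0. \<forall>\<epsilon>. 0 < \<epsilon> \<and> \<epsilon> < \<epsilon>0 \<longrightarrow> (\<forall>t>\<tau>. AE x in lebesgue. \<bar>v \<epsilon> t x + \<epsilon>\<bar> \<le> \<delta>)"
    proof (intro exI[of _ \<epsilon>0] conjI allI impI \<epsilon>0(1))
      fix \<epsilon> t assume e: "0 < \<epsilon> \<and> \<epsilon> < \<epsilon>0" and t: "\<tau> < t"
      have "AE x in lebesgue. W \<epsilon> t x + \<epsilon> \<le> \<delta>" unfolding AE_completion_iff using \<epsilon>0(2) e t by simp
      moreover have "AE x in lebesgue. v \<epsilon> t x = W \<epsilon> t x" using vW e t \<tau> by simp
      ultimately show "AE x in lebesgue. \<bar>v \<epsilon> t x + \<epsilon>\<bar> \<le> \<delta>"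
      proof eventually_elim
        case (elim x)
        then show ?case using nn[of \<epsilon> t x] e by simp
      qed
    qed
  next
    fix c :: "real^'d" and r \<tau> \<delta> :: real assume \<tau>: "0 < \<tau>" and \<delta>: "0 < \<delta>"
    from ball_integral_vanishes[OF \<tau> \<delta>, of c r] obtain \<epsilon>0 where \<epsilon>0: "\<epsilon>0 > 0"
      "\<And>\<epsilon> t. 0 < \<epsilon> \<Longrightarrow> \<epsilon> < \<epsilon>0 \<Longrightarrow> \<tau> \<le> t \<Longrightarrow> (\<integral>x. indicator (ball c r) x * (W \<epsilon> t x + \<epsilon>) \<partial>lborel) \<le> \<delta>" by blast
    show "\<exists>\<epsilon>0>0. \<forall>\<epsilon>. 0 < \<epsilon> \<and> \<epsilon> < \<epsilon>0 \<longrightarrow> (\<forall>t\<ge>\<tau>. (\<integral>x\<in>ball c r. \<bar>v \<epsilon> t x + \<epsilon>\<bar> \<partial>lebesgue) \<le> \<delta>)"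
    proof (intro exI[of _ \<epsilon>0] conjI allI impI \<epsilon>0(1))
      fix \<epsilon> t assume e: "0 < \<epsilon> \<and> \<epsilon> < \<epsilon>0" and t: "\<tau> \<le> t"
      have W_meas: "W \<epsilon> t \<in> borel_measurable borel" using frac_flow.v_meas1[OF W] e by blast
      have "(\<integral>x\<in>ball c r. \<bar>v \<epsilon> t x + \<epsilon>\<bar> \<partial>lebesgue) = (\<integral>x. indicator (ball c r) x * (W \<epsilon> t x + \<epsilon>) \<partial>lborel)"
        unfolding set_lebesgue_integral_def
      proof (rule integral_lebesgue_cong_AE)
        have "AE x in lebesgue. v \<epsilon> t x = W \<epsilon> t x" using vW e t \<tau> by simp
        then show "AE x in lebesgue. indicat_real (ball c r) x *\<^sub>R \<bar>v \<epsilon> t x + \<epsilon>\<bar> = indicator (ball c r) x * (W \<epsilon> t x + \<epsilon>)"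
          by eventually_elim (use nn[of \<epsilon> t] e in \<open>auto simp: abs_of_nonneg add_nonneg_nonneg less_imp_le\<close>)
        show "(\<lambda>x. indicator (ball c r) x * (W \<epsilon> t x + \<epsilon>)) \<in> borel_measurable borel"
          by (intro borel_measurable_times borel_measurable_indicator borel_measurable_add W_meas) auto
      qed
      also have "\<dots> \<le> \<delta>" using \<epsilon>0(2) e t by simp
      finally show "(\<integral>x\<in>ball c r. \<bar>v \<epsilon> t x + \<epsilon>\<bar> \<partial>lebesgue) \<le> \<delta>" .
    qed
  qed
qed

end
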